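(* Let $P$ be a countable (commutative) principal ideal domain and let $R=P[x]$ be the ring of polynomials in one variable over $P$. Let $S_1\subset R$ be the multiplicative subset of all nonzero elements of $P$ (viewed as elements of $P[x]$), and let $S_2\subset R$ be the multiplicative subset of all polynomials with content $1$. Put $\mathbf S=\{S_1,S_2\}$. Then all flat $R$-modules are $\mathbf S^\times$-strongly flat.
   Context: "Countable" means at most countable. The content of a polynomial $p(x)=p_nx^n+\dots+p_0\in P[x]$ is the greatest common divisor of its coefficients, an element of $P$ defined up to multiplication by an invertible element of $P$. For two multiplicative subsets $S_1,S_2$ of a commutative ring $R$, $S_1S_2$ denotes the multiplicative subset generated by $S_1$ and $S_2$. For $\mathbf S=\{S_1,S_2\}$, $\mathbf S^\times=\{\{1\},S_1,S_2,S_1S_2\}$. An $R$-module $C$ is $\mathbf S^\times$-weakly cotorsion if $\operatorname{Ext}^1_R(T^{-1}R,C)=0$ for every $T\in\mathbf S^\times$. An $R$-module $F$ is $\mathbf S^\times$-strongly flat if $\operatorname{Ext}^1_R(F,C)=0$ for all $\mathbf S^\times$-weakly cotorsion $R$-modules $C$. *)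

theory Defs
  imports
    "HOL-Algebra.UnivPoly"
    "HOL-Algebra.Ring_Divisibility"
    "HOL-Algebra.Elementary_Groups"
    "HOL-Algebra.Free_Abelian_Groups"
begin

section \<open>Module homomorphisms\<close>

definition mod_hom ::
    "('r, 's) ring_scheme \<Rightarrow> ('r, 'm, 't) module_scheme \<Rightarrow> ('r, 'n, 'u) module_scheme \<Rightarrow> ('m \<Rightarrow> 'n) set"
  where "mod_hom R M N =
    {f \<in> carrier M \<rightarrow> carrier N.
       (\<forall>x\<in>carrier M. \<forall>y\<in>carrier M. f (x \<oplus>\<^bsub>M\<^esub> y) = f x \<oplus>\<^bsub>N\<^esub> f y) \<and>
       (\<forall>a\<in>carrier R. \<forall>x\<in>carrier M. f (a \<odot>\<^bsub>M\<^esub> x) = a \<odot>\<^bsub>N\<^esub> f x)}"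

text \<open>The additive group of homomorphisms. Its elements are restricted to be undefined off
  \<open>carrier M\<close>, so that equality of elements is equality of homomorphisms.\<close>

definition Hom_group ::
    "('r, 's) ring_scheme \<Rightarrow> ('r, 'm, 't) module_scheme \<Rightarrow> ('r, 'n, 'u) module_scheme \<Rightarrow> ('m \<Rightarrow> 'n) monoid"
  where "Hom_group R M N =
    \<lparr>carrier = mod_hom R M N \<inter> extensional (carrier M),
     monoid.mult = (\<lambda>f g. \<lambda>x\<in>carrier M. f x \<oplus>\<^bsub>N\<^esub> g x),
     one = (\<lambda>x\<in>carrier M. \<zero>\<^bsub>N\<^esub>)\<rparr>"

section \<open>Tensor products and flatness\<close>

definition tensor_relations ::
    "('r, 's) ring_scheme \<Rightarrow> ('r, 'm, 't) module_scheme \<Rightarrow> ('r, 'n, 'u) module_scheme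
      \<Rightarrow> ('m \<times> 'n \<Rightarrow>\<^sub>0 int) set"
  where "tensor_relations R M N =
    {frag_of (x \<oplus>\<^bsub>M\<^esub> x', y) - frag_of (x, y) - frag_of (x', y) | x x' y.
       x \<in> carrier M \<and> x' \<in> carrier M \<and> y \<in> carrier N} \<union>
    {frag_of (x, y \<oplus>\<^bsub>N\<^esub> y') - frag_of (x, y) - frag_of (x, y') | x y y'.
       x \<in> carrier M \<and> y \<in> carrier N \<and> y' \<in> carrier N} \<union>
    {frag_of (a \<odot>\<^bsub>M\<^esub> x, y) - frag_of (x, a \<odot>\<^bsub>N\<^esub> y) | a x y.
       a \<in> carrier R \<and> x \<in> carrier M \<and> y \<in> carrier N}"

definition tensor_kernel ::
    "('r, 's) ring_scheme \<Rightarrow> ('r, 'm, 't) module_scheme \<Rightarrow> ('r, 'n, 'u) module_scheme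
      \<Rightarrow> ('m \<times> 'n \<Rightarrow>\<^sub>0 int) set"
  where "tensor_kernel R M N =
    generate (free_Abelian_group (carrier M \<times> carrier N)) (tensor_relations R M N)"

text \<open>The abelian group underlying the tensor product over \<open>R\<close>, in multiplicative notation.\<close>

definition tensor ::
    "('r, 's) ring_scheme \<Rightarrow> ('r, 'm, 't) module_scheme \<Rightarrow> ('r, 'n, 'u) module_scheme
      \<Rightarrow> ('m \<times> 'n \<Rightarrow>\<^sub>0 int) set monoid"
  where "tensor R M N =
    free_Abelian_group (carrier M \<times> carrier N) Mod tensor_kernel R M N"

text \<open>The map that a homomorphism \<open>f\<close> from \<open>M\<close> to \<open>M'\<close> induces on the tensor products with \<open>N\<close>.
  The image of a coset under the map on free groups lies in a single coset of the
  kernel for \<open>M'\<close>; the product with that kernel is this coset.\<close>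

definition tensor_map ::
    "('r, 's) ring_scheme \<Rightarrow> ('r, 'm, 't) module_scheme \<Rightarrow> ('r, 'k, 'v) module_scheme
      \<Rightarrow> ('r, 'n, 'u) module_scheme \<Rightarrow> ('m \<Rightarrow> 'k) \<Rightarrow> ('m \<times> 'n \<Rightarrow>\<^sub>0 int) set \<Rightarrow> ('k \<times> 'n \<Rightarrow>\<^sub>0 int) set"
  where "tensor_map R M M' N f X =
    tensor_kernel R M' N <#>\<^bsub>free_Abelian_group (carrier M' \<times> carrier N)\<^esub>
      frag_extend (\<lambda>(x, y). frag_of (f x, y)) ` X"

text \<open>Tensoring with \<open>F\<close> preserves injectivity. A definition cannot quantify over all types, so
  \<open>A\<close> and \<open>B\<close> range over the modules whose elements are taken from the type of sets of lists over
  the type of ring elements. Every finitely generated module, being a quotient of some power of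
  \<open>R\<close>, has an isomorphic copy there; so do \<open>R\<close> and its ideals, and already the inclusions of
  ideals into \<open>R\<close> suffice to test flatness.\<close>

definition flat_module :: "('r, 's) ring_scheme \<Rightarrow> ('r, 'f, 't) module_scheme \<Rightarrow> bool"
  where "flat_module R F \<longleftrightarrow> module R F \<and>
    (\<forall>(A :: ('r, 'r list set) module) (B :: ('r, 'r list set) module) f.
       module R A \<longrightarrow> module R B \<longrightarrow> f \<in> mod_hom R A B \<longrightarrow> inj_on f (carrier A) \<longrightarrow>
       inj_on (tensor_map R A B F f) (carrier (tensor R A F)))"

section \<open>Ext\<close>

text \<open>The free module on a set \<open>X\<close>: finitely supported coefficient functions on \<open>X\<close>.\<close>

definition free_module :: "('r, 's) ring_scheme \<Rightarrow> 'x set \<Rightarrow> ('r, 'x \<Rightarrow> 'r) module"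
  where "free_module R X =
    \<lparr>carrier = {c. (\<forall>x. c x \<in> carrier R) \<and> finite {x. c x \<noteq> \<zero>\<^bsub>R\<^esub>} \<and> {x. c x \<noteq> \<zero>\<^bsub>R\<^esub>} \<subseteq> X},
     monoid.mult = undefined, one = undefined,
     ring.zero = (\<lambda>x. \<zero>\<^bsub>R\<^esub>),
     ring.add = (\<lambda>c d x. c x \<oplus>\<^bsub>R\<^esub> d x),
     module.smult = (\<lambda>a c x. a \<otimes>\<^bsub>R\<^esub> c x)\<rparr>"

definition lin_comb :: "('r, 's) ring_scheme \<Rightarrow> ('r, 'm, 't) module_scheme \<Rightarrow> ('m \<Rightarrow> 'r) \<Rightarrow> 'm"
  where "lin_comb R M c = finsum M (\<lambda>x. c x \<odot>\<^bsub>M\<^esub> x) {x. c x \<noteq> \<zero>\<^bsub>R\<^esub>}"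

text \<open>The beginning of the standard free resolution
  \<open>res2 \<rightarrow> res1 \<rightarrow> res0 \<rightarrow> M \<rightarrow> 0\<close>, all of whose maps are \<open>lin_comb\<close>: \<open>res0\<close> is free on the
  elements of \<open>M\<close>, and each further term is free on the elements of the preceding kernel.\<close>

definition res0 :: "('r, 's) ring_scheme \<Rightarrow> ('r, 'm, 't) module_scheme \<Rightarrow> ('r, 'm \<Rightarrow> 'r) module"
  where "res0 R M = free_module R (carrier M)"

definition res1 :: "('r, 's) ring_scheme \<Rightarrow> ('r, 'm, 't) module_scheme \<Rightarrow> ('r, ('m \<Rightarrow> 'r) \<Rightarrow> 'r) module"
  where "res1 R M = free_module R {c \<in> carrier (res0 R M). lin_comb R M c = \<zero>\<^bsub>M\<^esub>}"

definition res2 ::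
    "('r, 's) ring_scheme \<Rightarrow> ('r, 'm, 't) module_scheme \<Rightarrow> ('r, (('m \<Rightarrow> 'r) \<Rightarrow> 'r) \<Rightarrow> 'r) module"
  where "res2 R M =
    free_module R {c \<in> carrier (res1 R M). lin_comb R (res0 R M) c = \<zero>\<^bsub>res0 R M\<^esub>}"

text \<open>The first cohomology group of \<open>Hom(res, C)\<close>, in multiplicative notation.\<close>

definition Ext1_cocycles ::
    "('r, 's) ring_scheme \<Rightarrow> ('r, 'm, 't) module_scheme \<Rightarrow> ('r, 'c, 'u) module_scheme
      \<Rightarrow> ((('m \<Rightarrow> 'r) \<Rightarrow> 'r) \<Rightarrow> 'c) set"
  where "Ext1_cocycles R M C =
    {f \<in> carrier (Hom_group R (res1 R M) C).
       \<forall>c\<in>carrier (res2 R M). f (lin_comb R (res1 R M) c) = \<zero>\<^bsub>C\<^esub>}"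

definition Ext1_coboundaries ::
    "('r, 's) ring_scheme \<Rightarrow> ('r, 'm, 't) module_scheme \<Rightarrow> ('r, 'c, 'u) module_scheme
      \<Rightarrow> ((('m \<Rightarrow> 'r) \<Rightarrow> 'r) \<Rightarrow> 'c) set"
  where "Ext1_coboundaries R M C =
    (\<lambda>g. \<lambda>c\<in>carrier (res1 R M). g (lin_comb R (res0 R M) c)) ` carrier (Hom_group R (res0 R M) C)"

definition Ext1 ::
    "('r, 's) ring_scheme \<Rightarrow> ('r, 'm, 't) module_scheme \<Rightarrow> ('r, 'c, 'u) module_scheme
      \<Rightarrow> ((('m \<Rightarrow> 'r) \<Rightarrow> 'r) \<Rightarrow> 'c) set monoid"
  where "Ext1 R M C =
    (Hom_group R (res1 R M) C)\<lparr>carrier := Ext1_cocycles R M C\<rparr> Mod Ext1_coboundaries R M C"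

section \<open>Localization\<close>

definition frac_rel :: "('r, 's) ring_scheme \<Rightarrow> 'r set \<Rightarrow> (('r \<times> 'r) \<times> ('r \<times> 'r)) set"
  where "frac_rel R T =
    {((r, t), (r', t')). r \<in> carrier R \<and> t \<in> T \<and> r' \<in> carrier R \<and> t' \<in> T \<and>
       (\<exists>u\<in>T. u \<otimes>\<^bsub>R\<^esub> (r \<otimes>\<^bsub>R\<^esub> t') = u \<otimes>\<^bsub>R\<^esub> (r' \<otimes>\<^bsub>R\<^esub> t))}"

definition fraction :: "('r, 's) ring_scheme \<Rightarrow> 'r set \<Rightarrow> 'r \<Rightarrow> 'r \<Rightarrow> ('r \<times> 'r) set"
  where "fraction R T r t = frac_rel R T `` {(r, t)}"

text \<open>The ring of fractions of \<open>R\<close> with denominators in \<open>T\<close>, as an \<open>R\<close>-algebra. Each union below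
  is over representatives and consists of copies of one and the same class.\<close>

definition localization :: "('r, 's) ring_scheme \<Rightarrow> 'r set \<Rightarrow> ('r, ('r \<times> 'r) set) module"
  where "localization R T =
    \<lparr>carrier = (carrier R \<times> T) // frac_rel R T,
     monoid.mult = (\<lambda>X Y. \<Union>(r, t)\<in>X. \<Union>(r', t')\<in>Y. fraction R T (r \<otimes>\<^bsub>R\<^esub> r') (t \<otimes>\<^bsub>R\<^esub> t')),
     one = fraction R T \<one>\<^bsub>R\<^esub> \<one>\<^bsub>R\<^esub>,
     ring.zero = fraction R T \<zero>\<^bsub>R\<^esub> \<one>\<^bsub>R\<^esub>,
     ring.add = (\<lambda>X Y. \<Union>(r, t)\<in>X. \<Union>(r', t')\<in>Y.
       fraction R T (r \<otimes>\<^bsub>R\<^esub> t' \<oplus>\<^bsub>R\<^esub> r' \<otimes>\<^bsub>R\<^esub> t) (t \<otimes>\<^bsub>R\<^esub> t')),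
     module.smult = (\<lambda>a X. \<Union>(r, t)\<in>X. fraction R T (a \<otimes>\<^bsub>R\<^esub> r) t)\<rparr>"

section \<open>Weakly cotorsion and strongly flat modules\<close>

text \<open>The collection \<open>{{1}, S1, S2, S1 S2}\<close>, where \<open>S1 S2\<close> is the multiplicative subset
  generated by \<open>S1\<close> and \<open>S2\<close>.\<close>

definition mult_cross :: "('r, 's) ring_scheme \<Rightarrow> 'r set \<Rightarrow> 'r set \<Rightarrow> 'r set set"
  where "mult_cross R S\<^sub>1 S\<^sub>2 =
    {{\<one>\<^bsub>R\<^esub>}, S\<^sub>1, S\<^sub>2, (\<lambda>T. submonoid T R) hull (S\<^sub>1 \<union> S\<^sub>2)}"

definition weakly_cotorsion ::
    "('r, 's) ring_scheme \<Rightarrow> 'r set set \<Rightarrow> ('r, 'c, 'u) module_scheme \<Rightarrow> bool"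
  where "weakly_cotorsion R \<T> C \<longleftrightarrow> module R C \<and>
    (\<forall>T\<in>\<T>. trivial_group (Ext1 R (localization R T) C))"

text \<open>The extra argument \<open>TYPE('c)\<close> is the type from which the elements of the weakly cotorsion
  modules are taken. The strong flatness of the literature is \<open>strongly_flat TYPE('c) R \<T> F\<close> for
  all types \<open>'c\<close>, that is, this property stated as a theorem with \<open>'c\<close> a type variable.\<close>

definition strongly_flat ::
    "'c itself \<Rightarrow> ('r, 's) ring_scheme \<Rightarrow> 'r set set \<Rightarrow> ('r, 'f, 't) module_scheme \<Rightarrow> bool"
  where "strongly_flat (_ :: 'c itself) R \<T> F \<longleftrightarrow> module R F \<and>
    (\<forall>C :: ('r, 'c) module. weakly_cotorsion R \<T> C \<longrightarrow> trivial_group (Ext1 R F C))"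

section \<open>Multiplicative subsets of a polynomial ring\<close>

definition nonzero_constants :: "('p, 'q) ring_scheme \<Rightarrow> (nat \<Rightarrow> 'p) set"
  where "nonzero_constants P = (\<lambda>a. up_ring.monom (UP P) a 0) ` (carrier P - {\<zero>\<^bsub>P\<^esub>})"

text \<open>The element \<open>c\<close> is a greatest common divisor of the coefficients of \<open>p\<close>.\<close>

definition is_content :: "('p, 'q) ring_scheme \<Rightarrow> (nat \<Rightarrow> 'p) \<Rightarrow> 'p \<Rightarrow> bool"
  where "is_content P p c \<longleftrightarrow> c \<in> carrier P \<and>
    (\<forall>n. c divides\<^bsub>P\<^esub> up_ring.coeff (UP P) p n) \<and>
    (\<forall>d\<in>carrier P. (\<forall>n. d divides\<^bsub>P\<^esub> up_ring.coeff (UP P) p n) \<longrightarrow> d divides\<^bsub>P\<^esub> c)"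

definition content_one_polys :: "('p, 'q) ring_scheme \<Rightarrow> (nat \<Rightarrow> 'p) set"
  where "content_one_polys P = {p \<in> carrier (UP P). is_content P p \<one>\<^bsub>P\<^esub>}"

end

theory Submission
  imports Defs "HOL-Library.Countable_Set"
begin

text \<open>Let \<open>R = P[x]\<close>, let \<open>F\<close> be flat over \<open>R\<close> and \<open>C\<close> weakly cotorsion, and let \<open>L\<close> be the free module on the
  elements of \<open>F\<close>, with \<open>K\<close> the kernel of \<open>L \<rightarrow> F\<close>. The group \<open>Ext1 R F C\<close> is trivial once every homomorphism
  \<open>\<phi>\<close> from \<open>K\<close> to \<open>C\<close> extends to \<open>L\<close> (\<open>trivial_Ext1_of_extension\<close>). Inside \<open>E = L \<times> C\<close>, such an extension is a
  submodule \<open>D\<close> that contains the graph of \<open>-\<phi>\<close> and is complementary to \<open>C\<close>. It is found by Zorn's lemma among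
  the submodules \<open>D\<close> with \<open>C \<inter> D = 0\<close> for which \<open>E/(C + D)\<close> is flat (\<open>complement_of_flat\<close>): for the graph itself
  this quotient is \<open>F\<close>, and if it is not \<open>0\<close>, then \<open>D\<close> can be enlarged.

  To enlarge \<open>D\<close>, take a nonzero element of the flat module \<open>E/(C + D)\<close>. As \<open>R\<close> is countable, the element lies in the image of the
  limit of a tower \<open>R\<^bsup>n(0)\<^esup> \<rightarrow> R\<^bsup>n(1)\<^esup> \<rightarrow> \<cdots>\<close> of finite free modules over \<open>E/(C + D)\<close>
  that eventually realizes every consequence of flatness (\<open>tower_exists\<close>), so that the limit embeds as a pure submodule. Lifting the tower to \<open>E/D\<close>
  means to solve in \<open>C\<close> the system \<open>y i k - (\<Sum>l. A i k l * y (i + 1) l) = c i k\<close>; the lifted tower then enlarges \<open>D\<close>.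

  The hypothesis on \<open>C\<close> provides only the systems \<open>y n - s n * y (n + 1) = c n\<close> in which each stage has one
  unknown, with \<open>s\<close> a sequence of elements of \<open>T\<close>: since \<open>T\<close> is countable, \<open>T\<inverse>R\<close> is the limit of
  copies of \<open>R\<close> along multiplication by such a sequence (\<open>telescopes_of_trivial_Ext1\<close>). The general system is
  reduced to these by Noetherian induction over the annihilators of subquotients \<open>A/B\<close>
  (\<open>solvable_noetherian\<close>). If \<open>A/B\<close> is a counterexample whose annihilator \<open>J\<close> is maximal, then for \<open>a \<notin> J\<close> the
  annihilator of \<open>A/(aA + B)\<close> is larger, so this quotient solves the system; if moreover \<open>ab \<in> J\<close> with
  \<open>b \<notin> J\<close>, then so does \<open>(aA + B)/B\<close>, and hence \<open>A/B\<close>. Thus \<open>J\<close> is prime. Now choose \<open>T\<close> such that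
  inverting \<open>T\<close> turns \<open>R/J\<close> into a field. Solving the system modulo \<open>s n * A\<close> for all \<open>n\<close>, and then
  telescoping, leaves a system whose unknowns and right-hand sides are homomorphisms from \<open>T\<inverse>R\<close> to
  \<open>A/B\<close>. These form a vector space over the field, and there the rows of the system are independent.

  Such a \<open>T\<close> exists for each prime \<open>J\<close> of \<open>P[x]\<close> (\<open>prime_field_after_inverting\<close>). For \<open>J = 0\<close>, invert all nonzero
  polynomials; for \<open>J \<noteq> 0\<close> meeting \<open>P\<close> in \<open>0\<close>, the nonzero constants; for \<open>J\<close> generated by a
  prime of \<open>P\<close>, the polynomials of content \<open>1\<close>; all other primes are maximal.\<close>

section \<open>Congruences modulo submodules\<close>

text \<open>Elements of \<open>M\<close> are compared modulo \<open>B\<close> instead of being passed to the quotient \<open>M/B\<close>. All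
  subquotients \<open>A/B\<close> of \<open>M\<close>, over which an induction will run, then live in one type.\<close>

definition mcong :: "('r, 'm, 't) module_scheme \<Rightarrow> 'm set \<Rightarrow> 'm \<Rightarrow> 'm \<Rightarrow> bool"
  where "mcong M B x y \<longleftrightarrow> x \<in> carrier M \<and> y \<in> carrier M \<and> x \<ominus>\<^bsub>M\<^esub> y \<in> B"

lemma mcongD: "mcong M B x y \<Longrightarrow> x \<in> carrier M" "mcong M B x y \<Longrightarrow> y \<in> carrier M"
  by (auto simp: mcong_def)

context module
begin

lemma neg_zero [simp]: "\<ominus>\<^bsub>M\<^esub> \<zero>\<^bsub>M\<^esub> = \<zero>\<^bsub>M\<^esub>"
  by (simp add: a_inv_def)

lemmas group_normalize = M.minus_eq M.minus_add M.minus_minus M.a_assoc M.a_comm M.a_lcomm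
  M.r_neg1 M.r_neg2 M.l_neg M.r_neg

lemma submodule_sub: "submodule A R M \<Longrightarrow> x \<in> A \<Longrightarrow> x \<in> carrier M"
  using submoduleE(1) by blast

lemma submodule_zero: "submodule A R M \<Longrightarrow> \<zero>\<^bsub>M\<^esub> \<in> A"
  using submodule.axioms(1) subgroup.one_closed by fastforce

lemma submodule_minus: "submodule A R M \<Longrightarrow> x \<in> A \<Longrightarrow> y \<in> A \<Longrightarrow> x \<ominus>\<^bsub>M\<^esub> y \<in> A"
  by (simp add: M.minus_eq submoduleE(3,5))

lemmas submodule_closed = submodule_sub submodule_zero submodule_minus submoduleE(3-5)

lemma submodule_finsum:
  assumes "submodule A R M" "\<And>i. i \<in> I \<Longrightarrow> f i \<in> A"
  shows "finsum M f I \<in> A"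
  using assms(2)
proof (induct I rule: infinite_finite_induct)
  case (insert x F)
  then show ?case
    using submodule_closed[OF assms(1)] by (subst M.finsum_insert) auto
qed (use submodule_closed[OF assms(1)] in auto)

lemma submodule_zero_set: "submodule {\<zero>\<^bsub>M\<^esub>} R M"
  by (rule submoduleI) auto

lemma mcong_refl: "submodule B R M \<Longrightarrow> x \<in> carrier M \<Longrightarrow> mcong M B x x"
  by (simp add: mcong_def M.minus_eq M.r_neg submodule_zero)

lemma mcong_sym: "submodule B R M \<Longrightarrow> mcong M B x y \<Longrightarrow> mcong M B y x"
  using submoduleE(3)[of B "x \<ominus>\<^bsub>M\<^esub> y"] by (auto simp: mcong_def group_normalize)

lemma mcong_trans:
  assumes "submodule B R M" "mcong M B x y" "mcong M B y z" shows "mcong M B x z"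
proof -
  have "(x \<ominus>\<^bsub>M\<^esub> y) \<oplus>\<^bsub>M\<^esub> (y \<ominus>\<^bsub>M\<^esub> z) = x \<ominus>\<^bsub>M\<^esub> z"
    using assms by (simp add: mcong_def group_normalize)
  then show ?thesis
    using assms submoduleE(5)[of B "x \<ominus>\<^bsub>M\<^esub> y" "y \<ominus>\<^bsub>M\<^esub> z"] by (simp add: mcong_def)
qed

lemma mcong_add:
  assumes "submodule B R M" "mcong M B x y" "mcong M B x' y'"
  shows "mcong M B (x \<oplus>\<^bsub>M\<^esub> x') (y \<oplus>\<^bsub>M\<^esub> y')"
proof -
  have "(x \<ominus>\<^bsub>M\<^esub> y) \<oplus>\<^bsub>M\<^esub> (x' \<ominus>\<^bsub>M\<^esub> y') = (x \<oplus>\<^bsub>M\<^esub> x') \<ominus>\<^bsub>M\<^esub> (y \<oplus>\<^bsub>M\<^esub> y')"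
    using assms by (simp add: mcong_def group_normalize)
  then show ?thesis
    using assms submoduleE(5)[of B "x \<ominus>\<^bsub>M\<^esub> y" "x' \<ominus>\<^bsub>M\<^esub> y'"] by (simp add: mcong_def)
qed

lemma smult_diff: "a \<in> carrier R \<Longrightarrow> x \<in> carrier M \<Longrightarrow> y \<in> carrier M \<Longrightarrow>
    a \<odot>\<^bsub>M\<^esub> (x \<ominus>\<^bsub>M\<^esub> y) = a \<odot>\<^bsub>M\<^esub> x \<ominus>\<^bsub>M\<^esub> a \<odot>\<^bsub>M\<^esub> y"
  by (simp add: M.minus_eq smult_r_distr smult_r_minus)

lemma smult_l_diff: "a \<in> carrier R \<Longrightarrow> b \<in> carrier R \<Longrightarrow> x \<in> carrier M \<Longrightarrow>
    (a \<ominus> b) \<odot>\<^bsub>M\<^esub> x = a \<odot>\<^bsub>M\<^esub> x \<ominus>\<^bsub>M\<^esub> b \<odot>\<^bsub>M\<^esub> x"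
  by (simp add: M.minus_eq R.minus_eq smult_l_distr smult_l_minus)

lemma mcong_smult:
  assumes "submodule B R M" "mcong M B x y" "a \<in> carrier R"
  shows "mcong M B (a \<odot>\<^bsub>M\<^esub> x) (a \<odot>\<^bsub>M\<^esub> y)"
  using assms submoduleE(4)[of B a "x \<ominus>\<^bsub>M\<^esub> y"] by (simp add: mcong_def smult_diff)

lemma mcong_neg:
  assumes "submodule B R M" "mcong M B x y"
  shows "mcong M B (\<ominus>\<^bsub>M\<^esub> x) (\<ominus>\<^bsub>M\<^esub> y)"
  using assms submoduleE(3)[of B "x \<ominus>\<^bsub>M\<^esub> y"] by (simp add: mcong_def group_normalize)

lemma mcong_minus:
  assumes "submodule B R M" "mcong M B x y" "mcong M B x' y'"
  shows "mcong M B (x \<ominus>\<^bsub>M\<^esub> x') (y \<ominus>\<^bsub>M\<^esub> y')"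
  using mcong_add[OF assms(1,2) mcong_neg[OF assms(1,3)]] by (simp add: M.minus_eq)

lemma mcong_finsum:
  assumes "submodule B R M" "\<And>i. i \<in> I \<Longrightarrow> mcong M B (f i) (g i)"
  shows "mcong M B (finsum M f I) (finsum M g I)"
  using assms(2)
proof (induct I rule: infinite_finite_induct)
  case (insert x F)
  then have "f \<in> F \<rightarrow> carrier M" "g \<in> F \<rightarrow> carrier M" "f x \<in> carrier M" "g x \<in> carrier M"
    by (auto dest: mcongD)
  then show ?case
    using insert mcong_add[OF assms(1)] by simp
qed (use mcong_refl[OF assms(1)] in auto)

lemma mcong_mono: "mcong M B x y \<Longrightarrow> B \<subseteq> B' \<Longrightarrow> mcong M B' x y"
  by (auto simp: mcong_def)

lemma mcong_zero_iff: "submodule B R M \<Longrightarrow> mcong M B x \<zero>\<^bsub>M\<^esub> \<longleftrightarrow> x \<in> B"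
  using submodule_sub[of B x] by (auto simp: mcong_def M.minus_eq)

lemma mcong_closed: "submodule A R M \<Longrightarrow> B \<subseteq> A \<Longrightarrow> mcong M B x y \<Longrightarrow> y \<in> A \<Longrightarrow> x \<in> A"
proof -
  assume a: "submodule A R M" "B \<subseteq> A" "mcong M B x y" "y \<in> A"
  then have "x = (x \<ominus>\<^bsub>M\<^esub> y) \<oplus>\<^bsub>M\<^esub> y" by (simp add: mcong_def group_normalize)
  then show "x \<in> A"
    using a submoduleE(5)[of A "x \<ominus>\<^bsub>M\<^esub> y" y] by (auto simp: mcong_def)
qed

lemma mcong_mem: "submodule B R M \<Longrightarrow> mcong M B x y \<Longrightarrow> y \<in> B \<longleftrightarrow> x \<in> B"
  using mcong_closed[of B B x y] mcong_closed[of B B y x] mcong_sym by blast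

lemma mcong_eq: "mcong M {\<zero>\<^bsub>M\<^esub>} x y \<longleftrightarrow> x \<in> carrier M \<and> y \<in> carrier M \<and> x = y"
proof -
  have "x = y" if "x \<in> carrier M" "y \<in> carrier M" "x \<ominus>\<^bsub>M\<^esub> y = \<zero>\<^bsub>M\<^esub>"
    using that by (metis M.minus_eq M.add.inv_closed M.minus_equality M.minus_minus)
  then show ?thesis by (auto simp: mcong_def M.minus_eq M.r_neg)
qed

lemma mcong_scalar:
  assumes "a \<ominus> b \<in> J" "a \<in> carrier R" "b \<in> carrier R" "x \<in> carrier M"
    and "\<And>j. j \<in> J \<Longrightarrow> j \<odot>\<^bsub>M\<^esub> x \<in> B"
  shows "mcong M B (a \<odot>\<^bsub>M\<^esub> x) (b \<odot>\<^bsub>M\<^esub> x)"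
  using assms by (auto simp: mcong_def smult_l_diff[symmetric])

end

section \<open>Finite linear combinations\<close>

definition comb :: "('r, 's) ring_scheme \<Rightarrow> ('r, 'm, 't) module_scheme \<Rightarrow> ('i \<Rightarrow> 'r) \<Rightarrow> ('i \<Rightarrow> 'm) \<Rightarrow> 'm"
  where "comb R M \<rho> y = finsum M (\<lambda>i. \<rho> i \<odot>\<^bsub>M\<^esub> y i) {i. \<rho> i \<noteq> \<zero>\<^bsub>R\<^esub>}"

abbreviation fsupp :: "('r, 's) ring_scheme \<Rightarrow> ('i \<Rightarrow> 'r) set"
  where "fsupp R \<equiv> carrier (free_module R UNIV)"

definition unitv :: "('r, 's) ring_scheme \<Rightarrow> 'i \<Rightarrow> 'i \<Rightarrow> 'r"
  where "unitv R i = (\<lambda>j. if j = i then \<one>\<^bsub>R\<^esub> else \<zero>\<^bsub>R\<^esub>)"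

lemma fsuppD:
  "\<rho> \<in> fsupp R \<Longrightarrow> \<rho> i \<in> carrier R" "\<rho> \<in> fsupp R \<Longrightarrow> finite {i. \<rho> i \<noteq> \<zero>\<^bsub>R\<^esub>}"
  by (auto simp: free_module_def)

lemma fsuppI:
  assumes "\<And>i. \<rho> i \<in> carrier R" "finite S" "\<And>i. i \<notin> S \<Longrightarrow> \<rho> i = \<zero>\<^bsub>R\<^esub>"
  shows "\<rho> \<in> fsupp R"
  using assms finite_subset[of "{i. \<rho> i \<noteq> \<zero>\<^bsub>R\<^esub>}" S] by (auto simp: free_module_def)

lemma (in cring) free_module_module: "module R (free_module R X)"
proof -
  let ?F = "free_module R X"
  have fin: "finite {i. c i \<noteq> \<zero>} \<Longrightarrow> finite {i. d i \<noteq> \<zero>} \<Longrightarrow>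
      (\<And>i. c i = \<zero> \<Longrightarrow> d i = \<zero> \<Longrightarrow> e i = \<zero>) \<Longrightarrow> finite {i. e i \<noteq> \<zero>}" for c d e :: "'i \<Rightarrow> 'a"
    by (rule finite_subset[of _ "{i. c i \<noteq> \<zero>} \<union> {i. d i \<noteq> \<zero>}"]) auto
  show ?thesis
  proof (rule moduleI[OF is_cring])
    show "abelian_group ?F"
    proof (rule abelian_groupI)
      fix c assume c: "c \<in> carrier ?F"
      have "(\<lambda>i. \<ominus> c i) \<in> carrier ?F"
        using c fin[of c c "\<lambda>i. \<ominus> c i"] by (auto simp: free_module_def)
      moreover have "(\<lambda>i. \<ominus> c i) \<oplus>\<^bsub>?F\<^esub> c = \<zero>\<^bsub>?F\<^esub>"
        using c by (auto simp: free_module_def l_neg)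
      ultimately show "\<exists>y\<in>carrier ?F. y \<oplus>\<^bsub>?F\<^esub> c = \<zero>\<^bsub>?F\<^esub>" by blast
    next
      fix c d assume cd: "c \<in> carrier ?F" "d \<in> carrier ?F"
      show "c \<oplus>\<^bsub>?F\<^esub> d \<in> carrier ?F"
        using cd fin[of c d "\<lambda>i. c i \<oplus> d i"]
        by (auto simp: free_module_def) (metis (mono_tags, lifting) l_zero mem_Collect_eq subsetD zero_closed)
      show "c \<oplus>\<^bsub>?F\<^esub> d = d \<oplus>\<^bsub>?F\<^esub> c"
        using cd by (auto simp: free_module_def a_comm)
    next
      fix x y z assume cd: "x \<in> carrier ?F" "y \<in> carrier ?F" "z \<in> carrier ?F"
      show "x \<oplus>\<^bsub>?F\<^esub> y \<oplus>\<^bsub>?F\<^esub> z = x \<oplus>\<^bsub>?F\<^esub> (y \<oplus>\<^bsub>?F\<^esub> z)"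
        using cd by (auto simp: free_module_def a_assoc)
    qed (auto simp: free_module_def)
  next
    fix a c assume ac: "a \<in> carrier R" "c \<in> carrier ?F"
    show "a \<odot>\<^bsub>?F\<^esub> c \<in> carrier ?F"
      using ac fin[of c c "\<lambda>i. a \<otimes> c i"] by (auto simp: free_module_def)
  qed (auto simp: free_module_def l_distr r_distr m_assoc)
qed

context module
begin

lemma fsupp_add: "\<rho> \<in> fsupp R \<Longrightarrow> \<sigma> \<in> fsupp R \<Longrightarrow> (\<lambda>i. \<rho> i \<oplus> \<sigma> i) \<in> fsupp R"
  by (rule fsuppI[where S="{i. \<rho> i \<noteq> \<zero>} \<union> {i. \<sigma> i \<noteq> \<zero>}"]) (auto simp: fsuppD)

lemma fsupp_smult: "a \<in> carrier R \<Longrightarrow> \<rho> \<in> fsupp R \<Longrightarrow> (\<lambda>i. a \<otimes> \<rho> i) \<in> fsupp R"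
  by (rule fsuppI[where S="{i. \<rho> i \<noteq> \<zero>}"]) (auto simp: fsuppD)

lemma fsupp_unitv: "unitv R i \<in> fsupp R"
  by (rule fsuppI[where S="{i}"]) (auto simp: unitv_def)

lemma fsupp_zero: "(\<lambda>_. \<zero>) \<in> fsupp R"
  by (rule fsuppI[where S="{}"]) auto

lemma comb_superset:
  assumes "\<rho> \<in> fsupp R" "finite S" "\<And>i. i \<notin> S \<Longrightarrow> \<rho> i = \<zero>" "\<And>i. i \<in> S \<Longrightarrow> y i \<in> carrier M"
  shows "comb R M \<rho> y = finsum M (\<lambda>i. \<rho> i \<odot>\<^bsub>M\<^esub> y i) S"
  unfolding comb_def
  by (rule M.add.finprod_mono_neutral_cong_left) (use assms fsuppD[OF assms(1)] in auto)

lemma comb_closed: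
  "\<rho> \<in> fsupp R \<Longrightarrow> (\<And>i. y i \<in> carrier M) \<Longrightarrow> comb R M \<rho> y \<in> carrier M"
  unfolding comb_def by (rule M.finsum_closed) (auto simp: fsuppD)

lemma comb_submodule:
  "submodule A R M \<Longrightarrow> \<rho> \<in> fsupp R \<Longrightarrow> (\<And>i. y i \<in> A) \<Longrightarrow> comb R M \<rho> y \<in> A"
  unfolding comb_def by (rule submodule_finsum) (auto simp: fsuppD submodule_closed)

lemma comb_cong_mod:
  "submodule B R M \<Longrightarrow> \<rho> \<in> fsupp R \<Longrightarrow> (\<And>i. mcong M B (y i) (z i)) \<Longrightarrow>
    mcong M B (comb R M \<rho> y) (comb R M \<rho> z)"
  unfolding comb_def by (rule mcong_finsum) (auto simp: fsuppD intro: mcong_smult)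

lemma comb_add:
  assumes "\<rho> \<in> fsupp R" "\<And>i. y i \<in> carrier M" "\<And>i. z i \<in> carrier M"
  shows "comb R M \<rho> (\<lambda>i. y i \<oplus>\<^bsub>M\<^esub> z i) = comb R M \<rho> y \<oplus>\<^bsub>M\<^esub> comb R M \<rho> z"
  unfolding comb_def
  by (subst M.finsum_addf[symmetric]) (use assms in \<open>auto simp: fsuppD smult_r_distr intro!: M.finsum_cong'\<close>)

lemma comb_smult:
  assumes "\<rho> \<in> fsupp R" "\<And>i. y i \<in> carrier M" "a \<in> carrier R"
  shows "comb R M \<rho> (\<lambda>i. a \<odot>\<^bsub>M\<^esub> y i) = a \<odot>\<^bsub>M\<^esub> comb R M \<rho> y"
  unfolding comb_def using assms
  by (subst finsum_smult_ldistr)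
    (auto simp: fsuppD smult_assoc1[symmetric] R.m_comm intro!: M.finsum_cong')

lemma comb_add_left:
  assumes "\<rho> \<in> fsupp R" "\<sigma> \<in> fsupp R" "\<And>i. y i \<in> carrier M"
  shows "comb R M (\<lambda>i. \<rho> i \<oplus> \<sigma> i) y = comb R M \<rho> y \<oplus>\<^bsub>M\<^esub> comb R M \<sigma> y"
proof -
  let ?S = "{i. \<rho> i \<noteq> \<zero>} \<union> {i. \<sigma> i \<noteq> \<zero>}"
  have "comb R M (\<lambda>i. \<rho> i \<oplus> \<sigma> i) y = finsum M (\<lambda>i. (\<rho> i \<oplus> \<sigma> i) \<odot>\<^bsub>M\<^esub> y i) ?S"
    by (rule comb_superset) (use assms fsupp_add in \<open>auto simp: fsuppD\<close>)
  also have "\<dots> = finsum M (\<lambda>i. \<rho> i \<odot>\<^bsub>M\<^esub> y i \<oplus>\<^bsub>M\<^esub> \<sigma> i \<odot>\<^bsub>M\<^esub> y i) ?S"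
    by (rule M.finsum_cong') (use assms in \<open>auto simp: fsuppD smult_l_distr\<close>)
  also have "\<dots> = finsum M (\<lambda>i. \<rho> i \<odot>\<^bsub>M\<^esub> y i) ?S \<oplus>\<^bsub>M\<^esub> finsum M (\<lambda>i. \<sigma> i \<odot>\<^bsub>M\<^esub> y i) ?S"
    by (rule M.finsum_addf) (use assms in \<open>auto simp: fsuppD\<close>)
  also have "finsum M (\<lambda>i. \<rho> i \<odot>\<^bsub>M\<^esub> y i) ?S = comb R M \<rho> y"
    by (rule comb_superset[symmetric]) (use assms in \<open>auto simp: fsuppD\<close>)
  also have "finsum M (\<lambda>i. \<sigma> i \<odot>\<^bsub>M\<^esub> y i) ?S = comb R M \<sigma> y"
    by (rule comb_superset[symmetric]) (use assms in \<open>auto simp: fsuppD\<close>)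
  finally show ?thesis .
qed

lemma comb_smult_left:
  assumes "\<rho> \<in> fsupp R" "\<And>i. y i \<in> carrier M" "a \<in> carrier R"
  shows "comb R M (\<lambda>i. a \<otimes> \<rho> i) y = a \<odot>\<^bsub>M\<^esub> comb R M \<rho> y"
proof -
  let ?S = "{i. \<rho> i \<noteq> \<zero>}"
  have "comb R M (\<lambda>i. a \<otimes> \<rho> i) y = finsum M (\<lambda>i. (a \<otimes> \<rho> i) \<odot>\<^bsub>M\<^esub> y i) ?S"
    by (rule comb_superset) (use assms fsupp_smult in \<open>auto simp: fsuppD\<close>)
  also have "\<dots> = finsum M (\<lambda>i. a \<odot>\<^bsub>M\<^esub> (\<rho> i \<odot>\<^bsub>M\<^esub> y i)) ?S"
    by (rule M.finsum_cong') (use assms in \<open>auto simp: fsuppD smult_assoc1\<close>)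
  finally show ?thesis
    unfolding comb_def using assms by (subst finsum_smult_ldistr) (auto simp: fsuppD)
qed

lemma comb_unitv:
  assumes "\<And>i. y i \<in> carrier M"
  shows "comb R M (unitv R i) y = y i"
proof -
  have "comb R M (unitv R i) y = finsum M (\<lambda>j. unitv R i j \<odot>\<^bsub>M\<^esub> y j) {i}"
    by (rule comb_superset[OF fsupp_unitv]) (use assms in \<open>auto simp: unitv_def\<close>)
  then show ?thesis using assms by (simp add: unitv_def)
qed

lemma comb_zero_left: "comb R M (\<lambda>_. \<zero>) y = \<zero>\<^bsub>M\<^esub>"
  by (simp add: comb_def)

end

lemma lin_comb_eq_comb: "lin_comb R M c = comb R M c (\<lambda>x. x)"
  by (simp add: lin_comb_def comb_def)

section \<open>Homomorphisms, powers and products of modules\<close>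

lemma mod_homD:
  assumes "h \<in> mod_hom R M N"
  shows "x \<in> carrier M \<Longrightarrow> h x \<in> carrier N"
    and "x \<in> carrier M \<Longrightarrow> y \<in> carrier M \<Longrightarrow> h (x \<oplus>\<^bsub>M\<^esub> y) = h x \<oplus>\<^bsub>N\<^esub> h y"
    and "a \<in> carrier R \<Longrightarrow> x \<in> carrier M \<Longrightarrow> h (a \<odot>\<^bsub>M\<^esub> x) = a \<odot>\<^bsub>N\<^esub> h x"
  using assms by (auto simp: mod_hom_def)

lemma mod_hom_zero:
  assumes "module R M" "module R N" "h \<in> mod_hom R M N"
  shows "h \<zero>\<^bsub>M\<^esub> = \<zero>\<^bsub>N\<^esub>"
proof -
  interpret M: module R M by fact
  interpret N: module R N by fact
  have "h \<zero>\<^bsub>M\<^esub> = h (\<zero>\<^bsub>R\<^esub> \<odot>\<^bsub>M\<^esub> \<zero>\<^bsub>M\<^esub>)" by simp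
  also have "\<dots> = \<zero>\<^bsub>R\<^esub> \<odot>\<^bsub>N\<^esub> h \<zero>\<^bsub>M\<^esub>" by (rule mod_homD(3)[OF assms(3)]) auto
  also have "\<dots> = \<zero>\<^bsub>N\<^esub>" by (simp add: mod_homD(1)[OF assms(3)])
  finally show ?thesis .
qed

lemma mod_hom_neg:
  assumes "module R M" "module R N" "h \<in> mod_hom R M N" "x \<in> carrier M"
  shows "h (\<ominus>\<^bsub>M\<^esub> x) = \<ominus>\<^bsub>N\<^esub> h x"
proof -
  interpret M: module R M by fact
  interpret N: module R N by fact
  have "h ((\<ominus>\<^bsub>R\<^esub> \<one>\<^bsub>R\<^esub>) \<odot>\<^bsub>M\<^esub> x) = (\<ominus>\<^bsub>R\<^esub> \<one>\<^bsub>R\<^esub>) \<odot>\<^bsub>N\<^esub> h x"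
    using mod_homD[OF assms(3)] assms(4) by simp
  then show ?thesis
    using mod_homD[OF assms(3)] assms(4) by (simp add: M.smult_l_minus N.smult_l_minus)
qed

lemma mod_hom_minus:
  assumes "module R M" "module R N" "h \<in> mod_hom R M N" "x \<in> carrier M" "y \<in> carrier M"
  shows "h (x \<ominus>\<^bsub>M\<^esub> y) = h x \<ominus>\<^bsub>N\<^esub> h y"
proof -
  interpret M: module R M by fact
  interpret N: module R N by fact
  show ?thesis
    using assms by (simp add: M.M.minus_eq N.M.minus_eq mod_homD[OF assms(3)] mod_hom_neg[OF assms(1-3)])
qed

lemma mod_hom_finsum:
  assumes "module R M" "module R N" "h \<in> mod_hom R M N" "\<And>i. i \<in> I \<Longrightarrow> f i \<in> carrier M"
  shows "h (finsum M f I) = finsum N (\<lambda>i. h (f i)) I"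
proof -
  interpret M: module R M by fact
  interpret N: module R N by fact
  show ?thesis using assms(4)
  proof (induct I rule: infinite_finite_induct)
    case (insert x F)
    then have "f \<in> F \<rightarrow> carrier M" "(\<lambda>i. h (f i)) \<in> F \<rightarrow> carrier N" "f x \<in> carrier M" "h (f x) \<in> carrier N"
      by (auto intro: mod_homD[OF assms(3)])
    then show ?case
      using insert mod_homD(2)[OF assms(3)] by (simp add: M.M.finsum_closed)
  qed (use mod_hom_zero[OF assms(1-3)] in auto)
qed

lemma mod_hom_comb:
  assumes "module R M" "module R N" "h \<in> mod_hom R M N" "\<rho> \<in> fsupp R" "\<And>i. y i \<in> carrier M"
  shows "h (comb R M \<rho> y) = comb R N \<rho> (\<lambda>i. h (y i))"
proof -
  interpret M: module R M by fact
  interpret N: module R N by fact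
  show ?thesis unfolding comb_def
    by (subst mod_hom_finsum[OF assms(1-3)])
      (use assms mod_homD[OF assms(3)] in \<open>auto simp: fsuppD intro!: N.M.finsum_cong'\<close>)
qed

definition regular :: "('r, 's) ring_scheme \<Rightarrow> ('r, 'r) module"
  where "regular R = \<lparr>carrier = carrier R, monoid.mult = monoid.mult R, one = \<one>\<^bsub>R\<^esub>, ring.zero = \<zero>\<^bsub>R\<^esub>,
    ring.add = ring.add R, module.smult = monoid.mult R\<rparr>"

definition fun_module :: "('r, 'm, 't) module_scheme \<Rightarrow> ('r, 'i \<Rightarrow> 'm) module"
  where "fun_module M = \<lparr>carrier = {z. \<forall>i. z i \<in> carrier M}, monoid.mult = undefined, one = undefined,
    ring.zero = (\<lambda>_. \<zero>\<^bsub>M\<^esub>), ring.add = (\<lambda>y z i. y i \<oplus>\<^bsub>M\<^esub> z i), module.smult = (\<lambda>a z i. a \<odot>\<^bsub>M\<^esub> z i)\<rparr>"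

definition prod_module ::
    "('r, 'm, 't) module_scheme \<Rightarrow> ('r, 'n, 'u) module_scheme \<Rightarrow> ('r, 'm \<times> 'n) module"
  where "prod_module M N = \<lparr>carrier = carrier M \<times> carrier N, monoid.mult = undefined, one = undefined,
    ring.zero = (\<zero>\<^bsub>M\<^esub>, \<zero>\<^bsub>N\<^esub>), ring.add = (\<lambda>(x, y) (x', y'). (x \<oplus>\<^bsub>M\<^esub> x', y \<oplus>\<^bsub>N\<^esub> y')),
    module.smult = (\<lambda>a (x, y). (a \<odot>\<^bsub>M\<^esub> x, a \<odot>\<^bsub>N\<^esub> y))\<rparr>"

lemma (in cring) regular_module: "module R (regular R)"
proof (rule moduleI[OF is_cring])
  show "abelian_group (regular R)"
  proof (rule abelian_groupI)
    fix c assume c: "c \<in> carrier (regular R)"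
    show "\<exists>y\<in>carrier (regular R). y \<oplus>\<^bsub>regular R\<^esub> c = \<zero>\<^bsub>regular R\<^esub>"
      using c by (intro bexI[of _ "\<ominus> c"]) (auto simp: regular_def l_neg)
  next
    fix x y assume "x \<in> carrier (regular R)" "y \<in> carrier (regular R)"
    then show "x \<oplus>\<^bsub>regular R\<^esub> y = y \<oplus>\<^bsub>regular R\<^esub> x"
      by (auto simp: regular_def a_comm)
  qed (auto simp: regular_def a_assoc)
qed (auto simp: regular_def l_distr r_distr m_assoc)

lemma (in module) fun_module_module: "module R (fun_module M :: ('a, 'i \<Rightarrow> 'c) module)" (is "module R ?F")
proof (rule moduleI[OF R.is_cring])
  show "abelian_group ?F"
  proof (rule abelian_groupI)
    fix c assume c: "c \<in> carrier ?F"
    show "\<exists>y\<in>carrier ?F. y \<oplus>\<^bsub>?F\<^esub> c = \<zero>\<^bsub>?F\<^esub>"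
      using c by (intro bexI[of _ "\<lambda>i. \<ominus>\<^bsub>M\<^esub> c i"]) (auto simp: fun_module_def M.l_neg)
  next
    fix x y assume "x \<in> carrier ?F" "y \<in> carrier ?F"
    then show "x \<oplus>\<^bsub>?F\<^esub> y = y \<oplus>\<^bsub>?F\<^esub> x"
      by (auto simp: fun_module_def M.a_comm)
  qed (auto simp: fun_module_def M.a_assoc)
qed (auto simp: fun_module_def smult_l_distr smult_r_distr smult_assoc1)

lemma prod_module_module:
  assumes "module R M" "module R N"
  shows "module R (prod_module M N)"
proof -
  interpret M: module R M by fact
  interpret N: module R N by fact
  show ?thesis
  proof (rule moduleI[OF M.R.is_cring])
    show "abelian_group (prod_module M N)"
    proof (rule abelian_groupI)
      fix c assume c: "c \<in> carrier (prod_module M N)"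
      show "\<exists>y\<in>carrier (prod_module M N). y \<oplus>\<^bsub>prod_module M N\<^esub> c = \<zero>\<^bsub>prod_module M N\<^esub>"
        using c by (intro bexI[of _ "(\<ominus>\<^bsub>M\<^esub> fst c, \<ominus>\<^bsub>N\<^esub> snd c)"])
          (auto simp: prod_module_def M.M.l_neg N.M.l_neg)
    next
      fix x y assume "x \<in> carrier (prod_module M N)" "y \<in> carrier (prod_module M N)"
      then show "x \<oplus>\<^bsub>prod_module M N\<^esub> y = y \<oplus>\<^bsub>prod_module M N\<^esub> x"
        by (auto simp: prod_module_def M.M.a_comm N.M.a_comm)
    qed (auto simp: prod_module_def M.M.a_assoc N.M.a_assoc)
  qed (auto simp: prod_module_def M.smult_l_distr M.smult_r_distr M.smult_assoc1
      N.smult_l_distr N.smult_r_distr N.smult_assoc1)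
qed

lemma eval_fun_module: "(\<lambda>z. z i) \<in> mod_hom R (fun_module M) M"
  by (auto simp: mod_hom_def fun_module_def)

lemma eval_free_module: "(\<lambda>z. z i) \<in> mod_hom R (free_module R X) (regular R)"
  by (auto simp: mod_hom_def free_module_def regular_def)

lemma fst_prod_module: "fst \<in> mod_hom R (prod_module M N) M"
  by (auto simp: mod_hom_def prod_module_def)

lemma snd_prod_module: "snd \<in> mod_hom R (prod_module M N) N"
  by (auto simp: mod_hom_def prod_module_def)

lemma prod_module_simps:
  "carrier (prod_module M N) = carrier M \<times> carrier N"
  "\<zero>\<^bsub>prod_module M N\<^esub> = (\<zero>\<^bsub>M\<^esub>, \<zero>\<^bsub>N\<^esub>)"
  "(x, y) \<oplus>\<^bsub>prod_module M N\<^esub> (x', y') = (x \<oplus>\<^bsub>M\<^esub> x', y \<oplus>\<^bsub>N\<^esub> y')"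
  "a \<odot>\<^bsub>prod_module M N\<^esub> (x, y) = (a \<odot>\<^bsub>M\<^esub> x, a \<odot>\<^bsub>N\<^esub> y)"
  by (simp_all add: prod_module_def)

lemma prod_module_minus:
  assumes M: "module R M" and N: "module R N"
    and "x \<in> carrier M" "x' \<in> carrier M" "y \<in> carrier N" "y' \<in> carrier N"
  shows "(x, y) \<ominus>\<^bsub>prod_module M N\<^esub> (x', y') = (x \<ominus>\<^bsub>M\<^esub> x', y \<ominus>\<^bsub>N\<^esub> y')"
  using mod_hom_minus[OF prod_module_module[OF M N] M fst_prod_module, of "(x, y)" "(x', y')"]
    mod_hom_minus[OF prod_module_module[OF M N] N snd_prod_module, of "(x, y)" "(x', y')"] assms
  by (auto simp: prod_module_simps intro: prod_eqI)

lemma (in cring) comb_free_unitv: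
  assumes "\<rho> \<in> fsupp R"
  shows "comb R (free_module R UNIV) \<rho> (unitv R) = \<rho>"
proof
  fix l
  interpret F: module R "free_module R UNIV" by (rule free_module_module)
  interpret G: module R "regular R" by (rule regular_module)
  have u: "unitv R i \<in> fsupp R" for i :: 'c by (rule F.fsupp_unitv)
  have "comb R (free_module R UNIV) \<rho> (unitv R) l = comb R (regular R) \<rho> (\<lambda>i. unitv R i l)"
    by (rule mod_hom_comb[OF free_module_module regular_module eval_free_module assms u])
  also have "\<dots> = finsum (regular R) (\<lambda>i. \<rho> i \<odot>\<^bsub>regular R\<^esub> unitv R i l) (insert l {i. \<rho> i \<noteq> \<zero>})"
    by (rule G.comb_superset[OF assms]) (use fsuppD[OF assms] in \<open>auto simp: regular_def unitv_def\<close>)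
  also have "\<dots> = finsum (regular R) (\<lambda>i. if l = i then \<rho> i else \<zero>\<^bsub>regular R\<^esub>) (insert l {i. \<rho> i \<noteq> \<zero>})"
    by (rule G.M.finsum_cong') (use fsuppD[OF assms] in \<open>auto simp: regular_def unitv_def\<close>)
  also have "\<dots> = \<rho> l"
    by (rule G.M.finsum_singleton) (use fsuppD[OF assms] in \<open>auto simp: regular_def\<close>)
  finally show "comb R (free_module R UNIV) \<rho> (unitv R) l = \<rho> l" .
qed

section \<open>Adjoining generators to a submodule, and complements\<close>

definition adjoin :: "('r, 's) ring_scheme \<Rightarrow> ('r, 'm, 't) module_scheme \<Rightarrow> 'm set \<Rightarrow> ('i \<Rightarrow> 'm) \<Rightarrow> 'm set"
  where "adjoin R M D w = {x. \<exists>a\<in>fsupp R. mcong M D x (comb R M a w)}"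

context module
begin

lemma comb_neg:
  assumes "\<rho> \<in> fsupp R" "\<And>i. y i \<in> carrier M"
  shows "comb R M \<rho> (\<lambda>i. \<ominus>\<^bsub>M\<^esub> y i) = \<ominus>\<^bsub>M\<^esub> comb R M \<rho> y"
proof -
  have "comb R M \<rho> (\<lambda>i. (\<ominus> \<one>) \<odot>\<^bsub>M\<^esub> y i) = (\<ominus> \<one>) \<odot>\<^bsub>M\<^esub> comb R M \<rho> y"
    by (rule comb_smult) (use assms in auto)
  then show ?thesis using assms comb_closed[of \<rho> y] by (simp add: smult_l_minus)
qed

lemma adjoin_submodule:
  assumes D: "submodule D R M" and w: "\<And>i. w i \<in> carrier M"
  shows "submodule (adjoin R M D w) R M"
proof (rule submoduleI)
  show "adjoin R M D w \<subseteq> carrier M" by (auto simp: adjoin_def dest: mcongD)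
  show "\<zero>\<^bsub>M\<^esub> \<in> adjoin R M D w"
    using fsupp_zero mcong_refl[OF D] unfolding adjoin_def
    by (auto intro!: bexI[of _ "\<lambda>_. \<zero>"] simp: comb_zero_left)
  show smult: "a \<odot>\<^bsub>M\<^esub> x \<in> adjoin R M D w" if "a \<in> carrier R" "x \<in> adjoin R M D w" for a x
  proof -
    obtain b where b: "b \<in> fsupp R" "mcong M D x (comb R M b w)" using \<open>x \<in> _\<close> by (auto simp: adjoin_def)
    have "mcong M D (a \<odot>\<^bsub>M\<^esub> x) (comb R M (\<lambda>i. a \<otimes> b i) w)"
      using mcong_smult[OF D b(2) that(1)] comb_smult_left[OF b(1) w that(1)] by simp
    then show ?thesis using fsupp_smult[OF that(1) b(1)] by (auto simp: adjoin_def)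
  qed
  show "x \<oplus>\<^bsub>M\<^esub> y \<in> adjoin R M D w" if xy: "x \<in> adjoin R M D w" "y \<in> adjoin R M D w" for x y
  proof -
    obtain b c where b: "b \<in> fsupp R" "mcong M D x (comb R M b w)" "c \<in> fsupp R" "mcong M D y (comb R M c w)"
      using xy by (auto simp: adjoin_def)
    have "mcong M D (x \<oplus>\<^bsub>M\<^esub> y) (comb R M (\<lambda>i. b i \<oplus> c i) w)"
      using mcong_add[OF D b(2,4)] comb_add_left[OF b(1,3) w] by simp
    then show ?thesis using fsupp_add[OF b(1,3)] by (auto simp: adjoin_def)
  qed
  fix x assume x: "x \<in> adjoin R M D w"
  then have "\<ominus>\<^bsub>M\<^esub> x = (\<ominus> \<one>) \<odot>\<^bsub>M\<^esub> x"
    by (auto simp: adjoin_def smult_l_minus dest: mcongD)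
  then show "\<ominus>\<^bsub>M\<^esub> x \<in> adjoin R M D w" using smult[OF _ x, of "\<ominus> \<one>"] by simp
qed

lemma adjoin_base: "submodule D R M \<Longrightarrow> D \<subseteq> adjoin R M D w"
  unfolding adjoin_def
  by (auto intro!: bexI[OF _ fsupp_zero] simp: comb_zero_left mcong_zero_iff)

lemma adjoin_gen:
  "submodule D R M \<Longrightarrow> (\<And>i. w i \<in> carrier M) \<Longrightarrow> w i \<in> adjoin R M D w"
  unfolding adjoin_def
  by (auto intro!: bexI[OF _ fsupp_unitv[of i]] simp: comb_unitv mcong_refl)

lemma adjoin_single:
  fixes e
  defines "w \<equiv> \<lambda>_::unit. e"
  assumes "e \<in> carrier M"
  shows "x \<in> adjoin R M D w \<longleftrightarrow> (\<exists>r\<in>carrier R. mcong M D x (r \<odot>\<^bsub>M\<^esub> e))"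
proof -
  have c: "comb R M a w = a () \<odot>\<^bsub>M\<^esub> e" if "a \<in> fsupp R" for a
    using comb_superset[OF that, of UNIV w] fsuppD[OF that] assms by (simp add: UNIV_unit)
  show ?thesis
  proof
    assume "x \<in> adjoin R M D w"
    then show "\<exists>r\<in>carrier R. mcong M D x (r \<odot>\<^bsub>M\<^esub> e)"
      using c fsuppD(1) unfolding adjoin_def by force
  next
    assume "\<exists>r\<in>carrier R. mcong M D x (r \<odot>\<^bsub>M\<^esub> e)"
    then obtain r where r: "r \<in> carrier R" "mcong M D x (r \<odot>\<^bsub>M\<^esub> e)" by blast
    have "(\<lambda>_::unit. r) \<in> fsupp R"
      by (rule fsuppI[where S=UNIV]) (use r in auto)
    then show "x \<in> adjoin R M D w"
      using c r unfolding adjoin_def by force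
  qed
qed

lemma submodule_Union_chain:
  assumes "\<C> \<noteq> {}" "\<And>D. D \<in> \<C> \<Longrightarrow> submodule D R M"
    and chain: "\<And>D D'. D \<in> \<C> \<Longrightarrow> D' \<in> \<C> \<Longrightarrow> D \<subseteq> D' \<or> D' \<subseteq> D"
  shows "submodule (\<Union>\<C>) R M"
proof (rule submoduleI)
  fix a b assume "a \<in> \<Union>\<C>" "b \<in> \<Union>\<C>"
  then obtain D where "D \<in> \<C>" "a \<in> D" "b \<in> D" using chain by blast
  then show "a \<oplus>\<^bsub>M\<^esub> b \<in> \<Union>\<C>" using submodule_closed(6)[OF assms(2)] by blast
next
  show "\<Union>\<C> \<subseteq> carrier M" using submodule_closed(1)[OF assms(2)] by blast
  show "\<zero>\<^bsub>M\<^esub> \<in> \<Union>\<C>" using assms(1) submodule_closed(2)[OF assms(2)] by blast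
  show "\<ominus>\<^bsub>M\<^esub> a \<in> \<Union>\<C>" if "a \<in> \<Union>\<C>" for a using that submodule_closed(4)[OF assms(2)] by blast
  show "r \<odot>\<^bsub>M\<^esub> a \<in> \<Union>\<C>" if "r \<in> carrier R" "a \<in> \<Union>\<C>" for r a
    using that submodule_closed(5)[OF assms(2)] by blast
qed

text \<open>Scalars outside \<open>J\<close> act bijectively on \<open>A/B\<close>. By Zorn's lemma, enlarge \<open>D\<close> to a maximal submodule
  meeting \<open>A\<close> only in \<open>B\<close>. An element \<open>e\<close> with \<open>J e \<subseteq> D\<close> can be adjoined to it if only scalars in \<open>J\<close> push
  \<open>e\<close> into its sum with \<open>A\<close>. If instead \<open>r e\<close> lies in this sum for some other \<open>r\<close>, division by \<open>r\<close> provides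
  an element \<open>a\<close> of \<open>A\<close> such that \<open>e - a\<close> can be adjoined.\<close>

lemma complement_of_divisible:
  assumes A: "submodule A R M" and B: "submodule B R M" and D: "submodule D R M"
    and BD: "B \<subseteq> D" and DA: "D \<inter> A \<subseteq> B" and BA: "B \<subseteq> A"
    and inj: "\<And>r x. r \<in> carrier R - J \<Longrightarrow> x \<in> A \<Longrightarrow> r \<odot>\<^bsub>M\<^esub> x \<in> B \<Longrightarrow> x \<in> B"
    and surj: "\<And>r x. r \<in> carrier R - J \<Longrightarrow> x \<in> A \<Longrightarrow> \<exists>y\<in>A. mcong M B (r \<odot>\<^bsub>M\<^esub> y) x"
  shows "\<exists>D'. submodule D' R M \<and> D \<subseteq> D' \<and> D' \<inter> A \<subseteq> B \<and>
    (\<forall>e\<in>carrier M. (\<forall>j\<in>J. j \<odot>\<^bsub>M\<^esub> e \<in> D) \<longrightarrow> (\<exists>a\<in>A. e \<ominus>\<^bsub>M\<^esub> a \<in> D'))"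
proof -
  let ?\<D> = "{D'. submodule D' R M \<and> D \<subseteq> D' \<and> D' \<inter> A \<subseteq> B}"
  have "\<exists>N\<in>?\<D>. \<forall>X\<in>?\<D>. N \<subseteq> X \<longrightarrow> X = N"
  proof (rule subset_Zorn_nonempty)
    show "?\<D> \<noteq> {}" using D DA by blast
    fix \<C> assume \<C>: "\<C> \<noteq> {}" "subset.chain ?\<D> \<C>"
    then have "submodule (\<Union>\<C>) R M"
      unfolding subset_chain_def by (intro submodule_Union_chain) blast+
    then show "\<Union>\<C> \<in> ?\<D>" using \<C> unfolding subset_chain_def by blast
  qed
  then obtain N where N: "submodule N R M" "D \<subseteq> N" "N \<inter> A \<subseteq> B"
    and max: "\<And>X. submodule X R M \<Longrightarrow> N \<subseteq> X \<Longrightarrow> X \<inter> A \<subseteq> B \<Longrightarrow> X = N"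
    by auto
  have absorb: "f \<in> N" if f: "f \<in> carrier M"
    and *: "\<And>u x. u \<in> carrier R \<Longrightarrow> x \<in> A \<Longrightarrow> mcong M N x (u \<odot>\<^bsub>M\<^esub> f) \<Longrightarrow> x \<in> B" for f
  proof -
    have "adjoin R M N (\<lambda>_::unit. f) = N"
    proof (rule max)
      show "adjoin R M N (\<lambda>_::unit. f) \<inter> A \<subseteq> B" using * f by (auto simp: adjoin_single)
      show "submodule (adjoin R M N (\<lambda>_::unit. f)) R M" by (rule adjoin_submodule[OF N(1) f])
      show "N \<subseteq> adjoin R M N (\<lambda>_::unit. f)" by (rule adjoin_base[OF N(1)])
    qed
    then show "f \<in> N" using adjoin_gen[OF N(1), of "\<lambda>_::unit. f"] f by simp
  qed
  have "\<exists>a\<in>A. e \<ominus>\<^bsub>M\<^esub> a \<in> N" if e: "e \<in> carrier M" and Je: "\<And>j. j \<in> J \<Longrightarrow> j \<odot>\<^bsub>M\<^esub> e \<in> D" for e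
  proof (cases "\<exists>r\<in>carrier R - J. \<exists>a\<in>A. mcong M N (r \<odot>\<^bsub>M\<^esub> e) a")
    case False
    have "e \<in> N"
    proof (rule absorb[OF e])
      fix u x assume u: "u \<in> carrier R" "x \<in> A" "mcong M N x (u \<odot>\<^bsub>M\<^esub> e)"
      then have "u \<in> J" using False mcong_sym[OF N(1)] by blast
      then have "x \<in> N" using Je N u mcong_mem[OF N(1) u(3)] by blast
      then show "x \<in> B" using u N by blast
    qed
    then show ?thesis using e submodule_zero[OF A] by (intro bexI[of _ "\<zero>\<^bsub>M\<^esub>"]) (auto simp: M.minus_eq)
  next
    case True
    then obtain r a where ra: "r \<in> carrier R" "r \<notin> J" "a \<in> A" "mcong M N (r \<odot>\<^bsub>M\<^esub> e) a" by blast
    then obtain a' where a': "a' \<in> A" "mcong M B (r \<odot>\<^bsub>M\<^esub> a') a" using surj by blast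
    have cl: "a' \<in> carrier M" "a \<in> carrier M" using a' ra submodule_sub[OF A] by auto
    have "mcong M N (r \<odot>\<^bsub>M\<^esub> a') a" by (rule mcong_mono[OF a'(2)]) (use BD N in blast)
    then have re: "r \<odot>\<^bsub>M\<^esub> (e \<ominus>\<^bsub>M\<^esub> a') \<in> N"
      using mcong_trans[OF N(1) ra(4) mcong_sym[OF N(1)]] e cl ra by (auto simp: smult_diff mcong_def)
    have "e \<ominus>\<^bsub>M\<^esub> a' \<in> N"
    proof (rule absorb)
      fix u x assume u: "u \<in> carrier R" "x \<in> A" "mcong M N x (u \<odot>\<^bsub>M\<^esub> (e \<ominus>\<^bsub>M\<^esub> a'))"
      have "mcong M N (r \<odot>\<^bsub>M\<^esub> x) (u \<odot>\<^bsub>M\<^esub> (r \<odot>\<^bsub>M\<^esub> (e \<ominus>\<^bsub>M\<^esub> a')))"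
        using mcong_smult[OF N(1) u(3) ra(1)] ra u e cl by (simp add: smult_assoc1[symmetric] R.m_comm)
      moreover have "u \<odot>\<^bsub>M\<^esub> (r \<odot>\<^bsub>M\<^esub> (e \<ominus>\<^bsub>M\<^esub> a')) \<in> N" by (rule submodule_closed(5)[OF N(1) u(1) re])
      ultimately have "r \<odot>\<^bsub>M\<^esub> x \<in> N" using mcong_mem[OF N(1)] by blast
      then have "r \<odot>\<^bsub>M\<^esub> x \<in> B" using N(3) submodule_closed(5)[OF A ra(1) u(2)] by blast
      then show "x \<in> B" using inj ra u by blast
    qed (use e cl in simp)
    then show ?thesis using a' by blast
  qed
  then show ?thesis using N by blast
qed

end

section \<open>Systems of linear equations with coefficients outside a prime\<close>

definition solvable :: "('r, 's) ring_scheme \<Rightarrow> ('r, 'm, 't) module_scheme \<Rightarrow> ('i \<Rightarrow> 'i \<Rightarrow> 'r) \<Rightarrow> 'm set \<Rightarrow> 'm set \<Rightarrow> bool"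
  where "solvable R M \<delta> A B \<longleftrightarrow>
    (\<forall>c. (\<forall>k. c k \<in> A) \<longrightarrow> (\<exists>y. (\<forall>l. y l \<in> A) \<and> (\<forall>k. mcong M B (comb R M (\<delta> k) y) (c k))))"

text \<open>Linear independence over \<open>R/J\<close> of the rows reduced modulo \<open>J\<close>.\<close>

definition indep_mod :: "('r, 's) ring_scheme \<Rightarrow> 'r set \<Rightarrow> ('i \<Rightarrow> 'i \<Rightarrow> 'r) \<Rightarrow> bool"
  where "indep_mod R J \<delta> \<longleftrightarrow>
    (\<forall>a\<in>fsupp R. (\<forall>l. comb R (free_module R UNIV) a \<delta> l \<in> J) \<longrightarrow> (\<forall>k. a k \<in> J))"

text \<open>If \<open>R/J\<close> is a field, this is linear algebra over it; here only the scalars outside \<open>J\<close> have to act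
  bijectively. The pairs of a row and the negative of its right-hand side generate a submodule \<open>D\<close> of the
  free module times \<open>M\<close>. By independence it meets \<open>A\<close> trivially modulo \<open>B\<close>, so it lies in a submodule \<open>D'\<close>
  that still does and that contains \<open>(e, -y)\<close> for each unit vector \<open>e\<close> and some \<open>y\<close> in \<open>A\<close>. The elements \<open>y\<close>
  solve the system, since a row is a combination of unit vectors.\<close>

lemma (in module) solvable_of_divisible:
  fixes \<delta> :: "'i \<Rightarrow> 'i \<Rightarrow> 'a"
  assumes A: "submodule A R M" and B: "submodule B R M" and BA: "B \<subseteq> A"
    and J: "ideal J R" and JA: "\<And>j x. j \<in> J \<Longrightarrow> x \<in> A \<Longrightarrow> j \<odot>\<^bsub>M\<^esub> x \<in> B"
    and inj: "\<And>r x. r \<in> carrier R - J \<Longrightarrow> x \<in> A \<Longrightarrow> r \<odot>\<^bsub>M\<^esub> x \<in> B \<Longrightarrow> x \<in> B"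
    and surj: "\<And>r x. r \<in> carrier R - J \<Longrightarrow> x \<in> A \<Longrightarrow> \<exists>y\<in>A. mcong M B (r \<odot>\<^bsub>M\<^esub> y) x"
    and \<delta>: "\<And>k. \<delta> k \<in> fsupp R" and indep: "indep_mod R J \<delta>"
  shows "solvable R M \<delta> A B"
  unfolding solvable_def
proof (intro allI impI)
  fix c :: "'i \<Rightarrow> 'c" assume c: "\<forall>k. c k \<in> A"
  then have cM: "c k \<in> carrier M" for k using submodule_sub[OF A] by blast
  let ?F = "free_module R (UNIV :: 'i set)"
  let ?E = "prod_module ?F M"
  interpret F: module R ?F by (rule R.free_module_module)
  have modM: "module R M" ..
  interpret E: module R ?E by (rule prod_module_module[OF F.module_axioms modM])
  interpret J: ideal J R by fact
  have E_carrier: "carrier ?E = carrier ?F \<times> carrier M" by (simp add: prod_module_def)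
  have E_minus: "(g, x) \<ominus>\<^bsub>?E\<^esub> (h, y) = (g \<ominus>\<^bsub>?F\<^esub> h, x \<ominus>\<^bsub>M\<^esub> y)"
    if "g \<in> carrier ?F" "h \<in> carrier ?F" "x \<in> carrier M" "y \<in> carrier M" for g h x y
    by (rule prod_module_minus[OF F.module_axioms modM that])
  have E_comb: "comb R ?E \<rho> w = (comb R ?F \<rho> (\<lambda>i. fst (w i)), comb R M \<rho> (\<lambda>i. snd (w i)))"
    if "\<rho> \<in> fsupp R" "\<And>i. w i \<in> carrier ?E" for \<rho> :: "'i \<Rightarrow> 'a" and w
  proof (rule prod_eqI)
    show "fst (comb R ?E \<rho> w) = fst (comb R ?F \<rho> (\<lambda>i. fst (w i)), comb R M \<rho> (\<lambda>i. snd (w i)))"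
      using mod_hom_comb[OF E.module_axioms F.module_axioms fst_prod_module that] by simp
    show "snd (comb R ?E \<rho> w) = snd (comb R ?F \<rho> (\<lambda>i. fst (w i)), comb R M \<rho> (\<lambda>i. snd (w i)))"
      using mod_hom_comb[OF E.module_axioms modM snd_prod_module that] by simp
  qed
  have E_smult: "a \<odot>\<^bsub>?E\<^esub> (g, x) = (a \<odot>\<^bsub>?F\<^esub> g, a \<odot>\<^bsub>M\<^esub> x)" for a g x by (simp add: prod_module_def)
  define JF where "JF = {g \<in> carrier ?F. \<forall>l. g l \<in> J}"
  have F_neg: "(\<ominus>\<^bsub>?F\<^esub> g) l = \<ominus> g l" if "g \<in> carrier ?F" for g l
  proof -
    have "(\<lambda>l. \<ominus> g l) \<in> carrier ?F"
      by (rule fsuppI[where S="{l. g l \<noteq> \<zero>}"]) (use fsuppD[OF that] in auto)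
    moreover have "(\<lambda>l. \<ominus> g l) \<oplus>\<^bsub>?F\<^esub> g = \<zero>\<^bsub>?F\<^esub>"
      using fsuppD(1)[OF that] by (simp add: free_module_def R.l_neg)
    ultimately show ?thesis using F.M.minus_equality that by metis
  qed
  have JF: "submodule JF R ?F"
  proof (rule F.submoduleI)
    fix a assume "a \<in> JF" then show "\<ominus>\<^bsub>?F\<^esub> a \<in> JF" by (auto simp: JF_def F_neg)
  next
    fix a b assume "a \<in> JF" "b \<in> JF"
    then have "a \<oplus>\<^bsub>?F\<^esub> b \<in> carrier ?F" "\<And>l. (a \<oplus>\<^bsub>?F\<^esub> b) l = a l \<oplus> b l"
      by (auto simp: JF_def) (auto simp: free_module_def)
    then show "a \<oplus>\<^bsub>?F\<^esub> b \<in> JF" using \<open>a \<in> JF\<close> \<open>b \<in> JF\<close> by (auto simp: JF_def)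
  next
    fix a b assume "a \<in> carrier R" "b \<in> JF"
    then have "a \<odot>\<^bsub>?F\<^esub> b \<in> carrier ?F" "\<And>l. (a \<odot>\<^bsub>?F\<^esub> b) l = a \<otimes> b l"
      by (auto simp: JF_def) (auto simp: free_module_def)
    then show "a \<odot>\<^bsub>?F\<^esub> b \<in> JF" using \<open>a \<in> carrier R\<close> \<open>b \<in> JF\<close> by (auto simp: JF_def J.I_l_closed)
  next
    have "\<zero>\<^bsub>?F\<^esub> \<in> carrier ?F" "\<And>l. \<zero>\<^bsub>?F\<^esub> l = \<zero>" by simp (simp add: free_module_def)
    then show "\<zero>\<^bsub>?F\<^esub> \<in> JF" by (auto simp: JF_def)
  qed (auto simp: JF_def)
  have prodsub: "submodule (X \<times> Y) R ?E" if X: "submodule X R ?F" and Y: "submodule Y R M" for X Y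
  proof (rule E.submoduleI)
    show "X \<times> Y \<subseteq> carrier ?E" using F.submodule_sub[OF X] submodule_sub[OF Y] by (auto simp: E_carrier)
    show "\<zero>\<^bsub>?E\<^esub> \<in> X \<times> Y" using F.submodule_zero[OF X] submodule_zero[OF Y] by (auto simp: prod_module_def)
    show "a \<oplus>\<^bsub>?E\<^esub> b \<in> X \<times> Y" if "a \<in> X \<times> Y" "b \<in> X \<times> Y" for a b
      using that F.submodule_closed[OF X] submodule_closed[OF Y] by (auto simp: prod_module_def)
    show smul: "r \<odot>\<^bsub>?E\<^esub> b \<in> X \<times> Y" if "r \<in> carrier R" "b \<in> X \<times> Y" for r b
      using that F.submodule_closed[OF X] submodule_closed[OF Y] by (auto simp: prod_module_def)
    fix b assume "b \<in> X \<times> Y"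
    moreover have "b \<in> carrier ?E"
      using \<open>b \<in> X \<times> Y\<close> F.submodule_sub[OF X] submodule_sub[OF Y] by (auto simp: E_carrier)
    ultimately show "\<ominus>\<^bsub>?E\<^esub> b \<in> X \<times> Y" using smul[of "\<ominus> \<one>" b] by (simp add: E.smult_l_minus)
  qed
  define w where "w k = (\<delta> k, \<ominus>\<^bsub>M\<^esub> c k)" for k
  have w: "w k \<in> carrier ?E" for k using \<delta> cM by (auto simp: w_def E_carrier)
  define D where "D = adjoin R ?E (JF \<times> B) w"
  have JFB: "submodule (JF \<times> B) R ?E" by (rule prodsub[OF JF B])
  have D: "submodule D R ?E" unfolding D_def by (rule E.adjoin_submodule[OF JFB w])
  have A': "submodule ({\<zero>\<^bsub>?F\<^esub>} \<times> A) R ?E" by (rule prodsub[OF F.submodule_zero_set A])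
  have B': "submodule ({\<zero>\<^bsub>?F\<^esub>} \<times> B) R ?E" by (rule prodsub[OF F.submodule_zero_set B])
  have base: "JF \<times> B \<subseteq> D" unfolding D_def by (rule E.adjoin_base[OF JFB])
  have DA: "D \<inter> {\<zero>\<^bsub>?F\<^esub>} \<times> A \<subseteq> {\<zero>\<^bsub>?F\<^esub>} \<times> B"
  proof
    fix z assume z: "z \<in> D \<inter> {\<zero>\<^bsub>?F\<^esub>} \<times> A"
    then obtain x a where x: "z = (\<zero>\<^bsub>?F\<^esub>, x)" "x \<in> A" and a: "a \<in> fsupp R"
      and "mcong ?E (JF \<times> B) z (comb R ?E a w)" by (auto simp: D_def adjoin_def)
    then have *: "\<zero>\<^bsub>?F\<^esub> \<ominus>\<^bsub>?F\<^esub> comb R ?F a \<delta> \<in> JF" "x \<ominus>\<^bsub>M\<^esub> (\<ominus>\<^bsub>M\<^esub> comb R M a c) \<in> B"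
      using submodule_sub[OF A x(2)] F.comb_closed[OF a \<delta>] comb_closed[OF a cM]
      by (auto simp: mcong_def E_comb[OF a w] w_def E_minus comb_neg[OF a cM])
    have "\<zero>\<^bsub>?F\<^esub> \<ominus>\<^bsub>?F\<^esub> comb R ?F a \<delta> = \<ominus>\<^bsub>?F\<^esub> comb R ?F a \<delta>"
      using F.comb_closed[OF a \<delta>] by (simp add: F.M.minus_eq)
    then have "comb R ?F a \<delta> \<in> JF"
      using * F.submodule_closed(4)[OF JF, of "\<zero>\<^bsub>?F\<^esub> \<ominus>\<^bsub>?F\<^esub> comb R ?F a \<delta>"] F.comb_closed[OF a \<delta>] by simp
    then have aJ: "a k \<in> J" for k using indep a unfolding indep_mod_def JF_def by blast
    have "comb R M a c \<in> B" unfolding comb_def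
      by (rule submodule_finsum[OF B]) (use JA aJ c in blast)
    then have "x \<in> B"
      using *(2) submodule_closed(3)[OF B *(2), of "comb R M a c"] submodule_sub[OF A x(2)] comb_closed[OF a cM]
      by (simp add: group_normalize)
    then show "z \<in> {\<zero>\<^bsub>?F\<^esub>} \<times> B" using x by simp
  qed
  have cong': "mcong ?E ({\<zero>\<^bsub>?F\<^esub>} \<times> B) (\<zero>\<^bsub>?F\<^esub>, x) (\<zero>\<^bsub>?F\<^esub>, y)" if "mcong M B x y" for x y
    using that by (auto simp: mcong_def E_carrier E_minus F.M.minus_eq)
  have zs: "r \<odot>\<^bsub>?E\<^esub> (\<zero>\<^bsub>?F\<^esub>, x) = (\<zero>\<^bsub>?F\<^esub>, r \<odot>\<^bsub>M\<^esub> x)" if "r \<in> carrier R" for r x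
    using that by (simp add: E_smult)
  have 1: "{\<zero>\<^bsub>?F\<^esub>} \<times> B \<subseteq> D" using base F.submodule_zero[OF JF] by blast
  have 2: "{\<zero>\<^bsub>?F\<^esub>} \<times> B \<subseteq> {\<zero>\<^bsub>?F\<^esub>} \<times> A" using BA by blast
  have 3: "z \<in> {\<zero>\<^bsub>?F\<^esub>} \<times> B"
    if r: "r \<in> carrier R - J" and z: "z \<in> {\<zero>\<^bsub>?F\<^esub>} \<times> A" "r \<odot>\<^bsub>?E\<^esub> z \<in> {\<zero>\<^bsub>?F\<^esub>} \<times> B" for r z
  proof -
    obtain x where x: "z = (\<zero>\<^bsub>?F\<^esub>, x)" "x \<in> A" using z by blast
    then have "r \<odot>\<^bsub>M\<^esub> x \<in> B" using z(2) r zs[of r x] by simp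
    then show ?thesis using inj[OF r x(2)] x by simp
  qed
  have 4: "\<exists>y\<in>{\<zero>\<^bsub>?F\<^esub>} \<times> A. mcong ?E ({\<zero>\<^bsub>?F\<^esub>} \<times> B) (r \<odot>\<^bsub>?E\<^esub> y) z"
    if r: "r \<in> carrier R - J" and z: "z \<in> {\<zero>\<^bsub>?F\<^esub>} \<times> A" for r z
  proof -
    obtain x where x: "z = (\<zero>\<^bsub>?F\<^esub>, x)" "x \<in> A" using z by blast
    obtain y where y: "y \<in> A" "mcong M B (r \<odot>\<^bsub>M\<^esub> y) x" using surj[OF r x(2)] by blast
    show ?thesis
      by (rule bexI[of _ "(\<zero>\<^bsub>?F\<^esub>, y)"]) (use cong'[OF y(2)] r x y zs[of r y] in simp_all)
  qed
  note ex = E.complement_of_divisible[OF A' B' D 1 DA 2 3 4]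
  from ex obtain D' where D'_all: "submodule D' R ?E \<and> D \<subseteq> D' \<and> D' \<inter> {\<zero>\<^bsub>?F\<^esub>} \<times> A \<subseteq> {\<zero>\<^bsub>?F\<^esub>} \<times> B \<and>
    (\<forall>e\<in>carrier ?E. (\<forall>j\<in>J. j \<odot>\<^bsub>?E\<^esub> e \<in> D) \<longrightarrow> (\<exists>a\<in>{\<zero>\<^bsub>?F\<^esub>} \<times> A. e \<ominus>\<^bsub>?E\<^esub> a \<in> D'))"
    by (rule exE)
  note D' = D'_all[THEN conjunct1] D'_all[THEN conjunct2, THEN conjunct1]
    D'_all[THEN conjunct2, THEN conjunct2, THEN conjunct1]
  note absorb = D'_all[THEN conjunct2, THEN conjunct2, THEN conjunct2, THEN bspec, THEN mp]
  have u: "unitv R l \<in> carrier ?F" for l :: 'i by (rule fsupp_unitv)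
  have "\<exists>y\<in>A. (unitv R l, \<ominus>\<^bsub>M\<^esub> y) \<in> D'" for l
  proof -
    have "\<exists>a\<in>{\<zero>\<^bsub>?F\<^esub>} \<times> A. (unitv R l, \<zero>\<^bsub>M\<^esub>) \<ominus>\<^bsub>?E\<^esub> a \<in> D'"
    proof (rule absorb)
      show "(unitv R l, \<zero>\<^bsub>M\<^esub>) \<in> carrier ?E" using u by (simp add: E_carrier)
      show "\<forall>j\<in>J. j \<odot>\<^bsub>?E\<^esub> (unitv R l, \<zero>\<^bsub>M\<^esub>) \<in> D"
      proof
        fix j assume j: "j \<in> J"
        then have jR: "j \<in> carrier R" by (rule J.Icarr)
        have "j \<odot>\<^bsub>?F\<^esub> unitv R l \<in> JF"
          using F.smult_closed[OF jR u] j jR J.zero_closed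
          by (auto simp: JF_def) (auto simp: free_module_def unitv_def)
        then show "j \<odot>\<^bsub>?E\<^esub> (unitv R l, \<zero>\<^bsub>M\<^esub>) \<in> D"
          using base jR submodule_zero[OF B] by (auto simp: E_smult)
      qed
    qed
    then obtain y where "y \<in> A" "(unitv R l, \<zero>\<^bsub>M\<^esub>) \<ominus>\<^bsub>?E\<^esub> (\<zero>\<^bsub>?F\<^esub>, y) \<in> D'" by auto
    then show ?thesis
      using u submodule_sub[OF A] by (auto simp: E_minus M.minus_eq F.M.minus_eq)
  qed
  then obtain y where y: "\<And>l. y l \<in> A" "\<And>l. (unitv R l, \<ominus>\<^bsub>M\<^esub> y l) \<in> D'" by metis
  have yM: "y l \<in> carrier M" for l using y submodule_sub[OF A] by blast
  have "mcong M B (comb R M (\<delta> k) y) (c k)" for k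
  proof -
    have "comb R ?E (\<delta> k) (\<lambda>l. (unitv R l, \<ominus>\<^bsub>M\<^esub> y l)) \<in> D'"
      by (rule E.comb_submodule[OF D'(1) \<delta> y(2)])
    then have 1: "(\<delta> k, \<ominus>\<^bsub>M\<^esub> comb R M (\<delta> k) y) \<in> D'"
      using u yM by (simp add: E_comb[OF \<delta>] E_carrier R.comb_free_unitv[OF \<delta>] comb_neg[OF \<delta> yM])
    have 2: "(\<delta> k, \<ominus>\<^bsub>M\<^esub> c k) \<in> D'"
      using E.adjoin_gen[where w=w and i=k, OF JFB w] D'(2) by (auto simp: D_def w_def)
    have cl: "comb R M (\<delta> k) y \<in> A" by (rule comb_submodule[OF A \<delta> y(1)])
    have "(\<zero>\<^bsub>?F\<^esub>, comb R M (\<delta> k) y \<ominus>\<^bsub>M\<^esub> c k) \<in> D'"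
      using E.submodule_minus[OF D'(1) 2 1] \<delta> cM submodule_sub[OF A cl]
      by (simp add: E_minus F.M.minus_eq F.M.r_neg group_normalize)
    then have "comb R M (\<delta> k) y \<ominus>\<^bsub>M\<^esub> c k \<in> B"
      using D'(3) submodule_minus[OF A cl, of "c k"] c by auto
    then show ?thesis using submodule_sub[OF A cl] cM by (simp add: mcong_def)
  qed
  then show "\<exists>y. (\<forall>l. y l \<in> A) \<and> (\<forall>k. mcong M B (comb R M (\<delta> k) y) (c k))" using y by blast
qed

section \<open>Telescoping equations\<close>

text \<open>Vanishing of the first derived limit of the inverse sequence of copies of \<open>A/B\<close> in which the maps are
  the multiplications by \<open>s n\<close>. If \<open>R \<rightarrow> R \<rightarrow> \<cdots>\<close> along the same multiplications has direct limit \<open>T\<inverse>R\<close>, this is the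
  vanishing of \<open>Ext\<close> from \<open>T\<inverse>R\<close> to \<open>A/B\<close>.\<close>

definition telescopes :: "('r, 's) ring_scheme \<Rightarrow> ('r, 'm, 't) module_scheme \<Rightarrow> (nat \<Rightarrow> 'r) \<Rightarrow> 'm set \<Rightarrow> 'm set \<Rightarrow> bool"
  where "telescopes R M s A B \<longleftrightarrow>
    (\<forall>c. (\<forall>n. c n \<in> A) \<longrightarrow>
      (\<exists>y. (\<forall>n. y n \<in> A) \<and> (\<forall>n. mcong M B (y n) (c n \<oplus>\<^bsub>M\<^esub> s n \<odot>\<^bsub>M\<^esub> y (Suc n)))))"

definition multiples :: "('r, 's) ring_scheme \<Rightarrow> ('r, 'm, 't) module_scheme \<Rightarrow> 'r \<Rightarrow> 'm set \<Rightarrow> 'm set \<Rightarrow> 'm set"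
  where "multiples R M a A B = {x. \<exists>y\<in>A. mcong M B x (a \<odot>\<^bsub>M\<^esub> y)}"

text \<open>Representatives of the elements of the inverse limit of the same sequence, that is, of homomorphisms
  to \<open>A/B\<close> from the limit of \<open>R \<rightarrow> R \<rightarrow> \<cdots>\<close>.\<close>

definition divisible_seqs :: "('r, 's) ring_scheme \<Rightarrow> ('r, 'm, 't) module_scheme \<Rightarrow> (nat \<Rightarrow> 'r) \<Rightarrow> 'm set \<Rightarrow> 'm set \<Rightarrow> (nat \<Rightarrow> 'm) set"
  where "divisible_seqs R M s A B =
    {z. (\<forall>n. z n \<in> A) \<and> (\<forall>n. mcong M B (z n) (s n \<odot>\<^bsub>M\<^esub> z (Suc n)))}"

definition annihilator :: "('r, 's) ring_scheme \<Rightarrow> ('r, 'm, 't) module_scheme \<Rightarrow> 'm set \<Rightarrow> 'm set \<Rightarrow> 'r set"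
  where "annihilator R M A B = {r \<in> carrier R. \<forall>x\<in>A. r \<odot>\<^bsub>M\<^esub> x \<in> B}"

lemma solvableE:
  assumes "solvable R M \<delta> A B" "\<And>k. c k \<in> A"
  obtains y where "\<And>l. y l \<in> A" "\<And>k. mcong M B (comb R M (\<delta> k) y) (c k)"
  using assms unfolding solvable_def by blast

lemma telescopesE:
  assumes "telescopes R M s A B" "\<And>n. c n \<in> A"
  obtains y where "\<And>n. y n \<in> A" "\<And>n. mcong M B (y n) (c n \<oplus>\<^bsub>M\<^esub> s n \<odot>\<^bsub>M\<^esub> y (Suc n))"
  using assms unfolding telescopes_def by blast

lemma fun_module_simps [simp]:
  "z \<in> carrier (fun_module M) \<longleftrightarrow> (\<forall>i. z i \<in> carrier M)"
  "(z \<oplus>\<^bsub>fun_module M\<^esub> w) i = z i \<oplus>\<^bsub>M\<^esub> w i"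
  "(a \<odot>\<^bsub>fun_module M\<^esub> z) i = a \<odot>\<^bsub>M\<^esub> z i"
  "\<zero>\<^bsub>fun_module M\<^esub> i = \<zero>\<^bsub>M\<^esub>"
  by (auto simp: fun_module_def)

context module
begin

lemma fun_module_minus:
  "(\<And>i. z i \<in> carrier M) \<Longrightarrow> (\<And>i. w i \<in> carrier M) \<Longrightarrow> (z \<ominus>\<^bsub>fun_module M\<^esub> w) i = z i \<ominus>\<^bsub>M\<^esub> w i"
  using mod_hom_minus[OF fun_module_module module_axioms eval_fun_module, of z w i] by simp

lemma fun_module_mcong:
  "mcong (fun_module M) {z. \<forall>i. z i \<in> B} z w \<longleftrightarrow> (\<forall>i. mcong M B (z i) (w i))"
  by (auto simp: mcong_def fun_module_minus)

lemma fun_module_comb: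
  assumes "\<rho> \<in> fsupp R" "\<And>l i. w l i \<in> carrier M"
  shows "comb R (fun_module M) \<rho> w i = comb R M \<rho> (\<lambda>l. w l i)"
  using mod_hom_comb[OF fun_module_module module_axioms eval_fun_module assms(1), of w i] assms(2) by simp

lemma submodule_smult_neg:
  assumes "H \<subseteq> carrier M" "\<zero>\<^bsub>M\<^esub> \<in> H" "\<And>a b. a \<in> H \<Longrightarrow> b \<in> H \<Longrightarrow> a \<oplus>\<^bsub>M\<^esub> b \<in> H"
    and smult: "\<And>a x. a \<in> carrier R \<Longrightarrow> x \<in> H \<Longrightarrow> a \<odot>\<^bsub>M\<^esub> x \<in> H"
  shows "submodule H R M"
proof (rule submoduleI)
  fix x assume x: "x \<in> H"
  then have "\<ominus>\<^bsub>M\<^esub> x = (\<ominus> \<one>) \<odot>\<^bsub>M\<^esub> x" using assms(1) by (auto simp: smult_l_minus)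
  then show "\<ominus>\<^bsub>M\<^esub> x \<in> H" using smult[OF _ x, of "\<ominus> \<one>"] by simp
qed (use assms in auto)

lemma submodule_fun_module:
  assumes B: "submodule B R M" shows "submodule {z. \<forall>i. z i \<in> B} R (fun_module M)"
proof -
  interpret X: module R "fun_module M" by (rule fun_module_module)
  show ?thesis by (rule X.submodule_smult_neg) (use submodule_closed[OF B] in auto)
qed

lemma submodule_multiples:
  assumes A: "submodule A R M" and B: "submodule B R M" and a: "a \<in> carrier R"
  shows "submodule (multiples R M a A B) R M"
proof (rule submodule_smult_neg)
  show "multiples R M a A B \<subseteq> carrier M" by (auto simp: multiples_def dest: mcongD)
  show "\<zero>\<^bsub>M\<^esub> \<in> multiples R M a A B"
    using submodule_zero[OF A] mcong_refl[OF B] a by (auto simp: multiples_def intro!: bexI[of _ "\<zero>\<^bsub>M\<^esub>"])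
next
  fix x x' assume "x \<in> multiples R M a A B" "x' \<in> multiples R M a A B"
  then obtain y y' where y: "y \<in> A" "mcong M B x (a \<odot>\<^bsub>M\<^esub> y)" "y' \<in> A" "mcong M B x' (a \<odot>\<^bsub>M\<^esub> y')"
    by (auto simp: multiples_def)
  have "mcong M B (x \<oplus>\<^bsub>M\<^esub> x') (a \<odot>\<^bsub>M\<^esub> (y \<oplus>\<^bsub>M\<^esub> y'))"
    using mcong_add[OF B y(2,4)] y submodule_sub[OF A] a by (simp add: smult_r_distr)
  then show "x \<oplus>\<^bsub>M\<^esub> x' \<in> multiples R M a A B"
    using submodule_closed(6)[OF A y(1,3)] by (auto simp: multiples_def)
next
  fix r x assume r: "r \<in> carrier R" "x \<in> multiples R M a A B"
  then obtain y where y: "y \<in> A" "mcong M B x (a \<odot>\<^bsub>M\<^esub> y)" by (auto simp: multiples_def)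
  have "mcong M B (r \<odot>\<^bsub>M\<^esub> x) (a \<odot>\<^bsub>M\<^esub> (r \<odot>\<^bsub>M\<^esub> y))"
    using mcong_smult[OF B y(2) r(1)] r a y submodule_sub[OF A] by (simp add: smult_assoc1[symmetric] R.m_comm)
  then show "r \<odot>\<^bsub>M\<^esub> x \<in> multiples R M a A B"
    using submodule_closed(5)[OF A r(1) y(1)] by (auto simp: multiples_def)
qed

lemma multiples_bounds:
  assumes A: "submodule A R M" and B: "submodule B R M" and a: "a \<in> carrier R" and BA: "B \<subseteq> A"
  shows "B \<subseteq> multiples R M a A B" "multiples R M a A B \<subseteq> A"
    "\<And>x. x \<in> A \<Longrightarrow> a \<odot>\<^bsub>M\<^esub> x \<in> multiples R M a A B"
proof -
  show "B \<subseteq> multiples R M a A B"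
    using submodule_zero[OF A] a
    by (auto simp: multiples_def mcong_zero_iff[OF B] intro!: bexI[of _ "\<zero>\<^bsub>M\<^esub>"])
  show "multiples R M a A B \<subseteq> A"
    using mcong_closed[OF A BA] submodule_closed(5)[OF A a] by (auto simp: multiples_def)
  show "\<And>x. x \<in> A \<Longrightarrow> a \<odot>\<^bsub>M\<^esub> x \<in> multiples R M a A B"
    using mcong_refl[OF B smult_closed[OF a submodule_sub[OF A]]] by (auto simp: multiples_def)
qed

lemma submodule_divisible_seqs:
  assumes A: "submodule A R M" and B: "submodule B R M" and s: "\<And>n. s n \<in> carrier R"
  shows "submodule (divisible_seqs R M s A B) R (fun_module M)"
proof -
  interpret X: module R "fun_module M" by (rule fun_module_module)
  note Ac = submodule_closed[OF A]
  show ?thesis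
  proof (rule X.submodule_smult_neg)
    show "divisible_seqs R M s A B \<subseteq> carrier (fun_module M)"
      using Ac(1) by (auto simp: divisible_seqs_def)
    show "\<zero>\<^bsub>fun_module M\<^esub> \<in> divisible_seqs R M s A B"
      using Ac(2) s mcong_refl[OF B] by (auto simp: divisible_seqs_def)
  next
    fix z w assume zw: "z \<in> divisible_seqs R M s A B" "w \<in> divisible_seqs R M s A B"
    then have z: "z n \<in> A" "w n \<in> A" "mcong M B (z n) (s n \<odot>\<^bsub>M\<^esub> z (Suc n))" "mcong M B (w n) (s n \<odot>\<^bsub>M\<^esub> w (Suc n))" for n
      by (auto simp: divisible_seqs_def)
    have "mcong M B (z n \<oplus>\<^bsub>M\<^esub> w n) (s n \<odot>\<^bsub>M\<^esub> (z (Suc n) \<oplus>\<^bsub>M\<^esub> w (Suc n)))" for n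
      using mcong_add[OF B z(3,4)[of n]] s Ac(1)[OF z(1)] Ac(1)[OF z(2)] by (simp add: smult_r_distr)
    then show "z \<oplus>\<^bsub>fun_module M\<^esub> w \<in> divisible_seqs R M s A B"
      using Ac(6)[OF z(1,2)] by (auto simp: divisible_seqs_def)
  next
    fix r z assume r: "r \<in> carrier R" and "z \<in> divisible_seqs R M s A B"
    then have z: "z n \<in> A" "mcong M B (z n) (s n \<odot>\<^bsub>M\<^esub> z (Suc n))" for n
      by (auto simp: divisible_seqs_def)
    have "mcong M B (r \<odot>\<^bsub>M\<^esub> z n) (s n \<odot>\<^bsub>M\<^esub> (r \<odot>\<^bsub>M\<^esub> z (Suc n)))" for n
      using mcong_smult[OF B z(2)[of n] r] s r Ac(1)[OF z(1)] by (simp add: smult_assoc1[symmetric] R.m_comm)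
    then show "r \<odot>\<^bsub>fun_module M\<^esub> z \<in> divisible_seqs R M s A B"
      using Ac(5)[OF r z(1)] by (auto simp: divisible_seqs_def)
  qed
qed

lemma ideal_annihilator:
  assumes A: "submodule A R M" and B: "submodule B R M"
  shows "ideal (annihilator R M A B) R"
proof (rule idealI[OF R.ring_axioms])
  note Ac = submodule_closed[OF A] and Bc = submodule_closed[OF B]
  show "subgroup (annihilator R M A B) (add_monoid R)"
  proof
    fix x assume "x \<in> annihilator R M A B"
    then show "inv\<^bsub>add_monoid R\<^esub> x \<in> annihilator R M A B"
      using Ac(1) Bc(4) by (auto simp: annihilator_def smult_l_minus simp flip: a_inv_def)
  qed (use Ac(1) Bc in \<open>auto simp: annihilator_def smult_l_distr\<close>)
  fix a x assume "a \<in> annihilator R M A B" and x: "x \<in> carrier R"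
  then show "x \<otimes> a \<in> annihilator R M A B"
    using Ac(1) Bc(5) by (auto simp: annihilator_def smult_assoc1)
  then show "a \<otimes> x \<in> annihilator R M A B"
    using x \<open>a \<in> _\<close> by (auto simp: annihilator_def R.m_comm)
qed

lemma telescopes_quotient:
  assumes "telescopes R M s A B" "B \<subseteq> B'"
  shows "telescopes R M s A B'"
  using assms unfolding telescopes_def by (meson mcong_mono)

lemma telescopes_multiples:
  assumes A: "submodule A R M" and B: "submodule B R M" and BA: "B \<subseteq> A"
    and s: "\<And>n. s n \<in> carrier R" and a: "a \<in> carrier R" and tel: "telescopes R M s A B"
  shows "telescopes R M s (multiples R M a A B) B"
  unfolding telescopes_def
proof (intro allI impI)
  fix c :: "nat \<Rightarrow> 'c" assume "\<forall>n. c n \<in> multiples R M a A B"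
  then have "\<forall>n. \<exists>y. y \<in> A \<and> mcong M B (c n) (a \<odot>\<^bsub>M\<^esub> y)" by (auto simp: multiples_def)
  then obtain d where d: "\<And>n. d n \<in> A" "\<And>n. mcong M B (c n) (a \<odot>\<^bsub>M\<^esub> d n)" by metis
  obtain y where y: "\<And>n. y n \<in> A" "\<And>n. mcong M B (y n) (d n \<oplus>\<^bsub>M\<^esub> s n \<odot>\<^bsub>M\<^esub> y (Suc n))"
    by (rule telescopesE[where c=d, OF tel d(1)]) blast
  note yM = submodule_sub[OF A y(1)] and dM = submodule_sub[OF A d(1)]
  have "mcong M B (a \<odot>\<^bsub>M\<^esub> y n) (c n \<oplus>\<^bsub>M\<^esub> s n \<odot>\<^bsub>M\<^esub> (a \<odot>\<^bsub>M\<^esub> y (Suc n)))" for n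
  proof -
    have "mcong M B (a \<odot>\<^bsub>M\<^esub> y n) (a \<odot>\<^bsub>M\<^esub> d n \<oplus>\<^bsub>M\<^esub> s n \<odot>\<^bsub>M\<^esub> (a \<odot>\<^bsub>M\<^esub> y (Suc n)))"
      using mcong_smult[OF B y(2)[of n] a] a s yM dM
      by (simp add: smult_r_distr smult_assoc1[symmetric] R.m_comm)
    moreover have "mcong M B (a \<odot>\<^bsub>M\<^esub> d n \<oplus>\<^bsub>M\<^esub> s n \<odot>\<^bsub>M\<^esub> (a \<odot>\<^bsub>M\<^esub> y (Suc n))) (c n \<oplus>\<^bsub>M\<^esub> s n \<odot>\<^bsub>M\<^esub> (a \<odot>\<^bsub>M\<^esub> y (Suc n)))"
      by (rule mcong_add[OF B mcong_sym[OF B d(2)] mcong_refl[OF B]]) (use a s yM in auto)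
    ultimately show ?thesis by (rule mcong_trans[OF B])
  qed
  then show "\<exists>y. (\<forall>n. y n \<in> multiples R M a A B) \<and> (\<forall>n. mcong M B (y n) (c n \<oplus>\<^bsub>M\<^esub> s n \<odot>\<^bsub>M\<^esub> y (Suc n)))"
    using multiples_bounds(3)[OF A B a BA y(1)] by (intro exI[of _ "\<lambda>n. a \<odot>\<^bsub>M\<^esub> y n"]) auto
qed

lemma add_diff_cancel: "x \<in> carrier M \<Longrightarrow> y \<in> carrier M \<Longrightarrow> x \<oplus>\<^bsub>M\<^esub> (y \<ominus>\<^bsub>M\<^esub> x) = y"
  by (simp add: M.minus_eq M.a_comm[of y] M.r_neg2)

lemma add_cancel_diff:
  assumes "x \<in> carrier M" "y \<in> carrier M" "z \<in> carrier M"
  shows "(x \<oplus>\<^bsub>M\<^esub> y) \<ominus>\<^bsub>M\<^esub> (x \<oplus>\<^bsub>M\<^esub> z) = y \<ominus>\<^bsub>M\<^esub> z"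
proof -
  have "(x \<oplus>\<^bsub>M\<^esub> y) \<ominus>\<^bsub>M\<^esub> (x \<oplus>\<^bsub>M\<^esub> z) = \<ominus>\<^bsub>M\<^esub> x \<oplus>\<^bsub>M\<^esub> (x \<oplus>\<^bsub>M\<^esub> (y \<ominus>\<^bsub>M\<^esub> z))"
    using assms by (simp add: M.minus_eq M.minus_add M.a_ac)
  then show ?thesis using assms by (simp add: M.r_neg1)
qed

text \<open>Solve modulo \<open>D\<close>, then correct the error, which lies in \<open>D\<close>, by a solution in \<open>D\<close>.\<close>

lemma solvable_extension:
  fixes \<delta> :: "'i \<Rightarrow> 'i \<Rightarrow> 'a"
  assumes A: "submodule A R M" and B: "submodule B R M" and D: "submodule D R M"
    and BD: "B \<subseteq> D" and DA: "D \<subseteq> A" and \<delta>: "\<And>k. \<delta> k \<in> fsupp R"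
    and "solvable R M \<delta> A D" "solvable R M \<delta> D B"
  shows "solvable R M \<delta> A B"
  unfolding solvable_def
proof (intro allI impI)
  fix c :: "'i \<Rightarrow> 'c" assume c: "\<forall>k. c k \<in> A"
  then have c': "c k \<in> A" for k by blast
  obtain y where y: "\<And>l. y l \<in> A" "\<And>k. mcong M D (comb R M (\<delta> k) y) (c k)"
    by (rule solvableE[where c=c, OF assms(7) c']) blast
  have *: "c k \<ominus>\<^bsub>M\<^esub> comb R M (\<delta> k) y \<in> D" for k
    using mcong_sym[OF D y(2)] by (simp add: mcong_def)
  obtain z where z: "\<And>l. z l \<in> D"
    "\<And>k. mcong M B (comb R M (\<delta> k) z) (c k \<ominus>\<^bsub>M\<^esub> comb R M (\<delta> k) y)"
    by (rule solvableE[where c="\<lambda>k. c k \<ominus>\<^bsub>M\<^esub> comb R M (\<delta> k) y", OF assms(8) *]) blast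
  note yM = submodule_sub[OF A y(1)] and zM = submodule_sub[OF D z(1)]
  have cM: "c k \<in> carrier M" for k using c submodule_sub[OF A] by blast
  have cy: "comb R M (\<delta> k) y \<in> carrier M" for k by (rule comb_closed[OF \<delta> yM])
  have "mcong M B (comb R M (\<delta> k) (\<lambda>l. y l \<oplus>\<^bsub>M\<^esub> z l)) (c k)" for k
    using mcong_add[OF B mcong_refl[OF B cy[of k]] z(2)[of k]]
    by (simp add: comb_add[OF \<delta> yM zM] add_diff_cancel cy cM)
  then show "\<exists>y. (\<forall>l. y l \<in> A) \<and> (\<forall>k. mcong M B (comb R M (\<delta> k) y) (c k))"
    using submodule_closed(6)[OF A y(1)] z(1) DA by (intro exI[of _ "\<lambda>l. y l \<oplus>\<^bsub>M\<^esub> z l"]) blast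
qed

text \<open>Solve modulo \<open>s 0 A\<close>, divide the error by \<open>s 0\<close>, solve for it modulo \<open>s 1 A\<close>, and so on. The partial
  solutions \<open>y n\<close> are summed to \<open>Y\<close> by telescoping. What then remains of the right-hand sides forms,
  together with the remainders at later stages, sequences in which each term is \<open>s n\<close> times the next one.\<close>

lemma solvable_of_telescopes:
  fixes \<delta> :: "'i \<Rightarrow> 'i \<Rightarrow> 'a"
  assumes A: "submodule A R M" and B: "submodule B R M" and BA: "B \<subseteq> A"
    and s: "\<And>n. s n \<in> carrier R" and tel: "telescopes R M s A B"
    and \<delta>: "\<And>k. \<delta> k \<in> fsupp R"
    and quot: "\<And>n. solvable R M \<delta> A (multiples R M (s n) A B)"
    and div: "solvable R (fun_module M) \<delta> (divisible_seqs R M s A B) {z. \<forall>n. z n \<in> B}"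
  shows "solvable R M \<delta> A B"
  unfolding solvable_def
proof (intro allI impI)
  fix c :: "'i \<Rightarrow> 'c" assume c: "\<forall>k. c k \<in> A"
  note Ac = submodule_closed[OF A]
  define Q where "Q n c y c' \<longleftrightarrow> ((\<forall>k. c k \<in> A) \<longrightarrow> (\<forall>l. y l \<in> A) \<and> (\<forall>k. c' k \<in> A) \<and>
      (\<forall>k. mcong M B (c k) (comb R M (\<delta> k) y \<oplus>\<^bsub>M\<^esub> s n \<odot>\<^bsub>M\<^esub> c' k)))" for n and c y c' :: "'i \<Rightarrow> 'c"
  have step: "\<exists>y c'. Q n c y c'" for n c
  proof (cases "\<forall>k. c k \<in> A")
    case True
    then have c': "c k \<in> A" for k by blast
    obtain y where y: "\<And>l. y l \<in> A" "\<And>k. mcong M (multiples R M (s n) A B) (comb R M (\<delta> k) y) (c k)"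
      by (rule solvableE[where c=c, OF quot[of n] c']) blast
    have cM: "c k \<in> carrier M" "comb R M (\<delta> k) y \<in> carrier M" for k
      using True Ac(1) comb_closed[OF \<delta> Ac(1)[OF y(1)]] by auto
    have "c k \<ominus>\<^bsub>M\<^esub> comb R M (\<delta> k) y \<in> multiples R M (s n) A B" for k
      using mcong_sym[OF submodule_multiples[OF A B s] y(2)] by (simp add: mcong_def)
    then have "\<forall>k. \<exists>d. d \<in> A \<and> mcong M B (c k \<ominus>\<^bsub>M\<^esub> comb R M (\<delta> k) y) (s n \<odot>\<^bsub>M\<^esub> d)"
      by (auto simp: multiples_def)
    then obtain d where d: "\<And>k. d k \<in> A" "\<And>k. mcong M B (c k \<ominus>\<^bsub>M\<^esub> comb R M (\<delta> k) y) (s n \<odot>\<^bsub>M\<^esub> d k)"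
      by metis
    have "mcong M B (c k) (comb R M (\<delta> k) y \<oplus>\<^bsub>M\<^esub> s n \<odot>\<^bsub>M\<^esub> d k)" for k
      using mcong_add[OF B mcong_refl[OF B cM(2)[of k]] d(2)[of k]] cM by (simp add: add_diff_cancel)
    then show ?thesis using y(1) d(1) unfolding Q_def by blast
  qed (auto simp: Q_def)
  then have "\<forall>n c. \<exists>p. Q n c (fst p) (snd p)" by simp
  then obtain pf where pf: "\<And>n c. Q n c (fst (pf n c)) (snd (pf n c))" by metis
  define yf cf where "yf n c = fst (pf n c)" and "cf n c = snd (pf n c)" for n c
  have yc: "(\<forall>l. yf n c l \<in> A) \<and> (\<forall>k. cf n c k \<in> A) \<and>
      (\<forall>k. mcong M B (c k) (comb R M (\<delta> k) (yf n c) \<oplus>\<^bsub>M\<^esub> s n \<odot>\<^bsub>M\<^esub> cf n c k))" if "\<forall>k. c k \<in> A" for n c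
    using pf[of n c] that unfolding Q_def yf_def cf_def by blast
  define C where "C = rec_nat c (\<lambda>n. cf n)"
  have CA: "\<forall>k. C n k \<in> A" for n by (induct n) (use c yc in \<open>auto simp: C_def\<close>)
  define y where "y n = yf n (C n)" for n
  have y: "y n l \<in> A" and Cy: "mcong M B (C n k) (comb R M (\<delta> k) (y n) \<oplus>\<^bsub>M\<^esub> s n \<odot>\<^bsub>M\<^esub> C (Suc n) k)" for n k l
    using yc[OF CA] by (auto simp: y_def C_def)
  have "\<forall>l. \<exists>Y. (\<forall>n. Y n \<in> A) \<and> (\<forall>n. mcong M B (Y n) (y n l \<oplus>\<^bsub>M\<^esub> s n \<odot>\<^bsub>M\<^esub> Y (Suc n)))"
    using tel y unfolding telescopes_def by simp
  from choice[OF this] obtain Y where Y: "\<And>l n. Y l n \<in> A"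
      "\<And>l n. mcong M B (Y l n) (y n l \<oplus>\<^bsub>M\<^esub> s n \<odot>\<^bsub>M\<^esub> Y l (Suc n))"
    by blast
  note yM = Ac(1)[OF y] and YM = Ac(1)[OF Y(1)]
  have CM: "C n k \<in> carrier M" for n k using CA Ac(1) by blast
  have combM: "comb R M (\<delta> k) (y n) \<in> carrier M" "comb R M (\<delta> k) (\<lambda>l. Y l n) \<in> carrier M" for k n
    using comb_closed[OF \<delta>] yM YM by auto
  define z where "z k n = C n k \<ominus>\<^bsub>M\<^esub> comb R M (\<delta> k) (\<lambda>l. Y l n)" for k n
  have zH: "z k \<in> divisible_seqs R M s A B" for k
  proof -
    have "mcong M B (z k n) (s n \<odot>\<^bsub>M\<^esub> z k (Suc n))" for n
    proof -
      have "mcong M B (comb R M (\<delta> k) (\<lambda>l. Y l n)) (comb R M (\<delta> k) (\<lambda>l. y n l \<oplus>\<^bsub>M\<^esub> s n \<odot>\<^bsub>M\<^esub> Y l (Suc n)))"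
        by (rule comb_cong_mod[OF B \<delta> Y(2)])
      also have "comb R M (\<delta> k) (\<lambda>l. y n l \<oplus>\<^bsub>M\<^esub> s n \<odot>\<^bsub>M\<^esub> Y l (Suc n)) =
          comb R M (\<delta> k) (y n) \<oplus>\<^bsub>M\<^esub> s n \<odot>\<^bsub>M\<^esub> comb R M (\<delta> k) (\<lambda>l. Y l (Suc n))"
        using s yM YM \<delta> by (simp add: comb_add comb_smult)
      finally have "mcong M B (z k n) ((comb R M (\<delta> k) (y n) \<oplus>\<^bsub>M\<^esub> s n \<odot>\<^bsub>M\<^esub> C (Suc n) k) \<ominus>\<^bsub>M\<^esub>
          (comb R M (\<delta> k) (y n) \<oplus>\<^bsub>M\<^esub> s n \<odot>\<^bsub>M\<^esub> comb R M (\<delta> k) (\<lambda>l. Y l (Suc n))))"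
        unfolding z_def by (rule mcong_minus[OF B Cy])
      also have "(comb R M (\<delta> k) (y n) \<oplus>\<^bsub>M\<^esub> s n \<odot>\<^bsub>M\<^esub> C (Suc n) k) \<ominus>\<^bsub>M\<^esub>
          (comb R M (\<delta> k) (y n) \<oplus>\<^bsub>M\<^esub> s n \<odot>\<^bsub>M\<^esub> comb R M (\<delta> k) (\<lambda>l. Y l (Suc n))) = s n \<odot>\<^bsub>M\<^esub> z k (Suc n)"
        using s CM combM by (simp add: z_def smult_diff add_cancel_diff)
      finally show ?thesis .
    qed
    moreover have "z k n \<in> A" for n
      unfolding z_def by (rule Ac(3)) (use CA comb_submodule[OF A \<delta> Y(1)] in auto)
    ultimately show ?thesis by (auto simp: divisible_seqs_def)
  qed
  obtain w where w: "\<And>l. w l \<in> divisible_seqs R M s A B"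
    "\<And>k. mcong (fun_module M) {z. \<forall>n. z n \<in> B} (comb R (fun_module M) (\<delta> k) w) (z k)"
    by (rule solvableE[where c=z, OF div zH]) blast
  have wA: "w l n \<in> A" for l n using w(1) by (auto simp: divisible_seqs_def)
  note wM = Ac(1)[OF wA]
  have "mcong M B (comb R M (\<delta> k) (\<lambda>l. Y l 0 \<oplus>\<^bsub>M\<^esub> w l 0)) (c k)" for k
  proof -
    have "mcong M B (comb R M (\<delta> k) (\<lambda>l. w l 0)) (z k 0)"
      using w(2)[of k] fun_module_comb[where w=w, OF \<delta> wM] by (simp add: fun_module_mcong)
    then have "mcong M B (comb R M (\<delta> k) (\<lambda>l. Y l 0) \<oplus>\<^bsub>M\<^esub> comb R M (\<delta> k) (\<lambda>l. w l 0)) (comb R M (\<delta> k) (\<lambda>l. Y l 0) \<oplus>\<^bsub>M\<^esub> z k 0)"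
      using mcong_add[OF B mcong_refl[OF B combM(2)[of k 0]]] by blast
    then show ?thesis
      using comb_add[where y="\<lambda>l. Y l 0" and z="\<lambda>l. w l 0", OF \<delta> YM wM] CM[of 0 k] combM(2)[of k 0] by (simp add: z_def add_diff_cancel C_def)
  qed
  then show "\<exists>y. (\<forall>l. y l \<in> A) \<and> (\<forall>k. mcong M B (comb R M (\<delta> k) y) (c k))"
    using Ac(6)[OF Y(1) wA] by (intro exI[of _ "\<lambda>l. Y l 0 \<oplus>\<^bsub>M\<^esub> w l 0"]) blast
qed

end

section \<open>Noetherian induction on annihilators\<close>

text \<open>Each element of \<open>T\<close> divides almost all terms, so the limit of copies of \<open>R\<close> along multiplication by
  the terms is the ring of fractions. For countable \<open>T\<close> the enumeration \<open>from_nat_into\<close> reaches each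
  element.\<close>

primrec den_seq :: "('r, 's) ring_scheme \<Rightarrow> 'r set \<Rightarrow> nat \<Rightarrow> 'r"
  where "den_seq R T 0 = from_nat_into T 0"
  | "den_seq R T (Suc n) = den_seq R T n \<otimes>\<^bsub>R\<^esub> from_nat_into T (Suc n)"

text \<open>For a prime ideal \<open>J\<close>, the ring of fractions of \<open>R/J\<close> with denominators in \<open>T\<close> is a field.\<close>

definition field_after_inverting :: "('r, 's) ring_scheme \<Rightarrow> 'r set \<Rightarrow> 'r set \<Rightarrow> bool"
  where "field_after_inverting R T J \<longleftrightarrow> T \<inter> J = {} \<and>
    (\<forall>r\<in>carrier R - J. \<exists>u\<in>carrier R. \<exists>t\<in>T. u \<otimes>\<^bsub>R\<^esub> r \<ominus>\<^bsub>R\<^esub> t \<in> J)"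

lemma den_seq_mem:
  assumes "submonoid T R"
  shows "den_seq R T n \<in> T"
proof -
  have "T \<noteq> {}" using submonoid.one_closed[OF assms] by blast
  then show ?thesis
    by (induct n) (auto intro: from_nat_into submonoid.m_closed[OF assms])
qed

lemma (in cring) den_seq_dvd:
  assumes T: "submonoid T R" and "countable T" and t: "t \<in> T"
  shows "\<exists>N. \<forall>n\<ge>N. \<exists>q\<in>carrier R. den_seq R T n = t \<otimes> q"
proof -
  have sub: "T \<subseteq> carrier R" using submonoid.subset[OF T] .
  have ne: "T \<noteq> {}" using t by blast
  have fn: "from_nat_into T n \<in> carrier R" for n using from_nat_into[OF ne] sub by blast
  have dn: "den_seq R T n \<in> carrier R" for n using den_seq_mem[OF T] sub by blast
  obtain N where N: "from_nat_into T N = t" using from_nat_into_surj[OF \<open>countable T\<close> t] by blast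
  have "\<exists>q\<in>carrier R. den_seq R T n = t \<otimes> q" if "N \<le> n" for n
    using that
  proof (induct n rule: dec_induct)
    case base
    show ?case
    proof (cases N)
      case 0
      then show ?thesis using N t sub by (intro bexI[of _ \<one>]) auto
    next
      case (Suc m)
      then show ?thesis using N t sub dn by (intro bexI[of _ "den_seq R T m"]) (auto simp: m_comm)
    qed
  next
    case (step n)
    then obtain q where "q \<in> carrier R" "den_seq R T n = t \<otimes> q" by blast
    then show ?case
      using t sub fn by (intro bexI[of _ "q \<otimes> from_nat_into T (Suc n)"]) (auto simp: m_assoc subsetD)
  qed
  then show ?thesis by blast
qed

lemma (in noetherian_ring) maximal_ideal_in:
  assumes "\<J> \<noteq> {}" "\<And>J. J \<in> \<J> \<Longrightarrow> ideal J R"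
  shows "\<exists>J\<in>\<J>. \<forall>I\<in>\<J>. J \<subseteq> I \<longrightarrow> I = J"
proof (rule subset_Zorn_nonempty[OF assms(1)])
  fix \<C> assume ne: "\<C> \<noteq> {}" and ch: "subset.chain \<J> \<C>"
  from ch have sub: "\<C> \<subseteq> \<J>" and lin: "\<forall>X\<in>\<C>. \<forall>Y\<in>\<C>. X \<subseteq> Y \<or> Y \<subseteq> X"
    by (simp_all add: subset_chain_def)
  have "subset.chain {I. ideal I R} \<C>"
    unfolding subset_chain_def using lin sub assms(2) by fastforce
  then have "\<Union>\<C> \<in> \<C>" by (rule ideal_chain_is_trivial[OF ne])
  then show "\<Union>\<C> \<in> \<J>" using sub by (rule rev_subsetD)
qed

context module
begin

text \<open>A scalar \<open>r\<close> outside \<open>J\<close> divides an element of \<open>T\<close> modulo \<open>J\<close>, hence almost all terms of the sequence.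
  So it acts bijectively on sequences in which each term is a multiple of the next: the quotients by \<open>r\<close> are
  computed from terms far enough to the right.\<close>

lemma solvable_divisible_seqs:
  fixes \<delta> :: "'i \<Rightarrow> 'i \<Rightarrow> 'a"
  assumes A: "submodule A R M" and B: "submodule B R M" and BA: "B \<subseteq> A"
    and J: "J = annihilator R M A B" and T: "submonoid T R" "countable T"
    and field: "field_after_inverting R T J"
    and \<delta>: "\<And>k. \<delta> k \<in> fsupp R" and indep: "indep_mod R J \<delta>"
  shows "solvable R (fun_module M) \<delta> (divisible_seqs R M (den_seq R T) A B) {z. \<forall>n. z n \<in> B}"
proof -
  interpret X: module R "fun_module M :: ('a, nat \<Rightarrow> 'c) module" by (rule fun_module_module)
  note mcong_trans[OF B, trans]
  define s where "s = den_seq R T"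
  have s: "s n \<in> carrier R" for n
    using den_seq_mem[OF T(1)] submonoid.subset[OF T(1)] by (auto simp: s_def)
  let ?H = "divisible_seqs R M s A B" and ?Z = "{z :: nat \<Rightarrow> 'c. \<forall>n. z n \<in> B}"
  note Ac = submodule_closed[OF A] and Bc = submodule_closed[OF B]
  have idJ: "ideal J R" unfolding J by (rule ideal_annihilator[OF A B])
  have JA: "j \<odot>\<^bsub>M\<^esub> x \<in> B" if "j \<in> J" "x \<in> A" for j x using that by (auto simp: J annihilator_def)
    have dvd: "\<exists>N p. \<forall>n\<ge>N. p n \<in> carrier R \<and> s n \<ominus> r \<otimes> p n \<in> J" if r: "r \<in> carrier R - J" for r
  proof -
    obtain u t where ut: "u \<in> carrier R" "t \<in> T" "u \<otimes> r \<ominus> t \<in> J"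
      using field r unfolding field_after_inverting_def by blast
    obtain N where "\<forall>n\<ge>N. \<exists>q\<in>carrier R. s n = t \<otimes> q"
      using R.den_seq_dvd[OF T ut(2)] by (auto simp: s_def)
    then obtain q where q: "\<And>n. N \<le> n \<Longrightarrow> q n \<in> carrier R \<and> s n = t \<otimes> q n" by metis
    have tR: "t \<in> carrier R" using ut submonoid.subset[OF T(1)] by blast
    have "s n \<ominus> r \<otimes> (u \<otimes> q n) \<in> J" if "N \<le> n" for n
    proof -
      have "(\<ominus> q n) \<otimes> (u \<otimes> r \<ominus> t) \<in> J" using q[OF that] ut(3) ideal.I_l_closed[OF idJ] by simp
      moreover have "(\<ominus> q n) \<otimes> (u \<otimes> r \<ominus> t) = s n \<ominus> r \<otimes> (u \<otimes> q n)"
        using q[OF that] r ut tR by simp algebra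
      ultimately show ?thesis by simp
    qed
    then show ?thesis using q ut by (intro exI[of _ N] exI[of _ "\<lambda>n. u \<otimes> q n"]) auto
  qed
  have HA: "z n \<in> A" and Hs: "mcong M B (z n) (s n \<odot>\<^bsub>M\<^esub> z (Suc n))" if "z \<in> ?H" for z n
    using that by (auto simp: divisible_seqs_def)
  define pr where "pr m k = rec_nat \<one> (\<lambda>k x. x \<otimes> s (m + k)) k" for m k
  have pr: "pr m 0 = \<one>" "pr m (Suc k) = pr m k \<otimes> s (m + k)" for m k by (auto simp: pr_def)
  have prR: "pr m k \<in> carrier R" for m k by (induct k) (use s pr in auto)
  have pr_shift: "s m \<otimes> pr (Suc m) k = pr m k \<otimes> s (m + k)" for m k
  proof (induct k)
    case (Suc k)
    have "s m \<otimes> pr (Suc m) (Suc k) = (s m \<otimes> pr (Suc m) k) \<otimes> s (Suc m + k)"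
      using s prR pr by (simp add: R.m_assoc)
    also have "\<dots> = pr m (Suc k) \<otimes> s (m + Suc k)" using Suc pr by simp
    finally show ?case .
  qed (use pr s in simp)
  have Hpr: "mcong M B (z m) (pr m k \<odot>\<^bsub>M\<^esub> z (m + k))" if "z \<in> ?H" for z m k
  proof (induct k)
    case 0 then show ?case using mcong_refl[OF B] Ac(1)[OF HA[OF that]] pr by simp
  next
    case (Suc k)
    have "mcong M B (pr m k \<odot>\<^bsub>M\<^esub> z (m + k)) (pr m k \<odot>\<^bsub>M\<^esub> (s (m + k) \<odot>\<^bsub>M\<^esub> z (Suc (m + k))))"
      by (rule mcong_smult[OF B Hs[OF that] prR])
    then show ?case
      using mcong_trans[OF B Suc] prR s pr Ac(1)[OF HA[OF that]] by (simp add: smult_assoc1)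
  qed
  have cong_sp: "mcong M B (a \<odot>\<^bsub>M\<^esub> (s n \<odot>\<^bsub>M\<^esub> x)) (a \<odot>\<^bsub>M\<^esub> (r \<odot>\<^bsub>M\<^esub> (p \<odot>\<^bsub>M\<^esub> x)))"
    if "s n \<ominus> r \<otimes> p \<in> J" "x \<in> A" "a \<in> carrier R" "r \<in> carrier R" "p \<in> carrier R" for n r p x a
    using mcong_smult[OF B mcong_scalar[OF that(1) s _ Ac(1)[OF that(2)]] that(3)] JA that Ac(1)
    by (simp add: smult_assoc1)
  have inj: "z \<in> ?Z" if r: "r \<in> carrier R - J" and z: "z \<in> ?H" and rz: "r \<odot>\<^bsub>fun_module M\<^esub> z \<in> ?Z" for r z
  proof -
    obtain N p where p: "\<And>n. N \<le> n \<Longrightarrow> p n \<in> carrier R \<and> s n \<ominus> r \<otimes> p n \<in> J" using dvd[OF r] by metis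
    have "z m \<in> B" for m
    proof -
      have pm: "p (m + N) \<in> carrier R" "s (m + N) \<ominus> r \<otimes> p (m + N) \<in> J" using p by auto
      let ?x = "z (Suc (m + N))"
      have x: "?x \<in> A" "?x \<in> carrier M" using HA[OF z] Ac(1) by auto
      have "mcong M B (z m) (pr m N \<odot>\<^bsub>M\<^esub> (s (m + N) \<odot>\<^bsub>M\<^esub> ?x))"
        using Hpr[OF z, of m "Suc N"] pr prR s x by (simp add: smult_assoc1)
      also have "mcong M B \<dots> (pr m N \<odot>\<^bsub>M\<^esub> (r \<odot>\<^bsub>M\<^esub> (p (m + N) \<odot>\<^bsub>M\<^esub> ?x)))"
        by (rule cong_sp) (use pm x prR r in auto)
      finally have c: "mcong M B (z m) (pr m N \<odot>\<^bsub>M\<^esub> (r \<odot>\<^bsub>M\<^esub> (p (m + N) \<odot>\<^bsub>M\<^esub> ?x)))" .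
      have "r \<odot>\<^bsub>M\<^esub> (p (m + N) \<odot>\<^bsub>M\<^esub> ?x) = p (m + N) \<odot>\<^bsub>M\<^esub> (r \<odot>\<^bsub>M\<^esub> ?x)"
        using r pm x by (simp add: smult_assoc1[symmetric] R.m_comm)
      moreover have "r \<odot>\<^bsub>M\<^esub> ?x \<in> B" using rz by auto
      ultimately have "pr m N \<odot>\<^bsub>M\<^esub> (r \<odot>\<^bsub>M\<^esub> (p (m + N) \<odot>\<^bsub>M\<^esub> ?x)) \<in> B" using Bc(5) prR pm by simp
      then show ?thesis using mcong_mem[OF B c] by simp
    qed
    then show ?thesis by blast
  qed
  have surj: "\<exists>w\<in>?H. mcong (fun_module M) ?Z (r \<odot>\<^bsub>fun_module M\<^esub> w) z"
    if r: "r \<in> carrier R - J" and z: "z \<in> ?H" for r z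
  proof -
    obtain N p where "\<And>n. N \<le> n \<Longrightarrow> p n \<in> carrier R \<and> s n \<ominus> r \<otimes> p n \<in> J" using dvd[OF r] by metis
    then have p: "p (m + N) \<in> carrier R" "s (m + N) \<ominus> r \<otimes> p (m + N) \<in> J" for m by auto
    have rR: "r \<in> carrier R" using r by blast
    \<comment> \<open>\<open>w m\<close> is \<open>(s m \<cdots> s (m + N) / r) z (m + N + 1)\<close>, which makes sense modulo the annihilator.\<close>
    define w where "w m = pr m N \<odot>\<^bsub>M\<^esub> (p (m + N) \<odot>\<^bsub>M\<^esub> z (Suc (m + N)))" for m
    note zA = HA[OF z] and zM = Ac(1)[OF HA[OF z]]
    have wA: "w m \<in> A" for m using Ac(5) prR p zA by (simp add: w_def)
    have "mcong M B (w m) (s m \<odot>\<^bsub>M\<^esub> w (Suc m))" for m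
    proof -
      let ?x = "z (Suc (Suc (m + N)))" and ?p = "p (m + N)" and ?p' = "p (Suc (m + N))"
      have p': "?p' \<in> carrier R" using p(1)[of "Suc m"] by simp
      have e: "s m \<odot>\<^bsub>M\<^esub> w (Suc m) = pr m N \<odot>\<^bsub>M\<^esub> (s (m + N) \<odot>\<^bsub>M\<^esub> (?p' \<odot>\<^bsub>M\<^esub> ?x))"
      proof -
        have "s m \<otimes> (pr (Suc m) N \<otimes> ?p') = pr m N \<otimes> (s (m + N) \<otimes> ?p')"
          using pr_shift[of m N] prR s p' by (simp add: R.m_assoc[symmetric])
        then show ?thesis using prR s p' zM by (simp add: w_def smult_assoc1[symmetric])
      qed
      have "mcong M B (pr m N \<odot>\<^bsub>M\<^esub> (s (m + N) \<odot>\<^bsub>M\<^esub> (?p' \<odot>\<^bsub>M\<^esub> ?x)))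
          (pr m N \<odot>\<^bsub>M\<^esub> (r \<odot>\<^bsub>M\<^esub> (?p \<odot>\<^bsub>M\<^esub> (?p' \<odot>\<^bsub>M\<^esub> ?x))))"
        by (rule cong_sp) (use p p' zA Ac(5) prR rR in auto)
      also have "pr m N \<odot>\<^bsub>M\<^esub> (r \<odot>\<^bsub>M\<^esub> (?p \<odot>\<^bsub>M\<^esub> (?p' \<odot>\<^bsub>M\<^esub> ?x))) = (pr m N \<otimes> ?p) \<odot>\<^bsub>M\<^esub> (r \<odot>\<^bsub>M\<^esub> (?p' \<odot>\<^bsub>M\<^esub> ?x))"
        using p p' zM prR rR by (simp add: smult_assoc1[symmetric] R.m_ac)
      also have "mcong M B \<dots> ((pr m N \<otimes> ?p) \<odot>\<^bsub>M\<^esub> (s (Suc (m + N)) \<odot>\<^bsub>M\<^esub> ?x))"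
        by (rule mcong_sym[OF B], rule cong_sp)
          (use p(2)[of "Suc m"] p p' zA prR rR in auto)
      finally have "mcong M B (s m \<odot>\<^bsub>M\<^esub> w (Suc m)) ((pr m N \<otimes> ?p) \<odot>\<^bsub>M\<^esub> (s (Suc (m + N)) \<odot>\<^bsub>M\<^esub> ?x))"
        unfolding e .
      also have "mcong M B \<dots> ((pr m N \<otimes> ?p) \<odot>\<^bsub>M\<^esub> z (Suc (m + N)))"
        by (rule mcong_smult[OF B mcong_sym[OF B Hs[OF z]]]) (use prR p in auto)
      also have "\<dots> = w m" using prR p zM by (simp add: w_def smult_assoc1)
      finally show ?thesis by (rule mcong_sym[OF B])
    qed
    then have wH: "w \<in> ?H" using wA by (simp add: divisible_seqs_def)
    have "mcong M B (r \<odot>\<^bsub>M\<^esub> w m) (z m)" for m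
    proof -
      let ?x = "z (Suc (m + N))"
      have "mcong M B (z m) (pr m N \<odot>\<^bsub>M\<^esub> (s (m + N) \<odot>\<^bsub>M\<^esub> ?x))"
        using Hpr[OF z, of m "Suc N"] pr prR s zM by (simp add: smult_assoc1)
      also have "mcong M B \<dots> (pr m N \<odot>\<^bsub>M\<^esub> (r \<odot>\<^bsub>M\<^esub> (p (m + N) \<odot>\<^bsub>M\<^esub> ?x)))"
        by (rule cong_sp) (use p zA prR rR in auto)
      also have "\<dots> = r \<odot>\<^bsub>M\<^esub> w m"
        using p zM prR rR by (simp add: w_def smult_assoc1[symmetric] R.m_ac)
      finally show ?thesis by (rule mcong_sym[OF B])
    qed
    then show ?thesis using wH by (intro bexI[of _ w]) (auto simp: fun_module_mcong)
  qed
  show ?thesis unfolding s_def[symmetric]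
  proof (rule X.solvable_of_divisible[OF _ _ _ idJ _ inj surj \<delta> indep])
    show "submodule ?H R (fun_module M)" by (rule submodule_divisible_seqs[OF A B s])
    show "submodule ?Z R (fun_module M)" by (rule submodule_fun_module[OF B])
    show "?Z \<subseteq> ?H"
    proof
      fix z assume "z \<in> ?Z"
      then have z: "z n \<in> B" for n by blast
      have "mcong M B (z n) (s n \<odot>\<^bsub>M\<^esub> z (Suc n))" for n
        using mcong_trans[OF B] mcong_sym[OF B] mcong_zero_iff[OF B] z Bc(5)[OF s z] by blast
      then show "z \<in> ?H" using z BA by (auto simp: divisible_seqs_def)
    qed
    show "j \<odot>\<^bsub>fun_module M\<^esub> z \<in> ?Z" if "j \<in> J" "z \<in> ?H" for j z
      using that HA JA by auto
  qed
qed

text \<open>Let \<open>A/B\<close> be a counterexample whose annihilator \<open>J\<close> is maximal among the annihilators of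
  counterexamples. Quotients and images under scalars inherit the solvability of telescopes, so larger
  annihilators force solvability: \<open>A/(aA + B)\<close> for \<open>a \<notin> J\<close> is solvable, and so is \<open>(aA + B)/B\<close> if it is
  annihilated by some \<open>b \<notin> J\<close>. Therefore \<open>J\<close> is prime, and at a prime the telescopes reduce the system to
  one over a field.\<close>

theorem solvable_noetherian:
  fixes \<delta> :: "'i \<Rightarrow> 'i \<Rightarrow> 'a"
  assumes "noetherian_ring R"
    and \<T>: "\<And>T. T \<in> \<T> \<Longrightarrow> submonoid T R \<and> countable T"
    and primes: "\<And>J. primeideal J R \<Longrightarrow> \<exists>T\<in>\<T>. field_after_inverting R T J"
    and \<delta>: "\<And>k. \<delta> k \<in> fsupp R" and indep: "\<And>J. primeideal J R \<Longrightarrow> indep_mod R J \<delta>"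
    and A: "submodule A R M" and B: "submodule B R M" and BA: "B \<subseteq> A"
    and tel: "\<And>T. T \<in> \<T> \<Longrightarrow> telescopes R M (den_seq R T) A B"
  shows "solvable R M \<delta> A B"
proof (rule ccontr)
  assume "\<not> solvable R M \<delta> A B"
  interpret N: noetherian_ring R by fact
  define bad where "bad A B \<longleftrightarrow> submodule A R M \<and> submodule B R M \<and> B \<subseteq> A \<and>
    (\<forall>T\<in>\<T>. telescopes R M (den_seq R T) A B) \<and> \<not> solvable R M \<delta> A B" for A B
  define \<J> where "\<J> = {annihilator R M A B | A B. bad A B}"
  have "bad A B" using assms \<open>\<not> _\<close> by (auto simp: bad_def)
  then have "\<J> \<noteq> {}" by (auto simp: \<J>_def)
  moreover have "ideal J R" if "J \<in> \<J>" for J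
    using that ideal_annihilator by (auto simp: \<J>_def bad_def)
  ultimately obtain J where "J \<in> \<J>" and max: "\<And>I. I \<in> \<J> \<Longrightarrow> J \<subseteq> I \<Longrightarrow> I = J"
    using N.maximal_ideal_in[of \<J>] by blast
  then obtain A B where J: "J = annihilator R M A B" and "bad A B" by (auto simp: \<J>_def)
  then have A: "submodule A R M" and B: "submodule B R M" and BA: "B \<subseteq> A"
    and tel: "\<And>T. T \<in> \<T> \<Longrightarrow> telescopes R M (den_seq R T) A B" and not: "\<not> solvable R M \<delta> A B"
    by (auto simp: bad_def)
  note Ac = submodule_closed[OF A] and Bc = submodule_closed[OF B]
  have seqR: "den_seq R T n \<in> carrier R" if "T \<in> \<T>" for T n
    using den_seq_mem submonoid.subset \<T>[OF that] by blast
  have solv: "solvable R M \<delta> A' B'" if "submodule A' R M" "submodule B' R M" "B' \<subseteq> A'"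
    "\<And>T. T \<in> \<T> \<Longrightarrow> telescopes R M (den_seq R T) A' B'" "J \<subseteq> annihilator R M A' B'"
    "a \<in> annihilator R M A' B'" "a \<notin> J" for A' B' a
    using max[of "annihilator R M A' B'"] that unfolding \<J>_def bad_def by blast
  have quot: "solvable R M \<delta> A (multiples R M a A B)" if a: "a \<in> carrier R" "a \<notin> J" for a
  proof (rule solv[OF A submodule_multiples[OF A B a(1)] _ _ _ _ a(2)])
    note mb = multiples_bounds[OF A B a(1) BA]
    show "multiples R M a A B \<subseteq> A" by (rule mb(2))
    show "\<And>T. T \<in> \<T> \<Longrightarrow> telescopes R M (den_seq R T) A (multiples R M a A B)"
      by (rule telescopes_quotient[OF tel mb(1)])
    show "J \<subseteq> annihilator R M A (multiples R M a A B)" using mb(1) by (auto simp: J annihilator_def)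
    show "a \<in> annihilator R M A (multiples R M a A B)" using mb(3) a by (auto simp: annihilator_def)
  qed
  have idJ: "ideal J R" unfolding J by (rule ideal_annihilator[OF A B])
  have "primeideal J R"
  proof (rule primeidealI[OF idJ R.is_cring])
    show "carrier R \<noteq> J"
    proof
      assume "carrier R = J"
      then have "\<one> \<odot>\<^bsub>M\<^esub> x \<in> B" if "x \<in> A" for x using that by (auto simp: J annihilator_def)
      then have "A \<subseteq> B" using Ac(1) by auto
      then have "mcong M B (comb R M (\<delta> k) (\<lambda>_. \<zero>\<^bsub>M\<^esub>)) (c k)" if "\<forall>k. c k \<in> A" for c k
        using that comb_submodule[OF A \<delta>, of "\<lambda>_. \<zero>\<^bsub>M\<^esub>"] Ac by (auto simp: mcong_def)
      then have "solvable R M \<delta> A B"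
        unfolding solvable_def using Ac(2) by (intro allI impI exI[of _ "\<lambda>_. \<zero>\<^bsub>M\<^esub>"] conjI) simp_all
      then show False using not by blast
    qed
    fix a b assume ab: "a \<in> carrier R" "b \<in> carrier R" "a \<otimes> b \<in> J"
    show "a \<in> J \<or> b \<in> J"
    proof (rule ccontr)
      assume n: "\<not> (a \<in> J \<or> b \<in> J)"
      let ?D = "multiples R M a A B"
      note mb = multiples_bounds[OF A B ab(1) BA]
      have D: "submodule ?D R M" by (rule submodule_multiples[OF A B ab(1)])
      have cong_in: "r \<odot>\<^bsub>M\<^esub> x \<in> B" if r: "r \<in> carrier R" "r \<otimes> a \<in> J" and x: "x \<in> ?D" for r x
      proof -
        obtain y where y: "y \<in> A" "mcong M B x (a \<odot>\<^bsub>M\<^esub> y)" using x by (auto simp: multiples_def)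
        have "(r \<otimes> a) \<odot>\<^bsub>M\<^esub> y \<in> B" using r y by (auto simp: J annihilator_def)
        then show ?thesis
          using mcong_mem[OF B mcong_smult[OF B y(2) r(1)]] r ab Ac(1)[OF y(1)] by (simp add: smult_assoc1)
      qed
      have "solvable R M \<delta> ?D B"
      proof (rule solv[OF D B mb(1)])
        show "\<And>T. T \<in> \<T> \<Longrightarrow> telescopes R M (den_seq R T) ?D B"
          by (rule telescopes_multiples[OF A B BA seqR ab(1) tel])
        show "J \<subseteq> annihilator R M ?D B"
          using cong_in ideal.I_r_closed[OF idJ _ ab(1)] ideal.Icarr[OF idJ] by (auto simp: annihilator_def)
        show "b \<in> annihilator R M ?D B" using cong_in ab by (auto simp: annihilator_def R.m_comm)
        show "b \<notin> J" using n by blast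
      qed
      then show False
        using solvable_extension[OF A B D mb(1,2) \<delta> quot[OF ab(1)]] n not by blast
    qed
  qed
  then obtain T where T: "T \<in> \<T>" "field_after_inverting R T J" using primes by blast
  have "den_seq R T n \<notin> J" for n
    using T den_seq_mem \<T> unfolding field_after_inverting_def by blast
  then have "solvable R M \<delta> A B"
    using solvable_of_telescopes[OF A B BA seqR[OF T(1)] tel[OF T(1)] \<delta> quot[OF seqR[OF T(1)]]]
      solvable_divisible_seqs[OF A B BA J _ _ T(2) \<delta> indep[OF \<open>primeideal J R\<close>]] \<T>[OF T(1)]
    by blast
  then show False using not by blast
qed

end

section \<open>Flat quotients and towers of free modules\<close>

definition lsum :: "('r, 'm, 't) module_scheme \<Rightarrow> nat \<Rightarrow> (nat \<Rightarrow> 'r) \<Rightarrow> (nat \<Rightarrow> 'm) \<Rightarrow> 'm"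
  where "lsum M n u v = finsum M (\<lambda>k. u k \<odot>\<^bsub>M\<^esub> v k) {..<n}"

text \<open>The equational criterion for flatness of \<open>M/N\<close>: every relation is a consequence of relations in \<open>R\<close>.\<close>

definition flat_quotient :: "('r, 's) ring_scheme \<Rightarrow> ('r, 'm, 't) module_scheme \<Rightarrow> 'm set \<Rightarrow> bool"
  where "flat_quotient R M N \<longleftrightarrow>
    (\<forall>m a x. (\<forall>k. a k \<in> carrier R) \<longrightarrow> (\<forall>k. x k \<in> carrier M) \<longrightarrow> lsum M m a x \<in> N \<longrightarrow>
      (\<exists>n b y. (\<forall>k l. b k l \<in> carrier R) \<and> (\<forall>l. y l \<in> carrier M) \<and>
        (\<forall>k<m. mcong M N (x k) (lsum M n (b k) y)) \<and>
        (\<forall>l<n. (\<Oplus>\<^bsub>R\<^esub>k\<in>{..<m}. a k \<otimes>\<^bsub>R\<^esub> b k l) = \<zero>\<^bsub>R\<^esub>)))"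

lemma flat_quotientE:
  assumes "flat_quotient R M N" "\<And>k. a k \<in> carrier R" "\<And>k. x k \<in> carrier M" "lsum M m a x \<in> N"
  obtains n b y where "\<And>k l. b k l \<in> carrier R" "\<And>l. y l \<in> carrier M"
    "\<And>k. k < m \<Longrightarrow> mcong M N (x k) (lsum M n (b k) y)"
    "\<And>l. l < n \<Longrightarrow> (\<Oplus>\<^bsub>R\<^esub>k\<in>{..<m}. a k \<otimes>\<^bsub>R\<^esub> b k l) = \<zero>\<^bsub>R\<^esub>"
proof -
  have "\<exists>n b y. (\<forall>k l. b k l \<in> carrier R) \<and> (\<forall>l. y l \<in> carrier M) \<and>
        (\<forall>k<m. mcong M N (x k) (lsum M n (b k) y)) \<and>
        (\<forall>l<n. (\<Oplus>\<^bsub>R\<^esub>k\<in>{..<m}. a k \<otimes>\<^bsub>R\<^esub> b k l) = \<zero>\<^bsub>R\<^esub>)"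
    using assms(1)[unfolded flat_quotient_def, rule_format, of a x m] assms(2-4) by blast
  then show thesis using that by blast
qed

text \<open>The coefficient vector \<open>u\<close> at stage \<open>j\<close> of the tower with transition matrices \<open>A\<close>, carried \<open>d\<close> stages
  further.\<close>

primrec pushv :: "('r, 's) ring_scheme \<Rightarrow> (nat \<Rightarrow> nat) \<Rightarrow> (nat \<Rightarrow> nat \<Rightarrow> nat \<Rightarrow> 'r) \<Rightarrow> nat \<Rightarrow> nat \<Rightarrow> (nat \<Rightarrow> 'r) \<Rightarrow> nat \<Rightarrow> 'r"
  where "pushv R n A j 0 u = u"
  | "pushv R n A j (Suc d) u = (\<lambda>l. \<Oplus>\<^bsub>R\<^esub>k\<in>{..<n (j + d)}. pushv R n A j d u k \<otimes>\<^bsub>R\<^esub> A (j + d) k l)"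

lemma (in abelian_monoid) finsum_split_add:
  fixes f :: "nat \<Rightarrow> 'a"
  assumes "\<And>k. f k \<in> carrier G"
  shows "finsum G f {..<m + n} = finsum G f {..<m} \<oplus> finsum G (\<lambda>k. f (m + k)) {..<n}"
proof (induct n)
  case (Suc n)
  have "finsum G f {..<m + Suc n} = finsum G f (insert (m + n) {..<m + n})"
    by (rule arg_cong[where f="finsum G f"]) auto
  also have "\<dots> = f (m + n) \<oplus> finsum G f {..<m + n}"
    using assms by (subst finsum_insert) auto
  also have "finsum G (\<lambda>k. f (m + k)) {..<Suc n} = f (m + n) \<oplus> finsum G (\<lambda>k. f (m + k)) {..<n}"
    using assms by (simp add: lessThan_Suc)
  ultimately show ?case using assms Suc by (simp add: a_lcomm)
qed (use assms in auto)

lemma (in abelian_monoid) finsum_swap: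
  assumes "finite S" "\<And>k l. f k l \<in> carrier G"
  shows "(\<Oplus>k\<in>S. \<Oplus>l\<in>T. f k l) = (\<Oplus>l\<in>T. \<Oplus>k\<in>S. f k l)"
  using assms(1)
proof (induct S)
  case empty then show ?case using finsum_zero by simp
next
  case (insert x S)
  have "(\<Oplus>l\<in>T. \<Oplus>k\<in>insert x S. f k l) = (\<Oplus>l\<in>T. f x l \<oplus> (\<Oplus>k\<in>S. f k l))"
    using insert assms(2) by (intro finsum_cong') auto
  also have "\<dots> = (\<Oplus>l\<in>T. f x l) \<oplus> (\<Oplus>l\<in>T. \<Oplus>k\<in>S. f k l)"
    using assms(2) by (intro finsum_addf) auto
  finally show ?case using insert assms(2) by simp
qed

context module
begin

lemma lsum_closed: "(\<And>k. u k \<in> carrier R) \<Longrightarrow> (\<And>k. v k \<in> carrier M) \<Longrightarrow> lsum M n u v \<in> carrier M"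
  unfolding lsum_def by (rule M.finsum_closed) auto

lemma lsum_cong_mod:
  "submodule N R M \<Longrightarrow> (\<And>k. u k \<in> carrier R) \<Longrightarrow> (\<And>k. k < n \<Longrightarrow> mcong M N (v k) (w k)) \<Longrightarrow>
    mcong M N (lsum M n u v) (lsum M n u w)"
  unfolding lsum_def by (rule mcong_finsum) (auto intro: mcong_smult)

lemma lsum_cong:
  "(\<And>k. k < n \<Longrightarrow> u k = u' k) \<Longrightarrow> (\<And>k. u k \<in> carrier R) \<Longrightarrow> (\<And>k. u' k \<in> carrier R) \<Longrightarrow>
    (\<And>k. v k \<in> carrier M) \<Longrightarrow> lsum M n u v = lsum M n u' v"
  unfolding lsum_def by (rule M.finsum_cong') auto

lemma lsum_zero: "(\<And>k. v k \<in> carrier M) \<Longrightarrow> lsum M n (\<lambda>_. \<zero>) v = \<zero>\<^bsub>M\<^esub>"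
  unfolding lsum_def by (simp add: M.add.finprod_one_eqI)

lemma lsum_add:
  "(\<And>k. u k \<in> carrier R) \<Longrightarrow> (\<And>k. v k \<in> carrier M) \<Longrightarrow> (\<And>k. w k \<in> carrier M) \<Longrightarrow>
    lsum M n u (\<lambda>k. v k \<oplus>\<^bsub>M\<^esub> w k) = lsum M n u v \<oplus>\<^bsub>M\<^esub> lsum M n u w"
  unfolding lsum_def by (subst M.finsum_addf[symmetric]) (auto simp: smult_r_distr intro!: M.finsum_cong')

lemma lsum_minus:
  assumes "\<And>k. u k \<in> carrier R" "\<And>k. v k \<in> carrier M" "\<And>k. w k \<in> carrier M"
  shows "lsum M n u (\<lambda>k. v k \<ominus>\<^bsub>M\<^esub> w k) = lsum M n u v \<ominus>\<^bsub>M\<^esub> lsum M n u w"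
proof -
  have "lsum M n u v = lsum M n u (\<lambda>k. (v k \<ominus>\<^bsub>M\<^esub> w k) \<oplus>\<^bsub>M\<^esub> w k)"
    unfolding lsum_def using assms by (intro M.finsum_cong') (auto simp: group_normalize)
  also have "\<dots> = lsum M n u (\<lambda>k. v k \<ominus>\<^bsub>M\<^esub> w k) \<oplus>\<^bsub>M\<^esub> lsum M n u w"
    by (rule lsum_add) (use assms in auto)
  finally have e: "lsum M n u v = lsum M n u (\<lambda>k. v k \<ominus>\<^bsub>M\<^esub> w k) \<oplus>\<^bsub>M\<^esub> lsum M n u w" .
  have c: "lsum M n u (\<lambda>k. v k \<ominus>\<^bsub>M\<^esub> w k) \<in> carrier M" "lsum M n u w \<in> carrier M"
    using assms by (auto intro: lsum_closed)
  show ?thesis unfolding e using c by (simp add: M.minus_eq M.a_assoc M.r_neg)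
qed

lemma lsum_add_left:
  "(\<And>k. u k \<in> carrier R) \<Longrightarrow> (\<And>k. u' k \<in> carrier R) \<Longrightarrow> (\<And>k. v k \<in> carrier M) \<Longrightarrow>
    lsum M n (\<lambda>k. u k \<oplus> u' k) v = lsum M n u v \<oplus>\<^bsub>M\<^esub> lsum M n u' v"
  unfolding lsum_def by (subst M.finsum_addf[symmetric]) (auto simp: smult_l_distr intro!: M.finsum_cong')

lemma lsum_smult_left:
  "a \<in> carrier R \<Longrightarrow> (\<And>k. u k \<in> carrier R) \<Longrightarrow> (\<And>k. v k \<in> carrier M) \<Longrightarrow>
    lsum M n (\<lambda>k. a \<otimes> u k) v = a \<odot>\<^bsub>M\<^esub> lsum M n u v"
  unfolding lsum_def by (subst finsum_smult_ldistr) (auto simp: smult_assoc1 intro!: M.finsum_cong')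

lemma lsum_unit:
  assumes "i < n" "\<And>k. v k \<in> carrier M"
  shows "lsum M n (\<lambda>k. if i = k then \<one> else \<zero>) v = v i"
proof -
  have "lsum M n (\<lambda>k. if i = k then \<one> else \<zero>) v = finsum M (\<lambda>k. if i = k then v k else \<zero>\<^bsub>M\<^esub>) {..<n}"
    unfolding lsum_def using assms by (intro M.finsum_cong') auto
  also have "\<dots> = v i" using assms by (intro M.finsum_singleton) auto
  finally show ?thesis .
qed

lemma finsum_smult_rdistr:
  "(\<And>k. f k \<in> carrier R) \<Longrightarrow> x \<in> carrier M \<Longrightarrow>
    finsum R f S \<odot>\<^bsub>M\<^esub> x = finsum M (\<lambda>k. f k \<odot>\<^bsub>M\<^esub> x) S"
proof (induct S rule: infinite_finite_induct)
  case (insert y S)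
  then show ?case by (simp add: smult_l_distr)
qed auto

lemma lsum_lsum:
  assumes "\<And>k. u k \<in> carrier R" "\<And>k l. b k l \<in> carrier R" "\<And>l. v l \<in> carrier M"
  shows "lsum M m u (\<lambda>k. lsum M n (b k) v) = lsum M n (\<lambda>l. \<Oplus>k\<in>{..<m}. u k \<otimes> b k l) v"
proof -
  have "lsum M m u (\<lambda>k. lsum M n (b k) v) = finsum M (\<lambda>k. finsum M (\<lambda>l. (u k \<otimes> b k l) \<odot>\<^bsub>M\<^esub> v l) {..<n}) {..<m}"
    unfolding lsum_def using assms
    by (intro M.finsum_cong') (auto simp: finsum_smult_ldistr smult_assoc1)
  also have "\<dots> = finsum M (\<lambda>l. finsum M (\<lambda>k. (u k \<otimes> b k l) \<odot>\<^bsub>M\<^esub> v l) {..<m}) {..<n}"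
    by (rule M.finsum_swap) (use assms in auto)
  also have "\<dots> = lsum M n (\<lambda>l. \<Oplus>k\<in>{..<m}. u k \<otimes> b k l) v"
    unfolding lsum_def using assms by (intro M.finsum_cong') (auto simp: finsum_smult_rdistr)
  finally show ?thesis .
qed

lemma pushv_closed:
  "(\<And>k. u k \<in> carrier R) \<Longrightarrow> (\<And>i k l. A i k l \<in> carrier R) \<Longrightarrow> pushv R n A j d u l \<in> carrier R"
  by (induct d arbitrary: l) auto

lemma pushv_agree:
  assumes "\<And>k. k < n j \<Longrightarrow> u k = u' k" "\<And>k. u k \<in> carrier R" "\<And>k. u' k \<in> carrier R"
    and A: "\<And>i k l. A i k l \<in> carrier R"
  shows "l < n (j + d) \<Longrightarrow> pushv R n A j d u l = pushv R n A j d u' l"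
proof (induct d arbitrary: l)
  case (Suc d)
  then show ?case using pushv_closed[where u=u and A=A, OF assms(2) A] pushv_closed[where u=u' and A=A, OF assms(3) A] A
    by (auto intro!: R.finsum_cong')
qed (use assms in auto)

lemma lsum_pushv:
  assumes N: "submodule N R M" and u: "\<And>k. u k \<in> carrier R" and A: "\<And>i k l. A i k l \<in> carrier R"
    and w: "\<And>i k. w i k \<in> carrier M"
    and tower: "\<And>i k. k < n i \<Longrightarrow> mcong M N (w i k) (lsum M (n (Suc i)) (A i k) (w (Suc i)))"
  shows "mcong M N (lsum M (n j) u (w j)) (lsum M (n (j + d)) (pushv R n A j d u) (w (j + d)))"
proof (induct d)
  case 0 then show ?case using mcong_refl[OF N] lsum_closed[OF u w] by simp
next
  case (Suc d)
  note p = pushv_closed[where u=u and A=A and n=n and j=j and d=d, OF u A]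
  have "mcong M N (lsum M (n (j + d)) (pushv R n A j d u) (w (j + d)))
    (lsum M (n (j + d)) (pushv R n A j d u) (\<lambda>k. lsum M (n (Suc (j + d))) (A (j + d) k) (w (Suc (j + d)))))"
    by (rule lsum_cong_mod[OF N p]) (use tower in simp)
  also have "lsum M (n (j + d)) (pushv R n A j d u) (\<lambda>k. lsum M (n (Suc (j + d))) (A (j + d) k) (w (Suc (j + d)))) =
    lsum M (n (j + Suc d)) (pushv R n A j (Suc d) u) (w (j + Suc d))"
    using p A w by (simp add: lsum_lsum)
  finally show ?case by (rule mcong_trans[OF N Suc])
qed

text \<open>The equation between \<open>\<Sum> a x\<close> and \<open>\<Sum> u v\<close> is a single relation among the \<open>x k\<close> and the \<open>v k\<close>. By
  flatness, both families are combinations of new elements \<open>v'\<close> for which the relation holds already between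
  the coefficients. If the equation has no solution \<open>x\<close>, the tower just stays where it is.\<close>

lemma tower_step:
  assumes N: "submodule N R M" and flat: "flat_quotient R M N"
    and v: "\<And>k. v k \<in> carrier M" and u: "\<And>k. u k \<in> carrier R" and a: "\<And>k. a k \<in> carrier R"
  shows "\<exists>n' v' A. (\<forall>l. v' l \<in> carrier M) \<and> (\<forall>k l. A k l \<in> carrier R) \<and>
    (\<forall>k<n. mcong M N (v k) (lsum M n' (A k) v')) \<and>
    ((\<exists>x. (\<forall>k. x k \<in> carrier M) \<and> mcong M N (lsum M m a x) (lsum M n u v)) \<longrightarrow>
      (\<exists>b. (\<forall>k l. b k l \<in> carrier R) \<and>
        (\<forall>l<n'. (\<Oplus>k\<in>{..<m}. a k \<otimes> b k l) = (\<Oplus>k\<in>{..<n}. u k \<otimes> A k l))))"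
proof (cases "\<exists>x. (\<forall>k. x k \<in> carrier M) \<and> mcong M N (lsum M m a x) (lsum M n u v)")
  case False
  then show ?thesis
    by (intro exI[of _ n] exI[of _ v] exI[of _ "\<lambda>k l. if k = l then \<one> else \<zero>"])
      (use v mcong_refl[OF N] in \<open>auto simp: lsum_unit\<close>)
next
  case True
  then obtain x where x: "\<And>k. x k \<in> carrier M" and eq: "mcong M N (lsum M m a x) (lsum M n u v)" by blast
  define a' where "a' k = (if k < m then a k else \<ominus> u (k - m))" for k
  define x' where "x' k = (if k < m then x k else v (k - m))" for k
  have a': "a' k \<in> carrier R" and x': "x' k \<in> carrier M" for k using a u x v by (auto simp: a'_def x'_def)
  have "lsum M (m + n) a' x' = lsum M m a x \<oplus>\<^bsub>M\<^esub> lsum M n (\<lambda>k. \<ominus> u k) v"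
  proof -
    have "lsum M (m + n) a' x' = finsum M (\<lambda>k. a' k \<odot>\<^bsub>M\<^esub> x' k) {..<m} \<oplus>\<^bsub>M\<^esub> finsum M (\<lambda>k. a' (m + k) \<odot>\<^bsub>M\<^esub> x' (m + k)) {..<n}"
      unfolding lsum_def by (rule M.finsum_split_add) (use a' x' in auto)
    also have "finsum M (\<lambda>k. a' k \<odot>\<^bsub>M\<^esub> x' k) {..<m} = lsum M m a x"
      unfolding lsum_def using a x by (intro M.finsum_cong') (auto simp: a'_def x'_def)
    also have "finsum M (\<lambda>k. a' (m + k) \<odot>\<^bsub>M\<^esub> x' (m + k)) {..<n} = lsum M n (\<lambda>k. \<ominus> u k) v"
      unfolding lsum_def using u v by (intro M.finsum_cong') (auto simp: a'_def x'_def)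
    finally show ?thesis .
  qed
  also have "lsum M n (\<lambda>k. \<ominus> u k) v = \<ominus>\<^bsub>M\<^esub> lsum M n u v"
    using lsum_smult_left[of "\<ominus> \<one>" u v n] u v lsum_closed[of u v n] by (simp add: R.l_minus smult_l_minus)
  finally have "lsum M (m + n) a' x' \<in> N" using eq by (simp add: mcong_def M.minus_eq)
  from this obtain n' b y where b: "\<And>k l. b k l \<in> carrier R" and y: "\<And>l. y l \<in> carrier M"
    and xy: "\<And>k. k < m + n \<Longrightarrow> mcong M N (x' k) (lsum M n' (b k) y)"
    and z: "\<And>l. l < n' \<Longrightarrow> (\<Oplus>k\<in>{..<m + n}. a' k \<otimes> b k l) = \<zero>"
    by (rule flat_quotientE[where a=a' and x=x', OF flat a' x']) blast
  have "mcong M N (v k) (lsum M n' (b (m + k)) y)" if "k < n" for k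
    using xy[of "m + k"] that by (simp add: x'_def)
  moreover have "(\<Oplus>k\<in>{..<m}. a k \<otimes> b k l) = (\<Oplus>k\<in>{..<n}. u k \<otimes> b (m + k) l)" if l: "l < n'" for l
  proof -
    let ?X = "\<Oplus>k\<in>{..<m}. a k \<otimes> b k l" and ?Y = "\<Oplus>k\<in>{..<n}. u k \<otimes> b (m + k) l"
    have cl: "?X \<in> carrier R" "?Y \<in> carrier R" using a b u by auto
    have "(\<Oplus>k\<in>{..<m + n}. a' k \<otimes> b k l) = (\<Oplus>k\<in>{..<m}. a' k \<otimes> b k l) \<oplus> (\<Oplus>k\<in>{..<n}. a' (m + k) \<otimes> b (m + k) l)"
      by (rule R.finsum_split_add) (use a' b in auto)
    also have "(\<Oplus>k\<in>{..<m}. a' k \<otimes> b k l) = ?X"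
      using a b by (intro R.finsum_cong') (auto simp: a'_def)
    also have "(\<Oplus>k\<in>{..<n}. a' (m + k) \<otimes> b (m + k) l) = (\<Oplus>k\<in>{..<n}. (\<ominus> \<one>) \<otimes> (u k \<otimes> b (m + k) l))"
      using u b by (intro R.finsum_cong') (auto simp: a'_def R.l_minus)
    also have "\<dots> = (\<ominus> \<one>) \<otimes> ?Y"
      using u b by (subst R.finsum_rdistr) auto
    finally have "?X \<oplus> (\<ominus> ?Y) = \<zero>" using z[OF l] cl by (simp add: R.l_minus)
    then show ?thesis using cl R.minus_equality R.minus_minus R.a_inv_closed by metis
  qed
  ultimately show ?thesis
    using b y by (intro exI[of _ n'] exI[of _ y] exI[of _ "\<lambda>k. b (m + k)"]) (auto intro!: exI[of _ b])
qed

text \<open>The last clause says that every solvable equation \<open>\<Sum> a x = w\<close>, with \<open>w\<close> in the image of a stage, is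
  solved within the tower at a later stage. There are countably many such tasks, a task being a stage with
  coefficients \<open>u\<close> and \<open>a\<close>. They are enumerated so that none comes up before the stage it refers to, and
  \<open>tower_step\<close> settles it when it does. The case \<open>m = 0\<close> says that elements of a stage that vanish in \<open>M/N\<close>
  vanish at a later stage.\<close>

lemma tower_exists:
  assumes N: "submodule N R M" and flat: "flat_quotient R M N" and count: "countable (carrier R)"
    and e: "e \<in> carrier M"
  shows "\<exists>n v A. n 0 = Suc 0 \<and> v 0 0 = e \<and> (\<forall>i k. v i k \<in> carrier M) \<and> (\<forall>i k l. A i k l \<in> carrier R) \<and>
    (\<forall>i k. k < n i \<longrightarrow> mcong M N (v i k) (lsum M (n (Suc i)) (A i k) (v (Suc i)))) \<and>
    (\<forall>j u m a. (\<forall>k. u k \<in> carrier R) \<longrightarrow> (\<forall>k. a k \<in> carrier R) \<longrightarrow>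
      (\<exists>x. (\<forall>k. x k \<in> carrier M) \<and> mcong M N (lsum M m a x) (lsum M (n j) u (v j))) \<longrightarrow>
      (\<exists>d b. (\<forall>k l. b k l \<in> carrier R) \<and>
        (\<forall>l<n (j + d). (\<Oplus>k\<in>{..<m}. a k \<otimes> b k l) = pushv R n A j d u l)))"
proof -
  define vec where "vec us = (\<lambda>k. if k < length us then us ! k else \<zero>)" for us :: "'a list"
  have vecR: "vec us k \<in> carrier R" if "us \<in> lists (carrier R)" for us k
    using that by (auto simp: vec_def in_lists_conv_set)
  define Q where "Q n v u m a p \<longleftrightarrow> (\<forall>l. fst (snd p) l \<in> carrier M) \<and> (\<forall>k l. snd (snd p) k l \<in> carrier R) \<and>
    (\<forall>k<n. mcong M N (v k) (lsum M (fst p) (snd (snd p) k) (fst (snd p)))) \<and>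
    ((\<exists>x. (\<forall>k. x k \<in> carrier M) \<and> mcong M N (lsum M m a x) (lsum M n u v)) \<longrightarrow>
      (\<exists>b. (\<forall>k l. b k l \<in> carrier R) \<and>
        (\<forall>l<fst p. (\<Oplus>k\<in>{..<m}. a k \<otimes> b k l) = (\<Oplus>k\<in>{..<n}. u k \<otimes> snd (snd p) k l))))"
    for n m :: nat and u a :: "nat \<Rightarrow> 'a" and v :: "nat \<Rightarrow> 'c" and p :: "nat \<times> (nat \<Rightarrow> 'c) \<times> (nat \<Rightarrow> nat \<Rightarrow> 'a)"
  define stp where "stp n v u m a = (SOME p. Q n v u m a p)" for n v u m a
  have stp: "Q n v u m a (stp n v u m a)"
    if "\<And>k. v k \<in> carrier M" "\<And>k. u k \<in> carrier R" "\<And>k. a k \<in> carrier R" for n v u m a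
  proof -
    have "\<exists>p. Q n v u m a p"
      using tower_step[where v=v and u=u and a=a and n=n and m=m, OF N flat that] unfolding Q_def by (simp add: split_paired_Ex)
    then show ?thesis unfolding stp_def by (rule someI_ex)
  qed
  \<comment> \<open>A task \<open>(j, us, as)\<close> asks for the solution of \<open>\<Sum> as x = \<Sum> us (v j)\<close>.\<close>
  define Ts :: "(nat \<times> 'a list \<times> 'a list) set" where "Ts = UNIV \<times> lists (carrier R) \<times> lists (carrier R)"
  have Ts: "countable Ts" "Ts \<noteq> {}"
    using count lists.Nil unfolding Ts_def by (auto intro!: countable_SIGMA countable_lists)
  define task where "task i = from_nat_into Ts (fst (prod_decode i))" for i
  have task: "task i \<in> Ts" for i unfolding task_def by (rule from_nat_into[OF Ts(2)])
  \<comment> \<open>The state at step \<open>i\<close> is \<open>(n i, v i, g)\<close>, where \<open>g j\<close> carries coefficient vectors from stage \<open>j\<close> to stage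
    \<open>i\<close>, so that the task of step \<open>i\<close> can be stated at stage \<open>i\<close>.\<close>
  define U where "U i g = g (fst (task i)) (vec (fst (snd (task i))))"
    for i and g :: "nat \<Rightarrow> (nat \<Rightarrow> 'a) \<Rightarrow> nat \<Rightarrow> 'a"
  define al where "al i = snd (snd (task i))" for i
  define stq where "stq i n v g = stp n v (U i g) (length (al i)) (vec (al i))" for i n v g
  define nxt where "nxt i st = (let n = fst st; v = fst (snd st); g = snd (snd st); p = stq i n v g in
      (fst p, fst (snd p), \<lambda>j u. if j \<le> i then (\<lambda>l. \<Oplus>k\<in>{..<n}. g j u k \<otimes> snd (snd p) k l) else u))" for i st
  define S where "S = rec_nat (Suc 0, (\<lambda>_. e), (\<lambda>j u. u)) nxt"
  define n v g where "n i = fst (S i)" and "v i = fst (snd (S i))" and "g i = snd (snd (S i))" for i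
  define A where "A i = snd (snd (stq i (n i) (v i) (g i)))" for i
  have S0: "n 0 = Suc 0" "v 0 = (\<lambda>_. e)" "g 0 = (\<lambda>j u. u)" by (auto simp: n_def v_def g_def S_def)
  have SSS: "S (Suc i) = nxt i (S i)" for i by (simp add: S_def)
  have SS: "n (Suc i) = fst (stq i (n i) (v i) (g i))" "v (Suc i) = fst (snd (stq i (n i) (v i) (g i)))"
    "g (Suc i) = (\<lambda>j u. if j \<le> i then (\<lambda>l. \<Oplus>k\<in>{..<n i}. g i j u k \<otimes> A i k l) else u)" for i
    by (simp_all add: n_def v_def g_def SSS nxt_def A_def Let_def fun_eq_iff)
  have tl: "al i \<in> lists (carrier R)" "fst (snd (task i)) \<in> lists (carrier R)" for i
    using task[of i] unfolding al_def Ts_def by (simp_all add: mem_Times_iff)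
  note alR = vecR[OF tl(1)]
  have inv: "(\<forall>k. v i k \<in> carrier M) \<and> (\<forall>j u l. (\<forall>k. u k \<in> carrier R) \<longrightarrow> g i j u l \<in> carrier R)" for i
  proof (induct i)
    case 0 then show ?case using e by (simp add: S0)
  next
    case (Suc i)
    have U: "U i (g i) k \<in> carrier R" for k
      using Suc vecR[OF tl(2)] by (simp add: U_def)
    have "Q (n i) (v i) (U i (g i)) (length (al i)) (vec (al i)) (stq i (n i) (v i) (g i))"
      unfolding stq_def by (rule stp) (use Suc U alR in auto)
    then have "\<forall>k. v (Suc i) k \<in> carrier M" "\<forall>k l. A i k l \<in> carrier R"
      unfolding Q_def SS A_def by blast+
    then show ?case using Suc by (auto simp: SS(3))
  qed
  have U: "U i (g i) k \<in> carrier R" for i k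
    using inv vecR[OF tl(2)] by (simp add: U_def)
  have QS: "Q (n i) (v i) (U i (g i)) (length (al i)) (vec (al i)) (stq i (n i) (v i) (g i))" for i
    unfolding stq_def by (rule stp) (use inv U alR in auto)
  have vM: "v i k \<in> carrier M" for i k using inv by blast
  have AR: "A i k l \<in> carrier R" for i k l using QS[of i] unfolding Q_def A_def by blast
  have tower: "mcong M N (v i k) (lsum M (n (Suc i)) (A i k) (v (Suc i)))" if "k < n i" for i k
    using QS[of i] that unfolding Q_def A_def SS by blast
  have g_push: "g (j + d) j u = pushv R n A j d u" for j d u
  proof (induct d)
    case 0 show ?case by (cases j) (simp_all add: S0 SS(3))
  next
    case (Suc d) then show ?case by (simp add: SS(3))
  qed
  have "\<exists>d b. (\<forall>k l. b k l \<in> carrier R) \<and> (\<forall>l<n (j + d). (\<Oplus>k\<in>{..<m}. a k \<otimes> b k l) = pushv R n A j d u l)"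
    if u: "\<And>k. u k \<in> carrier R" and a: "\<And>k. a k \<in> carrier R"
      and x: "\<And>k. x k \<in> carrier M" and eq: "mcong M N (lsum M m a x) (lsum M (n j) u (v j))" for j u m a x
  proof -
    define ul where "ul = map u [0..<n j]"
    define bl where "bl = map a [0..<m]"
    have lR: "ul \<in> lists (carrier R)" "bl \<in> lists (carrier R)"
      using u a by (auto simp: ul_def bl_def)
    have vu: "vec ul k = u k" if "k < n j" for k using that by (simp add: vec_def ul_def)
    have va: "vec bl k = a k" if "k < m" for k using that by (simp add: vec_def bl_def)
    have "(j, ul, bl) \<in> Ts" using lR by (simp add: Ts_def)
    then obtain p where p: "from_nat_into Ts p = (j, ul, bl)" using from_nat_into_surj[OF Ts(1)] by blast
    \<comment> \<open>As \<open>j\<close> is the second component, \<open>i \<ge> j\<close>: stage \<open>j\<close> exists when the task is treated.\<close>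
    define i where "i = prod_encode (p, j)"
    have ti: "task i = (j, ul, bl)" by (simp add: task_def i_def p)
    have "j \<le> i" unfolding i_def by (rule le_prod_encode_2)
    then obtain d where d: "i = j + d" using le_Suc_ex by blast
    have Ui: "U i (g i) = pushv R n A j d (vec ul)" unfolding U_def ti by (simp add: d g_push)
    have ali: "al i = bl" by (simp add: al_def ti)
    have len: "length bl = m" by (simp add: bl_def)
    note vuR = vecR[OF lR(1)] and vaR = vecR[OF lR(2)]
    have "mcong M N (lsum M (n j) u (v j)) (lsum M (n i) (pushv R n A j d u) (v i))"
      unfolding d by (rule lsum_pushv[where u=u and A=A and w=v and n=n, OF N u AR vM tower])
    also have "lsum M (n i) (pushv R n A j d u) (v i) = lsum M (n i) (pushv R n A j d (vec ul)) (v i)"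
      by (rule lsum_cong) (use pushv_agree[of n j u "vec ul" A, OF _ u vuR AR] vu pushv_closed[where u=u and A=A, OF u AR]
          pushv_closed[where u="vec ul" and A=A, OF vuR AR] vM d in auto)
    finally have 1: "mcong M N (lsum M m a x) (lsum M (n i) (U i (g i)) (v i))"
      unfolding Ui by (rule mcong_trans[OF N eq])
    have 2: "lsum M m a x = lsum M m (vec bl) x" by (rule lsum_cong) (use va a vaR x in auto)
    have imp: "(\<exists>x. (\<forall>k. x k \<in> carrier M) \<and> mcong M N (lsum M m (vec bl) x) (lsum M (n i) (U i (g i)) (v i))) \<longrightarrow>
      (\<exists>b. (\<forall>k l. b k l \<in> carrier R) \<and>
        (\<forall>l<n (Suc i). (\<Oplus>k\<in>{..<m}. vec bl k \<otimes> b k l) = (\<Oplus>k\<in>{..<n i}. U i (g i) k \<otimes> A i k l)))"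
      using QS[of i] unfolding Q_def ali len SS(1) A_def by (elim conjE)
    have ex: "\<exists>x. (\<forall>k. x k \<in> carrier M) \<and> mcong M N (lsum M m (vec bl) x) (lsum M (n i) (U i (g i)) (v i))"
      by (rule exI[of _ x]) (use 1 2 x in simp)
    from mp[OF imp ex] obtain b where b: "\<And>k l. b k l \<in> carrier R"
      and bs: "\<And>l. l < n (Suc i) \<Longrightarrow> (\<Oplus>k\<in>{..<m}. vec bl k \<otimes> b k l) = (\<Oplus>k\<in>{..<n i}. U i (g i) k \<otimes> A i k l)"
      by blast
    have "(\<Oplus>k\<in>{..<m}. a k \<otimes> b k l) = pushv R n A j (Suc d) u l" if l: "l < n (j + Suc d)" for l
    proof -
      have "(\<Oplus>k\<in>{..<m}. a k \<otimes> b k l) = (\<Oplus>k\<in>{..<m}. vec bl k \<otimes> b k l)"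
        using va a vaR b by (intro R.finsum_cong') auto
      also have "\<dots> = pushv R n A j (Suc d) (vec ul) l" using bs[of l] l Ui by (simp add: d)
      also have "\<dots> = pushv R n A j (Suc d) u l"
        by (rule pushv_agree[of n j "vec ul" u A, OF vu vuR u AR l])
      finally show ?thesis .
    qed
    then show ?thesis using b by blast
  qed
  note kill = this
  show ?thesis
    by (rule exI[of _ n], rule exI[of _ v], rule exI[of _ A]) (intro conjI allI impI, use S0 vM AR tower in simp_all, elim exE conjE, rule kill, auto)
qed

end

section \<open>Complements of modules that solve all telescopes\<close>

text \<open>The row with index \<open>(i, k)\<close> of the system \<open>y i k - (\<Sum>l. A i k l * y (i + 1) l) = c i k\<close>.\<close>

definition tower_rows :: "('r, 's) ring_scheme \<Rightarrow> (nat \<Rightarrow> nat) \<Rightarrow> (nat \<Rightarrow> nat \<Rightarrow> nat \<Rightarrow> 'r) \<Rightarrow> nat \<times> nat \<Rightarrow> nat \<times> nat \<Rightarrow> 'r"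
  where "tower_rows R n A p q = (if q = p then \<one>\<^bsub>R\<^esub> else \<zero>\<^bsub>R\<^esub>) \<ominus>\<^bsub>R\<^esub>
    (if fst q = Suc (fst p) \<and> snd q < n (fst q) then A (fst p) (snd p) (snd q) else \<zero>\<^bsub>R\<^esub>)"

definition sub_sum :: "('r, 'm, 't) module_scheme \<Rightarrow> 'm set \<Rightarrow> 'm set \<Rightarrow> 'm set"
  where "sub_sum M C D = {x. \<exists>c\<in>C. mcong M D x c}"

context module
begin

lemma diff_diff_cancel: "x \<in> carrier M \<Longrightarrow> y \<in> carrier M \<Longrightarrow> x \<ominus>\<^bsub>M\<^esub> (x \<ominus>\<^bsub>M\<^esub> y) = y"
  by (simp add: M.minus_eq M.minus_add M.r_neg2)

lemma tower_rows_fsupp: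
  assumes A: "\<And>i k l. A i k l \<in> carrier R"
  shows "tower_rows R n A p \<in> fsupp R"
proof (rule fsuppI)
  show "finite (insert p ({Suc (fst p)} \<times> {..<n (Suc (fst p))}))" by simp
  fix q assume "q \<notin> insert p ({Suc (fst p)} \<times> {..<n (Suc (fst p))})"
  then show "tower_rows R n A p q = \<zero>"
    by (cases q) (auto simp: tower_rows_def R.minus_eq)
qed (use A in \<open>auto simp: tower_rows_def\<close>)

lemma comb_tower_rows:
  assumes A: "\<And>i k l. A i k l \<in> carrier R" and y: "\<And>q. y q \<in> carrier M"
  shows "comb R M (tower_rows R n A (i, k)) y = y (i, k) \<ominus>\<^bsub>M\<^esub> lsum M (n (Suc i)) (A i k) (\<lambda>l. y (Suc i, l))"
proof -
  let ?T = "{Suc i} \<times> {..<n (Suc i)}"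
  have "comb R M (tower_rows R n A (i, k)) y = finsum M (\<lambda>q. tower_rows R n A (i, k) q \<odot>\<^bsub>M\<^esub> y q) (insert (i, k) ?T)"
    by (rule comb_superset[OF tower_rows_fsupp[OF A]]) (use y in \<open>auto simp: tower_rows_def R.minus_eq\<close>)
  also have "\<dots> = tower_rows R n A (i, k) (i, k) \<odot>\<^bsub>M\<^esub> y (i, k) \<oplus>\<^bsub>M\<^esub> finsum M (\<lambda>q. tower_rows R n A (i, k) q \<odot>\<^bsub>M\<^esub> y q) ?T"
    using fsuppD(1)[OF tower_rows_fsupp[OF A]] y by (subst M.finsum_insert) auto
  also have "tower_rows R n A (i, k) (i, k) \<odot>\<^bsub>M\<^esub> y (i, k) = y (i, k)"
    using y by (simp add: tower_rows_def R.minus_eq)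
  also have "finsum M (\<lambda>q. tower_rows R n A (i, k) q \<odot>\<^bsub>M\<^esub> y q) ?T = finsum M (\<lambda>q. (\<ominus> \<one>) \<odot>\<^bsub>M\<^esub> (A i k (snd q) \<odot>\<^bsub>M\<^esub> y q)) ?T"
    using A y by (intro M.finsum_cong') (auto simp: tower_rows_def R.minus_eq smult_l_minus)
  also have "\<dots> = (\<ominus> \<one>) \<odot>\<^bsub>M\<^esub> finsum M (\<lambda>q. A i k (snd q) \<odot>\<^bsub>M\<^esub> y q) ?T"
    using A y by (subst finsum_smult_ldistr) auto
  also have "?T = Pair (Suc i) ` {..<n (Suc i)}" by auto
  also have "finsum M (\<lambda>q. A i k (snd q) \<odot>\<^bsub>M\<^esub> y q) (Pair (Suc i) ` {..<n (Suc i)}) =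
      lsum M (n (Suc i)) (A i k) (\<lambda>l. y (Suc i, l))"
    unfolding lsum_def using A y by (subst M.finsum_reindex) (auto simp: inj_on_def)
  finally show ?thesis
    using A y lsum_closed[of "A i k" "\<lambda>l. y (Suc i, l)"] by (simp add: M.minus_eq smult_l_minus)
qed

text \<open>The row \<open>(i, k)\<close> has entry \<open>1\<close> at \<open>(i, k)\<close>, and its other entries belong to stage \<open>i + 1\<close>. So the
  coefficients of a combination that vanishes modulo \<open>J\<close> lie in \<open>J\<close>, by induction on the stage.\<close>

lemma tower_rows_indep:
  assumes A: "\<And>i k l. A i k l \<in> carrier R" and J: "ideal J R"
  shows "indep_mod R J (tower_rows R n A)"
  unfolding indep_mod_def
proof (intro ballI impI allI)
  fix a p assume a: "a \<in> fsupp R"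
    and *: "\<forall>l. comb R (free_module R UNIV) a (tower_rows R n A) l \<in> J"
  interpret G: module R "regular R" by (rule R.regular_module)
  interpret J: ideal J R by fact
  have Gs: "carrier (regular R) = carrier R" "\<zero>\<^bsub>regular R\<^esub> = \<zero>"
    "r \<odot>\<^bsub>regular R\<^esub> s = r \<otimes> s" "r \<oplus>\<^bsub>regular R\<^esub> s = r \<oplus> s" for r s
    by (simp_all add: regular_def)
  have JG: "submodule J R (regular R)"
    by (rule G.submodule_smult_neg) (use J.Icarr J.I_l_closed in \<open>auto simp: Gs\<close>)
  note tR = fsuppD(1)[OF tower_rows_fsupp[OF A]]
  have step: "a (j, l) \<in> J" if IH: "\<And>i k. j = Suc i \<Longrightarrow> a (i, k) \<in> J" for j l
  proof -
    let ?S = "insert (j, l) {p. a p \<noteq> \<zero>}" and ?\<delta> = "tower_rows R n A"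
    have "comb R (free_module R UNIV) a ?\<delta> (j, l) = comb R (regular R) a (\<lambda>p. ?\<delta> p (j, l))"
      by (rule mod_hom_comb[OF R.free_module_module R.regular_module eval_free_module a tower_rows_fsupp[OF A]])
    also have "\<dots> = finsum (regular R) (\<lambda>p. a p \<odot>\<^bsub>regular R\<^esub> ?\<delta> p (j, l)) ?S"
      by (rule G.comb_superset[OF a]) (use fsuppD[OF a] tR in \<open>auto simp: Gs\<close>)
    finally have 1: "finsum (regular R) (\<lambda>p. a p \<odot>\<^bsub>regular R\<^esub> ?\<delta> p (j, l)) ?S \<in> J"
      using spec[OF *, of "(j, l)"] by (rule subst)
    have "mcong (regular R) J (finsum (regular R) (\<lambda>p. a p \<odot>\<^bsub>regular R\<^esub> ?\<delta> p (j, l)) ?S)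
        (finsum (regular R) (\<lambda>p. if (j, l) = p then a p else \<zero>\<^bsub>regular R\<^esub>) ?S)"
    proof (rule G.mcong_finsum[OF JG])
      fix p
      show "mcong (regular R) J (a p \<odot>\<^bsub>regular R\<^esub> ?\<delta> p (j, l)) (if (j, l) = p then a p else \<zero>\<^bsub>regular R\<^esub>)"
      proof (cases "(j, l) = p")
        case True
        then have "?\<delta> p (j, l) = \<one>" by (auto simp: tower_rows_def R.minus_eq)
        then show ?thesis
          using True G.mcong_refl[OF JG, of "a p"] fsuppD(1)[OF a] by (simp add: Gs)
      next
        case False
        have "a p \<otimes> ?\<delta> p (j, l) \<in> J"
        proof (cases "j = Suc (fst p)")
          case True
          then show ?thesis using IH[of "fst p" "snd p"] J.I_r_closed tR by simp
        next
          assume "j \<noteq> Suc (fst p)"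
          then have "?\<delta> p (j, l) = \<zero>" using False by (auto simp: tower_rows_def R.minus_eq)
          then show ?thesis using fsuppD(1)[OF a] J.zero_closed by simp
        qed
        then show ?thesis using False G.mcong_zero_iff[OF JG] by (simp add: Gs)
      qed
    qed
    then have "finsum (regular R) (\<lambda>p. if (j, l) = p then a p else \<zero>\<^bsub>regular R\<^esub>) ?S \<in> J"
      using G.mcong_mem[OF JG] 1 by blast
    also have "finsum (regular R) (\<lambda>p. if (j, l) = p then a p else \<zero>\<^bsub>regular R\<^esub>) ?S = a (j, l)"
      by (rule G.M.finsum_singleton) (use fsuppD[OF a] in \<open>auto simp: Gs\<close>)
    finally show ?thesis .
  qed
  have "a (j, l) \<in> J" for j l
  proof (induct j arbitrary: l)
    case (Suc j)
    show ?case by (rule step) (use Suc in simp)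
  qed (rule step, simp)
  then show "a p \<in> J" by (cases p) simp
qed

lemma sub_sum_eq: "C \<subseteq> carrier M \<Longrightarrow> sub_sum M C D = multiples R M \<one> C D"
  unfolding sub_sum_def multiples_def using smult_one by (auto simp: subset_iff)

lemma sub_sum_submodule: "submodule C R M \<Longrightarrow> submodule D R M \<Longrightarrow> submodule (sub_sum M C D) R M"
  using submodule_multiples[of C D \<one>] submoduleE(1)[of C] by (simp add: sub_sum_eq)

lemma sub_sum_left: "submodule C R M \<Longrightarrow> submodule D R M \<Longrightarrow> C \<subseteq> sub_sum M C D"
  unfolding sub_sum_def using mcong_refl submodule_sub by blast

lemma sub_sum_right: "submodule C R M \<Longrightarrow> submodule D R M \<Longrightarrow> D \<subseteq> sub_sum M C D"
  unfolding sub_sum_def using mcong_zero_iff submodule_zero by blast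

lemma sub_sum_mono: "D \<subseteq> D' \<Longrightarrow> sub_sum M C D \<subseteq> sub_sum M C D'"
  unfolding sub_sum_def using mcong_mono by blast

text \<open>Take a tower over \<open>M/(C + D)\<close> that starts at \<open>e\<close>. Its transition equations hold in \<open>M/D\<close> up to
  elements \<open>c\<close> of \<open>C\<close>. If \<open>y\<close> solves the system with right-hand side \<open>c\<close>, the corrected elements \<open>v - y\<close>
  form a tower over \<open>M/D\<close>, and \<open>D'\<close> is the preimage of its image. The last clause of \<open>tower_exists\<close> applies
  twice. An element of \<open>C\<close> in \<open>D'\<close> vanishes modulo \<open>C + D\<close>, so its coefficients die along the tower, and it
  lies in \<open>D\<close>. A relation modulo \<open>C + D'\<close> is matched by one with the same coefficients inside \<open>D'\<close>, and the
  difference is a relation modulo \<open>C + D\<close>, to which flatness applies.\<close>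

lemma enlarge_complement:
  assumes C: "submodule C R M" and D: "submodule D R M" and CD: "C \<inter> D \<subseteq> {\<zero>\<^bsub>M\<^esub>}"
    and flat: "flat_quotient R M (sub_sum M C D)" and count: "countable (carrier R)"
    and solv: "\<And>n A. (\<And>i k l. A i k l \<in> carrier R) \<Longrightarrow> solvable R M (tower_rows R n A) C {\<zero>\<^bsub>M\<^esub>}"
    and e: "e \<in> carrier M" "e \<notin> sub_sum M C D"
  shows "\<exists>D'. submodule D' R M \<and> D \<subset> D' \<and> C \<inter> D' \<subseteq> {\<zero>\<^bsub>M\<^esub>} \<and> flat_quotient R M (sub_sum M C D')"
proof -
  let ?N = "sub_sum M C D"
  note N = sub_sum_submodule[OF C D] and CN = sub_sum_left[OF C D] and DN = sub_sum_right[OF C D]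
  note Cc = submodule_closed[OF C]
  from tower_exists[OF N flat count e(1)] obtain n v A where T: "n 0 = Suc 0 \<and> v 0 0 = e \<and>
    (\<forall>i k. v i k \<in> carrier M) \<and> (\<forall>i k l. A i k l \<in> carrier R) \<and>
    (\<forall>i k. k < n i \<longrightarrow> mcong M ?N (v i k) (lsum M (n (Suc i)) (A i k) (v (Suc i)))) \<and>
    (\<forall>j u m a. (\<forall>k. u k \<in> carrier R) \<longrightarrow> (\<forall>k. a k \<in> carrier R) \<longrightarrow>
      (\<exists>x. (\<forall>k. x k \<in> carrier M) \<and> mcong M ?N (lsum M m a x) (lsum M (n j) u (v j))) \<longrightarrow>
      (\<exists>d b. (\<forall>k l. b k l \<in> carrier R) \<and>
        (\<forall>l<n (j + d). (\<Oplus>k\<in>{..<m}. a k \<otimes> b k l) = pushv R n A j d u l)))"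
    by (elim exE)
  note n0 = T[THEN conjunct1] and T2 = T[THEN conjunct2]
  note v0 = T2[THEN conjunct1] and T3 = T2[THEN conjunct2]
  note v = T3[THEN conjunct1, rule_format] and T4 = T3[THEN conjunct2]
  note A = T4[THEN conjunct1, rule_format] and T5 = T4[THEN conjunct2]
  note vt = T5[THEN conjunct1, rule_format] and kill' = T5[THEN conjunct2]
  have kill: "\<exists>d b. (\<forall>k l. b k l \<in> carrier R) \<and>
      (\<forall>l<n (j + d). (\<Oplus>k\<in>{..<m}. a k \<otimes> b k l) = pushv R n A j d u l)"
    if "\<And>k. u k \<in> carrier R" "\<And>k. a k \<in> carrier R" "\<And>k. x k \<in> carrier M"
      "mcong M ?N (lsum M m a x) (lsum M (n j) u (v j))" for j u m a x
    using kill'[THEN spec, THEN spec, THEN spec, THEN spec, of u a m j] that by blast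
  \<comment> \<open>Solving the tower in \<open>C\<close> lifts it from a tower modulo \<open>C + D\<close> to a tower modulo \<open>D\<close>.\<close>
  let ?l = "\<lambda>v i k. lsum M (n (Suc i)) (A i k) (v (Suc i))"
  have "\<exists>c. c \<in> C \<and> (snd p < n (fst p) \<longrightarrow> mcong M D (v (fst p) (snd p) \<ominus>\<^bsub>M\<^esub> ?l v (fst p) (snd p)) c)" for p
  proof (cases "snd p < n (fst p)")
    case True
    then have "v (fst p) (snd p) \<ominus>\<^bsub>M\<^esub> ?l v (fst p) (snd p) \<in> ?N"
      using vt by (simp add: mcong_def)
    then show ?thesis unfolding sub_sum_def by blast
  qed (use Cc(2) in blast)
  then obtain c where c: "\<And>p. c p \<in> C"
    and vc: "\<And>p. snd p < n (fst p) \<Longrightarrow> mcong M D (v (fst p) (snd p) \<ominus>\<^bsub>M\<^esub> ?l v (fst p) (snd p)) (c p)"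
    by metis
  have slv: "solvable R M (tower_rows R n A) C {\<zero>\<^bsub>M\<^esub>}" by (rule solv) (rule A)
  obtain y where yC: "\<And>p. y p \<in> C"
    and y: "\<And>p. mcong M {\<zero>\<^bsub>M\<^esub>} (comb R M (tower_rows R n A p) y) (c p)"
    by (rule solvableE[where c=c, OF slv c]) blast
  note yM = Cc(1)[OF yC]
  define y' where "y' = (\<lambda>i k. y (i, k))"
  have y'C: "y' i k \<in> C" and y'M: "y' i k \<in> carrier M" for i k using yC yM by (auto simp: y'_def)
  have yc: "c (i, k) = y' i k \<ominus>\<^bsub>M\<^esub> ?l y' i k" for i k
    using y[of "(i, k)"] comb_tower_rows[where y=y and A=A and n=n and i=i and k=k, OF A yM]
    by (simp add: mcong_eq y'_def)
  define w where "w i k = v i k \<ominus>\<^bsub>M\<^esub> y' i k" for i k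
  have w: "w i k \<in> carrier M" for i k using v y'M by (simp add: w_def)
  have lv: "?l v i k \<in> carrier M" and ly: "?l y' i k \<in> carrier M" and lw: "?l w i k \<in> carrier M" for i k
    using A v y'M w by (auto intro: lsum_closed)
  have wt: "mcong M D (w i k) (?l w i k)" if "k < n i" for i k
  proof -
    have 1: "?l w i k = ?l v i k \<ominus>\<^bsub>M\<^esub> ?l y' i k"
      unfolding w_def by (rule lsum_minus) (use A v y'M in auto)
    have "(v i k \<ominus>\<^bsub>M\<^esub> ?l v i k) \<ominus>\<^bsub>M\<^esub> c (i, k) = w i k \<ominus>\<^bsub>M\<^esub> ?l w i k"
      unfolding 1 yc w_def using v[of i k] y'M[of i k] lv[of i k] ly[of i k] by (simp add: group_normalize)
    then show ?thesis using vc[of "(i, k)"] that w lw by (simp add: mcong_def)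
  qed
  have vw: "mcong M ?N (lsum M m u (v i)) (lsum M m u (w i))" if "\<And>k. u k \<in> carrier R" for m u i
  proof (rule lsum_cong_mod[OF N that])
    fix k
    have "v i k \<ominus>\<^bsub>M\<^esub> w i k = y' i k"
      using v[of i k] y'M[of i k] by (simp add: w_def diff_diff_cancel)
    then show "mcong M ?N (v i k) (w i k)" using v w y'C CN by (auto simp: mcong_def)
  qed
  note push = lsum_pushv[where w=w and A=A and n=n, OF D _ A w wt]
  define D' where "D' = {x. \<exists>i u. (\<forall>k. u k \<in> carrier R) \<and> mcong M D x (lsum M (n i) u (w i))}"
  have level: "\<exists>u'. (\<forall>k. u' k \<in> carrier R) \<and> mcong M D x (lsum M (n j) u' (w j))"
    if "\<And>k. u k \<in> carrier R" "mcong M D x (lsum M (n i) u (w i))" "i \<le> j" for x u i j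
  proof -
    obtain d where "j = i + d" using le_Suc_ex[OF \<open>i \<le> j\<close>] by blast
    then show ?thesis
      using mcong_trans[OF D that(2) push[where u=u and j=i and d=d, OF that(1)]]
        pushv_closed[where u=u and A=A, OF that(1) A] by blast
  qed
  have D': "submodule D' R M"
  proof (rule submodule_smult_neg)
    show "D' \<subseteq> carrier M" by (auto simp: D'_def dest: mcongD)
    show "\<zero>\<^bsub>M\<^esub> \<in> D'"
      unfolding D'_def using mcong_refl[OF D] lsum_zero[where v="w 0" and n="n 0", OF w]
      by (intro CollectI exI[of _ 0] exI[of _ "\<lambda>_. \<zero>"]) auto
  next
    fix x x' assume "x \<in> D'" "x' \<in> D'"
    then obtain i u i' u' where u: "\<And>k. u k \<in> carrier R" "mcong M D x (lsum M (n i) u (w i))"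
      and u': "\<And>k. u' k \<in> carrier R" "mcong M D x' (lsum M (n i') u' (w i'))"
      unfolding D'_def by blast
    obtain p where p: "\<And>k. p k \<in> carrier R" "mcong M D x (lsum M (n (max i i')) p (w (max i i')))"
      using level[where u=u, OF u, of "max i i'"] by auto
    obtain p' where p': "\<And>k. p' k \<in> carrier R" "mcong M D x' (lsum M (n (max i i')) p' (w (max i i')))"
      using level[where u=u', OF u', of "max i i'"] by auto
    have "mcong M D (x \<oplus>\<^bsub>M\<^esub> x') (lsum M (n (max i i')) (\<lambda>k. p k \<oplus> p' k) (w (max i i')))"
      using mcong_add[OF D p(2) p'(2)] lsum_add_left[where u=p and u'=p' and v="w (max i i')", OF p(1) p'(1) w] by simp
    then show "x \<oplus>\<^bsub>M\<^esub> x' \<in> D'" unfolding D'_def using p(1) p'(1)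
      by (intro CollectI exI[of _ "max i i'"] exI[of _ "\<lambda>k. p k \<oplus> p' k"]) auto
  next
    fix r x assume r: "r \<in> carrier R" and "x \<in> D'"
    then obtain i u where u: "\<And>k. u k \<in> carrier R" "mcong M D x (lsum M (n i) u (w i))"
      unfolding D'_def by blast
    have "mcong M D (r \<odot>\<^bsub>M\<^esub> x) (lsum M (n i) (\<lambda>k. r \<otimes> u k) (w i))"
      using mcong_smult[OF D u(2) r] lsum_smult_left[where u=u and v="w i", OF r u(1) w] by simp
    then show "r \<odot>\<^bsub>M\<^esub> x \<in> D'" unfolding D'_def using r u(1)
      by (intro CollectI exI[of _ i] exI[of _ "\<lambda>k. r \<otimes> u k"]) auto
  qed
  have DD': "D \<subseteq> D'"
  proof
    fix x assume "x \<in> D"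
    then show "x \<in> D'" unfolding D'_def
      using mcong_zero_iff[OF D] lsum_zero[where v="w 0" and n="n 0", OF w]
      by (intro CollectI exI[of _ 0] exI[of _ "\<lambda>_. \<zero>"]) auto
  qed
  have "w 0 0 \<in> D'"
    unfolding D'_def using mcong_refl[OF D w] lsum_unit[of 0 "n 0" "w 0"] w n0
    by (intro CollectI exI[of _ 0] exI[of _ "\<lambda>k. if 0 = k then \<one> else \<zero>"]) auto
  moreover have "w 0 0 \<notin> D"
  proof
    assume "w 0 0 \<in> D"
    then have "mcong M D e (y' 0 0)" using e(1) y'M by (simp add: w_def v0 mcong_def)
    then show False using e(2) y'C unfolding sub_sum_def by blast
  qed
  ultimately have strict: "D \<subset> D'" using DD' by blast
  have disj: "C \<inter> D' \<subseteq> {\<zero>\<^bsub>M\<^esub>}"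
  proof
    fix x assume x: "x \<in> C \<inter> D'"
    then obtain i u where u: "\<And>k. u k \<in> carrier R" "mcong M D x (lsum M (n i) u (w i))"
      unfolding D'_def by blast
    have "mcong M ?N x (lsum M (n i) u (w i))" by (rule mcong_mono[OF u(2) DN])
    then have "lsum M (n i) u (w i) \<in> ?N" using mcong_mem[OF N] x CN by blast
    then have "mcong M ?N (lsum M (n i) u (v i)) \<zero>\<^bsub>M\<^esub>"
      using mcong_mem[OF N vw[where u=u, OF u(1)]] mcong_zero_iff[OF N] by blast
    then have "mcong M ?N (lsum M 0 (\<lambda>_. \<zero>) (v 0)) (lsum M (n i) u (v i))"
      using mcong_sym[OF N] by (simp add: lsum_def)
    then obtain d where d: "\<And>l. l < n (i + d) \<Longrightarrow> \<zero> = pushv R n A i d u l"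
      using kill[where u=u and a="\<lambda>_. \<zero>" and m=0 and j=i and x="v 0"] u(1) v by auto
    have "mcong M D x (lsum M (n (i + d)) (pushv R n A i d u) (w (i + d)))"
      by (rule mcong_trans[OF D u(2) push[where u=u, OF u(1)]])
    also have "lsum M (n (i + d)) (pushv R n A i d u) (w (i + d)) = lsum M (n (i + d)) (\<lambda>_. \<zero>) (w (i + d))"
      by (rule lsum_cong) (use d[symmetric] pushv_closed[where u=u and A=A, OF u(1) A] w in auto)
    also have "\<dots> = \<zero>\<^bsub>M\<^esub>" by (rule lsum_zero[OF w])
    finally have "x \<in> D" using mcong_zero_iff[OF D] by blast
    then show "x \<in> {\<zero>\<^bsub>M\<^esub>}" using x CD by blast
  qed
  let ?N' = "sub_sum M C D'"
  note N' = sub_sum_submodule[OF C D'] and NN' = sub_sum_mono[OF DD', of C]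
  have D'N': "D' \<subseteq> ?N'" by (rule sub_sum_right[OF C D'])
  have "flat_quotient R M ?N'"
    unfolding flat_quotient_def
  proof (intro allI impI)
    fix m a x assume a': "\<forall>k. a k \<in> carrier R" and x': "\<forall>k. x k \<in> carrier M" and rel: "lsum M m a x \<in> ?N'"
    then have a: "a k \<in> carrier R" and x: "x k \<in> carrier M" for k by auto
    from rel obtain c where c: "c \<in> C" "lsum M m a x \<ominus>\<^bsub>M\<^esub> c \<in> D'"
      by (auto simp: sub_sum_def mcong_def)
    then obtain i u where u: "\<And>k. u k \<in> carrier R" "mcong M D (lsum M m a x \<ominus>\<^bsub>M\<^esub> c) (lsum M (n i) u (w i))"
      unfolding D'_def by blast
    have ax: "lsum M m a x \<in> carrier M" by (rule lsum_closed[OF a x])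
    have "lsum M m a x \<ominus>\<^bsub>M\<^esub> (lsum M m a x \<ominus>\<^bsub>M\<^esub> c) = c"
      using ax Cc(1)[OF c(1)] by (simp add: diff_diff_cancel)
    then have "mcong M ?N (lsum M m a x) (lsum M m a x \<ominus>\<^bsub>M\<^esub> c)"
      using ax Cc(1)[OF c(1)] c(1) CN by (auto simp: mcong_def)
    then have rw: "mcong M ?N (lsum M m a x) (lsum M (n i) u (w i))"
      by (rule mcong_trans[OF N _ mcong_mono[OF u(2) DN]])
    have "mcong M ?N (lsum M m a x) (lsum M (n i) u (v i))"
      by (rule mcong_trans[OF N rw mcong_sym[OF N vw[where u=u, OF u(1)]]])
    then obtain d b where b: "\<And>k l. b k l \<in> carrier R"
      and bp: "\<And>l. l < n (i + d) \<Longrightarrow> (\<Oplus>k\<in>{..<m}. a k \<otimes> b k l) = pushv R n A i d u l"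
      using kill[where u=u and a=a and m=m and j=i and x=x] u(1) a x by blast
    define z where "z k = lsum M (n (i + d)) (b k) (w (i + d))" for k
    have zM: "z k \<in> carrier M" for k unfolding z_def by (rule lsum_closed[OF b w])
    have zD': "z k \<in> D'" for k
      unfolding D'_def z_def
      by (intro CollectI exI[of _ "i + d"] exI[of _ "b k"] conjI allI b mcong_refl[OF D] lsum_closed w)
    have "lsum M m a z = lsum M (n (i + d)) (\<lambda>l. \<Oplus>k\<in>{..<m}. a k \<otimes> b k l) (w (i + d))"
      unfolding z_def by (rule lsum_lsum[OF a b w])
    also have "\<dots> = lsum M (n (i + d)) (pushv R n A i d u) (w (i + d))"
      by (rule lsum_cong) (use bp a b pushv_closed[where u=u and A=A, OF u(1) A] w in auto)
    finally have "mcong M D (lsum M (n i) u (w i)) (lsum M m a z)"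
      using push[where u=u and j=i and d=d, OF u(1)] by simp
    then have "mcong M ?N (lsum M m a x) (lsum M m a z)"
      by (rule mcong_trans[OF N rw mcong_mono[OF _ DN]])
    then have xz: "lsum M m a (\<lambda>k. x k \<ominus>\<^bsub>M\<^esub> z k) \<in> ?N"
      using lsum_minus[where u=a and v=x and w=z, OF a x zM] by (simp add: mcong_def)
    have xzM: "x k \<ominus>\<^bsub>M\<^esub> z k \<in> carrier M" for k using x zM by simp
    obtain n' b' q where q: "\<And>k l. b' k l \<in> carrier R" "\<And>l. q l \<in> carrier M"
      "\<And>k. k < m \<Longrightarrow> mcong M ?N (x k \<ominus>\<^bsub>M\<^esub> z k) (lsum M n' (b' k) q)"
      "\<And>l. l < n' \<Longrightarrow> (\<Oplus>k\<in>{..<m}. a k \<otimes> b' k l) = \<zero>"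
      by (rule flat_quotientE[where a=a and x="\<lambda>k. x k \<ominus>\<^bsub>M\<^esub> z k", OF flat a xzM xz]) blast
    have "mcong M ?N' (x k) (lsum M n' (b' k) q)" if "k < m" for k
    proof -
      have "x k \<ominus>\<^bsub>M\<^esub> (x k \<ominus>\<^bsub>M\<^esub> z k) = z k" using x[of k] zM[of k] by (simp add: diff_diff_cancel)
      then have "mcong M ?N' (x k) (x k \<ominus>\<^bsub>M\<^esub> z k)" using x xzM zD' D'N' by (auto simp: mcong_def)
      then show ?thesis by (rule mcong_trans[OF N' _ mcong_mono[OF q(3)[OF that] NN']])
    qed
    then show "\<exists>n b y. (\<forall>k l. b k l \<in> carrier R) \<and> (\<forall>l. y l \<in> carrier M) \<and>
        (\<forall>k<m. mcong M ?N' (x k) (lsum M n (b k) y)) \<and>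
        (\<forall>l<n. (\<Oplus>k\<in>{..<m}. a k \<otimes> b k l) = \<zero>)"
      using q by (intro exI[of _ n'] exI[of _ b'] exI[of _ q]) auto
  qed
  then show ?thesis using D' strict disj by blast
qed

text \<open>The union of a chain of submodules \<open>D\<close> meeting \<open>C\<close> trivially and with flat \<open>M/(C + D)\<close> is again of
  this kind, since each relation holds modulo a member of the chain. A maximal one has \<open>C + D = M\<close> by
  \<open>enlarge_complement\<close>.\<close>

theorem complement_of_flat:
  assumes C: "submodule C R M" and D0: "submodule D0 R M" and CD: "C \<inter> D0 \<subseteq> {\<zero>\<^bsub>M\<^esub>}"
    and flat: "flat_quotient R M (sub_sum M C D0)" and count: "countable (carrier R)"
    and solv: "\<And>n A. (\<And>i k l. A i k l \<in> carrier R) \<Longrightarrow> solvable R M (tower_rows R n A) C {\<zero>\<^bsub>M\<^esub>}"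
  shows "\<exists>D. submodule D R M \<and> D0 \<subseteq> D \<and> C \<inter> D \<subseteq> {\<zero>\<^bsub>M\<^esub>} \<and> sub_sum M C D = carrier M"
proof -
  let ?\<D> = "{D. submodule D R M \<and> D0 \<subseteq> D \<and> C \<inter> D \<subseteq> {\<zero>\<^bsub>M\<^esub>} \<and> flat_quotient R M (sub_sum M C D)}"
  have "\<exists>D\<in>?\<D>. \<forall>X\<in>?\<D>. D \<subseteq> X \<longrightarrow> X = D"
  proof (rule subset_Zorn_nonempty)
    show "?\<D> \<noteq> {}" using D0 CD flat by blast
    fix \<C> assume ne: "\<C> \<noteq> {}" and ch: "subset.chain ?\<D> \<C>"
    from ch have sub: "\<C> \<subseteq> ?\<D>" and lin: "\<forall>X\<in>\<C>. \<forall>Y\<in>\<C>. X \<subseteq> Y \<or> Y \<subseteq> X"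
      by (simp_all add: subset_chain_def)
    have 1: "submodule (\<Union>\<C>) R M"
      by (rule submodule_Union_chain[OF ne]) (use sub lin in blast)+
    have "flat_quotient R M (sub_sum M C (\<Union>\<C>))"
      unfolding flat_quotient_def
    proof (intro allI impI)
      fix m a x assume a': "\<forall>k. a k \<in> carrier R" and x': "\<forall>k. x k \<in> carrier M"
        and rel: "lsum M m a x \<in> sub_sum M C (\<Union>\<C>)"
      then have a: "a k \<in> carrier R" and x: "x k \<in> carrier M" for k by auto
      from rel obtain D where D: "D \<in> \<C>" "lsum M m a x \<in> sub_sum M C D"
        by (auto simp: sub_sum_def mcong_def)
      then have fl: "flat_quotient R M (sub_sum M C D)" using sub by blast
      obtain n' b q where q: "\<And>k l. b k l \<in> carrier R" "\<And>l. q l \<in> carrier M"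
        "\<And>k. k < m \<Longrightarrow> mcong M (sub_sum M C D) (x k) (lsum M n' (b k) q)"
        "\<And>l. l < n' \<Longrightarrow> (\<Oplus>k\<in>{..<m}. a k \<otimes> b k l) = \<zero>"
        by (rule flat_quotientE[where a=a and x=x, OF fl a x D(2)]) blast
      have "sub_sum M C D \<subseteq> sub_sum M C (\<Union>\<C>)" by (rule sub_sum_mono) (use D in blast)
      then show "\<exists>n b y. (\<forall>k l. b k l \<in> carrier R) \<and> (\<forall>l. y l \<in> carrier M) \<and>
          (\<forall>k<m. mcong M (sub_sum M C (\<Union>\<C>)) (x k) (lsum M n (b k) y)) \<and>
          (\<forall>l<n. (\<Oplus>k\<in>{..<m}. a k \<otimes> b k l) = \<zero>)"
        using q(1,2,4) mcong_mono[OF q(3)] by (intro exI[of _ n'] exI[of _ b] exI[of _ q]) auto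
    qed
    moreover have "D0 \<subseteq> \<Union>\<C>" "C \<inter> \<Union>\<C> \<subseteq> {\<zero>\<^bsub>M\<^esub>}" using ne sub by blast+
    ultimately show "\<Union>\<C> \<in> ?\<D>" using 1 by blast
  qed
  then obtain D where D_in: "D \<in> ?\<D>" and max: "\<forall>X\<in>?\<D>. D \<subseteq> X \<longrightarrow> X = D" by (rule bexE)
  from D_in have D: "submodule D R M" "D0 \<subseteq> D" "C \<inter> D \<subseteq> {\<zero>\<^bsub>M\<^esub>}" "flat_quotient R M (sub_sum M C D)"
    by simp_all
  have "carrier M \<subseteq> sub_sum M C D"
  proof
    fix e assume e: "e \<in> carrier M"
    show "e \<in> sub_sum M C D"
    proof (rule ccontr)
      assume ne: "e \<notin> sub_sum M C D"
      have "\<exists>D'. submodule D' R M \<and> D \<subset> D' \<and> C \<inter> D' \<subseteq> {\<zero>\<^bsub>M\<^esub>} \<and> flat_quotient R M (sub_sum M C D')"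
        by (rule enlarge_complement[OF C D(1,3,4) count _ e ne]) (rule solv)
      then obtain D' where D': "submodule D' R M \<and> D \<subset> D' \<and> C \<inter> D' \<subseteq> {\<zero>\<^bsub>M\<^esub>} \<and> flat_quotient R M (sub_sum M C D')"
        by (rule exE)
      then have "D' \<in> ?\<D>" using D(2) by auto
      then show False using max D' by blast
    qed
  qed
  then have "sub_sum M C D = carrier M" by (auto simp: sub_sum_def dest: mcongD)
  then show ?thesis using D by blast
qed

end

section \<open>Ext and extension of homomorphisms\<close>

lemma free_module_mono: "c \<in> carrier (free_module R X) \<Longrightarrow> c \<in> fsupp R"
  by (auto simp: free_module_def)

lemma free_module_outside: "c \<in> carrier (free_module R X) \<Longrightarrow> x \<notin> X \<Longrightarrow> c x = \<zero>\<^bsub>R\<^esub>"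
  by (auto simp: free_module_def)

lemma free_module_ops [simp]:
  "c \<oplus>\<^bsub>free_module R X\<^esub> d = (\<lambda>x. c x \<oplus>\<^bsub>R\<^esub> d x)"
  "a \<odot>\<^bsub>free_module R X\<^esub> c = (\<lambda>x. a \<otimes>\<^bsub>R\<^esub> c x)"
  "\<zero>\<^bsub>free_module R X\<^esub> = (\<lambda>x. \<zero>\<^bsub>R\<^esub>)"
  by (simp_all add: free_module_def)

lemma (in cring) unitv_free: "x \<in> X \<Longrightarrow> unitv R x \<in> carrier (free_module R X)"
proof -
  assume "x \<in> X"
  moreover have "{y. unitv R x y \<noteq> \<zero>} \<subseteq> {x}" by (auto simp: unitv_def)
  moreover have "finite {y. unitv R x y \<noteq> \<zero>}" using calculation(2) finite_subset by blast
  ultimately show ?thesis by (auto simp: free_module_def unitv_def)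
qed

context module
begin

text \<open>Makes \<open>comb\<close>, which evaluates a family at every index, applicable to combinations of elements of \<open>X\<close>
  only.\<close>

definition on :: "'c set \<Rightarrow> 'c \<Rightarrow> 'c"
  where "on X x = (if x \<in> X then x else \<zero>\<^bsub>M\<^esub>)"

lemma on_closed: "X \<subseteq> carrier M \<Longrightarrow> on X x \<in> carrier M"
  by (auto simp: on_def)

lemma lin_comb_on:
  assumes "X \<subseteq> carrier M" "c \<in> carrier (free_module R X)"
  shows "lin_comb R M c = comb R M c (on X)"
  unfolding lin_comb_eq_comb comb_def
  by (rule M.finsum_cong') (use assms on_closed fsuppD[OF free_module_mono[OF assms(2)]] free_module_outside[OF assms(2)] in
      \<open>auto simp: on_def\<close>)

lemma lin_comb_hom:
  assumes "X \<subseteq> carrier M"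
  shows "lin_comb R M \<in> mod_hom R (free_module R X) M"
proof -
  interpret F: module R "free_module R X" by (rule R.free_module_module)
  note m = free_module_mono and y = on_closed[OF assms]
  have "lin_comb R M (c \<oplus>\<^bsub>free_module R X\<^esub> d) = lin_comb R M c \<oplus>\<^bsub>M\<^esub> lin_comb R M d"
    if "c \<in> carrier (free_module R X)" "d \<in> carrier (free_module R X)" for c d
    using lin_comb_on[OF assms F.M.a_closed[OF that]] lin_comb_on[OF assms that(1)] lin_comb_on[OF assms that(2)]
      comb_add_left[where y="on X", OF m[OF that(1)] m[OF that(2)] y] by simp
  moreover have "lin_comb R M (a \<odot>\<^bsub>free_module R X\<^esub> c) = a \<odot>\<^bsub>M\<^esub> lin_comb R M c"
    if "a \<in> carrier R" "c \<in> carrier (free_module R X)" for a c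
    using lin_comb_on[OF assms F.smult_closed[OF that]] lin_comb_on[OF assms that(2)]
      comb_smult_left[where y="on X", OF m[OF that(2)] y that(1)] by simp
  moreover have "lin_comb R M c \<in> carrier M" if "c \<in> carrier (free_module R X)" for c
    unfolding lin_comb_on[OF assms that] by (rule comb_closed[OF m[OF that] y])
  ultimately show ?thesis by (auto simp: mod_hom_def)
qed

lemma lin_comb_unitv: "x \<in> carrier M \<Longrightarrow> lin_comb R M (unitv R x) = x"
  using lin_comb_on[of "carrier M" "unitv R x"] R.unitv_free[of x "carrier M"]
    comb_unitv[where y="on (carrier M)" and i=x, OF on_closed] by (simp add: on_def)

lemma lin_comb_lin_comb:
  assumes X: "X \<subseteq> carrier M"
    and Y: "Y \<subseteq> {c \<in> carrier (free_module R X). lin_comb R M c = \<zero>\<^bsub>M\<^esub>}"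
    and c: "c \<in> carrier (free_module R Y)"
  shows "lin_comb R (free_module R X) c \<in> carrier (free_module R X)"
    and "lin_comb R M (lin_comb R (free_module R X) c) = \<zero>\<^bsub>M\<^esub>"
proof -
  interpret F: module R "free_module R X" by (rule R.free_module_module)
  have YF: "Y \<subseteq> carrier (free_module R X)" using Y by blast
  note hom = lin_comb_hom[OF X]
  have z: "lin_comb R M (F.on Y y) = \<zero>\<^bsub>M\<^esub>" for y
    using Y mod_hom_zero[OF F.module_axioms module_axioms hom] by (auto simp: F.on_def)
  note m = free_module_mono[OF c]
  show "lin_comb R (free_module R X) c \<in> carrier (free_module R X)"
    unfolding F.lin_comb_on[OF YF c] by (rule F.comb_closed[OF m F.on_closed[OF YF]])
  have "lin_comb R M (lin_comb R (free_module R X) c) = comb R M c (\<lambda>y. lin_comb R M (F.on Y y))"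
    unfolding F.lin_comb_on[OF YF c]
    by (rule mod_hom_comb[OF F.module_axioms module_axioms hom m F.on_closed[OF YF]])
  also have "\<dots> = \<zero>\<^bsub>M\<^esub>"
    unfolding comb_def z using fsuppD[OF m] by (auto intro!: M.add.finprod_one_eqI)
  finally show "lin_comb R M (lin_comb R (free_module R X) c) = \<zero>\<^bsub>M\<^esub>" .
qed

text \<open>The kernel of \<open>res0 \<rightarrow> M\<close>, onto which \<open>res1\<close> maps.\<close>

definition syz :: "('c \<Rightarrow> 'a) set"
  where "syz = {c \<in> carrier (res0 R M). lin_comb R M c = \<zero>\<^bsub>M\<^esub>}"

lemma res0_module: "module R (res0 R M)"
  unfolding res0_def by (rule R.free_module_module)

lemma res1_module: "module R (res1 R M)"
  unfolding res1_def by (rule R.free_module_module)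

lemma res1_eq: "res1 R M = free_module R syz"
  by (simp add: res1_def syz_def)

lemma syz_res0: "syz \<subseteq> carrier (res0 R M)"
  by (auto simp: syz_def)

lemma eps_hom: "lin_comb R M \<in> mod_hom R (res0 R M) M"
  unfolding res0_def by (rule lin_comb_hom) simp

lemma d1_hom: "lin_comb R (res0 R M) \<in> mod_hom R (res1 R M) (res0 R M)"
  unfolding res1_eq by (rule module.lin_comb_hom[OF res0_module syz_res0])

lemma d1_syz: "c \<in> carrier (res1 R M) \<Longrightarrow> lin_comb R (res0 R M) c \<in> syz"
  using lin_comb_lin_comb[of "carrier M" syz c] syz_res0 unfolding syz_def res0_def res1_eq[unfolded syz_def res0_def]
  by auto

lemma d1_unitv: "k \<in> syz \<Longrightarrow> unitv R k \<in> carrier (res1 R M) \<and> lin_comb R (res0 R M) (unitv R k) = k"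
  unfolding res1_eq using R.unitv_free[of k syz] module.lin_comb_unitv[OF res0_module, of k] syz_res0
  by (auto simp: subset_iff)

lemma d2_unitv:
  assumes "c \<in> carrier (res1 R M)" "lin_comb R (res0 R M) c = \<zero>\<^bsub>res0 R M\<^esub>"
  shows "unitv R c \<in> carrier (res2 R M)" "lin_comb R (res1 R M) (unitv R c) = c"
  using assms unfolding res2_def by (auto intro!: R.unitv_free module.lin_comb_unitv[OF res1_module])

lemma d1_d2:
  assumes "c \<in> carrier (res2 R M)"
  shows "lin_comb R (res1 R M) c \<in> carrier (res1 R M)"
    and "lin_comb R (res0 R M) (lin_comb R (res1 R M) c) = \<zero>\<^bsub>res0 R M\<^esub>"
  using module.lin_comb_lin_comb[OF res0_module syz_res0 _ assms[unfolded res2_def]]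
  unfolding res1_eq by auto

lemma syz_submodule: "submodule syz R (res0 R M)"
proof -
  interpret G: module R "res0 R M" by (rule res0_module)
  note e = mod_homD[OF eps_hom]
  show ?thesis
    by (rule G.submodule_smult_neg)
      (use mod_hom_zero[OF res0_module module_axioms eps_hom] e in \<open>auto simp: syz_def\<close>)
qed

end

text \<open>Vanishing of Ext with respect to the standard resolution of \<open>M\<close> implies the extension property with
  respect to each surjection \<open>p\<close> from a module \<open>G\<close> onto \<open>M\<close>: a lift of the standard resolution to \<open>G\<close>
  turns \<open>\<phi>\<close> into a cocycle, and a cochain \<open>g\<close> that bounds it measures how the value on \<open>x\<close> has
  to differ from the value of \<open>\<phi>\<close> on the part of \<open>x\<close> that is left after lifting \<open>p x\<close>.\<close>

lemma extension_of_trivial_Ext1: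
  assumes M: "module R M" and G: "module R G" and C: "module R C"
    and triv: "trivial_group (Ext1 R M C)"
    and p: "p \<in> mod_hom R G M" and surj: "carrier M \<subseteq> p ` carrier G"
    and \<phi>: "\<phi> \<in> mod_hom R (G\<lparr>carrier := {x \<in> carrier G. p x = \<zero>\<^bsub>M\<^esub>}\<rparr>) C"
  shows "\<exists>h\<in>mod_hom R G C. \<forall>x\<in>carrier G. p x = \<zero>\<^bsub>M\<^esub> \<longrightarrow> h x = \<phi> x"
proof -
  interpret M: module R M by fact
  interpret G: module R G by fact
  interpret C: module R C by fact
  interpret R0: module R "res0 R M" by (rule M.res0_module)
  interpret R1: module R "res1 R M" by (rule M.res1_module)
  let ?K = "{x \<in> carrier G. p x = \<zero>\<^bsub>M\<^esub>}"
  note ph = mod_homD[OF p] and eps = mod_homD[OF M.eps_hom]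
  have K0: "\<zero>\<^bsub>G\<^esub> \<in> ?K" using mod_hom_zero[OF G M p] by simp
  have \<phi>c: "\<phi> x \<in> carrier C" if "x \<in> ?K" for x using \<phi> that by (auto simp: mod_hom_def)
  have \<phi>a: "\<phi> (x \<oplus>\<^bsub>G\<^esub> y) = \<phi> x \<oplus>\<^bsub>C\<^esub> \<phi> y" if "x \<in> ?K" "y \<in> ?K" for x y
    using \<phi> that by (auto simp: mod_hom_def)
  have \<phi>s: "\<phi> (a \<odot>\<^bsub>G\<^esub> x) = a \<odot>\<^bsub>C\<^esub> \<phi> x" if "a \<in> carrier R" "x \<in> ?K" for a x
    using \<phi> that by (auto simp: mod_hom_def)
  define \<psi>0 where "\<psi>0 m = (if m \<in> carrier M then SOME x. x \<in> carrier G \<and> p x = m else \<zero>\<^bsub>G\<^esub>)" for m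
  have "\<psi>0 m \<in> carrier G \<and> p (\<psi>0 m) = m" if m: "m \<in> carrier M" for m
  proof -
    have "\<exists>x. x \<in> carrier G \<and> p x = m" using subsetD[OF surj m] by (auto simp: image_iff)
    then have "(SOME x. x \<in> carrier G \<and> p x = m) \<in> carrier G \<and> p (SOME x. x \<in> carrier G \<and> p x = m) = m"
      by (rule someI_ex)
    then show ?thesis using m by (simp add: \<psi>0_def)
  qed
  then have \<psi>0: "\<psi>0 m \<in> carrier G \<and> (m \<in> carrier M \<longrightarrow> p (\<psi>0 m) = m)" for m
    by (cases "m \<in> carrier M") (simp_all add: \<psi>0_def)
  note \<psi>0 = \<psi>0[THEN conjunct1] \<psi>0[THEN conjunct2, rule_format]
  define \<psi> where "\<psi> c = comb R G c \<psi>0" for c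
  have m0: "c \<in> fsupp R" if "c \<in> carrier (res0 R M)" for c
    using that free_module_mono unfolding res0_def by blast
  have \<psi>c: "\<psi> c \<in> carrier G" if "c \<in> carrier (res0 R M)" for c
    unfolding \<psi>_def by (rule G.comb_closed[OF m0[OF that] \<psi>0(1)])
  have \<psi>a: "\<psi> (c \<oplus>\<^bsub>res0 R M\<^esub> d) = \<psi> c \<oplus>\<^bsub>G\<^esub> \<psi> d" if "c \<in> carrier (res0 R M)" "d \<in> carrier (res0 R M)" for c d
    using G.comb_add_left[where y=\<psi>0, OF m0[OF that(1)] m0[OF that(2)] \<psi>0(1)] by (simp add: \<psi>_def res0_def)
  have \<psi>s: "\<psi> (a \<odot>\<^bsub>res0 R M\<^esub> c) = a \<odot>\<^bsub>G\<^esub> \<psi> c" if "a \<in> carrier R" "c \<in> carrier (res0 R M)" for a c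
    using G.comb_smult_left[where y=\<psi>0, OF m0[OF that(2)] \<psi>0(1) that(1)] by (simp add: \<psi>_def res0_def)
  have \<psi>h: "\<psi> \<in> mod_hom R (res0 R M) G" using \<psi>c \<psi>a \<psi>s by (auto simp: mod_hom_def)
  have p\<psi>: "p (\<psi> c) = lin_comb R M c" if "c \<in> carrier (res0 R M)" for c
  proof -
    have "p (\<psi> c) = comb R M c (\<lambda>m. p (\<psi>0 m))"
      unfolding \<psi>_def by (rule mod_hom_comb[OF G M p m0[OF that] \<psi>0(1)])
    also have "\<dots> = lin_comb R M c"
      unfolding lin_comb_eq_comb comb_def
      by (rule M.M.finsum_cong') (use that \<psi>0(2) fsuppD[OF m0[OF that]] in \<open>auto simp: res0_def free_module_def subset_iff\<close>)
    finally show ?thesis .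
  qed
  have \<psi>K: "\<psi> c \<in> ?K" if "c \<in> M.syz" for c
    using that \<psi>c p\<psi> by (auto simp: M.syz_def)
  define f where "f = (\<lambda>c\<in>carrier (res1 R M). \<phi> (\<psi> (lin_comb R (res0 R M) c)))"
  have f: "f \<in> Ext1_cocycles R M C"
  proof -
    note d1 = mod_homD[OF M.d1_hom]
    have s: "\<psi> (lin_comb R (res0 R M) c) \<in> ?K" if "c \<in> carrier (res1 R M)" for c
      by (rule \<psi>K[OF M.d1_syz[OF that]])
    have "f \<in> mod_hom R (res1 R M) C"
      unfolding mod_hom_def
    proof (intro CollectI conjI ballI)
      show "f \<in> carrier (res1 R M) \<rightarrow> carrier C" using \<phi>c[OF s] by (auto simp: f_def)
      fix c d assume cd: "c \<in> carrier (res1 R M)" "d \<in> carrier (res1 R M)"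
      show "f (c \<oplus>\<^bsub>res1 R M\<^esub> d) = f c \<oplus>\<^bsub>C\<^esub> f d"
        using cd d1 \<psi>a \<phi>a[OF s[OF cd(1)] s[OF cd(2)]] by (simp add: f_def)
    next
      fix a c assume ac: "a \<in> carrier R" "c \<in> carrier (res1 R M)"
      show "f (a \<odot>\<^bsub>res1 R M\<^esub> c) = a \<odot>\<^bsub>C\<^esub> f c"
        using ac d1 \<psi>s \<phi>s[OF ac(1) s[OF ac(2)]] by (simp add: f_def)
    qed
    moreover have "f \<in> extensional (carrier (res1 R M))" by (simp add: f_def)
    moreover have "f (lin_comb R (res1 R M) c) = \<zero>\<^bsub>C\<^esub>" if "c \<in> carrier (res2 R M)" for c
    proof -
      have "\<phi> \<zero>\<^bsub>G\<^esub> = \<zero>\<^bsub>C\<^esub>" using \<phi>s[OF M.R.zero_closed K0] \<phi>c[OF K0] C.smult_l_null G.smult_l_null by simp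
      then show ?thesis
        using M.d1_d2[OF that] mod_hom_zero[OF M.res0_module G \<psi>h] by (simp add: f_def)
    qed
    ultimately show ?thesis by (simp add: Ext1_cocycles_def Hom_group_def)
  qed
  have "f \<in> Ext1_coboundaries R M C"
  proof -
    let ?B = "Ext1_coboundaries R M C" and ?H = "(Hom_group R (res1 R M) C)\<lparr>carrier := Ext1_cocycles R M C\<rparr>"
    have car: "carrier (Ext1 R M C) = rcosets\<^bsub>?H\<^esub> ?B" and one: "\<one>\<^bsub>Ext1 R M C\<^esub> = ?B"
      by (simp_all add: Ext1_def FactGroup_def)
    have "?B #>\<^bsub>?H\<^esub> f \<in> rcosets\<^bsub>?H\<^esub> ?B" using f by (auto simp: RCOSETS_def)
    then have e: "?B #>\<^bsub>?H\<^esub> f = ?B"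
      using triv car one by (auto simp: trivial_group_def)
    let ?z = "\<lambda>c\<in>carrier (res0 R M). \<zero>\<^bsub>C\<^esub>"
    have "?z \<in> carrier (Hom_group R (res0 R M) C)"
      by (auto simp: Hom_group_def mod_hom_def)
    then have "(\<lambda>c\<in>carrier (res1 R M). ?z (lin_comb R (res0 R M) c)) \<in> ?B"
      unfolding Ext1_coboundaries_def by blast
    then have "(\<lambda>c\<in>carrier (res1 R M). ?z (lin_comb R (res0 R M) c)) \<otimes>\<^bsub>?H\<^esub> f \<in> ?B #>\<^bsub>?H\<^esub> f"
      by (auto simp: r_coset_def)
    moreover have "(\<lambda>c\<in>carrier (res1 R M). ?z (lin_comb R (res0 R M) c)) \<otimes>\<^bsub>?H\<^esub> f = f"
    proof -
      have "f \<in> extensional (carrier (res1 R M))" "f \<in> carrier (res1 R M) \<rightarrow> carrier C"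
        using f by (auto simp: Ext1_cocycles_def Hom_group_def mod_hom_def)
      then show ?thesis
        using mod_homD(1)[OF M.d1_hom] by (auto simp: Hom_group_def fun_eq_iff extensional_def Pi_iff)
    qed
    ultimately show ?thesis using e by simp
  qed
  then obtain g where g: "g \<in> mod_hom R (res0 R M) C"
    and fg: "f = (\<lambda>c\<in>carrier (res1 R M). g (lin_comb R (res0 R M) c))"
    by (auto simp: Ext1_coboundaries_def Hom_group_def)
  note gh = mod_homD[OF g]
  have g_syz: "g k = \<phi> (\<psi> k)" if "k \<in> M.syz" for k
  proof -
    have "f (unitv R k) = g k" "f (unitv R k) = \<phi> (\<psi> k)"
      using M.d1_unitv[OF that] by (simp add: fg) (use M.d1_unitv[OF that] in \<open>simp add: f_def\<close>)
    then show ?thesis by simp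
  qed
  define h where "h x = g (unitv R (p x)) \<oplus>\<^bsub>C\<^esub> \<phi> (x \<ominus>\<^bsub>G\<^esub> \<psi> (unitv R (p x)))" for x
  have u: "unitv R (p x) \<in> carrier (res0 R M)" "lin_comb R M (unitv R (p x)) = p x" if "x \<in> carrier G" for x
    using M.R.unitv_free[OF ph(1)[OF that]] M.lin_comb_unitv[OF ph(1)[OF that]] by (simp_all add: res0_def)
  have inK: "x \<ominus>\<^bsub>G\<^esub> \<psi> c \<in> ?K" if "x \<in> carrier G" "c \<in> carrier (res0 R M)" "lin_comb R M c = p x" for x c
    using that \<psi>c[OF that(2)] p\<psi>[OF that(2)] mod_hom_minus[OF G M p that(1) \<psi>c[OF that(2)]] ph(1)[OF that(1)]
    by (simp add: M.M.minus_eq M.M.r_neg)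
  \<comment> \<open>Any lift of \<open>p x\<close> computes \<open>h x\<close>.\<close>
  have h: "h x = g c \<oplus>\<^bsub>C\<^esub> \<phi> (x \<ominus>\<^bsub>G\<^esub> \<psi> c)"
    if x: "x \<in> carrier G" and c: "c \<in> carrier (res0 R M)" "lin_comb R M c = p x" for x c
  proof -
    let ?u = "unitv R (p x)" and ?k = "unitv R (p x) \<ominus>\<^bsub>res0 R M\<^esub> c"
    note u = u[OF x]
    have k: "?k \<in> M.syz"
      using u c mod_hom_minus[OF M.res0_module M M.eps_hom u(1) c(1)] ph(1)[OF x]
      by (simp add: M.syz_def M.M.minus_eq M.M.r_neg)
    have gk: "g ?u = g c \<oplus>\<^bsub>C\<^esub> \<phi> (\<psi> ?k)"
    proof -
      have "?u = c \<oplus>\<^bsub>res0 R M\<^esub> ?k" by (rule R0.add_diff_cancel[symmetric]) (use u c in auto)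
      then have "g ?u = g c \<oplus>\<^bsub>C\<^esub> g ?k" using gh(2)[OF c(1), of ?k] u c by simp
      then show ?thesis using g_syz[OF k] by simp
    qed
    have "\<psi> ?k = \<psi> ?u \<ominus>\<^bsub>G\<^esub> \<psi> c" by (rule mod_hom_minus[OF M.res0_module G \<psi>h u(1) c(1)])
    then have "\<psi> ?k \<oplus>\<^bsub>G\<^esub> (x \<ominus>\<^bsub>G\<^esub> \<psi> ?u) = x \<ominus>\<^bsub>G\<^esub> \<psi> c"
      using x \<psi>c[OF u(1)] \<psi>c[OF c(1)]
      by (simp add: G.M.minus_eq G.M.a_ac) (simp add: G.M.a_lcomm[of "\<psi> ?u"] G.M.r_neg2 G.M.r_neg G.M.a_comm)
    then have "\<phi> (x \<ominus>\<^bsub>G\<^esub> \<psi> c) = \<phi> (\<psi> ?k) \<oplus>\<^bsub>C\<^esub> \<phi> (x \<ominus>\<^bsub>G\<^esub> \<psi> ?u)"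
      using \<phi>a[OF \<psi>K[OF k] inK[OF x u]] by simp
    then show ?thesis
      unfolding h_def gk using gh(1)[OF c(1)] \<phi>c[OF \<psi>K[OF k]] \<phi>c[OF inK[OF x u]]
      by (simp add: C.M.a_assoc)
  qed
  have "h \<in> mod_hom R G C"
    unfolding mod_hom_def
  proof (intro CollectI conjI ballI)
    show "h \<in> carrier G \<rightarrow> carrier C"
      using gh(1) u \<phi>c inK by (auto simp: h_def)
    fix x y assume x: "x \<in> carrier G" and y: "y \<in> carrier G"
    let ?u = "unitv R (p x)" and ?v = "unitv R (p y)"
    note ux = u[OF x] and uy = u[OF y]
    have "h (x \<oplus>\<^bsub>G\<^esub> y) = g (?u \<oplus>\<^bsub>res0 R M\<^esub> ?v) \<oplus>\<^bsub>C\<^esub> \<phi> ((x \<oplus>\<^bsub>G\<^esub> y) \<ominus>\<^bsub>G\<^esub> \<psi> (?u \<oplus>\<^bsub>res0 R M\<^esub> ?v))"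
      by (rule h) (use x y ux uy eps(2) ph(2) in auto)
    also have "(x \<oplus>\<^bsub>G\<^esub> y) \<ominus>\<^bsub>G\<^esub> \<psi> (?u \<oplus>\<^bsub>res0 R M\<^esub> ?v) = (x \<ominus>\<^bsub>G\<^esub> \<psi> ?u) \<oplus>\<^bsub>G\<^esub> (y \<ominus>\<^bsub>G\<^esub> \<psi> ?v)"
      using x y \<psi>c[OF ux(1)] \<psi>c[OF uy(1)] \<psi>a[OF ux(1) uy(1)] by (simp add: G.group_normalize)
    also have "\<phi> \<dots> = \<phi> (x \<ominus>\<^bsub>G\<^esub> \<psi> ?u) \<oplus>\<^bsub>C\<^esub> \<phi> (y \<ominus>\<^bsub>G\<^esub> \<psi> ?v)"
      by (rule \<phi>a[OF inK[OF x ux] inK[OF y uy]])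
    finally show "h (x \<oplus>\<^bsub>G\<^esub> y) = h x \<oplus>\<^bsub>C\<^esub> h y"
      unfolding h_def[of x] h_def[of y]
      using gh(1)[OF ux(1)] gh(1)[OF uy(1)] gh(2)[OF ux(1) uy(1)] \<phi>c[OF inK[OF x ux]] \<phi>c[OF inK[OF y uy]]
      by (simp add: C.M.a_ac)
  next
    fix a x assume a: "a \<in> carrier R" and x: "x \<in> carrier G"
    let ?u = "unitv R (p x)"
    note ux = u[OF x]
    have "h (a \<odot>\<^bsub>G\<^esub> x) = g (a \<odot>\<^bsub>res0 R M\<^esub> ?u) \<oplus>\<^bsub>C\<^esub> \<phi> ((a \<odot>\<^bsub>G\<^esub> x) \<ominus>\<^bsub>G\<^esub> \<psi> (a \<odot>\<^bsub>res0 R M\<^esub> ?u))"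
      by (rule h) (use x a ux eps(3) ph(3) in auto)
    also have "(a \<odot>\<^bsub>G\<^esub> x) \<ominus>\<^bsub>G\<^esub> \<psi> (a \<odot>\<^bsub>res0 R M\<^esub> ?u) = a \<odot>\<^bsub>G\<^esub> (x \<ominus>\<^bsub>G\<^esub> \<psi> ?u)"
      using x a \<psi>c[OF ux(1)] \<psi>s[OF a ux(1)] by (simp add: G.smult_diff)
    also have "\<phi> \<dots> = a \<odot>\<^bsub>C\<^esub> \<phi> (x \<ominus>\<^bsub>G\<^esub> \<psi> ?u)"
      by (rule \<phi>s[OF a inK[OF x ux]])
    finally show "h (a \<odot>\<^bsub>G\<^esub> x) = a \<odot>\<^bsub>C\<^esub> h x"
      unfolding h_def[of x]
      using gh(1)[OF ux(1)] gh(3)[OF a ux(1)] \<phi>c[OF inK[OF x ux]] a by (simp add: C.smult_r_distr)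
  qed
  moreover have "h x = \<phi> x" if x: "x \<in> carrier G" "p x = \<zero>\<^bsub>M\<^esub>" for x
  proof -
    have "h x = g \<zero>\<^bsub>res0 R M\<^esub> \<oplus>\<^bsub>C\<^esub> \<phi> (x \<ominus>\<^bsub>G\<^esub> \<psi> \<zero>\<^bsub>res0 R M\<^esub>)"
      by (rule h[OF x(1)]) (use x mod_hom_zero[OF M.res0_module M M.eps_hom] in auto)
    then show ?thesis
      using x \<phi>c[of x] mod_hom_zero[OF M.res0_module C g] mod_hom_zero[OF M.res0_module G \<psi>h]
      by (simp add: G.M.minus_eq)
  qed
  ultimately show ?thesis by blast
qed

text \<open>A cocycle vanishes on the image of \<open>res2\<close>, which is the kernel of \<open>res1 \<rightarrow> res0\<close>. So it is induced by a
  homomorphism \<open>\<phi>\<close> on the image of \<open>res1\<close>, which is the kernel of \<open>res0 \<rightarrow> M\<close>, and an extension of \<open>\<phi>\<close> to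
  \<open>res0\<close> bounds it.\<close>

lemma trivial_Ext1_of_extension:
  assumes M: "module R M" and C: "module R C"
    and ext: "\<And>\<phi>. \<phi> \<in> mod_hom R ((res0 R M)\<lparr>carrier := {c \<in> carrier (res0 R M). lin_comb R M c = \<zero>\<^bsub>M\<^esub>}\<rparr>) C \<Longrightarrow>
      \<exists>g\<in>mod_hom R (res0 R M) C. \<forall>c\<in>carrier (res0 R M). lin_comb R M c = \<zero>\<^bsub>M\<^esub> \<longrightarrow> g c = \<phi> c"
  shows "trivial_group (Ext1 R M C)"
proof -
  interpret M: module R M by fact
  interpret C: module R C by fact
  interpret R0: module R "res0 R M" by (rule M.res0_module)
  interpret R1: module R "res1 R M" by (rule M.res1_module)
  let ?B = "Ext1_coboundaries R M C" and ?Z = "Ext1_cocycles R M C"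
  let ?H = "(Hom_group R (res1 R M) C)\<lparr>carrier := ?Z\<rparr>"
  note syz = R0.submodule_closed[OF M.syz_submodule]
  have ZB: "f \<in> ?B" if "f \<in> ?Z" for f
  proof -
    from that have f: "f \<in> mod_hom R (res1 R M) C" and fe: "f \<in> extensional (carrier (res1 R M))"
      and f2: "\<And>c. c \<in> carrier (res2 R M) \<Longrightarrow> f (lin_comb R (res1 R M) c) = \<zero>\<^bsub>C\<^esub>"
      by (auto simp: Ext1_cocycles_def Hom_group_def)
    note fh = mod_homD[OF f] and d1 = mod_homD[OF M.d1_hom]
    have f0: "f c = f c'"
      if c: "c \<in> carrier (res1 R M)" "c' \<in> carrier (res1 R M)"
        "lin_comb R (res0 R M) c = lin_comb R (res0 R M) c'" for c c'
    proof -
      let ?d = "c \<ominus>\<^bsub>res1 R M\<^esub> c'"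
      have "lin_comb R (res0 R M) ?d = \<zero>\<^bsub>res0 R M\<^esub>"
        using mod_hom_minus[OF M.res1_module M.res0_module M.d1_hom c(1,2)] c d1(1)[OF c(2)]
        by (simp add: R0.M.minus_eq R0.M.r_neg)
      then have "f ?d = \<zero>\<^bsub>C\<^esub>" using M.d2_unitv[of ?d] f2[of "unitv R ?d"] c by simp
      then have "mcong C {\<zero>\<^bsub>C\<^esub>} (f c) (f c')"
        using mod_hom_minus[OF M.res1_module C f c(1,2)] fh(1) c by (simp add: mcong_def)
      then show ?thesis by (simp add: C.mcong_eq)
    qed
    define \<phi> where "\<phi> k = f (unitv R k)" for k
    note du = M.d1_unitv
    have "\<phi> \<in> mod_hom R ((res0 R M)\<lparr>carrier := {c \<in> carrier (res0 R M). lin_comb R M c = \<zero>\<^bsub>M\<^esub>}\<rparr>) C"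
      unfolding mod_hom_def M.syz_def[symmetric]
    proof (intro CollectI conjI ballI, simp_all)
      show "\<phi> \<in> M.syz \<rightarrow> carrier C" using fh(1) du by (auto simp: \<phi>_def)
      fix x y assume xy: "x \<in> M.syz" "y \<in> M.syz"
      have "\<phi> (x \<oplus>\<^bsub>res0 R M\<^esub> y) = f (unitv R x \<oplus>\<^bsub>res1 R M\<^esub> unitv R y)"
        unfolding \<phi>_def by (rule f0) (use du xy du[OF syz(6)[OF xy]] d1(2) in auto)
      then show "\<phi> (x \<oplus>\<^bsub>res0 R M\<^esub> y) = \<phi> x \<oplus>\<^bsub>C\<^esub> \<phi> y"
        using fh(2) du xy by (simp add: \<phi>_def)
    next
      fix a x assume ax: "a \<in> carrier R" "x \<in> M.syz"
      have "\<phi> (a \<odot>\<^bsub>res0 R M\<^esub> x) = f (a \<odot>\<^bsub>res1 R M\<^esub> unitv R x)"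
        unfolding \<phi>_def by (rule f0) (use du ax du[OF syz(5)[OF ax]] d1(3) in auto)
      then show "\<phi> (a \<odot>\<^bsub>res0 R M\<^esub> x) = a \<odot>\<^bsub>C\<^esub> \<phi> x"
        using fh(3) du ax by (simp add: \<phi>_def)
    qed
    from ext[OF this] obtain g where g: "g \<in> mod_hom R (res0 R M) C" and g\<phi>: "\<And>c. c \<in> M.syz \<Longrightarrow> g c = \<phi> c"
      by (auto simp: M.syz_def)
    have gf: "g (lin_comb R (res0 R M) c) = f c" if c: "c \<in> carrier (res1 R M)" for c
      unfolding g\<phi>[OF M.d1_syz[OF c]] \<phi>_def
      by (rule f0) (use du[OF M.d1_syz[OF c]] c in auto)
    let ?g = "restrict g (carrier (res0 R M))"
    have "?g \<in> carrier (Hom_group R (res0 R M) C)"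
      using g by (auto simp: Hom_group_def mod_hom_def)
    moreover have "f = (\<lambda>c\<in>carrier (res1 R M). ?g (lin_comb R (res0 R M) c))"
      using fe gf d1(1) by (auto simp: fun_eq_iff extensional_def)
    ultimately show ?thesis unfolding Ext1_coboundaries_def by blast
  qed
  have BZ: "f \<in> ?Z" if "f \<in> ?B" for f
  proof -
    from that obtain g where g: "g \<in> mod_hom R (res0 R M) C"
      and fg: "f = (\<lambda>c\<in>carrier (res1 R M). g (lin_comb R (res0 R M) c))"
      by (auto simp: Ext1_coboundaries_def Hom_group_def)
    note d1 = mod_homD[OF M.d1_hom] and gh = mod_homD[OF g]
    have "f \<in> mod_hom R (res1 R M) C"
      using d1 gh by (auto simp: fg mod_hom_def)
    then show ?thesis
      using M.d1_d2 mod_hom_zero[OF M.res0_module C g] by (auto simp: Ext1_cocycles_def Hom_group_def fg)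
  qed
  have eq: "?B = ?Z" using ZB BZ by blast
  have "group ?H"
  proof (rule groupI)
    show "\<one>\<^bsub>?H\<^esub> \<in> carrier ?H"
      using M.d1_d2 by (auto simp: Ext1_cocycles_def Hom_group_def mod_hom_def)
  next
    fix f g assume "f \<in> carrier ?H" "g \<in> carrier ?H"
    then show "f \<otimes>\<^bsub>?H\<^esub> g \<in> carrier ?H"
      using M.d1_d2
      by (auto simp: Ext1_cocycles_def Hom_group_def mod_hom_def Pi_iff C.M.a_ac C.smult_r_distr)
  next
    fix f g k assume "f \<in> carrier ?H" "g \<in> carrier ?H" "k \<in> carrier ?H"
    then show "f \<otimes>\<^bsub>?H\<^esub> g \<otimes>\<^bsub>?H\<^esub> k = f \<otimes>\<^bsub>?H\<^esub> (g \<otimes>\<^bsub>?H\<^esub> k)"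
      by (auto simp: Ext1_cocycles_def Hom_group_def mod_hom_def Pi_iff C.M.a_assoc fun_eq_iff)
  next
    fix f assume "f \<in> carrier ?H"
    then show "\<one>\<^bsub>?H\<^esub> \<otimes>\<^bsub>?H\<^esub> f = f"
      by (auto simp: Ext1_cocycles_def Hom_group_def mod_hom_def Pi_iff fun_eq_iff extensional_def)
  next
    fix f assume f: "f \<in> carrier ?H"
    let ?g = "\<lambda>x\<in>carrier (res1 R M). \<ominus>\<^bsub>C\<^esub> f x"
    have "?g \<in> carrier ?H"
      using f M.d1_d2
      by (auto simp: Ext1_cocycles_def Hom_group_def mod_hom_def Pi_iff C.M.minus_add C.smult_r_minus)
    moreover have "?g \<otimes>\<^bsub>?H\<^esub> f = \<one>\<^bsub>?H\<^esub>"
      using f by (auto simp: Ext1_cocycles_def Hom_group_def mod_hom_def Pi_iff fun_eq_iff C.M.l_neg)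
    ultimately show "\<exists>g\<in>carrier ?H. g \<otimes>\<^bsub>?H\<^esub> f = \<one>\<^bsub>?H\<^esub>" by blast
  qed
  then interpret H: group ?H .
  have "normal (carrier ?H) ?H"
    unfolding H.normal_inv_iff by (intro conjI ballI H.subgroup_self H.m_closed H.inv_closed)
  then have n: "normal ?Z ?H" by simp
  have "group (?H Mod ?Z)" by (rule normal.factorgroup_is_group[OF n])
  moreover have "carrier (?H Mod ?Z) = {\<one>\<^bsub>?H Mod ?Z\<^esub>}"
  proof -
    have "?Z #>\<^bsub>?H\<^esub> f = ?Z" if "f \<in> ?Z" for f
      using H.coset_join2[of f ?Z] H.subgroup_self that by simp
    moreover have "\<one>\<^bsub>?H\<^esub> \<in> ?Z" using H.one_closed by simp
    ultimately show ?thesis by (auto simp: FactGroup_def RCOSETS_def)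
  qed
  ultimately show ?thesis by (simp add: trivial_group_def Ext1_def eq)
qed

section \<open>Localizations as telescopes\<close>

lemma UN_pair_const:
  assumes "(a0, s0) \<in> X" "\<And>a s. (a, s) \<in> X \<Longrightarrow> f a s = F"
  shows "(\<Union>(a, s)\<in>X. f a s) = F"
proof -
  have "(\<Union>(a, s)\<in>X. f a s) = (\<Union>x\<in>X. F)" by (rule SUP_cong) (use assms(2) in auto)
  then show ?thesis using assms(1) by auto
qed

lemma module_of_surjection:
  assumes G: "module R G" and surj: "carrier L = p ` carrier G"
    and add: "\<And>x y. x \<in> carrier G \<Longrightarrow> y \<in> carrier G \<Longrightarrow> p (x \<oplus>\<^bsub>G\<^esub> y) = p x \<oplus>\<^bsub>L\<^esub> p y"
    and smult: "\<And>a x. a \<in> carrier R \<Longrightarrow> x \<in> carrier G \<Longrightarrow> p (a \<odot>\<^bsub>G\<^esub> x) = a \<odot>\<^bsub>L\<^esub> p x"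
    and zero: "p \<zero>\<^bsub>G\<^esub> = \<zero>\<^bsub>L\<^esub>"
  shows "module R L"
proof -
  interpret G: module R G by fact
  note add' = add[symmetric] and smult' = smult[symmetric] and zero' = zero[symmetric]
  show ?thesis
  proof (rule moduleI[OF G.R.is_cring])
    show "abelian_group L"
    proof (rule abelian_groupI)
      fix x assume "x \<in> carrier L"
      then obtain u where u: "u \<in> carrier G" "x = p u" by (auto simp: surj)
      have "p (\<ominus>\<^bsub>G\<^esub> u) \<oplus>\<^bsub>L\<^esub> x = \<zero>\<^bsub>L\<^esub>"
        using u by (simp add: add' zero' G.M.l_neg)
      then show "\<exists>y\<in>carrier L. y \<oplus>\<^bsub>L\<^esub> x = \<zero>\<^bsub>L\<^esub>" using u by (auto simp: surj)
    qed (auto simp: surj add' zero' G.M.a_ac)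
  qed (auto simp: surj add' smult' G.smult_l_distr G.smult_r_distr G.smult_assoc1)
qed

context domain
begin

context
  fixes T assumes T: "submonoid T R" and T0: "\<zero> \<notin> T"
begin

lemma T_carrier: "t \<in> T \<Longrightarrow> t \<in> carrier R"
  using submonoid.subset[OF T] by blast

lemma T_closed: "t \<in> T \<Longrightarrow> t' \<in> T \<Longrightarrow> t \<otimes> t' \<in> T" "\<one> \<in> T"
  using submonoid.m_closed[OF T] submonoid.one_closed[OF T] by auto

lemma T_nz: "t \<in> T \<Longrightarrow> t \<noteq> \<zero>"
  using T0 by blast

lemma frac_rel_iff:
  "((r, t), (r', t')) \<in> frac_rel R T \<longleftrightarrow>
    r \<in> carrier R \<and> t \<in> T \<and> r' \<in> carrier R \<and> t' \<in> T \<and> r \<otimes> t' = r' \<otimes> t"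
proof -
  have "r \<otimes> t' = r' \<otimes> t" if "u \<in> T" "r \<in> carrier R" "t \<in> T" "r' \<in> carrier R" "t' \<in> T"
    "u \<otimes> (r \<otimes> t') = u \<otimes> (r' \<otimes> t)" for u
    using m_lcancel[of u "r \<otimes> t'" "r' \<otimes> t"] that T_carrier T_nz by simp
  then show ?thesis using T_closed(2) by (auto simp: frac_rel_def)
qed

lemma frac_equiv: "equiv (carrier R \<times> T) (frac_rel R T)"
proof (rule equivI)
  show "frac_rel R T \<subseteq> (carrier R \<times> T) \<times> (carrier R \<times> T)"
    by (auto simp: frac_rel_def)
  show "refl_on (carrier R \<times> T) (frac_rel R T)"
    by (rule refl_onI) (auto simp: frac_rel_iff)
  show "sym (frac_rel R T)"
    by (rule symI) (auto simp: frac_rel_iff)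
  show "trans (frac_rel R T)"
  proof (rule transI)
    fix x y z assume xy: "(x, y) \<in> frac_rel R T" and yz: "(y, z) \<in> frac_rel R T"
    obtain a s b t c u where e: "x = (a, s)" "y = (b, t)" "z = (c, u)" by (cases x, cases y, cases z)
    from xy yz have c: "a \<in> carrier R" "b \<in> carrier R" "c \<in> carrier R" "s \<in> T" "t \<in> T" "u \<in> T"
      and 1: "a \<otimes> t = b \<otimes> s" "b \<otimes> u = c \<otimes> t" by (auto simp: e frac_rel_iff)
    note tc = T_carrier[OF c(4)] T_carrier[OF c(5)] T_carrier[OF c(6)]
    have "t \<otimes> (a \<otimes> u) = (a \<otimes> t) \<otimes> u" using c tc by (simp add: m_ac)
    also have "\<dots> = (b \<otimes> u) \<otimes> s" unfolding 1(1) using c tc by (simp add: m_ac)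
    also have "\<dots> = t \<otimes> (c \<otimes> s)" unfolding 1(2) using c tc by (simp add: m_ac)
    finally have "a \<otimes> u = c \<otimes> s" using m_lcancel[of t "a \<otimes> u" "c \<otimes> s"] c tc T_nz by simp
    then show "(x, z) \<in> frac_rel R T" using c by (simp add: e frac_rel_iff)
  qed
qed

lemma fraction_eq_iff:
  assumes "r \<in> carrier R" "t \<in> T" "r' \<in> carrier R" "t' \<in> T"
  shows "fraction R T r t = fraction R T r' t' \<longleftrightarrow> r \<otimes> t' = r' \<otimes> t"
  unfolding fraction_def using eq_equiv_class_iff[OF frac_equiv] assms by (simp add: frac_rel_iff)

lemma fraction_mem_iff:
  assumes "r \<in> carrier R" "t \<in> T"
  shows "(r', t') \<in> fraction R T r t \<longleftrightarrow> r' \<in> carrier R \<and> t' \<in> T \<and> r \<otimes> t' = r' \<otimes> t"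
  using assms by (simp add: fraction_def frac_rel_iff)

lemma fraction_add:
  assumes c: "r \<in> carrier R" "t \<in> T" "r' \<in> carrier R" "t' \<in> T"
  shows "fraction R T r t \<oplus>\<^bsub>localization R T\<^esub> fraction R T r' t' = fraction R T (r \<otimes> t' \<oplus> r' \<otimes> t) (t \<otimes> t')"
    (is "_ = ?F")
proof -
  have "fraction R T (a \<otimes> s' \<oplus> a' \<otimes> s) (s \<otimes> s') = ?F"
    if "(a, s) \<in> fraction R T r t" "(a', s') \<in> fraction R T r' t'" for a s a' s'
  proof -
    from that c have m: "a \<in> carrier R" "s \<in> T" "a' \<in> carrier R" "s' \<in> T"
      and e: "r \<otimes> s = a \<otimes> t" "r' \<otimes> s' = a' \<otimes> t'" by (auto simp: fraction_mem_iff)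
    note tc = T_carrier[OF m(2)] T_carrier[OF m(4)] T_carrier[OF c(2)] T_carrier[OF c(4)]
    have "(a \<otimes> s' \<oplus> a' \<otimes> s) \<otimes> (t \<otimes> t') = (a \<otimes> t) \<otimes> (s' \<otimes> t') \<oplus> (a' \<otimes> t') \<otimes> (s \<otimes> t)"
      using m c tc by (simp add: l_distr r_distr m_ac)
    also have "\<dots> = (r \<otimes> t' \<oplus> r' \<otimes> t) \<otimes> (s \<otimes> s')"
      unfolding e[symmetric] using m c tc by (simp add: l_distr r_distr m_ac)
    finally show ?thesis
      using m c tc T_closed by (subst fraction_eq_iff) auto
  qed
  note const = this
  have 1: "(r, t) \<in> fraction R T r t" and 2: "(r', t') \<in> fraction R T r' t'"
    using c by (auto simp: fraction_mem_iff)
  have "(\<Union>(a, s)\<in>fraction R T r t. \<Union>(a', s')\<in>fraction R T r' t'.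
      fraction R T (a \<otimes> s' \<oplus> a' \<otimes> s) (s \<otimes> s')) = ?F"
    by (rule UN_pair_const[OF 1], rule UN_pair_const[OF 2], rule const)
  then show ?thesis by (simp add: localization_def)
qed

lemma fraction_smult:
  assumes c: "b \<in> carrier R" "r \<in> carrier R" "t \<in> T"
  shows "b \<odot>\<^bsub>localization R T\<^esub> fraction R T r t = fraction R T (b \<otimes> r) t"
    (is "_ = ?F")
proof -
  have "fraction R T (b \<otimes> a) s = ?F" if "(a, s) \<in> fraction R T r t" for a s
  proof -
    from that c have m: "a \<in> carrier R" "s \<in> T" and e: "r \<otimes> s = a \<otimes> t" by (auto simp: fraction_mem_iff)
    have "(b \<otimes> a) \<otimes> t = (b \<otimes> r) \<otimes> s"
      using m c e T_carrier[OF m(2)] T_carrier[OF c(3)] by (simp add: m_assoc)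
    then show ?thesis using m c by (subst fraction_eq_iff) auto
  qed
  note const = this
  have 1: "(r, t) \<in> fraction R T r t" using c by (auto simp: fraction_mem_iff)
  have "(\<Union>(a, s)\<in>fraction R T r t. fraction R T (b \<otimes> a) s) = ?F"
    by (rule UN_pair_const[OF 1], rule const)
  then show ?thesis by (simp add: localization_def)
qed

lemma localization_carrier: "carrier (localization R T) = {fraction R T r t | r t. r \<in> carrier R \<and> t \<in> T}"
  by (auto simp: localization_def fraction_def quotient_def)

text \<open>The ring of fractions is the direct limit of \<open>R \<rightarrow> R \<rightarrow> \<cdots>\<close> along multiplication by \<open>den_seq R T n\<close>.
  The free module on the natural numbers maps onto it by sending the \<open>n\<close>-th generator to the
  inverse of \<open>prefix n\<close>, and the kernel is free on the differences of consecutive generators; the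
  coordinates of an element of the kernel in this basis are the \<open>coord\<close> below. The sum of \<open>a n / prefix n\<close>
  over \<open>n < N\<close> is \<open>numer a N / prefix N\<close>.\<close>

primrec prefix :: "nat \<Rightarrow> 'a"
  where "prefix 0 = \<one>" | "prefix (Suc n) = prefix n \<otimes> den_seq R T n"

primrec numer :: "(nat \<Rightarrow> 'a) \<Rightarrow> nat \<Rightarrow> 'a"
  where "numer a 0 = \<zero>" | "numer a (Suc n) = den_seq R T n \<otimes> (numer a n \<oplus> a n)"

definition coord :: "(nat \<Rightarrow> 'a) \<Rightarrow> nat \<Rightarrow> 'a"
  where "coord a n = numer a n \<oplus> a n"

text \<open>From the end of the support of \<open>a\<close> on, the fraction does not depend on the stage \<open>N\<close>.\<close>

definition limit_map :: "(nat \<Rightarrow> 'a) \<Rightarrow> ('a \<times> 'a) set"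
  where "limit_map a = (let N = (LEAST N. \<forall>n\<ge>N. a n = \<zero>) in fraction R T (numer a N) (prefix N))"

lemma den_mem: "den_seq R T n \<in> T"
  by (rule den_seq_mem[OF T])

lemma prefix_mem: "prefix n \<in> T"
  by (induct n) (auto intro: T_closed den_mem)

lemma numer_closed: "(\<And>n. a n \<in> carrier R) \<Longrightarrow> numer a n \<in> carrier R"
  by (induct n) (auto intro: T_carrier den_mem)

lemma numer_add:
  "(\<And>n. a n \<in> carrier R) \<Longrightarrow> (\<And>n. b n \<in> carrier R) \<Longrightarrow>
    numer (\<lambda>n. a n \<oplus> b n) N = numer a N \<oplus> numer b N"
  using T_carrier[OF den_mem] by (induct N) (simp_all add: numer_closed r_distr a_ac)

lemma numer_smult:
  "c \<in> carrier R \<Longrightarrow> (\<And>n. a n \<in> carrier R) \<Longrightarrow> numer (\<lambda>n. c \<otimes> a n) N = c \<otimes> numer a N"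
  using T_carrier[OF den_mem] by (induct N) (simp_all add: numer_closed r_distr m_ac)

lemma fsupp_bound:
  fixes a :: "nat \<Rightarrow> 'a"
  assumes "a \<in> fsupp R"
  shows "\<exists>N. \<forall>n\<ge>N. a n = \<zero>"
proof -
  from assms have "finite {n. a n \<noteq> \<zero>}" by (rule fsuppD(2))
  then have "\<exists>N. {n. a n \<noteq> \<zero>} \<subseteq> {..<N}" by (simp only: finite_nat_iff_bounded)
  then obtain N where "{n. a n \<noteq> \<zero>} \<subseteq> {..<N}" by (rule exE)
  then have "\<forall>n\<ge>N. a n = \<zero>" by (auto simp: subset_iff not_less[symmetric])
  then show ?thesis by (rule exI)
qed

lemma numer_stable:
  assumes aR: "\<And>n. a n \<in> carrier R" and k: "\<forall>n\<ge>k. a n = \<zero>" and "k \<le> N"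
  shows "fraction R T (numer a k) (prefix k) = fraction R T (numer a N) (prefix N)"
  using \<open>k \<le> N\<close>
proof (induct N rule: dec_induct)
  case (step n)
  have n: "numer a n \<in> carrier R" "den_seq R T n \<in> carrier R" "prefix n \<in> carrier R"
    using numer_closed[where a=a, OF aR] T_carrier[OF den_mem] T_carrier[OF prefix_mem] by auto
  have m: "prefix n \<in> T" "prefix n \<otimes> den_seq R T n \<in> T"
    using prefix_mem[of n] prefix_mem[of "Suc n"] by simp_all
  have an: "a n = \<zero>" using k step(1) by simp
  have "numer a n \<otimes> (prefix n \<otimes> den_seq R T n) = (den_seq R T n \<otimes> numer a n) \<otimes> prefix n"
    using n by (simp add: m_ac)
  then have "fraction R T (numer a n) (prefix n) = fraction R T (den_seq R T n \<otimes> numer a n) (prefix n \<otimes> den_seq R T n)"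
    using n m by (subst fraction_eq_iff) auto
  then show ?case using step(3) n an by simp
qed simp

lemma limit_map_eq:
  assumes a: "a \<in> fsupp R" and N: "\<forall>n\<ge>N. a n = \<zero>"
  shows "limit_map a = fraction R T (numer a N) (prefix N)"
proof -
  have L: "\<forall>n\<ge>(LEAST N. \<forall>n\<ge>N. a n = \<zero>). a n = \<zero>" by (rule LeastI[of "\<lambda>N. \<forall>n\<ge>N. a n = \<zero>", OF N])
  have "(LEAST N. \<forall>n\<ge>N. a n = \<zero>) \<le> N" by (rule Least_le[of "\<lambda>N. \<forall>n\<ge>N. a n = \<zero>", OF N])
  from numer_stable[where a=a, OF fsuppD(1)[OF a] L this] show ?thesis
    unfolding limit_map_def Let_def .
qed

lemma common_bound:
  fixes a b :: "nat \<Rightarrow> 'a"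
  assumes "a \<in> fsupp R" "b \<in> fsupp R"
  obtains N where "\<forall>n\<ge>N. a n = \<zero>" "\<forall>n\<ge>N. b n = \<zero>"
proof -
  obtain N N' where "\<forall>n\<ge>N. a n = \<zero>" "\<forall>n\<ge>N'. b n = \<zero>"
    using fsupp_bound[OF assms(1)] fsupp_bound[OF assms(2)] by auto
  then show thesis using that[of "max N N'"] by auto
qed

lemma limit_map_add:
  assumes a: "a \<in> fsupp R" and b: "b \<in> fsupp R"
  shows "limit_map (\<lambda>n. a n \<oplus> b n) = limit_map a \<oplus>\<^bsub>localization R T\<^esub> limit_map b"
proof -
  interpret F: module R "free_module R (UNIV :: nat set)" by (rule free_module_module)
  note aR = fsuppD(1)[OF a] and bR = fsuppD(1)[OF b]
  obtain N where N: "\<forall>n\<ge>N. a n = \<zero>" "\<forall>n\<ge>N. b n = \<zero>" by (rule common_bound[OF a b])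
  then have N': "\<forall>n\<ge>N. a n \<oplus> b n = \<zero>" by simp
  note cl = numer_closed[where a=a, OF aR] numer_closed[where a=b, OF bR] prefix_mem[of N]
  show ?thesis
    unfolding limit_map_eq[OF a N(1)] limit_map_eq[OF b N(2)] limit_map_eq[OF F.fsupp_add[OF a b] N']
    using cl T_carrier[OF cl(3)] T_closed(1)[OF cl(3) cl(3)]
    by (subst fraction_add) (auto simp: fraction_eq_iff numer_add[where a=a and b=b, OF aR bR] l_distr r_distr m_ac)
qed

lemma limit_map_smult:
  assumes c: "c \<in> carrier R" and a: "a \<in> fsupp R"
  shows "limit_map (\<lambda>n. c \<otimes> a n) = c \<odot>\<^bsub>localization R T\<^esub> limit_map a"
proof -
  interpret F: module R "free_module R (UNIV :: nat set)" by (rule free_module_module)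
  note aR = fsuppD(1)[OF a]
  obtain N where N: "\<forall>n\<ge>N. a n = \<zero>" using fsupp_bound[OF a] by blast
  then have N': "\<forall>n\<ge>N. c \<otimes> a n = \<zero>" using c by simp
  show ?thesis
    unfolding limit_map_eq[OF a N] limit_map_eq[OF F.fsupp_smult[OF c a] N']
    using fraction_smult[OF c numer_closed[where a=a, OF aR] prefix_mem] numer_smult[where a=a, OF c aR] by simp
qed

lemma limit_map_zero: "limit_map (\<lambda>_. \<zero>) = \<zero>\<^bsub>localization R T\<^esub>"
proof -
  interpret F: module R "free_module R (UNIV :: nat set)" by (rule free_module_module)
  have "limit_map (\<lambda>_. \<zero>) = fraction R T (numer (\<lambda>_. \<zero>) 0) (prefix 0)"
    by (rule limit_map_eq[OF F.fsupp_zero]) simp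
  then show ?thesis by (simp add: localization_def)
qed

lemma limit_map_surj:
  assumes "countable T"
  shows "carrier (localization R T) = limit_map ` fsupp R"
proof
  show "limit_map ` fsupp R \<subseteq> carrier (localization R T)"
  proof
    fix x assume "x \<in> limit_map ` fsupp R"
    then obtain a where a: "a \<in> fsupp R" "x = limit_map a" by blast
    obtain N where N: "\<forall>n\<ge>N. a n = \<zero>" using fsupp_bound[OF a(1)] by blast
    then show "x \<in> carrier (localization R T)"
      unfolding localization_carrier a(2) limit_map_eq[OF a(1) N]
      using numer_closed[where a=a, OF fsuppD(1)[OF a(1)]] prefix_mem by blast
  qed
  show "carrier (localization R T) \<subseteq> limit_map ` fsupp R"
  proof
    fix x assume "x \<in> carrier (localization R T)"
    then obtain r t where rt: "r \<in> carrier R" "t \<in> T" "x = fraction R T r t"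
      by (auto simp: localization_carrier)
    obtain N q where q: "q \<in> carrier R" "den_seq R T N = t \<otimes> q"
      using den_seq_dvd[OF T assms rt(2)] by blast
    let ?c = "prefix N \<otimes> q \<otimes> r"
    note tc = T_carrier[OF rt(2)] T_carrier[OF prefix_mem[of N]] T_carrier[OF den_mem]
    have cR: "?c \<in> carrier R" using q rt tc by simp
    define a where "a n = (if n = Suc N then ?c else \<zero>)" for n
    have a: "a \<in> fsupp R"
      by (rule fsuppI[where S="{Suc N}"]) (use cR in \<open>auto simp: a_def\<close>)
    have n0: "numer a k = \<zero>" if "k \<le> Suc N" for k
      using that tc by (induct k) (auto simp: a_def)
    have "limit_map a = fraction R T (numer a (Suc (Suc N))) (prefix (Suc (Suc N)))"
      by (rule limit_map_eq[OF a]) (auto simp: a_def)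
    also have "numer a (Suc (Suc N)) = den_seq R T (Suc N) \<otimes> ?c"
      using n0[of "Suc N"] cR by (simp add: a_def del: numer.simps) (simp add: n0 a_def)
    also have "fraction R T (den_seq R T (Suc N) \<otimes> ?c) (prefix (Suc (Suc N))) = x"
    proof -
      have "den_seq R T (Suc N) \<otimes> ?c \<otimes> t = r \<otimes> prefix (Suc (Suc N))"
        using q rt tc by (simp del: den_seq.simps add: m_ac)
      then show ?thesis
        unfolding rt(3) using rt(1,2) m_closed[OF tc(3)[of "Suc N"] cR] prefix_mem[of "Suc (Suc N)"]
        by (subst fraction_eq_iff) (simp_all del: prefix.simps den_seq.simps)
    qed
    finally show "x \<in> limit_map ` fsupp R" using a by blast
  qed
qed

lemma localization_module:
  assumes "countable T"
  shows "module R (localization R T)"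
  by (rule module_of_surjection[OF free_module_module[of "UNIV :: nat set"] limit_map_surj[OF assms]])
    (simp_all add: limit_map_add limit_map_smult limit_map_zero)

lemma limit_map_hom:
  assumes "countable T"
  shows "limit_map \<in> mod_hom R (free_module R UNIV) (localization R T)"
  using limit_map_surj[OF assms] limit_map_add limit_map_smult by (auto simp: mod_hom_def)

text \<open>As \<open>R\<close> is a domain, an element of the kernel has numerator \<open>0\<close> from the end of its support on.\<close>

lemma numer_kernel:
  assumes a: "a \<in> fsupp R" and z: "limit_map a = \<zero>\<^bsub>localization R T\<^esub>" and N: "\<forall>n\<ge>N. a n = \<zero>"
  shows "\<forall>n\<ge>N. coord a n = \<zero>"
proof (intro allI impI)
  fix n assume n: "N \<le> n"
  note aR = fsuppD(1)[OF a]
  have "limit_map a = fraction R T (numer a n) (prefix n)"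
    by (rule limit_map_eq[OF a]) (use N n in auto)
  then have "fraction R T (numer a n) (prefix n) = fraction R T \<zero> \<one>"
    using z by (simp add: localization_def)
  then have "numer a n = \<zero>"
    using numer_closed[where a=a, OF aR] prefix_mem T_carrier T_closed by (simp add: fraction_eq_iff)
  then show "coord a n = \<zero>" using N n by (simp add: coord_def)
qed

text \<open>Let \<open>\<phi>\<close> send the basis element \<open>e n - s n * e (n + 1)\<close> of the kernel of \<open>limit_map\<close> to \<open>c n\<close>. As \<open>Ext\<close>
  vanishes, \<open>\<phi>\<close> extends to a homomorphism \<open>h\<close> on the whole free module, and \<open>y n = h (e n)\<close> solves the
  telescope.\<close>

theorem telescopes_of_trivial_Ext1:
  assumes "countable T" and C: "module R C" and triv: "trivial_group (Ext1 R (localization R T) C)"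
  shows "telescopes R C (den_seq R T) (carrier C) {\<zero>\<^bsub>C\<^esub>}"
  unfolding telescopes_def
proof (intro allI impI)
  fix c :: "nat \<Rightarrow> 'c" assume c': "\<forall>n. c n \<in> carrier C"
  then have c: "c n \<in> carrier C" for n by blast
  interpret C: module R C by fact
  let ?G = "free_module R (UNIV :: nat set)" and ?L = "localization R T" and ?s = "den_seq R T"
  interpret G: module R ?G by (rule free_module_module)
  interpret L: module R ?L by (rule localization_module[OF assms(1)])
  let ?K = "{a \<in> carrier ?G. limit_map a = \<zero>\<^bsub>?L\<^esub>}"
  define bd where "bd a = (LEAST N. \<forall>n\<ge>N. a n = \<zero>)" for a :: "nat \<Rightarrow> 'a"
  define \<phi> where "\<phi> a = lsum C (bd a) (coord a) c" for a
  have sR: "?s n \<in> carrier R" for n by (rule T_carrier[OF den_mem])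
  have coR: "coord a n \<in> carrier R" if "a \<in> fsupp R" for a n
    using numer_closed[where a=a, OF fsuppD(1)[OF that]] fsuppD(1)[OF that] by (simp add: coord_def)
  have \<phi>_eq: "\<phi> a = lsum C N (coord a) c" if a: "a \<in> ?K" and N: "\<forall>n\<ge>N. a n = \<zero>" for a N
  proof -
    have aF: "a \<in> fsupp R" using a by simp
    have L: "\<forall>n\<ge>bd a. a n = \<zero>"
      unfolding bd_def by (rule LeastI[of "\<lambda>N. \<forall>n\<ge>N. a n = \<zero>", OF N])
    have "bd a \<le> N" unfolding bd_def by (rule Least_le[of "\<lambda>N. \<forall>n\<ge>N. a n = \<zero>", OF N])
    moreover have "\<forall>n\<ge>bd a. coord a n = \<zero>" by (rule numer_kernel) (use a L in auto)
    ultimately show ?thesis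
      unfolding \<phi>_def lsum_def
      by (intro C.M.add.finprod_mono_neutral_cong_left) (use coR[OF aF] c in auto)
  qed
  have "\<phi> \<in> mod_hom R (?G\<lparr>carrier := ?K\<rparr>) C"
    unfolding mod_hom_def
  proof (intro CollectI conjI ballI)
    show "\<phi> \<in> carrier (?G\<lparr>carrier := ?K\<rparr>) \<rightarrow> carrier C"
      using c coR by (auto simp: \<phi>_def intro!: C.lsum_closed)
    fix a b assume "a \<in> carrier (?G\<lparr>carrier := ?K\<rparr>)" "b \<in> carrier (?G\<lparr>carrier := ?K\<rparr>)"
    then have a: "a \<in> ?K" and b: "b \<in> ?K" by simp_all
    then have aF: "a \<in> fsupp R" and bF: "b \<in> fsupp R" by simp_all
    obtain N where N: "\<forall>n\<ge>N. a n = \<zero>" "\<forall>n\<ge>N. b n = \<zero>" by (rule common_bound[OF aF bF])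
    have ab: "(\<lambda>n. a n \<oplus> b n) \<in> ?K"
      using a b limit_map_add[OF aF bF] G.fsupp_add[OF aF bF] by simp
    have "\<phi> (\<lambda>n. a n \<oplus> b n) = lsum C N (coord (\<lambda>n. a n \<oplus> b n)) c"
      by (rule \<phi>_eq[OF ab]) (use N in auto)
    also have "coord (\<lambda>n. a n \<oplus> b n) = (\<lambda>n. coord a n \<oplus> coord b n)"
      using fsuppD(1)[OF aF] fsuppD(1)[OF bF]
      by (auto simp: coord_def numer_add numer_closed a_ac)
    also have "lsum C N (\<lambda>n. coord a n \<oplus> coord b n) c = \<phi> a \<oplus>\<^bsub>C\<^esub> \<phi> b"
      unfolding \<phi>_eq[OF a N(1)] \<phi>_eq[OF b N(2)]
      by (rule C.lsum_add_left) (use coR aF bF c in auto)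
    finally show "\<phi> (a \<oplus>\<^bsub>?G\<lparr>carrier := ?K\<rparr>\<^esub> b) = \<phi> a \<oplus>\<^bsub>C\<^esub> \<phi> b" by simp
  next
    fix r a assume r: "r \<in> carrier R" and "a \<in> carrier (?G\<lparr>carrier := ?K\<rparr>)"
    then have a: "a \<in> ?K" and aF: "a \<in> fsupp R" by simp_all
    obtain N where N: "\<forall>n\<ge>N. a n = \<zero>" using fsupp_bound[OF aF] by blast
    have ra: "(\<lambda>n. r \<otimes> a n) \<in> ?K"
      using a limit_map_smult[OF r aF] G.fsupp_smult[OF r aF] r by simp
    have "\<phi> (\<lambda>n. r \<otimes> a n) = lsum C N (coord (\<lambda>n. r \<otimes> a n)) c"
      by (rule \<phi>_eq[OF ra]) (use N r in auto)
    also have "coord (\<lambda>n. r \<otimes> a n) = (\<lambda>n. r \<otimes> coord a n)"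
      using fsuppD(1)[OF aF] r by (auto simp: coord_def numer_smult numer_closed r_distr)
    also have "lsum C N (\<lambda>n. r \<otimes> coord a n) c = r \<odot>\<^bsub>C\<^esub> \<phi> a"
      unfolding \<phi>_eq[OF a N] by (rule C.lsum_smult_left) (use coR aF c r in auto)
    finally show "\<phi> (r \<odot>\<^bsub>?G\<lparr>carrier := ?K\<rparr>\<^esub> a) = r \<odot>\<^bsub>C\<^esub> \<phi> a" by simp
  qed
  from extension_of_trivial_Ext1[OF L.module_axioms G.module_axioms C triv limit_map_hom[OF assms(1)] _ this]
  obtain h where h: "h \<in> mod_hom R ?G C" and h\<phi>: "\<And>a. a \<in> ?K \<Longrightarrow> h a = \<phi> a"
    using limit_map_surj[OF assms(1)] by auto
  note hh = mod_homD[OF h] and uF = G.fsupp_unitv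
  define y where "y n = h (unitv R n)" for n
  have yC: "y n \<in> carrier C" for n unfolding y_def by (rule hh(1)[OF uF])
  have yn: "y n = c n \<oplus>\<^bsub>C\<^esub> ?s n \<odot>\<^bsub>C\<^esub> y (Suc n)" for n
  proof -
    let ?e = "unitv R n" and ?e' = "unitv R (Suc n)"
    define k where "k = (\<lambda>j. ?e j \<oplus> (\<ominus> ?s n) \<otimes> ?e' j)"
    have kF: "k \<in> fsupp R"
      unfolding k_def by (rule G.fsupp_add[OF uF G.fsupp_smult[OF _ uF]]) (use sR in simp)
    have k: "k j = (if j = n then \<one> else if j = Suc n then \<ominus> ?s n else \<zero>)" for j
      using sR[of n] by (auto simp: k_def unitv_def)
    have k_num: "numer k j = (if j = Suc n then ?s n else \<zero>)" for j
      using sR by (induct j) (auto simp del: den_seq.simps simp: k r_neg)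
    have k_co: "coord k j = (if j = n then \<one> else \<zero>)" for j
      using sR[of n] by (auto simp: coord_def k_num k r_neg)
    have kb: "\<forall>j\<ge>Suc (Suc n). k j = \<zero>" by (auto simp: k)
    have "limit_map k = fraction R T \<zero> (prefix (Suc (Suc n)))"
      using limit_map_eq[OF kF kb] by (simp only: k_num) simp
    also have "\<dots> = \<zero>\<^bsub>?L\<^esub>"
      using T_carrier[OF prefix_mem] T_closed(2) prefix_mem[of "Suc (Suc n)"]
      by (simp add: localization_def fraction_eq_iff del: prefix.simps)
    finally have kK: "k \<in> ?K" using kF by simp
    have "h k = lsum C (Suc (Suc n)) (coord k) c" using h\<phi>[OF kK] \<phi>_eq[OF kK kb] by simp
    also have "coord k = (\<lambda>j. if n = j then \<one> else \<zero>)" using k_co by auto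
    also have "lsum C (Suc (Suc n)) (\<lambda>j. if n = j then \<one> else \<zero>) c = c n"
      by (rule C.lsum_unit) (use c in auto)
    finally have hk: "h k = c n" .
    have "h k = h (?e \<oplus>\<^bsub>?G\<^esub> (\<ominus> ?s n) \<odot>\<^bsub>?G\<^esub> ?e')" by (simp add: k_def)
    also have "\<dots> = h ?e \<oplus>\<^bsub>C\<^esub> h ((\<ominus> ?s n) \<odot>\<^bsub>?G\<^esub> ?e')"
      by (rule hh(2)[OF uF G.smult_closed[OF _ uF]]) (use sR[of n] in simp)
    also have "h ((\<ominus> ?s n) \<odot>\<^bsub>?G\<^esub> ?e') = (\<ominus> ?s n) \<odot>\<^bsub>C\<^esub> h ?e'"
      by (rule hh(3)[OF _ uF]) (use sR[of n] in simp)
    finally have "c n = y n \<oplus>\<^bsub>C\<^esub> (\<ominus>\<^bsub>C\<^esub> (?s n \<odot>\<^bsub>C\<^esub> y (Suc n)))"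
      using hk sR[of n] yC by (simp add: y_def C.smult_l_minus)
    then show ?thesis using yC sR[of n] by (simp add: C.M.a_assoc C.M.l_neg)
  qed
  have "mcong C {\<zero>\<^bsub>C\<^esub>} (y n) (c n \<oplus>\<^bsub>C\<^esub> ?s n \<odot>\<^bsub>C\<^esub> y (Suc n))" for n
    unfolding C.mcong_eq by (intro conjI yn yC C.M.a_closed c C.smult_closed sR)
  with yC show "\<exists>y. (\<forall>n. y n \<in> carrier C) \<and> (\<forall>n. mcong C {\<zero>\<^bsub>C\<^esub>} (y n) (c n \<oplus>\<^bsub>C\<^esub> ?s n \<odot>\<^bsub>C\<^esub> y (Suc n)))"
    by (intro exI[of _ y] conjI allI)
qed

end

end

section \<open>Prime ideals of polynomial rings\<close>

lemma (in ring) ideal_finsum: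
  assumes "ideal I R" "\<And>i. i \<in> S \<Longrightarrow> f i \<in> I"
  shows "finsum R f S \<in> I"
proof -
  interpret I: ideal I R by fact
  show ?thesis using assms(2)
  proof (induct S rule: infinite_finite_induct)
    case (insert x F)
    then have "f \<in> F \<rightarrow> carrier R" "f x \<in> carrier R" using I.Icarr by auto
    then show ?case using insert by (simp add: I.a_closed)
  qed (use I.zero_closed in auto)
qed

lemma (in ring) ideal_diff:
  assumes "ideal I R" "x \<in> I" "y \<in> I"
  shows "x \<ominus> y \<in> I"
proof -
  interpret I: ideal I R by fact
  show ?thesis using assms by (simp add: minus_eq I.a_closed I.a_inv_closed)
qed

lemma (in ring) ideal_mem_cong:
  assumes "ideal I R" "x \<in> carrier R" "y \<in> carrier R" "x \<ominus> y \<in> I"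
  shows "x \<in> I \<longleftrightarrow> y \<in> I"
proof -
  interpret I: ideal I R by fact
  have x: "x = (x \<ominus> y) \<oplus> y" using assms by (simp add: minus_eq a_assoc l_neg)
  have y: "y = x \<ominus> (x \<ominus> y)" using assms by (simp add: minus_eq minus_add r_neg2)
  show ?thesis
  proof
    assume "x \<in> I" then show "y \<in> I" using ideal_diff[OF assms(1) _ assms(4)] y by metis
  next
    assume "y \<in> I" then show "x \<in> I" using I.a_closed[OF assms(4)] x by metis
  qed
qed

context UP_cring
begin

definition ext_ideal :: "'a set \<Rightarrow> (nat \<Rightarrow> 'a) set"
  where "ext_ideal q = {f \<in> carrier P. \<forall>n. coeff P f n \<in> q}"

definition const_ideal :: "(nat \<Rightarrow> 'a) set \<Rightarrow> 'a set"
  where "const_ideal J = {a \<in> carrier R. monom P a 0 \<in> J}"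

definition lead :: "(nat \<Rightarrow> 'a) \<Rightarrow> 'a"
  where "lead f = coeff P f (deg R f)"

lemma coeff_of_function:
  assumes "\<And>n. f n \<in> carrier R" "\<And>n. N < n \<Longrightarrow> f n = \<zero>"
  shows "f \<in> carrier P" "coeff P f n = f n"
proof -
  have "f \<in> up R" by (rule mem_upI) (use assms in \<open>auto simp: bound_def intro!: exI[of _ N]\<close>)
  then show "f \<in> carrier P" "coeff P f n = f n" by (simp_all add: P_def UP_def)
qed

lemma ext_ideal_ideal:
  assumes q: "ideal q R"
  shows "ideal (ext_ideal q) P"
proof -
  interpret q: ideal q R by fact
  have r: "x \<otimes>\<^bsub>P\<^esub> a \<in> ext_ideal q" if "a \<in> ext_ideal q" "x \<in> carrier P" for a x
    using that unfolding ext_ideal_def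
    by (auto intro!: R.ideal_finsum[OF q] q.I_l_closed simp: coeff_mult)
  show ?thesis
  proof (rule idealI[OF P.ring_axioms])
    show "subgroup (ext_ideal q) (add_monoid P)"
    proof
      fix x assume "x \<in> ext_ideal q"
      then show "inv\<^bsub>add_monoid P\<^esub> x \<in> ext_ideal q"
        using q.a_inv_closed by (auto simp: ext_ideal_def simp flip: a_inv_def)
    qed (auto simp: ext_ideal_def q.a_closed)
    fix a x assume ax: "a \<in> ext_ideal q" "x \<in> carrier P"
    then have "a \<in> carrier P" by (auto simp: ext_ideal_def)
    then show "a \<otimes>\<^bsub>P\<^esub> x \<in> ext_ideal q" using r[OF ax] ax P.m_comm by simp
  qed (rule r)
qed

lemma const_ideal_ideal:
  assumes J: "ideal J P"
  shows "ideal (const_ideal J) R"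
proof -
  interpret J: ideal J P by fact
  have m: "monom P (a \<otimes> b) 0 = monom P a 0 \<otimes>\<^bsub>P\<^esub> monom P b 0" if "a \<in> carrier R" "b \<in> carrier R" for a b
    using monom_mult[of a b 0 0] that by simp
  show ?thesis
  proof (rule idealI[OF R.ring_axioms])
    show "subgroup (const_ideal J) (add_monoid R)"
    proof
      fix x assume "x \<in> const_ideal J"
      then show "inv\<^bsub>add_monoid R\<^esub> x \<in> const_ideal J"
        using J.a_inv_closed by (auto simp: const_ideal_def simp flip: a_inv_def)
    qed (use J.zero_closed J.a_closed in \<open>auto simp: const_ideal_def\<close>)
  qed (use J.I_l_closed J.I_r_closed in \<open>auto simp: const_ideal_def m\<close>)
qed

lemma ext_const_ideal:
  assumes J: "ideal J P"
  shows "ext_ideal (const_ideal J) \<subseteq> J"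
proof
  fix f assume "f \<in> ext_ideal (const_ideal J)"
  then have f: "f \<in> carrier P" and c: "\<And>n. monom P (coeff P f n) 0 \<in> J"
    by (auto simp: ext_ideal_def const_ideal_def)
  have "monom P (coeff P f i) i \<in> J" for i
  proof -
    have "monom P (coeff P f i) i = monom P (coeff P f i) 0 \<otimes>\<^bsub>P\<^esub> monom P \<one> i"
      using monom_mult[of "coeff P f i" \<one> 0 i] f by simp
    then show ?thesis using ideal.I_r_closed[OF J c] by simp
  qed
  then have "(\<Oplus>\<^bsub>P\<^esub>i\<in>{..deg R f}. monom P (coeff P f i) i) \<in> J"
    by (intro P.ideal_finsum[OF J])
  then show "f \<in> J" using up_repr[OF f] by simp
qed

lemma coeff_top_mult:
  assumes f: "f \<in> carrier P" and g: "g \<in> carrier P"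
  shows "coeff P (f \<otimes>\<^bsub>P\<^esub> g) (deg R f + deg R g) = lead f \<otimes> lead g"
proof -
  have "coeff P (f \<otimes>\<^bsub>P\<^esub> g) (deg R f + deg R g) =
      (\<Oplus>i\<in>{..deg R f + deg R g}. if deg R f = i then lead f \<otimes> lead g else \<zero>)"
    unfolding coeff_mult[OF f g]
  proof (rule R.finsum_cong')
    fix i assume "i \<in> {..deg R f + deg R g}"
    show "coeff P f i \<otimes> coeff P g (deg R f + deg R g - i) = (if deg R f = i then lead f \<otimes> lead g else \<zero>)"
    proof (cases "deg R f = i")
      case False
      then have "deg R f < i \<or> deg R g < deg R f + deg R g - i" by auto
      then show ?thesis using False f g deg_aboveD[of f i] deg_aboveD[of g "deg R f + deg R g - i"] by auto
    qed (auto simp: lead_def)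
  qed (use f g in \<open>auto simp: lead_def\<close>)
  also have "\<dots> = lead f \<otimes> lead g"
    by (rule R.finsum_singleton) (use f g in \<open>auto simp: lead_def\<close>)
  finally show ?thesis .
qed

text \<open>Drop the coefficients above the last one that lies outside \<open>q\<close>.\<close>

lemma truncate_mod:
  assumes q: "ideal q R" and f: "f \<in> carrier P" "f \<notin> ext_ideal q"
  shows "\<exists>f'\<in>carrier P. f \<ominus>\<^bsub>P\<^esub> f' \<in> ext_ideal q \<and> deg R f' \<le> deg R f \<and> lead f' \<notin> q"
proof -
  interpret q: ideal q R by fact
  from f obtain m where m: "coeff P f m \<notin> q" by (auto simp: ext_ideal_def)
  have le: "n \<le> deg R f" if "coeff P f n \<notin> q" for n
    using that f(1) deg_aboveD[of f n] q.zero_closed by (cases "n \<le> deg R f") auto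
  define n where "n = (GREATEST n. coeff P f n \<notin> q)"
  have n: "coeff P f n \<notin> q" unfolding n_def by (rule GreatestI_nat[of "\<lambda>n. coeff P f n \<notin> q" m "deg R f", OF m]) (rule le)
  have above: "coeff P f k \<in> q" if "n < k" for k
  proof (rule ccontr)
    assume "coeff P f k \<notin> q"
    then have "k \<le> n" unfolding n_def by (rule Greatest_le_nat[of "\<lambda>n. coeff P f n \<notin> q" k "deg R f"]) (use le in auto)
    then show False using that by simp
  qed
  define f' where "f' i = (if i \<le> n then coeff P f i else \<zero>)" for i
  have f': "f' \<in> carrier P" and c: "coeff P f' i = f' i" for i
    by (rule coeff_of_function[where N=n]; use f(1) in \<open>simp add: f'_def\<close>)+
  have nz: "coeff P f n \<noteq> \<zero>" using n q.zero_closed by auto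
  have deg: "deg R f' = n"
    by (rule le_antisym[OF deg_aboveI deg_belowI]) (use f' c nz in \<open>auto simp: f'_def\<close>)
  have "f \<ominus>\<^bsub>P\<^esub> f' \<in> ext_ideal q"
    using f(1) f' above c q.zero_closed
    by (auto simp: ext_ideal_def coeff_minus) (auto simp: f'_def R.minus_eq R.r_neg not_le)
  then show ?thesis
    using f' deg le[OF n] n c by (intro bexI[of _ f']) (auto simp: lead_def f'_def)
qed

text \<open>Modulo the extension of \<open>q\<close>, both factors have leading coefficients outside \<open>q\<close>, and so has the
  product.\<close>

lemma ext_ideal_prime:
  assumes q: "primeideal q R" and f: "f \<in> carrier P" "f \<notin> ext_ideal q" and g: "g \<in> carrier P" "g \<notin> ext_ideal q"
  shows "f \<otimes>\<^bsub>P\<^esub> g \<notin> ext_ideal q"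
proof
  assume fg: "f \<otimes>\<^bsub>P\<^esub> g \<in> ext_ideal q"
  have qi: "ideal q R" by (rule primeideal.axioms(1)[OF q])
  note E = ext_ideal_ideal[OF qi]
  interpret E: ideal "ext_ideal q" P by (rule E)
  obtain f' g' where f': "f' \<in> carrier P" "f \<ominus>\<^bsub>P\<^esub> f' \<in> ext_ideal q" "lead f' \<notin> q"
    and g': "g' \<in> carrier P" "g \<ominus>\<^bsub>P\<^esub> g' \<in> ext_ideal q" "lead g' \<notin> q"
    using truncate_mod[OF qi f] truncate_mod[OF qi g] by blast
  have "(f \<otimes>\<^bsub>P\<^esub> g) \<ominus>\<^bsub>P\<^esub> (f' \<otimes>\<^bsub>P\<^esub> g') = (f \<ominus>\<^bsub>P\<^esub> f') \<otimes>\<^bsub>P\<^esub> g \<oplus>\<^bsub>P\<^esub> f' \<otimes>\<^bsub>P\<^esub> (g \<ominus>\<^bsub>P\<^esub> g')"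
    using f g f' g' by (simp add: P.minus_eq P.l_distr P.r_distr P.l_minus P.r_minus P.a_assoc P.r_neg1)
  also have "\<dots> \<in> ext_ideal q"
    using f g f' g' by (intro E.a_closed E.I_l_closed E.I_r_closed) auto
  finally have "f' \<otimes>\<^bsub>P\<^esub> g' \<in> ext_ideal q"
    using P.ideal_mem_cong[OF E, of "f \<otimes>\<^bsub>P\<^esub> g" "f' \<otimes>\<^bsub>P\<^esub> g'"] f g f' g' fg by simp
  then have "lead f' \<otimes> lead g' \<in> q"
    using coeff_top_mult[OF f'(1) g'(1)] unfolding ext_ideal_def by (metis (mono_tags) mem_Collect_eq)
  then show False
    using primeideal.I_prime[OF q, of "lead f'" "lead g'"] f' g' by (simp add: lead_def)
qed

lemma const_ideal_prime:
  assumes J: "primeideal J P"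
  shows "primeideal (const_ideal J) R"
proof (rule primeidealI[OF const_ideal_ideal R.is_cring])
  show "ideal J P" by (rule primeideal.axioms(1)[OF J])
  show "carrier R \<noteq> const_ideal J"
  proof
    assume "carrier R = const_ideal J"
    then have "\<one> \<in> const_ideal J" using R.one_closed by (rule subst)
    then have "\<one>\<^bsub>P\<^esub> \<in> J" by (simp add: const_ideal_def)
    then show False
      using ideal.one_imp_carrier[OF primeideal.axioms(1)[OF J]] primeideal.I_notcarr[OF J] by simp
  qed
  fix a b assume "a \<in> carrier R" "b \<in> carrier R" "a \<otimes> b \<in> const_ideal J"
  moreover then have "monom P a 0 \<otimes>\<^bsub>P\<^esub> monom P b 0 \<in> J"
    using monom_mult[of a b 0 0] by (simp add: const_ideal_def)
  ultimately show "a \<in> const_ideal J \<or> b \<in> const_ideal J"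
    using primeideal.I_prime[OF J] by (auto simp: const_ideal_def)
qed

text \<open>Let \<open>q\<close> be the contraction of the prime \<open>J\<close> to \<open>R\<close>. If \<open>J\<close> is larger than the extension of \<open>q\<close>, then
  \<open>J\<close> is maximal after the constants outside \<open>q\<close> are inverted. This is division with remainder over
  the residue field of \<open>q\<close>, performed with pseudo-division and leading coefficients outside \<open>q\<close>.\<close>

lemma prime_contraction_unit:
  assumes J: "primeideal J P" and f0: "f0 \<in> J" "f0 \<notin> ext_ideal (const_ideal J)"
    and r: "r \<in> carrier P" "r \<notin> J"
  shows "\<exists>u\<in>carrier P. \<exists>a\<in>carrier R - const_ideal J. u \<otimes>\<^bsub>P\<^esub> r \<ominus>\<^bsub>P\<^esub> monom P a 0 \<in> J"
proof -
  define q where "q = const_ideal J"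
  have Ji: "ideal J P" by (rule primeideal.axioms(1)[OF J])
  interpret J: ideal J P by (rule Ji)
  have q: "primeideal q R" unfolding q_def by (rule const_ideal_prime[OF J])
  have qi: "ideal q R" by (rule primeideal.axioms(1)[OF q])
  interpret q: ideal q R by (rule qi)
  have EJ: "ext_ideal q \<subseteq> J" unfolding q_def by (rule ext_const_ideal[OF Ji])
  interpret E: ideal "ext_ideal q" P by (rule ext_ideal_ideal[OF qi])
  \<comment> \<open>The elements that are multiples of \<open>r\<close> modulo \<open>J\<close>.\<close>
  define I where "I = {h \<in> carrier P. \<exists>u\<in>carrier P. u \<otimes>\<^bsub>P\<^esub> r \<ominus>\<^bsub>P\<^esub> h \<in> J}"
  have Iadd: "h \<oplus>\<^bsub>P\<^esub> j \<in> I" if "h \<in> I" "j \<in> J" for h j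
  proof -
    from that obtain u where u: "h \<in> carrier P" "u \<in> carrier P" "u \<otimes>\<^bsub>P\<^esub> r \<ominus>\<^bsub>P\<^esub> h \<in> J" by (auto simp: I_def)
    have "u \<otimes>\<^bsub>P\<^esub> r \<ominus>\<^bsub>P\<^esub> (h \<oplus>\<^bsub>P\<^esub> j) = (u \<otimes>\<^bsub>P\<^esub> r \<ominus>\<^bsub>P\<^esub> h) \<ominus>\<^bsub>P\<^esub> j"
      using u r J.Icarr[OF that(2)] by (simp add: P.minus_eq P.minus_add P.a_assoc)
    then have "u \<otimes>\<^bsub>P\<^esub> r \<ominus>\<^bsub>P\<^esub> (h \<oplus>\<^bsub>P\<^esub> j) \<in> J" using P.ideal_diff[OF Ji u(3) that(2)] by simp
    then show ?thesis
      unfolding I_def using u J.Icarr[OF that(2)] by (intro CollectI conjI bexI[of _ u]) auto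
  qed
  have Imult: "p \<otimes>\<^bsub>P\<^esub> h \<in> I" if "h \<in> I" "p \<in> carrier P" for h p
  proof -
    from that obtain u where u: "h \<in> carrier P" "u \<in> carrier P" "u \<otimes>\<^bsub>P\<^esub> r \<ominus>\<^bsub>P\<^esub> h \<in> J" by (auto simp: I_def)
    have "(p \<otimes>\<^bsub>P\<^esub> u) \<otimes>\<^bsub>P\<^esub> r \<ominus>\<^bsub>P\<^esub> p \<otimes>\<^bsub>P\<^esub> h = p \<otimes>\<^bsub>P\<^esub> (u \<otimes>\<^bsub>P\<^esub> r \<ominus>\<^bsub>P\<^esub> h)"
      using u r that by (simp add: P.minus_eq P.r_distr P.r_minus P.m_assoc)
    then have "(p \<otimes>\<^bsub>P\<^esub> u) \<otimes>\<^bsub>P\<^esub> r \<ominus>\<^bsub>P\<^esub> p \<otimes>\<^bsub>P\<^esub> h \<in> J" using J.I_l_closed[OF u(3) that(2)] by simp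
    then show ?thesis
      unfolding I_def using u that by (intro CollectI conjI bexI[of _ "p \<otimes>\<^bsub>P\<^esub> u"]) auto
  qed
  have trunc: "\<exists>h'. h' \<in> I \<and> h' \<notin> J \<and> lead h' \<notin> q \<and> deg R h' \<le> deg R h" if h: "h \<in> I" "h \<notin> J" for h
  proof -
    have hP: "h \<in> carrier P" using h by (simp add: I_def)
    obtain h' where h': "h' \<in> carrier P" "h \<ominus>\<^bsub>P\<^esub> h' \<in> ext_ideal q" "deg R h' \<le> deg R h" "lead h' \<notin> q"
      using truncate_mod[OF qi hP] h EJ by blast
    have d: "h \<ominus>\<^bsub>P\<^esub> h' \<in> J" using h' EJ by blast
    have "h' \<notin> J" using P.ideal_mem_cong[OF Ji hP h'(1) d] h by simp
    moreover have "h \<oplus>\<^bsub>P\<^esub> (\<ominus>\<^bsub>P\<^esub> (h \<ominus>\<^bsub>P\<^esub> h')) \<in> I" by (rule Iadd[OF h(1) J.a_inv_closed[OF d]])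
    moreover have "h \<oplus>\<^bsub>P\<^esub> (\<ominus>\<^bsub>P\<^esub> (h \<ominus>\<^bsub>P\<^esub> h')) = h'"
      using hP h' by (simp add: P.minus_eq P.minus_add P.r_neg2)
    ultimately show ?thesis using h' by auto
  qed
  have rI: "r \<in> I"
    using r J.zero_closed by (auto simp: I_def P.minus_eq P.r_neg intro!: bexI[of _ "\<one>\<^bsub>P\<^esub>"])
  \<comment> \<open>\<open>g\<close> has least degree in \<open>I - J\<close>, and \<open>f\<close> has least degree in \<open>J\<close> outside the extension of \<open>q\<close>.\<close>
  obtain g where g: "g \<in> I" "g \<notin> J" "lead g \<notin> q"
    and gmin: "\<And>h. h \<in> I \<Longrightarrow> h \<notin> J \<Longrightarrow> lead h \<notin> q \<Longrightarrow> deg R g \<le> deg R h"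
    using trunc[OF rI r(2)] ex_has_least_nat[of "\<lambda>h. h \<in> I \<and> h \<notin> J \<and> lead h \<notin> q" _ "deg R"] by blast
  have gmin': "deg R g \<le> deg R h" if "h \<in> I" "h \<notin> J" for h
    using trunc[OF that] gmin by (meson le_trans)
  obtain f0' where f0': "f0' \<in> carrier P" "f0 \<ominus>\<^bsub>P\<^esub> f0' \<in> ext_ideal q" "lead f0' \<notin> q"
    using truncate_mod[OF qi _ f0(2)[folded q_def]] f0 J.Icarr by blast
  have "f0' \<in> J" using P.ideal_mem_cong[OF Ji J.Icarr[OF f0(1)] f0'(1)] f0' f0 EJ by blast
  then obtain f where f: "f \<in> J" "lead f \<notin> q"
    and fmin: "\<And>h. h \<in> J \<Longrightarrow> lead h \<notin> q \<Longrightarrow> deg R f \<le> deg R h"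
    using f0'(3) ex_has_least_nat[of "\<lambda>h. h \<in> J \<and> lead h \<notin> q" f0' "deg R"] by blast
  have fmin': "deg R f \<le> deg R h" if h: "h \<in> J" "h \<notin> ext_ideal q" for h
  proof -
    obtain h' where h': "h' \<in> carrier P" "h \<ominus>\<^bsub>P\<^esub> h' \<in> ext_ideal q" "deg R h' \<le> deg R h" "lead h' \<notin> q"
      using truncate_mod[OF qi J.Icarr[OF h(1)] h(2)] by blast
    then have "h' \<in> J" using P.ideal_mem_cong[OF Ji J.Icarr[OF h(1)] h'(1)] h EJ by blast
    then show ?thesis using fmin[OF _ h'(4)] h' by simp
  qed
  have fP: "f \<in> carrier P" and gP: "g \<in> carrier P" using f J.Icarr g by (auto simp: I_def)
  have f_nz: "f \<noteq> \<zero>\<^bsub>P\<^esub>" and g_nz: "g \<noteq> \<zero>\<^bsub>P\<^esub>"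
    using f g q.zero_closed by (auto simp: lead_def)
  have powq: "c [^] (k::nat) \<notin> q" if "c \<in> carrier R" "c \<notin> q" for c k
  proof (induct k)
    case 0
    then show ?case using q.one_imp_carrier primeideal.I_notcarr[OF q] by auto
  next
    case (Suc k)
    then show ?case using primeideal.I_prime[OF q, of "c [^] k" c] that by auto
  qed
  have smJ: "c \<odot>\<^bsub>P\<^esub> h \<in> J \<longleftrightarrow> h \<in> J" if c: "c \<in> carrier R" "c \<notin> q" and h: "h \<in> carrier P" for c h
  proof -
    have e: "c \<odot>\<^bsub>P\<^esub> h = monom P c 0 \<otimes>\<^bsub>P\<^esub> h" using monom_mult_is_smult[OF c(1) h] by simp
    have "monom P c 0 \<notin> J" using c unfolding q_def const_ideal_def by blast
    show ?thesis
    proof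
      assume "c \<odot>\<^bsub>P\<^esub> h \<in> J"
      then show "h \<in> J"
        using primeideal.I_prime[OF J monom_closed[OF c(1)] h] \<open>monom P c 0 \<notin> J\<close> unfolding e by blast
    next
      assume "h \<in> J"
      then show "c \<odot>\<^bsub>P\<^esub> h \<in> J" unfolding e by (rule J.I_l_closed[OF _ monom_closed[OF c(1)]])
    qed
  qed
  have smI: "c \<odot>\<^bsub>P\<^esub> h \<in> I" if c: "c \<in> carrier R" and h: "h \<in> I" for c h
    using Imult[OF h, of "monom P c 0"] monom_mult_is_smult[of c h] c h by (auto simp: I_def)
  have remI: "s \<in> I" if "x \<in> I" "y \<in> J" "s \<in> carrier P" "x = y \<oplus>\<^bsub>P\<^esub> s" for x y s
  proof -
    have "x \<oplus>\<^bsub>P\<^esub> (\<ominus>\<^bsub>P\<^esub> y) = s"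
      using that J.Icarr[OF that(2)] by (simp add: P.a_comm[of y s] P.a_assoc P.r_neg)
    then show ?thesis using Iadd[OF that(1) J.a_inv_closed[OF that(2)]] by simp
  qed
  \<comment> \<open>By minimality of \<open>g\<close>, division of \<open>g\<close> by \<open>f\<close> shows \<open>deg R g \<le> deg R f\<close>. If \<open>deg R g\<close> were positive,
    divide \<open>f\<close> by \<open>g\<close>: by minimality of \<open>g\<close> the remainder lies in \<open>J\<close>, and it has smaller degree than \<open>f\<close>, so it lies in the
    extension of \<open>q\<close>. As \<open>g\<close> is outside the prime \<open>J\<close>, the quotient is in \<open>J\<close>. Modulo \<open>q\<close> its degree is smaller than
    that of \<open>f\<close>, so it lies in the extension of \<open>q\<close> as well, and then so does a multiple of \<open>f\<close> by a
    constant outside \<open>q\<close>.\<close>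
  have "deg R g = 0"
  proof (rule ccontr)
    assume d: "deg R g \<noteq> 0"
    have gf: "deg R g \<le> deg R f"
    proof (rule ccontr)
      assume gt: "\<not> deg R g \<le> deg R f"
      obtain q0 s k where qs: "q0 \<in> carrier P" "s \<in> carrier P"
        and e: "lead f [^] (k::nat) \<odot>\<^bsub>P\<^esub> g = f \<otimes>\<^bsub>P\<^esub> q0 \<oplus>\<^bsub>P\<^esub> s" and s: "s = \<zero>\<^bsub>P\<^esub> \<or> deg R s < deg R f"
        using long_div_theorem[OF fP gP f_nz] unfolding lead_def by blast
      have c: "lead f [^] k \<in> carrier R" "lead f [^] k \<notin> q"
        using powq[of "lead f" k] f fP by (auto simp: lead_def)
      have y: "f \<otimes>\<^bsub>P\<^esub> q0 \<in> J" by (rule J.I_r_closed[OF f(1) qs(1)])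
      have "s \<in> I" by (rule remI[OF smI[OF c(1) g(1)] y qs(2) e])
      moreover have "s \<notin> J"
      proof
        assume "s \<in> J"
        then have "lead f [^] k \<odot>\<^bsub>P\<^esub> g \<in> J" unfolding e by (rule J.a_closed[OF y])
        then show False using smJ[OF c gP] g by simp
      qed
      ultimately have "deg R g \<le> deg R s" "s \<noteq> \<zero>\<^bsub>P\<^esub>" using gmin' J.zero_closed by auto
      then show False using s gt by simp
    qed
    obtain q0 s k where qs: "q0 \<in> carrier P" "s \<in> carrier P"
      and e: "lead g [^] (k::nat) \<odot>\<^bsub>P\<^esub> f = g \<otimes>\<^bsub>P\<^esub> q0 \<oplus>\<^bsub>P\<^esub> s" and s: "s = \<zero>\<^bsub>P\<^esub> \<or> deg R s < deg R g"
      using long_div_theorem[OF gP fP g_nz] unfolding lead_def by blast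
    let ?c = "lead g [^] k"
    have c: "?c \<in> carrier R" "?c \<notin> q" using powq[of "lead g" k] g gP by (auto simp: lead_def)
    have cf: "?c \<odot>\<^bsub>P\<^esub> f \<in> J" using smJ[OF c fP] f by simp
    have gq: "g \<otimes>\<^bsub>P\<^esub> q0 \<in> carrier P" using gP qs by simp
    have "s \<in> J"
    proof (rule ccontr)
      assume "s \<notin> J"
      have gI: "g \<otimes>\<^bsub>P\<^esub> q0 \<in> I" using Imult[OF g(1) qs(1)] gP qs by (simp add: P.m_comm)
      have "(\<ominus>\<^bsub>P\<^esub> \<one>\<^bsub>P\<^esub>) \<otimes>\<^bsub>P\<^esub> (g \<otimes>\<^bsub>P\<^esub> q0) \<oplus>\<^bsub>P\<^esub> ?c \<odot>\<^bsub>P\<^esub> f \<in> I"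
        by (rule Iadd[OF Imult[OF gI] cf]) simp
      also have "(\<ominus>\<^bsub>P\<^esub> \<one>\<^bsub>P\<^esub>) \<otimes>\<^bsub>P\<^esub> (g \<otimes>\<^bsub>P\<^esub> q0) \<oplus>\<^bsub>P\<^esub> ?c \<odot>\<^bsub>P\<^esub> f = s"
        unfolding e using gq qs by (simp add: P.l_minus P.r_neg1)
      finally have "deg R g \<le> deg R s" using gmin' \<open>s \<notin> J\<close> by blast
      then show False using s d \<open>s \<notin> J\<close> J.zero_closed by auto
    qed
    have sE: "s \<in> ext_ideal q"
    proof (rule ccontr)
      assume "s \<notin> ext_ideal q"
      then have "deg R f \<le> deg R s" "s \<noteq> \<zero>\<^bsub>P\<^esub>" using fmin'[OF \<open>s \<in> J\<close>] E.zero_closed by auto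
      then show False using s gf by simp
    qed
    have "g \<otimes>\<^bsub>P\<^esub> q0 = ?c \<odot>\<^bsub>P\<^esub> f \<ominus>\<^bsub>P\<^esub> s"
      unfolding e using gq qs by (simp add: P.minus_eq P.a_assoc P.r_neg)
    then have "g \<otimes>\<^bsub>P\<^esub> q0 \<in> J" using P.ideal_diff[OF Ji cf \<open>s \<in> J\<close>] by simp
    then have q0J: "q0 \<in> J" using primeideal.I_prime[OF J gP qs(1)] g by blast
    have "q0 \<in> ext_ideal q"
    proof (rule ccontr)
      assume nq: "q0 \<notin> ext_ideal q"
      obtain p where p: "p \<in> carrier P" "q0 \<ominus>\<^bsub>P\<^esub> p \<in> ext_ideal q" "lead p \<notin> q"
        using truncate_mod[OF qi qs(1) nq] by blast
      have "p \<in> J" using P.ideal_mem_cong[OF Ji qs(1) p(1)] p EJ q0J by blast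
      then have fp: "deg R f \<le> deg R p" using fmin p by blast
      let ?N = "deg R g + deg R p"
      have N: "deg R f < ?N" using d fp by simp
      have "(?c \<odot>\<^bsub>P\<^esub> f) \<ominus>\<^bsub>P\<^esub> g \<otimes>\<^bsub>P\<^esub> p = g \<otimes>\<^bsub>P\<^esub> (q0 \<ominus>\<^bsub>P\<^esub> p) \<oplus>\<^bsub>P\<^esub> s"
        unfolding e using gP qs p by (simp add: P.minus_eq P.r_distr P.r_minus P.a_ac)
      also have "\<dots> \<in> ext_ideal q" by (intro E.a_closed E.I_l_closed p(2) gP sE)
      finally have "coeff P ((?c \<odot>\<^bsub>P\<^esub> f) \<ominus>\<^bsub>P\<^esub> g \<otimes>\<^bsub>P\<^esub> p) ?N \<in> q" unfolding ext_ideal_def by blast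
      then have "\<ominus> (lead g \<otimes> lead p) \<in> q"
        using N c fP gP p coeff_top_mult[OF gP p(1)] deg_aboveD[OF N fP]
        by (simp add: coeff_minus R.minus_eq lead_def)
      then have "lead g \<otimes> lead p \<in> q" using q.a_inv_closed gP p by (fastforce simp: lead_def)
      then show False using primeideal.I_prime[OF q, of "lead g" "lead p"] g p gP by (simp add: lead_def)
    qed
    then have "g \<otimes>\<^bsub>P\<^esub> q0 \<oplus>\<^bsub>P\<^esub> s \<in> ext_ideal q" using sE gP by (intro E.a_closed E.I_l_closed)
    then have "coeff P (?c \<odot>\<^bsub>P\<^esub> f) (deg R f) \<in> q" unfolding e ext_ideal_def by blast
    then have "?c \<otimes> lead f \<in> q" using c fP by (simp add: lead_def)
    then show False using primeideal.I_prime[OF q, of ?c "lead f"] c f fP by (simp add: lead_def)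
  qed
  then have "g = monom P (lead g) 0" unfolding lead_def using deg_zero_impl_monom[OF gP] by simp
  moreover obtain u where "u \<in> carrier P" "u \<otimes>\<^bsub>P\<^esub> r \<ominus>\<^bsub>P\<^esub> g \<in> J" using g by (auto simp: I_def)
  moreover have "lead g \<in> carrier R" using gP by (simp add: lead_def)
  ultimately show ?thesis using g(3) unfolding q_def by (metis DiffI)
qed

end

section \<open>Polynomials over a principal ideal domain\<close>

locale UP_principal = UP_domain R P + principal_domain R for R (structure) and P (structure)
begin

text \<open>Hilbert's basis theorem. The coefficients at \<open>n\<close> of the elements of \<open>I\<close> of degree at most \<open>n\<close> form an
  ideal. These ideals increase, hence become constant, and as each of them is principal, finitely many
  polynomials realize their generators.\<close>

theorem UP_noetherian: "noetherian_ring P"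
proof (rule P.noetherian_ringI)
  fix I assume I: "ideal I P"
  interpret I: ideal I P by (rule I)
  define L where "L n = {coeff P h n | h. h \<in> I \<and> (\<forall>m>n. coeff P h m = \<zero>)}" for n
  have L: "ideal (L n) R" for n
  proof (rule idealI[OF R.ring_axioms])
    have mult: "x \<otimes> a \<in> L n" if "a \<in> L n" "x \<in> carrier R" for a x
    proof -
      from that obtain h where h: "h \<in> I" "\<forall>m>n. coeff P h m = \<zero>" "a = coeff P h n" by (auto simp: L_def)
      have hP: "h \<in> carrier P" using h I.Icarr by blast
      have "x \<odot>\<^bsub>P\<^esub> h \<in> I"
        using monom_mult_is_smult[OF that(2) hP] I.I_l_closed[OF h(1), of "monom P x 0"] that by simp
      then show ?thesis unfolding L_def using h hP that
        by (intro CollectI exI[of _ "x \<odot>\<^bsub>P\<^esub> h"]) auto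
    qed
    show "x \<otimes> a \<in> L n" "a \<otimes> x \<in> L n" if "a \<in> L n" "x \<in> carrier R" for a x
    proof -
      have "a \<in> carrier R" using that I.Icarr by (auto simp: L_def)
      then show "x \<otimes> a \<in> L n" "a \<otimes> x \<in> L n" using mult[OF that] that R.m_comm by auto
    qed
    show "subgroup (L n) (add_monoid R)"
    proof
      show "L n \<subseteq> carrier (add_monoid R)" using I.Icarr by (auto simp: L_def)
      show "\<one>\<^bsub>add_monoid R\<^esub> \<in> L n"
        using I.zero_closed unfolding L_def by (auto intro!: exI[of _ "\<zero>\<^bsub>P\<^esub>"])
      fix x assume x: "x \<in> L n"
      then have "x \<in> carrier R" using I.Icarr by (auto simp: L_def)
      then show "inv\<^bsub>add_monoid R\<^esub> x \<in> L n"
        using mult[OF x, of "\<ominus> \<one>"] by (simp add: R.l_minus flip: a_inv_def)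
      fix y assume "y \<in> L n"
      with x obtain h k where "h \<in> I" "\<forall>m>n. coeff P h m = \<zero>" "x = coeff P h n"
        "k \<in> I" "\<forall>m>n. coeff P k m = \<zero>" "y = coeff P k n" by (auto simp: L_def)
      then show "x \<otimes>\<^bsub>add_monoid R\<^esub> y \<in> L n"
        unfolding L_def using I.Icarr I.a_closed by (intro CollectI exI[of _ "h \<oplus>\<^bsub>P\<^esub> k"]) auto
    qed
  qed
  have L_Suc: "L n \<subseteq> L (Suc n)" for n
  proof
    fix x assume "x \<in> L n"
    then obtain h where h: "h \<in> I" "\<forall>m>n. coeff P h m = \<zero>" "x = coeff P h n" by (auto simp: L_def)
    have hP: "h \<in> carrier P" using h I.Icarr by blast
    have c: "coeff P (monom P \<one> 1 \<otimes>\<^bsub>P\<^esub> h) (Suc m) = coeff P h m" for m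
      using coeff_monom_mult[OF R.one_closed hP, of 1 m] hP by simp
    have "coeff P (monom P \<one> 1 \<otimes>\<^bsub>P\<^esub> h) m = \<zero>" if "m > Suc n" for m
      using c[of "m - 1"] h(2) that by simp
    then show "x \<in> L (Suc n)"
      unfolding L_def using h c[of n] I.I_l_closed[OF h(1), of "monom P \<one> 1"]
      by (intro CollectI exI[of _ "monom P \<one> 1 \<otimes>\<^bsub>P\<^esub> h"]) auto
  qed
  have mono: "L m \<subseteq> L n" if "m \<le> n" for m n by (rule lift_Suc_mono_le[of L, OF L_Suc that])
  have "subset.chain {I. ideal I R} (range L)"
    unfolding subset_chain_def
  proof (intro conjI ballI)
    show "range L \<subseteq> {I. ideal I R}" using L by blast
    fix X Y assume "X \<in> range L" "Y \<in> range L"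
    then obtain m n where "X = L m" "Y = L n" by blast
    then show "X \<subseteq> Y \<or> Y \<subseteq> X" using mono[of m n] mono[of n m] by (cases "m \<le> n") auto
  qed
  then have "\<Union>(range L) \<in> range L" by (intro ideal_chain_is_trivial) auto
  then obtain D where D: "\<Union>(range L) = L D" by blast
  have "\<exists>f. f \<in> I \<and> (\<forall>m>n. coeff P f m = \<zero>) \<and> (\<forall>x\<in>L n. \<exists>c\<in>carrier R. x = c \<otimes> coeff P f n)" for n
  proof -
    obtain a where a: "a \<in> carrier R" "L n = PIdl a" using exists_gen[OF L] by blast
    have "a \<in> L n" using a R.cgenideal_self by simp
    then obtain f where f: "f \<in> I" "\<forall>m>n. coeff P f m = \<zero>" "a = coeff P f n" by (auto simp: L_def)
    then show ?thesis using a(2) by (intro exI[of _ f]) (auto simp: cgenideal_def)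
  qed
  from choice[OF allI[OF this]] obtain f where F: "\<forall>n. f n \<in> I \<and> (\<forall>m>n. coeff P (f n) m = \<zero>) \<and>
      (\<forall>x\<in>L n. \<exists>c\<in>carrier R. x = c \<otimes> coeff P (f n) n)" by (rule exE)
  note f = F[rule_format, THEN conjunct1] F[rule_format, THEN conjunct2, THEN conjunct1, rule_format]
  note fL = F[rule_format, THEN conjunct2, THEN conjunct2, THEN bspec]
  have fP: "f n \<in> carrier P" for n using f I.Icarr by blast
  let ?A = "f ` {..D}"
  have A: "?A \<subseteq> carrier P" using fP by blast
  interpret G: ideal "genideal P ?A" P by (rule P.genideal_ideal[OF A])
  have fG: "f d \<in> genideal P ?A" if "d \<le> D" for d using P.genideal_self[OF A] that by auto
  have "h \<in> genideal P ?A" if "h \<in> I" "\<forall>m\<ge>n. coeff P h m = \<zero>" for h n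
    using that
  proof (induct n arbitrary: h)
    case 0
    then have "h = \<zero>\<^bsub>P\<^esub>" using I.Icarr by (intro up_eqI) auto
    then show ?case using G.zero_closed by simp
  next
    case (Suc n)
    have hP: "h \<in> carrier P" using Suc I.Icarr by blast
    have "coeff P h n \<in> L n" unfolding L_def using Suc by auto
    then have "coeff P h n \<in> L (min n D)" using D by (cases "n \<le> D") auto
    then obtain c where c: "c \<in> carrier R" "coeff P h n = c \<otimes> coeff P (f (min n D)) (min n D)" using fL by blast
    let ?d = "min n D"
    let ?g = "monom P c (n - ?d) \<otimes>\<^bsub>P\<^esub> f ?d"
    have gP: "?g \<in> carrier P" using c fP by simp
    have cg: "coeff P ?g (m + (n - ?d)) = c \<otimes> coeff P (f ?d) m" for m
      by (rule coeff_monom_mult[OF c(1) fP])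
    have "?d + (n - ?d) = n" by simp
    then have gn: "coeff P ?g n = coeff P h n" using cg[of ?d] c(2) by metis
    have gm: "coeff P ?g m = \<zero>" if m: "m > n" for m
    proof -
      have "m - (n - ?d) + (n - ?d) = m" "m - (n - ?d) > ?d" using m by auto
      then show ?thesis using cg[of "m - (n - ?d)"] f(2)[of ?d "m - (n - ?d)"] c(1) by (metis R.r_null)
    qed
    have "h \<ominus>\<^bsub>P\<^esub> ?g \<in> genideal P ?A"
    proof (rule Suc(1))
      show "h \<ominus>\<^bsub>P\<^esub> ?g \<in> I"
        by (rule P.ideal_diff[OF I Suc(2) I.I_l_closed[OF f(1)]]) (use c in simp)
      show "\<forall>m\<ge>n. coeff P (h \<ominus>\<^bsub>P\<^esub> ?g) m = \<zero>"
      proof (intro allI impI)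
        fix m assume "n \<le> m"
        show "coeff P (h \<ominus>\<^bsub>P\<^esub> ?g) m = \<zero>"
        proof (cases "m = n")
          case True
          then show ?thesis using gn hP gP by (simp add: coeff_minus R.minus_eq R.r_neg)
        next
          case False
          then show ?thesis using gm[of m] Suc(3) \<open>n \<le> m\<close> hP gP by (simp add: coeff_minus R.minus_eq)
        qed
      qed
    qed
    moreover have "?g \<in> genideal P ?A" by (rule G.I_l_closed[OF fG]) (use c in auto)
    ultimately have "(h \<ominus>\<^bsub>P\<^esub> ?g) \<oplus>\<^bsub>P\<^esub> ?g \<in> genideal P ?A" by (rule G.a_closed)
    then show ?case using hP gP by (simp add: P.minus_eq P.a_assoc P.l_neg)
  qed
  then have "I \<subseteq> genideal P ?A" using I.Icarr deg_aboveD by (meson Suc_le_lessD subsetI)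
  moreover have "genideal P ?A \<subseteq> I" by (rule P.genideal_minimal[OF I]) (use f in blast)
  ultimately show "\<exists>A\<subseteq>carrier P. finite A \<and> I = genideal P A" using A by (intro exI[of _ ?A]) auto
qed

lemmas P_integral = domain.integral[OF UP_domain]

lemma P_one_not_zero: "\<one>\<^bsub>P\<^esub> \<noteq> \<zero>\<^bsub>P\<^esub>"
  by (rule domain.one_not_zero[OF UP_domain])

lemma content_one_iff:
  "g \<in> content_one_polys R \<longleftrightarrow> g \<in> carrier P \<and>
    (\<forall>d\<in>carrier R. (\<forall>n. d divides coeff P g n) \<longrightarrow> d divides \<one>)"
proof -
  have "\<one> divides coeff P g n" if "g \<in> carrier P" for n
    by (rule R.one_divides[OF coeff_closed[OF that]])
  then show ?thesis
    unfolding content_one_polys_def is_content_def P_def[symmetric] using R.one_closed by blast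
qed

lemma content_oneD:
  "g \<in> content_one_polys R \<Longrightarrow> d \<in> carrier R \<Longrightarrow> (\<And>n. d divides coeff P g n) \<Longrightarrow> d divides \<one>"
  unfolding content_one_iff by blast

lemma content_oneI:
  "g \<in> carrier P \<Longrightarrow> (\<And>d. d \<in> carrier R \<Longrightarrow> (\<And>n. d divides coeff P g n) \<Longrightarrow> d divides \<one>) \<Longrightarrow>
    g \<in> content_one_polys R"
  unfolding content_one_iff by blast

text \<open>The content is a generator of the ideal generated by the coefficients.\<close>

lemma content_factorization:
  assumes f: "f \<in> carrier P" "f \<noteq> \<zero>\<^bsub>P\<^esub>"
  shows "\<exists>c\<in>carrier R - {\<zero>}. \<exists>g\<in>content_one_polys R. f = monom P c 0 \<otimes>\<^bsub>P\<^esub> g"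
proof -
  let ?C = "range (coeff P f)"
  have C: "?C \<subseteq> carrier R" using f by auto
  obtain c where c: "c \<in> carrier R" "genideal R ?C = PIdl c" using exists_gen[OF R.genideal_ideal[OF C]] by blast
  have dvd: "\<exists>x\<in>carrier R. coeff P f n = x \<otimes> c" for n
    using R.genideal_self[OF C] c(2) by (auto simp: cgenideal_def)
  have c0: "c \<noteq> \<zero>"
  proof
    assume "c = \<zero>"
    then have "coeff P f n = \<zero>" for n using dvd[of n] by auto
    then show False using f up_eqI[of f "\<zero>\<^bsub>P\<^esub>"] by auto
  qed
  from dvd have "\<forall>n. \<exists>x. x \<in> carrier R \<and> coeff P f n = x \<otimes> c" by blast
  from choice[OF this] obtain g where g: "\<And>n. g n \<in> carrier R" "\<And>n. coeff P f n = g n \<otimes> c" by blast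
  have g0: "g n = \<zero>" if "deg R f < n" for n
    using deg_aboveD[OF that f(1)] g[of n] R.integral[of "g n" c] c c0 by auto
  note gP = coeff_of_function(1)[where f=g and N="deg R f", OF g(1) g0]
  note cg = coeff_of_function(2)[where f=g and N="deg R f", OF g(1) g0]
  have fg: "f = monom P c 0 \<otimes>\<^bsub>P\<^esub> g"
  proof (rule up_eqI)
    fix n
    have "coeff P (monom P c 0 \<otimes>\<^bsub>P\<^esub> g) n = c \<otimes> g n"
      using coeff_monom_mult[OF c(1) gP, of 0 n] cg by simp
    then show "coeff P f n = coeff P (monom P c 0 \<otimes>\<^bsub>P\<^esub> g) n" using g[of n] c R.m_comm by simp
  qed (use f gP c in auto)
  have "d divides \<one>" if d: "d \<in> carrier R" "\<And>n. d divides coeff P g n" for d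
  proof -
    have dc: "d \<otimes> c \<in> carrier R" using d c by simp
    have "coeff P f n \<in> PIdl (d \<otimes> c)" for n
    proof -
      obtain y where y: "y \<in> carrier R" "g n = d \<otimes> y" using d(2)[of n] cg by (auto simp: factor_def)
      have "coeff P f n = y \<otimes> (d \<otimes> c)" using g(2)[of n] y d c by (simp add: R.m_ac)
      then show ?thesis using y by (auto simp: cgenideal_def)
    qed
    then have "genideal R ?C \<subseteq> PIdl (d \<otimes> c)" by (intro R.genideal_minimal[OF R.cgenideal_ideal[OF dc]]) auto
    then have "c \<in> PIdl (d \<otimes> c)" using c(2) R.cgenideal_self[OF c(1)] by blast
    then obtain y where y: "y \<in> carrier R" "c = y \<otimes> (d \<otimes> c)" by (auto simp: cgenideal_def)
    then have "c \<otimes> \<one> = c \<otimes> (d \<otimes> y)" using d c(1) by (simp add: R.m_ac)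
    then have "\<one> = d \<otimes> y" using R.m_lcancel[OF c0 c(1)] d y by simp
    then show ?thesis using y by (auto simp: factor_def)
  qed
  note dv = this
  have "g \<in> content_one_polys R"
  proof (rule content_oneI)
    show "g \<in> carrier P" by (rule gP)
    show "d divides \<one>" if "d \<in> carrier R" "\<And>n. d divides coeff P g n" for d
      by (rule dv[OF that])
  qed
  then show ?thesis using fg c c0 by blast
qed

lemma nonzero_constants_submonoid: "submonoid (nonzero_constants R) P"
proof
  show "nonzero_constants R \<subseteq> carrier P" by (auto simp: nonzero_constants_def P_def[symmetric])
  show "\<one>\<^bsub>P\<^esub> \<in> nonzero_constants R"
    using R.one_not_zero by (auto simp: nonzero_constants_def P_def[symmetric] image_iff intro!: bexI[of _ \<one>])
  fix x y assume "x \<in> nonzero_constants R" "y \<in> nonzero_constants R"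
  then obtain a b where ab: "a \<in> carrier R" "a \<noteq> \<zero>" "b \<in> carrier R" "b \<noteq> \<zero>"
    "x = monom P a 0" "y = monom P b 0" by (auto simp: nonzero_constants_def P_def[symmetric])
  then have "x \<otimes>\<^bsub>P\<^esub> y = monom P (a \<otimes> b) 0" "a \<otimes> b \<noteq> \<zero>"
    using monom_mult[of a b 0 0] R.integral[of a b] by auto
  then show "x \<otimes>\<^bsub>P\<^esub> y \<in> nonzero_constants R" using ab by (auto simp: nonzero_constants_def P_def[symmetric])
qed

lemma content_one_nonzero: "\<zero>\<^bsub>P\<^esub> \<notin> content_one_polys R"
proof
  assume z: "\<zero>\<^bsub>P\<^esub> \<in> content_one_polys R"
  have "\<zero> divides \<one>"
    by (rule content_oneD[OF z R.zero_closed]) (use R.divides_zero[OF R.zero_closed] in simp)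
  then show False using R.one_not_zero by (auto simp: factor_def)
qed

text \<open>Gauss's lemma: if a nonunit divided all coefficients of the product, then so would an irreducible \<open>b\<close>, and the
  product would lie in the extension of the prime ideal \<open>PIdl b\<close>, which contains neither factor.\<close>

lemma content_one_submonoid: "submonoid (content_one_polys R) P"
proof
  show "content_one_polys R \<subseteq> carrier P" by (auto simp: content_one_iff)
  show "\<one>\<^bsub>P\<^esub> \<in> content_one_polys R"
  proof (rule content_oneI)
    show "d divides \<one>" if "\<And>n. d divides coeff P \<one>\<^bsub>P\<^esub> n" for d using that[of 0] by simp
  qed simp
  fix f g assume fg: "f \<in> content_one_polys R" "g \<in> content_one_polys R"
  then have P: "f \<in> carrier P" "g \<in> carrier P" by (auto simp: content_one_iff)
  have "d divides \<one>" if d: "d \<in> carrier R" "\<And>n. d divides coeff P (f \<otimes>\<^bsub>P\<^esub> g) n" for d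
  proof (rule ccontr)
    assume nd: "\<not> d divides \<one>"
    then have dU: "d \<notin> Units R" using d R.divides_one by blast
    have "d \<noteq> \<zero>"
    proof
      assume "d = \<zero>"
      then have "coeff P (f \<otimes>\<^bsub>P\<^esub> g) n = \<zero>" for n using d(2)[of n] P by (auto simp: factor_def)
      then have "f \<otimes>\<^bsub>P\<^esub> g = \<zero>\<^bsub>P\<^esub>" using P by (intro up_eqI) auto
      then show False using P_integral[of f g] P fg content_one_nonzero by auto
    qed
    then obtain b where b: "b \<in> carrier R" "ring_irreducible b" "b divides d"
      using exists_irreducible_divisor[of d] d dU by blast
    have max: "maximalideal (PIdl b) R" by (rule irreducible_imp_maximalideal[OF b(1,2)])
    then have pr: "primeideal (PIdl b) R" by (rule R.maximalideal_prime)
    have mem: "b divides x" if "x \<in> PIdl b" for x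
      using that b(1) R.m_comm by (auto simp: cgenideal_def factor_def)
    have "h \<notin> ext_ideal (PIdl b)" if h: "h \<in> content_one_polys R" for h
    proof
      assume "h \<in> ext_ideal (PIdl b)"
      then have "\<And>n. b divides coeff P h n" using mem by (auto simp: ext_ideal_def)
      then have "b divides \<one>" by (rule content_oneD[OF h b(1)])
      then have "b \<in> Units R" using R.divides_one[OF b(1)] by blast
      then have "carrier R = PIdl b" using R.ideal_eq_carrier_iff[OF b(1)] by blast
      then show False using maximalideal.I_notcarr[OF max] by blast
    qed
    then have "f \<otimes>\<^bsub>P\<^esub> g \<notin> ext_ideal (PIdl b)" using ext_ideal_prime[OF pr P(1) _ P(2)] fg by blast
    moreover have "coeff P (f \<otimes>\<^bsub>P\<^esub> g) n \<in> PIdl b" for n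
    proof -
      have "b divides coeff P (f \<otimes>\<^bsub>P\<^esub> g) n" using R.divides_trans[OF b(3) d(2) b(1)] by blast
      then show ?thesis using b(1) R.m_comm by (auto simp: cgenideal_def factor_def)
    qed
    ultimately show False using P by (auto simp: ext_ideal_def)
  qed
  note dv = this
  show "f \<otimes>\<^bsub>P\<^esub> g \<in> content_one_polys R"
  proof (rule content_oneI)
    show "f \<otimes>\<^bsub>P\<^esub> g \<in> carrier P" by (rule P.m_closed[OF P])
    show "d divides \<one>" if "d \<in> carrier R" "\<And>n. d divides coeff P (f \<otimes>\<^bsub>P\<^esub> g) n" for d
      by (rule dv[OF that])
  qed
qed

lemma hull_nonzero:
  "(\<lambda>T. submonoid T P) hull (nonzero_constants R \<union> content_one_polys R) = carrier P - {\<zero>\<^bsub>P\<^esub>}"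
    (is "?H = _")
proof
  have nz: "submonoid (carrier P - {\<zero>\<^bsub>P\<^esub>}) P"
  proof
    fix x y assume "x \<in> carrier P - {\<zero>\<^bsub>P\<^esub>}" "y \<in> carrier P - {\<zero>\<^bsub>P\<^esub>}"
    then show "x \<otimes>\<^bsub>P\<^esub> y \<in> carrier P - {\<zero>\<^bsub>P\<^esub>}" using P_integral[of x y] by auto
  qed (use P_one_not_zero in auto)
  show "?H \<subseteq> carrier P - {\<zero>\<^bsub>P\<^esub>}"
  proof (rule hull_minimal[of _ _ "\<lambda>T. submonoid T P", OF _ nz])
    have "monom P a 0 \<noteq> \<zero>\<^bsub>P\<^esub>" if "a \<in> carrier R" "a \<noteq> \<zero>" for a
      using coeff_monom[OF that(1), of 0 0] that(2) coeff_zero[of 0] by auto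
    then show "nonzero_constants R \<union> content_one_polys R \<subseteq> carrier P - {\<zero>\<^bsub>P\<^esub>}"
      using content_one_nonzero submonoid.subset[OF content_one_submonoid] submonoid.subset[OF nonzero_constants_submonoid]
      by (auto simp: nonzero_constants_def P_def[symmetric])
  qed
  have H: "submonoid ?H P"
  proof -
    let ?S = "nonzero_constants R \<union> content_one_polys R"
    have "?H = \<Inter>{T. submonoid T P \<and> ?S \<subseteq> T}" by (simp add: hull_def)
    moreover have "submonoid (\<Inter>{T. submonoid T P \<and> ?S \<subseteq> T}) P"
    proof
      show "\<Inter>{T. submonoid T P \<and> ?S \<subseteq> T} \<subseteq> carrier P"
        using \<open>?H \<subseteq> carrier P - {\<zero>\<^bsub>P\<^esub>}\<close> calculation by auto
    qed (auto intro: submonoid.m_closed submonoid.one_closed)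
    ultimately show ?thesis by simp
  qed
  have sub: "nonzero_constants R \<union> content_one_polys R \<subseteq> ?H" by (rule hull_subset)
  show "carrier P - {\<zero>\<^bsub>P\<^esub>} \<subseteq> ?H"
  proof
    fix f assume "f \<in> carrier P - {\<zero>\<^bsub>P\<^esub>}"
    then obtain c g where "c \<in> carrier R - {\<zero>}" "g \<in> content_one_polys R" "f = monom P c 0 \<otimes>\<^bsub>P\<^esub> g"
      using content_factorization by blast
    moreover then have "monom P c 0 \<in> nonzero_constants R" by (auto simp: nonzero_constants_def P_def[symmetric])
    ultimately show "f \<in> ?H" using sub submonoid.m_closed[OF H, of "monom P c 0" g] by auto
  qed
qed

definition mult_sets :: "(nat \<Rightarrow> 'a) set set"
  where "mult_sets = mult_cross P (nonzero_constants R) (content_one_polys R)"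

lemma mult_sets_eq: "mult_sets = {{\<one>\<^bsub>P\<^esub>}, nonzero_constants R, content_one_polys R, carrier P - {\<zero>\<^bsub>P\<^esub>}}"
  unfolding mult_sets_def mult_cross_def hull_nonzero ..

lemma mult_sets_submonoid:
  assumes "T \<in> mult_sets"
  shows "submonoid T P" "\<zero>\<^bsub>P\<^esub> \<notin> T"
proof -
  have 1: "submonoid {\<one>\<^bsub>P\<^esub>} P" by standard auto
  have 2: "submonoid (carrier P - {\<zero>\<^bsub>P\<^esub>}) P"
  proof
    fix x y assume "x \<in> carrier P - {\<zero>\<^bsub>P\<^esub>}" "y \<in> carrier P - {\<zero>\<^bsub>P\<^esub>}"
    then show "x \<otimes>\<^bsub>P\<^esub> y \<in> carrier P - {\<zero>\<^bsub>P\<^esub>}" using P_integral[of x y] by auto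
  qed (use P_one_not_zero in auto)
  show "submonoid T P"
    using assms 1 2 nonzero_constants_submonoid content_one_submonoid unfolding mult_sets_eq by blast
  have nz: "monom P a 0 \<noteq> \<zero>\<^bsub>P\<^esub>" if "a \<in> carrier R" "a \<noteq> \<zero>" for a
    using coeff_monom[OF that(1), of 0 0] that(2) coeff_zero[of 0] by auto
  have "\<zero>\<^bsub>P\<^esub> \<notin> nonzero_constants R"
  proof
    assume "\<zero>\<^bsub>P\<^esub> \<in> nonzero_constants R"
    then obtain a where "\<zero>\<^bsub>P\<^esub> = monom P a 0" "a \<in> carrier R - {\<zero>}"
      unfolding nonzero_constants_def P_def[symmetric] by (rule imageE)
    then show False using nz[of a] by (elim DiffE) (auto dest: sym)
  qed
  then show "\<zero>\<^bsub>P\<^esub> \<notin> T"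
    using assms content_one_nonzero P_one_not_zero unfolding mult_sets_eq by auto
qed

lemma countable_UP:
  assumes "countable (carrier R)"
  shows "countable (carrier P)"
proof -
  have "carrier P \<subseteq> (\<lambda>l n. if n < length l then l ! n else \<zero>) ` lists (carrier R)"
  proof
    fix f assume f: "f \<in> carrier P"
    have c: "coeff P f n = f n" for n using f by (simp add: P_def UP_def)
    let ?l = "map f [0..<Suc (deg R f)]"
    have "f n \<in> carrier R" for n using coeff_closed[OF f, of n] c by simp
    then have "?l \<in> lists (carrier R)" by auto
    moreover have "f = (\<lambda>n. if n < length ?l then ?l ! n else \<zero>)"
    proof
      fix n
      show "f n = (if n < length ?l then ?l ! n else \<zero>)"
        using deg_aboveD[of f n] f c[of n] by (cases "n \<le> deg R f") (auto simp del: upt_Suc)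
    qed
    ultimately show "f \<in> (\<lambda>l n. if n < length l then l ! n else \<zero>) ` lists (carrier R)"
      by (rule rev_image_eqI)
  qed
  then show ?thesis
    by (rule countable_subset) (rule countable_image[OF countable_lists[OF assms]])
qed

text \<open>Let \<open>q\<close> be the contraction of \<open>J\<close> to the coefficients. If \<open>J\<close> is \<open>0\<close>, all nonzero polynomials are
  inverted. If \<open>J \<noteq> 0\<close> and \<open>q = 0\<close>, the nonzero constants are inverted (\<open>prime_contraction_unit\<close>). If \<open>q \<noteq>
  0\<close>, then \<open>q\<close> is maximal, generated by a prime \<open>p\<close>. Either \<open>J\<close> contains no polynomial of content \<open>1\<close>; then
  a polynomial outside \<open>J\<close> is a polynomial of content \<open>1\<close> times a constant that is invertible modulo \<open>q\<close>. Or
  \<open>J\<close> contains one; it lies outside the extension of \<open>q\<close>, and \<open>J\<close> is maximal.\<close>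

theorem prime_field_after_inverting:
  assumes J: "primeideal J P"
  shows "\<exists>T\<in>mult_sets. field_after_inverting P T J"
proof -
  have Ji: "ideal J P" by (rule primeideal.axioms(1)[OF J])
  interpret J: ideal J P by (rule Ji)
  define q where "q = const_ideal J"
  have q: "primeideal q R" unfolding q_def by (rule const_ideal_prime[OF J])
  have qi: "ideal q R" by (rule primeideal.axioms(1)[OF q])
  interpret q: ideal q R by (rule qi)
  have qJ: "monom P a 0 \<in> J \<longleftrightarrow> a \<in> q" if "a \<in> carrier R" for a using that unfolding q_def const_ideal_def by blast
  consider (zero) "J = {\<zero>\<^bsub>P\<^esub>}" | (vertical) "J \<noteq> {\<zero>\<^bsub>P\<^esub>}" "q = {\<zero>}" | (horizontal) "q \<noteq> {\<zero>}" by blast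
  then show ?thesis
  proof cases
    case zero
    have "field_after_inverting P (carrier P - {\<zero>\<^bsub>P\<^esub>}) J"
      unfolding field_after_inverting_def zero
    proof (intro conjI ballI)
      fix r assume r: "r \<in> carrier P - {\<zero>\<^bsub>P\<^esub>}"
      show "\<exists>u\<in>carrier P. \<exists>t\<in>carrier P - {\<zero>\<^bsub>P\<^esub>}. u \<otimes>\<^bsub>P\<^esub> r \<ominus>\<^bsub>P\<^esub> t \<in> {\<zero>\<^bsub>P\<^esub>}"
        by (rule bexI[of _ "\<one>\<^bsub>P\<^esub>"], rule bexI[OF _ r]) (use r in \<open>auto simp: P.minus_eq P.r_neg\<close>)
    qed blast
    then show ?thesis by (auto simp: mult_sets_eq)
  next
    case vertical
    obtain f where f: "f \<in> J" "f \<noteq> \<zero>\<^bsub>P\<^esub>" using vertical(1) J.zero_closed by blast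
    have fP: "f \<in> carrier P" using f J.Icarr by blast
    have "f \<notin> ext_ideal q"
    proof
      assume "f \<in> ext_ideal q"
      then have "coeff P f n = \<zero>" for n unfolding vertical(2) ext_ideal_def by auto
      then show False using f fP up_eqI[of f "\<zero>\<^bsub>P\<^esub>"] by auto
    qed
    then have K: "\<exists>u\<in>carrier P. \<exists>a\<in>carrier R - q. u \<otimes>\<^bsub>P\<^esub> r \<ominus>\<^bsub>P\<^esub> monom P a 0 \<in> J" if "r \<in> carrier P" "r \<notin> J" for r
      using prime_contraction_unit[OF J f(1) _ that] unfolding q_def by blast
    have "field_after_inverting P (nonzero_constants R) J"
      unfolding field_after_inverting_def
    proof
      show "nonzero_constants R \<inter> J = {}"
        using qJ vertical(2) by (auto simp: nonzero_constants_def P_def[symmetric])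
      show "\<forall>r\<in>carrier P - J. \<exists>u\<in>carrier P. \<exists>t\<in>nonzero_constants R. u \<otimes>\<^bsub>P\<^esub> r \<ominus>\<^bsub>P\<^esub> t \<in> J"
      proof
        fix r assume "r \<in> carrier P - J"
        then obtain u a where ua: "u \<in> carrier P" "a \<in> carrier R - q" "u \<otimes>\<^bsub>P\<^esub> r \<ominus>\<^bsub>P\<^esub> monom P a 0 \<in> J"
          using K by blast
        then have "monom P a 0 \<in> nonzero_constants R"
          using vertical(2) by (auto simp: nonzero_constants_def P_def[symmetric])
        then show "\<exists>u\<in>carrier P. \<exists>t\<in>nonzero_constants R. u \<otimes>\<^bsub>P\<^esub> r \<ominus>\<^bsub>P\<^esub> t \<in> J" using ua by blast
      qed
    qed
    then show ?thesis by (auto simp: mult_sets_eq)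
  next
    case horizontal
    obtain p where p: "p \<in> carrier R" "q = PIdl p" using exists_gen[OF qi] by blast
    have "p \<noteq> \<zero>"
    proof
      assume "p = \<zero>"
      then have "q = {\<zero>}" unfolding p(2) by (auto simp: cgenideal_def intro!: exI[of _ \<zero>])
      then show False using horizontal by blast
    qed
    then have "ring_prime p" using R.primeideal_iff_prime[of p] p q by simp
    then have "ring_irreducible p" using primeness_condition[OF p(1)] by blast
    then have max: "maximalideal q R" unfolding p(2) by (rule irreducible_imp_maximalideal[OF p(1)])
    have qinv: "\<exists>v\<in>carrier R. v \<otimes> c \<ominus> \<one> \<in> q" if c: "c \<in> carrier R" "c \<notin> q" for c
    proof -
      have Pc: "ideal (PIdl c) R" by (rule R.cgenideal_ideal[OF c(1)])
      have S: "ideal (q <+>\<^bsub>R\<^esub> PIdl c) R" by (rule R.add_ideals[OF qi Pc])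
      have mem: "a \<oplus> b \<in> q <+>\<^bsub>R\<^esub> PIdl c" if "a \<in> q" "b \<in> PIdl c" for a b
        unfolding set_add_def' using that by blast
      have qS: "q \<subseteq> q <+>\<^bsub>R\<^esub> PIdl c"
      proof
        fix x assume x: "x \<in> q"
        show "x \<in> q <+>\<^bsub>R\<^esub> PIdl c"
          using mem[OF x additive_subgroup.zero_closed[OF ideal.axioms(1)[OF Pc]]] q.Icarr[OF x] by simp
      qed
      have cS: "c \<in> q <+>\<^bsub>R\<^esub> PIdl c"
        using mem[OF q.zero_closed R.cgenideal_self[OF c(1)]] c by simp
      have "q <+>\<^bsub>R\<^esub> PIdl c = carrier R"
        using maximalideal.I_maximal[OF max S qS] cS c S ideal.Icarr[OF S] by blast
      then have "\<one> \<in> q <+>\<^bsub>R\<^esub> PIdl c" by simp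
      then obtain x v where xv: "x \<in> q" "v \<in> carrier R" "\<one> = x \<oplus> v \<otimes> c"
        by (auto simp: set_add_def' cgenideal_def)
      have xR: "x \<in> carrier R" using xv q.Icarr by blast
      have "v \<otimes> c \<ominus> \<one> = \<ominus> x"
        unfolding xv(3) using xR xv(2) c by (simp add: R.minus_eq R.minus_add R.a_lcomm[of "v \<otimes> c"] R.r_neg)
      then show ?thesis using xv q.a_inv_closed by (intro bexI[of _ v]) auto
    qed
    show ?thesis
    proof (cases "content_one_polys R \<inter> J = {}")
      case True
      have "field_after_inverting P (content_one_polys R) J"
        unfolding field_after_inverting_def
      proof (intro conjI True ballI)
        fix r assume r: "r \<in> carrier P - J"
        then have "r \<noteq> \<zero>\<^bsub>P\<^esub>" using J.zero_closed by auto
        then obtain c g where c: "c \<in> carrier R" and g: "g \<in> content_one_polys R" and e: "r = monom P c 0 \<otimes>\<^bsub>P\<^esub> g"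
          using content_factorization r by blast
        have gP: "g \<in> carrier P" using g by (simp add: content_one_iff)
        have "c \<notin> q"
          using r qJ[OF c] J.I_r_closed[of "monom P c 0" g] gP unfolding e by blast
        then obtain v where v: "v \<in> carrier R" "v \<otimes> c \<ominus> \<one> \<in> q" using qinv[OF c] by blast
        have "monom P v 0 \<otimes>\<^bsub>P\<^esub> r \<ominus>\<^bsub>P\<^esub> g = monom P (v \<otimes> c \<ominus> \<one>) 0 \<otimes>\<^bsub>P\<^esub> g"
          using v c gP monom_mult[of v c 0 0]
          by (simp add: e R.minus_eq P.minus_eq P.l_distr P.l_minus P.m_assoc[symmetric])
        also have "\<dots> \<in> J" using J.I_r_closed qJ v c gP by simp
        finally show "\<exists>u\<in>carrier P. \<exists>t\<in>content_one_polys R. u \<otimes>\<^bsub>P\<^esub> r \<ominus>\<^bsub>P\<^esub> t \<in> J"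
          using g v by (intro bexI[of _ "monom P v 0"] bexI[of _ g]) auto
      qed
      then show ?thesis by (auto simp: mult_sets_eq)
    next
      case False
      then obtain f where f: "f \<in> J" "f \<in> content_one_polys R" by blast
      have "f \<notin> ext_ideal q"
      proof
        assume "f \<in> ext_ideal q"
        then have cq: "coeff P f n \<in> PIdl p" for n unfolding p(2) ext_ideal_def by blast
        have "p divides coeff P f n" for n
        proof -
          obtain y where "y \<in> carrier R" "coeff P f n = y \<otimes> p" using cq[of n] unfolding cgenideal_def by blast
          then show ?thesis unfolding factor_def using R.m_comm[OF p(1)] by auto
        qed
        then have "p divides \<one>" by (rule content_oneD[OF f(2) p(1)])
        then have "carrier R = q" unfolding p(2) using R.divides_one[OF p(1)] R.ideal_eq_carrier_iff[OF p(1)] by blast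
        then show False using primeideal.I_notcarr[OF q] by blast
      qed
      then have K: "\<exists>u\<in>carrier P. \<exists>a\<in>carrier R - q. u \<otimes>\<^bsub>P\<^esub> r \<ominus>\<^bsub>P\<^esub> monom P a 0 \<in> J" if "r \<in> carrier P" "r \<notin> J" for r
        using prime_contraction_unit[OF J f(1) _ that] unfolding q_def by blast
      have "field_after_inverting P {\<one>\<^bsub>P\<^esub>} J"
        unfolding field_after_inverting_def
      proof
        show "{\<one>\<^bsub>P\<^esub>} \<inter> J = {}" using J.one_imp_carrier primeideal.I_notcarr[OF J] by auto
        show "\<forall>r\<in>carrier P - J. \<exists>u\<in>carrier P. \<exists>t\<in>{\<one>\<^bsub>P\<^esub>}. u \<otimes>\<^bsub>P\<^esub> r \<ominus>\<^bsub>P\<^esub> t \<in> J"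
        proof
          fix r assume r: "r \<in> carrier P - J"
          then obtain u a where ua: "u \<in> carrier P" "a \<in> carrier R" "a \<notin> q" "u \<otimes>\<^bsub>P\<^esub> r \<ominus>\<^bsub>P\<^esub> monom P a 0 \<in> J"
            using K by blast
          obtain v where v: "v \<in> carrier R" "v \<otimes> a \<ominus> \<one> \<in> q" using qinv[OF ua(2,3)] by blast
          let ?v = "monom P v 0"
          have va: "?v \<otimes>\<^bsub>P\<^esub> monom P a 0 = monom P (v \<otimes> a) 0" using monom_mult[of v a 0 0] v ua by simp
          have "(?v \<otimes>\<^bsub>P\<^esub> u) \<otimes>\<^bsub>P\<^esub> r \<ominus>\<^bsub>P\<^esub> \<one>\<^bsub>P\<^esub> =
              ?v \<otimes>\<^bsub>P\<^esub> (u \<otimes>\<^bsub>P\<^esub> r \<ominus>\<^bsub>P\<^esub> monom P a 0) \<oplus>\<^bsub>P\<^esub> monom P (v \<otimes> a \<ominus> \<one>) 0"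
            using v ua r va
            by (simp add: R.minus_eq P.minus_eq P.r_distr P.r_minus P.m_assoc P.a_assoc P.r_neg1)
          also have "\<dots> \<in> J" using J.a_closed J.I_l_closed[OF ua(4)] qJ v ua by simp
          finally show "\<exists>u\<in>carrier P. \<exists>t\<in>{\<one>\<^bsub>P\<^esub>}. u \<otimes>\<^bsub>P\<^esub> r \<ominus>\<^bsub>P\<^esub> t \<in> J"
            using v ua by (intro bexI[of _ "?v \<otimes>\<^bsub>P\<^esub> u"] bexI[of _ "\<one>\<^bsub>P\<^esub>"]) simp_all
        qed
      qed
      then show ?thesis by (auto simp: mult_sets_eq)
    qed
  qed
qed

end

section \<open>The equational criterion for flatness\<close>

lemma free_Abelian_group_diff:
  "u \<in> carrier (free_Abelian_group S) \<Longrightarrow> v \<in> carrier (free_Abelian_group S) \<Longrightarrow>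
    u - v \<in> carrier (free_Abelian_group S)"
  using keys_diff[of u v] by auto

lemma tensor_relations_carrier:
  assumes "module R M" "module R N"
  shows "tensor_relations R M N \<subseteq> carrier (free_Abelian_group (carrier M \<times> carrier N))"
proof -
  interpret M: module R M by fact
  interpret N: module R N by fact
  show ?thesis
    unfolding tensor_relations_def
    by (intro Un_least subsetI; elim CollectE exE conjE; hypsubst;
        intro free_Abelian_group_diff; simp)
qed

lemma subgroup_tensor_kernel:
  assumes "module R M" "module R N"
  shows "subgroup (tensor_kernel R M N) (free_Abelian_group (carrier M \<times> carrier N))"
  unfolding tensor_kernel_def
  by (rule group.generate_is_subgroup[OF group_free_Abelian_group tensor_relations_carrier[OF assms]])

lemma tensor_kernel_ops:
  assumes "module R M" "module R N"
  shows "0 \<in> tensor_kernel R M N"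
    and "u \<in> tensor_kernel R M N \<Longrightarrow> v \<in> tensor_kernel R M N \<Longrightarrow> u + v \<in> tensor_kernel R M N"
    and "u \<in> tensor_kernel R M N \<Longrightarrow> - u \<in> tensor_kernel R M N"
    and "u \<in> tensor_kernel R M N \<Longrightarrow> v \<in> tensor_kernel R M N \<Longrightarrow> u - v \<in> tensor_kernel R M N"
proof -
  note sg = subgroup_tensor_kernel[OF assms]
  show "0 \<in> tensor_kernel R M N" using subgroup.one_closed[OF sg] by simp
  show a: "u + v \<in> tensor_kernel R M N" if "u \<in> tensor_kernel R M N" "v \<in> tensor_kernel R M N" for u v
    using subgroup.m_closed[OF sg that] by simp
  show n: "- u \<in> tensor_kernel R M N" if "u \<in> tensor_kernel R M N" for u
    using subgroup.m_inv_closed[OF sg that] subgroup.mem_carrier[OF sg that] by simp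
  show "u - v \<in> tensor_kernel R M N" if "u \<in> tensor_kernel R M N" "v \<in> tensor_kernel R M N" for u v
    using a[OF that(1) n[OF that(2)]] by simp
qed

lemma tensor_kernel_rel:
  "u \<in> tensor_relations R M N \<Longrightarrow> u \<in> tensor_kernel R M N"
  unfolding tensor_kernel_def by (rule generate.incl)

lemma tensor_kernel_mono:
  assumes "carrier A \<subseteq> carrier B" "ring.add A = ring.add B" "module.smult A = module.smult B"
    and A: "module R A" and B: "module R B" and F: "module R F"
  shows "tensor_kernel R A F \<subseteq> tensor_kernel R B F"
proof
  fix u assume "u \<in> tensor_kernel R A F"
  then show "u \<in> tensor_kernel R B F"
    unfolding tensor_kernel_def[of R A]
  proof (induct u rule: generate.induct)
    case one then show ?case using tensor_kernel_ops(1)[OF B F] by simp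
  next
    case (incl h)
    then have "h \<in> tensor_relations R B F" using assms(1) unfolding tensor_relations_def assms(2,3) by blast
    then show ?case by (rule tensor_kernel_rel)
  next
    case (inv h)
    then have "h \<in> tensor_relations R B F" using assms(1) unfolding tensor_relations_def assms(2,3) by blast
    moreover have "h \<in> carrier (free_Abelian_group (carrier A \<times> carrier F))"
      using inv tensor_relations_carrier[OF A F] by blast
    ultimately show ?case using tensor_kernel_ops(3)[OF B F tensor_kernel_rel] by simp
  next
    case (eng h1 h2)
    then show ?case using tensor_kernel_ops(2)[OF B F] by simp
  qed
qed

text \<open>Moving the scalars across the tensor sign collects the sum into one simple tensor.\<close>

lemma tensor_sum_in_kernel:
  fixes a :: "nat \<Rightarrow> 'r"
  assumes B: "module R B" and F: "module R F" and e: "e \<in> carrier B"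
    and a: "\<And>k. a k \<in> carrier R" and x: "\<And>k. x k \<in> carrier F"
  shows "(\<Sum>k<m. frag_of (a k \<odot>\<^bsub>B\<^esub> e, x k)) - frag_of (e, lsum F m a x) \<in> tensor_kernel R B F"
proof (induct m)
  interpret B: module R B by fact
  interpret F: module R F by fact
  note ops = tensor_kernel_ops[OF B F]
  have add: "frag_of (e, y \<oplus>\<^bsub>F\<^esub> y') - frag_of (e, y) - frag_of (e, y') \<in> tensor_kernel R B F"
    if "y \<in> carrier F" "y' \<in> carrier F" for y y'
    by (rule tensor_kernel_rel) (use that e in \<open>unfold tensor_relations_def; blast\<close>)
  case 0
  have "frag_of (e, \<zero>\<^bsub>F\<^esub>) - frag_of (e, \<zero>\<^bsub>F\<^esub>) - frag_of (e, \<zero>\<^bsub>F\<^esub>) \<in> tensor_kernel R B F"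
    using add[of "\<zero>\<^bsub>F\<^esub>" "\<zero>\<^bsub>F\<^esub>"] by simp
  then show ?case by (simp add: lsum_def)
next
  interpret B: module R B by fact
  interpret F: module R F by fact
  note ops = tensor_kernel_ops[OF B F]
  have add: "frag_of (e, y \<oplus>\<^bsub>F\<^esub> y') - frag_of (e, y) - frag_of (e, y') \<in> tensor_kernel R B F"
    if "y \<in> carrier F" "y' \<in> carrier F" for y y'
    by (rule tensor_kernel_rel) (use that e in \<open>unfold tensor_relations_def; blast\<close>)
  case (Suc m)
  have mv: "frag_of (a m \<odot>\<^bsub>B\<^esub> e, x m) - frag_of (e, a m \<odot>\<^bsub>F\<^esub> x m) \<in> tensor_kernel R B F"
    by (rule tensor_kernel_rel) (use a x e in \<open>unfold tensor_relations_def; blast\<close>)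
  have s: "lsum F (Suc m) a x = a m \<odot>\<^bsub>F\<^esub> x m \<oplus>\<^bsub>F\<^esub> lsum F m a x"
    using a x by (simp add: lsum_def lessThan_Suc)
  have cl: "lsum F m a x \<in> carrier F" "a m \<odot>\<^bsub>F\<^esub> x m \<in> carrier F" using a x F.lsum_closed by auto
  have eq: "(\<Sum>k<Suc m. frag_of (a k \<odot>\<^bsub>B\<^esub> e, x k)) - frag_of (e, lsum F (Suc m) a x) =
    ((\<Sum>k<m. frag_of (a k \<odot>\<^bsub>B\<^esub> e, x k)) - frag_of (e, lsum F m a x)) +
    (frag_of (a m \<odot>\<^bsub>B\<^esub> e, x m) - frag_of (e, a m \<odot>\<^bsub>F\<^esub> x m)) -
    (frag_of (e, a m \<odot>\<^bsub>F\<^esub> x m \<oplus>\<^bsub>F\<^esub> lsum F m a x) - frag_of (e, a m \<odot>\<^bsub>F\<^esub> x m) - frag_of (e, lsum F m a x))"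
    unfolding s by simp
  show ?case unfolding eq by (rule ops(4)[OF ops(2)[OF Suc mv] add[OF cl(2,1)]])
qed

text \<open>The relation \<open>\<Sum> a x = 0\<close> holds for trivial reasons: the \<open>x k\<close> are combinations of elements \<open>y l\<close> whose
  coefficients in the relation cancel in \<open>R\<close>.\<close>

definition trivial_combination :: "('r, 's) ring_scheme \<Rightarrow> ('r, 'm, 't) module_scheme \<Rightarrow> nat \<Rightarrow> (nat \<Rightarrow> 'r) \<Rightarrow> (nat \<Rightarrow> 'm) \<Rightarrow> bool"
  where "trivial_combination R M m a x \<longleftrightarrow>
    (\<exists>n b y. (\<forall>k l. b k l \<in> carrier R) \<and> (\<forall>l. y l \<in> carrier M) \<and>
      (\<forall>k<m. x k = lsum M n (b k) y) \<and> (\<forall>l<n. (\<Oplus>\<^bsub>R\<^esub>k\<in>{..<m}. a k \<otimes>\<^bsub>R\<^esub> b k l) = \<zero>\<^bsub>R\<^esub>))"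

context module
begin

lemma trivial_combinationI:
  assumes "\<And>k l. b k l \<in> carrier R" "\<And>l. y l \<in> carrier M" "\<And>k. k < m \<Longrightarrow> x k = lsum M n (b k) y"
    "\<And>l. l < n \<Longrightarrow> (\<Oplus>k\<in>{..<m}. a k \<otimes> b k l) = \<zero>"
  shows "trivial_combination R M m a x"
  unfolding trivial_combination_def using assms by (intro exI[of _ n] exI[of _ b] exI[of _ y]) auto

lemma trivial_combination_one:
  assumes b: "\<And>k. b k \<in> carrier R" and y: "y \<in> carrier M" and z: "(\<Oplus>k\<in>{..<m}. a k \<otimes> b k) = \<zero>"
  shows "trivial_combination R M m a (\<lambda>k. b k \<odot>\<^bsub>M\<^esub> y)"
  by (rule trivial_combinationI[where n="Suc 0" and b="\<lambda>k l. b k" and y="\<lambda>_. y"])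
    (use assms in \<open>auto simp: lsum_def lessThan_Suc\<close>)

lemma trivial_combination_add:
  assumes a: "\<And>k. a k \<in> carrier R"
    and "trivial_combination R M m a x" "trivial_combination R M m a x'"
  shows "trivial_combination R M m a (\<lambda>k. x k \<oplus>\<^bsub>M\<^esub> x' k)"
proof -
  obtain n b y where 1: "\<And>k l. b k l \<in> carrier R" "\<And>l. y l \<in> carrier M" "\<And>k. k < m \<Longrightarrow> x k = lsum M n (b k) y"
    "\<And>l. l < n \<Longrightarrow> (\<Oplus>k\<in>{..<m}. a k \<otimes> b k l) = \<zero>"
    using assms(2) unfolding trivial_combination_def by auto
  obtain n' b' y' where 2: "\<And>k l. b' k l \<in> carrier R" "\<And>l. y' l \<in> carrier M" "\<And>k. k < m \<Longrightarrow> x' k = lsum M n' (b' k) y'"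
    "\<And>l. l < n' \<Longrightarrow> (\<Oplus>k\<in>{..<m}. a k \<otimes> b' k l) = \<zero>"
    using assms(3) unfolding trivial_combination_def by auto
  define c where "c k l = (if l < n then b k l else b' k (l - n))" for k l
  define w where "w l = (if l < n then y l else y' (l - n))" for l
  have cw: "c k l \<in> carrier R" "w l \<in> carrier M" for k l using 1 2 by (auto simp: c_def w_def)
  show ?thesis
  proof (rule trivial_combinationI[where n="n + n'" and b=c and y=w])
    fix k assume k: "k < m"
    have "lsum M (n + n') (c k) w = finsum M (\<lambda>l. c k l \<odot>\<^bsub>M\<^esub> w l) {..<n} \<oplus>\<^bsub>M\<^esub> finsum M (\<lambda>l. c k (n + l) \<odot>\<^bsub>M\<^esub> w (n + l)) {..<n'}"
      unfolding lsum_def by (rule M.finsum_split_add) (use cw in auto)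
    also have "finsum M (\<lambda>l. c k l \<odot>\<^bsub>M\<^esub> w l) {..<n} = x k"
      unfolding 1(3)[OF k] lsum_def using 1 by (intro M.finsum_cong') (auto simp: c_def w_def)
    also have "finsum M (\<lambda>l. c k (n + l) \<odot>\<^bsub>M\<^esub> w (n + l)) {..<n'} = x' k"
      unfolding 2(3)[OF k] lsum_def using 2 by (intro M.finsum_cong') (auto simp: c_def w_def)
    finally show "x k \<oplus>\<^bsub>M\<^esub> x' k = lsum M (n + n') (c k) w" by simp
  next
    fix l assume l: "l < n + n'"
    show "(\<Oplus>k\<in>{..<m}. a k \<otimes> c k l) = \<zero>"
      using 1(4)[of l] 2(4)[of "l - n"] l by (cases "l < n") (auto simp: c_def)
  qed (rule cw)+
qed

lemma trivial_combination_neg: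
  assumes a: "\<And>k. a k \<in> carrier R" and "trivial_combination R M m a x"
  shows "trivial_combination R M m a (\<lambda>k. \<ominus>\<^bsub>M\<^esub> x k)"
proof -
  obtain n b y where 1: "\<And>k l. b k l \<in> carrier R" "\<And>l. y l \<in> carrier M" "\<And>k. k < m \<Longrightarrow> x k = lsum M n (b k) y"
    "\<And>l. l < n \<Longrightarrow> (\<Oplus>k\<in>{..<m}. a k \<otimes> b k l) = \<zero>"
    using assms(2) unfolding trivial_combination_def by auto
  show ?thesis
  proof (rule trivial_combinationI[where n=n and b="\<lambda>k l. (\<ominus> \<one>) \<otimes> b k l" and y=y])
    fix k assume k: "k < m"
    show "\<ominus>\<^bsub>M\<^esub> x k = lsum M n (\<lambda>l. (\<ominus> \<one>) \<otimes> b k l) y"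
      unfolding 1(3)[OF k] using lsum_smult_left[where a="\<ominus> \<one>" and u="b k" and v=y and n=n] 1 lsum_closed[of "b k" y n]
      by (simp add: smult_l_minus)
  next
    fix l assume l: "l < n"
    have "(\<Oplus>k\<in>{..<m}. a k \<otimes> ((\<ominus> \<one>) \<otimes> b k l)) = (\<Oplus>k\<in>{..<m}. (\<ominus> \<one>) \<otimes> (a k \<otimes> b k l))"
      using a 1(1) by (intro R.finsum_cong') (auto simp: R.l_minus R.r_minus)
    also have "\<dots> = (\<ominus> \<one>) \<otimes> (\<Oplus>k\<in>{..<m}. a k \<otimes> b k l)"
      using a 1(1) by (subst R.finsum_rdistr) auto
    finally show "(\<Oplus>k\<in>{..<m}. a k \<otimes> ((\<ominus> \<one>) \<otimes> b k l)) = \<zero>" using 1(4)[OF l] by simp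
  qed (use 1 in auto)
qed

text \<open>The coefficients \<open>rr X\<close> express the element of the ideal that \<open>X\<close> stands for in terms of the generators
  \<open>a k\<close>. They depend on \<open>X\<close> linearly only up to relations between the generators, and the tuples in \<open>M\<close> that
  come from such relations are the trivial combinations.\<close>

lemma trivial_combination_of_tensor:
  fixes A :: "('a, 'z) module"
  assumes A: "module R A" and a: "\<And>k. a k \<in> carrier R"
    and un: "un \<in> mod_hom R A (regular R)"
    and rr: "\<And>X k. X \<in> carrier A \<Longrightarrow> rr X k \<in> carrier R"
      "\<And>X. X \<in> carrier A \<Longrightarrow> (\<Oplus>k\<in>{..<m}. a k \<otimes> rr X k) = un X"
    and X: "\<And>j. X j \<in> carrier A" and unX: "\<And>j. un (X j) = a j" and x: "\<And>j. x j \<in> carrier M"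
    and z: "(\<Sum>j<m. frag_of (X j, x j)) \<in> tensor_kernel R A M"
  shows "trivial_combination R M m a x"
proof -
  interpret A: module R A by fact
  let ?S = "carrier A \<times> carrier M" and ?X = "fun_module M :: ('a, nat \<Rightarrow> 'c) module"
  interpret FM: module R ?X by (rule fun_module_module)
  have cg: "comm_group (add_monoid ?X)" by (rule FM.M.a_comm_group)
  define \<phi> where "\<phi> = (\<lambda>(X, y) k. if X \<in> carrier A \<and> y \<in> carrier M then rr X k \<odot>\<^bsub>M\<^esub> y else \<zero>\<^bsub>M\<^esub>)"
  have \<phi>: "\<phi> (Z, y) = (\<lambda>k. rr Z k \<odot>\<^bsub>M\<^esub> y)" if "Z \<in> carrier A" "y \<in> carrier M" for Z y
    using that by (auto simp: \<phi>_def)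
  have "\<phi> ` ?S \<subseteq> carrier (add_monoid ?X)" using rr(1) by (auto simp: \<phi>_def)
  then obtain h where h: "h \<in> hom (free_Abelian_group ?S) (add_monoid ?X)"
    and hf: "\<And>p. p \<in> ?S \<Longrightarrow> h (frag_of p) = \<phi> p"
    by (rule comm_group.free_Abelian_group_universal[OF cg]) blast
  let ?FG = "free_Abelian_group ?S"
  have hc: "h u k \<in> carrier M" if "u \<in> carrier ?FG" for u k
    using hom_in_carrier[OF h that] by simp
  have ha: "h (u + v) k = h u k \<oplus>\<^bsub>M\<^esub> h v k" if "u \<in> carrier ?FG" "v \<in> carrier ?FG" for u v k
    using hom_mult[OF h that] by simp
  have h0: "h 0 k = \<zero>\<^bsub>M\<^esub>" for k
    using hom_one[OF h group_free_Abelian_group] cg by (simp add: comm_group_def)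
  have hd: "h (u - v) k = h u k \<ominus>\<^bsub>M\<^esub> h v k" if u: "u \<in> carrier ?FG" and v: "v \<in> carrier ?FG" for u v k
  proof -
    have d: "u - v \<in> carrier ?FG" by (rule free_Abelian_group_diff[OF u v])
    have "h u k = h (u - v) k \<oplus>\<^bsub>M\<^esub> h v k" using ha[OF d v, of k] by simp
    then show ?thesis using hc[OF d] hc[OF v] by (simp add: M.minus_eq M.a_assoc M.r_neg)
  qed
  have fr: "frag_of p \<in> carrier ?FG" if "p \<in> ?S" for p using that by simp
  have unA: "un (Y \<oplus>\<^bsub>A\<^esub> Y') = un Y \<oplus> un Y'" "un (r \<odot>\<^bsub>A\<^esub> Y) = r \<otimes> un Y" "un Y \<in> carrier R"
    if "Y \<in> carrier A" "Y' \<in> carrier A" "r \<in> carrier R" for Y Y' r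
    using mod_homD[OF un] that by (auto simp: regular_def)
  have rel: "trivial_combination R M m a (h u)" if "u \<in> tensor_relations R A M" for u
    using that unfolding tensor_relations_def
  proof (elim UnE CollectE exE conjE)
    fix Y Y' y assume u: "u = frag_of (Y \<oplus>\<^bsub>A\<^esub> Y', y) - frag_of (Y, y) - frag_of (Y', y)"
      and c: "Y \<in> carrier A" "Y' \<in> carrier A" "y \<in> carrier M"
    let ?r = "\<lambda>k. rr (Y \<oplus>\<^bsub>A\<^esub> Y') k \<ominus> rr Y k \<ominus> rr Y' k"
    have cA: "Y \<oplus>\<^bsub>A\<^esub> Y' \<in> carrier A" using c by simp
    have "h u = (\<lambda>k. ?r k \<odot>\<^bsub>M\<^esub> y)"
      unfolding u using c cA rr(1) by (intro ext) (simp add: hd fr free_Abelian_group_diff hf \<phi> smult_l_diff del: carrier_free_Abelian_group_iff)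
    moreover have "(\<Oplus>k\<in>{..<m}. a k \<otimes> ?r k) = \<zero>"
    proof -
      have "(\<Oplus>k\<in>{..<m}. a k \<otimes> rr (Y \<oplus>\<^bsub>A\<^esub> Y') k) =
        (\<Oplus>k\<in>{..<m}. a k \<otimes> ?r k \<oplus> (a k \<otimes> rr Y k \<oplus> a k \<otimes> rr Y' k))"
        using a rr(1)[OF cA] rr(1)[OF c(1)] rr(1)[OF c(2)]
        by (intro R.finsum_cong') (auto simp: R.minus_eq R.r_distr R.r_minus R.a_ac R.r_neg1 R.r_neg2 R.l_neg R.r_neg)
      also have "\<dots> = (\<Oplus>k\<in>{..<m}. a k \<otimes> ?r k) \<oplus> ((\<Oplus>k\<in>{..<m}. a k \<otimes> rr Y k) \<oplus> (\<Oplus>k\<in>{..<m}. a k \<otimes> rr Y' k))"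
        using a rr(1)[OF cA] rr(1)[OF c(1)] rr(1)[OF c(2)] by (simp add: R.finsum_addf)
      finally have "un Y \<oplus> un Y' = (\<Oplus>k\<in>{..<m}. a k \<otimes> ?r k) \<oplus> (un Y \<oplus> un Y')"
        using rr(2)[OF cA] rr(2)[OF c(1)] rr(2)[OF c(2)] unA(1)[OF c(1,2) R.one_closed] by simp
      then show ?thesis
        using a rr(1)[OF cA] rr(1)[OF c(1)] rr(1)[OF c(2)] unA(3)[OF c(1) c(1) R.one_closed] unA(3)[OF c(2) c(2) R.one_closed]
        by (intro R.add.l_cancel_one'[THEN iffD1, of "un Y \<oplus> un Y'", symmetric, THEN sym]) auto
    qed
    ultimately show ?thesis
      using trivial_combination_one[where b="?r" and y=y and m=m and a=a] c rr(1)[OF cA] rr(1)[OF c(1)] rr(1)[OF c(2)] by simp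
  next
    fix Y y y' assume u: "u = frag_of (Y, y \<oplus>\<^bsub>M\<^esub> y') - frag_of (Y, y) - frag_of (Y, y')"
      and c: "Y \<in> carrier A" "y \<in> carrier M" "y' \<in> carrier M"
    have "h u = (\<lambda>k. \<zero> \<odot>\<^bsub>M\<^esub> y)"
    proof
      fix k
      have "h u k = (rr Y k \<odot>\<^bsub>M\<^esub> y \<oplus>\<^bsub>M\<^esub> rr Y k \<odot>\<^bsub>M\<^esub> y') \<ominus>\<^bsub>M\<^esub> rr Y k \<odot>\<^bsub>M\<^esub> y \<ominus>\<^bsub>M\<^esub> rr Y k \<odot>\<^bsub>M\<^esub> y'"
        unfolding u using c rr(1)[OF c(1)]
        by (simp add: hd fr free_Abelian_group_diff hf \<phi> smult_r_distr del: carrier_free_Abelian_group_iff)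
      also have "\<dots> = \<zero>\<^bsub>M\<^esub>"
        using c rr(1)[OF c(1)] by (simp add: M.minus_eq M.a_ac M.r_neg M.r_neg2)
      finally show "h u k = \<zero> \<odot>\<^bsub>M\<^esub> y" using c by simp
    qed
    then show ?thesis using trivial_combination_one[where b="\<lambda>_. \<zero>" and y=y and m=m and a=a] c a by (simp add: R.add.finprod_one_eqI)
  next
    fix r Y y assume u: "u = frag_of (r \<odot>\<^bsub>A\<^esub> Y, y) - frag_of (Y, r \<odot>\<^bsub>M\<^esub> y)"
      and c: "r \<in> carrier R" "Y \<in> carrier A" "y \<in> carrier M"
    let ?r = "\<lambda>k. rr (r \<odot>\<^bsub>A\<^esub> Y) k \<ominus> rr Y k \<otimes> r"
    have cA: "r \<odot>\<^bsub>A\<^esub> Y \<in> carrier A" using c by simp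
    have "h u = (\<lambda>k. ?r k \<odot>\<^bsub>M\<^esub> y)"
      unfolding u using c cA rr(1)
      by (intro ext) (simp add: hd fr free_Abelian_group_diff hf \<phi> smult_l_diff smult_assoc1 del: carrier_free_Abelian_group_iff)
    moreover have "(\<Oplus>k\<in>{..<m}. a k \<otimes> ?r k) = \<zero>"
    proof -
      have "(\<Oplus>k\<in>{..<m}. a k \<otimes> rr (r \<odot>\<^bsub>A\<^esub> Y) k) = (\<Oplus>k\<in>{..<m}. a k \<otimes> ?r k \<oplus> (a k \<otimes> rr Y k) \<otimes> r)"
        using a c rr(1)[OF cA] rr(1)[OF c(2)]
        by (intro R.finsum_cong') (auto simp: R.minus_eq R.r_distr R.r_minus R.a_assoc R.m_assoc R.l_neg)
      also have "\<dots> = (\<Oplus>k\<in>{..<m}. a k \<otimes> ?r k) \<oplus> (\<Oplus>k\<in>{..<m}. (a k \<otimes> rr Y k) \<otimes> r)"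
        using a c rr(1)[OF cA] rr(1)[OF c(2)] by (intro R.finsum_addf) auto
      also have "(\<Oplus>k\<in>{..<m}. (a k \<otimes> rr Y k) \<otimes> r) = (\<Oplus>k\<in>{..<m}. a k \<otimes> rr Y k) \<otimes> r"
        using a c rr(1)[OF c(2)] by (subst R.finsum_ldistr) auto
      finally have "r \<otimes> un Y = (\<Oplus>k\<in>{..<m}. a k \<otimes> ?r k) \<oplus> r \<otimes> un Y"
        using rr(2) c cA unA[of Y Y r] by (simp add: R.m_comm)
      then show ?thesis
        using a c rr(1)[OF cA] rr(1)[OF c(2)] unA(3)[OF c(2) c(2) R.one_closed]
        by (intro R.add.l_cancel_one'[THEN iffD1, of "r \<otimes> un Y", symmetric, THEN sym]) auto
    qed
    ultimately show ?thesis
      using trivial_combination_one[where b="?r" and y=y and m=m and a=a] c rr(1)[OF cA] rr(1)[OF c(2)] by simp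
  qed
  have ker: "trivial_combination R M m a (h u) \<and> u \<in> carrier ?FG" if "u \<in> tensor_kernel R A M" for u
    using that unfolding tensor_kernel_def
  proof (induct u rule: generate.induct)
    case one
    have "trivial_combination R M m a (\<lambda>k. \<zero> \<odot>\<^bsub>M\<^esub> \<zero>\<^bsub>M\<^esub>)"
      by (rule trivial_combination_one) (use a in \<open>simp_all add: R.add.finprod_one_eqI\<close>)
    moreover have "h 0 = (\<lambda>k. \<zero> \<odot>\<^bsub>M\<^esub> \<zero>\<^bsub>M\<^esub>)" using h0 by (simp add: fun_eq_iff)
    ultimately show ?case by simp
  next
    case (incl u)
    then show ?case using rel tensor_relations_carrier[OF A module_axioms] by blast
  next
    case (inv u)
    have uc: "u \<in> carrier ?FG" using inv tensor_relations_carrier[OF A module_axioms] by blast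
    have "h (0 - u) = (\<lambda>k. \<ominus>\<^bsub>M\<^esub> h u k)"
      using hd[of 0 u] uc h0 hc[OF uc] by (intro ext) (simp add: M.minus_eq)
    then show ?case using trivial_combination_neg[OF a rel[OF inv]] uc by simp
  next
    case (eng u v)
    have "h (u + v) = (\<lambda>k. h u k \<oplus>\<^bsub>M\<^esub> h v k)" using ha eng by (intro ext) blast
    then show ?case
      using trivial_combination_add[where x="h u" and x'="h v", OF a] eng keys_add[of u v] by auto
  qed
  let ?z = "\<lambda>n. \<Sum>j<n. frag_of (X j, x j)"
  have hz: "h (?z n) k = lsum M n (\<lambda>j. rr (X j) k) x \<and> ?z n \<in> carrier ?FG" for n k
  proof (induct n)
    case 0 then show ?case using h0 by (simp add: lsum_def)
  next
    case (Suc n)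
    have f: "frag_of (X n, x n) \<in> carrier ?FG" using X x by simp
    have "?z (Suc n) \<in> carrier ?FG" using Suc f keys_add[of "?z n" "frag_of (X n, x n)"] by auto
    moreover have "h (?z (Suc n)) k = rr (X n) k \<odot>\<^bsub>M\<^esub> x n \<oplus>\<^bsub>M\<^esub> lsum M n (\<lambda>j. rr (X j) k) x"
      using ha[OF conjunct2[OF Suc] f] Suc hf X x rr(1) lsum_closed[of "\<lambda>j. rr (X j) k" x n] by (simp add: \<phi> M.a_comm)
    ultimately show ?case using X x rr(1) by (simp add: lsum_def lessThan_Suc)
  qed
  \<comment> \<open>The family \<open>x\<close> is the image under \<open>h\<close> of the vanishing tensor, plus a combination of the \<open>x j\<close> with
    coefficients \<open>?b k j\<close>. These cancel in the relation, since \<open>rr (X j)\<close> expresses \<open>a j\<close> through \<open>a\<close>.\<close>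
  have 1: "trivial_combination R M m a (h (?z m))" using ker[OF z] by blast
  let ?b = "\<lambda>k j. (if k = j then \<one> else \<zero>) \<ominus> rr (X j) k"
  have bR: "?b k j \<in> carrier R" for k j using rr(1)[OF X] by simp
  have 2: "trivial_combination R M m a (\<lambda>k. lsum M m (?b k) x)"
  proof (rule trivial_combinationI[where n=m and b="?b" and y=x])
    fix j assume j: "j < m"
    have "(\<Oplus>k\<in>{..<m}. a k \<otimes> (if k = j then \<one> else \<zero>)) = (\<Oplus>k\<in>{..<m}. if j = k then a k else \<zero>)"
      using a by (intro R.finsum_cong') auto
    also have "\<dots> = a j" using a j by (intro R.finsum_singleton) auto
    also have "(\<Oplus>k\<in>{..<m}. a k \<otimes> (if k = j then \<one> else \<zero>)) =
        (\<Oplus>k\<in>{..<m}. a k \<otimes> ?b k j \<oplus> a k \<otimes> rr (X j) k)"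
      using a rr(1)[OF X] by (intro R.finsum_cong') (auto simp: R.minus_eq R.r_distr R.r_minus R.a_assoc R.l_neg)
    also have "\<dots> = (\<Oplus>k\<in>{..<m}. a k \<otimes> ?b k j) \<oplus> a j"
      using a rr(1)[OF X] rr(2)[OF X] unX by (simp add: R.finsum_addf)
    finally have "(\<Oplus>k\<in>{..<m}. a k \<otimes> ?b k j) \<oplus> a j = a j" by simp
    then show "(\<Oplus>k\<in>{..<m}. a k \<otimes> ?b k j) = \<zero>"
      using a bR R.add.r_cancel_one[of "a j" "\<Oplus>k\<in>{..<m}. a k \<otimes> ?b k j"] by simp
  qed (use bR x in auto)
  have 3: "x k = lsum M m (?b k) x \<oplus>\<^bsub>M\<^esub> h (?z m) k" if k: "k < m" for k
  proof -
    have "x k = lsum M m (\<lambda>j. if k = j then \<one> else \<zero>) x" using lsum_unit[where v=x, OF k x] by simp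
    also have "\<dots> = lsum M m (\<lambda>j. ?b k j \<oplus> rr (X j) k) x"
      by (rule lsum_cong) (use rr(1)[OF X] x in \<open>auto simp: R.minus_eq R.a_assoc R.l_neg\<close>)
    also have "\<dots> = lsum M m (?b k) x \<oplus>\<^bsub>M\<^esub> lsum M m (\<lambda>j. rr (X j) k) x"
      by (rule lsum_add_left) (use rr(1)[OF X] x in auto)
    finally show ?thesis using hz by simp
  qed
  have "trivial_combination R M m a (\<lambda>k. lsum M m (?b k) x \<oplus>\<^bsub>M\<^esub> h (?z m) k)"
    by (rule trivial_combination_add[OF a 2 1])
  then show ?thesis unfolding trivial_combination_def using 3 by auto
qed

end

lemma frag_extend_pair:
  fixes u :: "'x \<times> 'y \<Rightarrow>\<^sub>0 int"
  shows "frag_extend (\<lambda>(x, y). frag_of (x, y)) u = u"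
proof -
  have "(\<lambda>(x, y). frag_of (x, y)) = (frag_of :: 'x \<times> 'y \<Rightarrow> _)" by auto
  then show ?thesis using frag_expansion[of u] by metis
qed

text \<open>On representatives the map induced by an inclusion is the identity, so its injectivity compares the
  two kernels.\<close>

lemma tensor_map_inclusion:
  assumes sub: "carrier A \<subseteq> carrier B" "ring.add A = ring.add B" "module.smult A = module.smult B"
    and A: "module R A" and B: "module R B" and F: "module R F"
    and z: "z \<in> carrier (free_Abelian_group (carrier A \<times> carrier F))" "z \<in> tensor_kernel R B F"
    and inj: "inj_on (tensor_map R A B F (\<lambda>X. X)) (carrier (tensor R A F))"
  shows "z \<in> tensor_kernel R A F"
proof -
  let ?G = "free_Abelian_group (carrier A \<times> carrier F)"
  let ?KA = "tensor_kernel R A F" and ?KB = "tensor_kernel R B F"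
  note oA = tensor_kernel_ops[OF A F] and oB = tensor_kernel_ops[OF B F]
  have KAB: "?KA \<subseteq> ?KB" by (rule tensor_kernel_mono[OF sub A B F])
  have map: "tensor_map R A B F (\<lambda>X. X) (?KA #>\<^bsub>?G\<^esub> w) = ?KB" if "w \<in> ?KB" for w
  proof -
    have "tensor_map R A B F (\<lambda>X. X) (?KA #>\<^bsub>?G\<^esub> w) = {k + (k' + w) | k k'. k \<in> ?KB \<and> k' \<in> ?KA}"
      unfolding tensor_map_def r_coset_def set_mult_def by (auto simp: frag_extend_pair image_iff)
    also have "\<dots> = ?KB"
    proof
      show "{k + (k' + w) | k k'. k \<in> ?KB \<and> k' \<in> ?KA} \<subseteq> ?KB" using oB(2) KAB that by blast
      show "?KB \<subseteq> {k + (k' + w) | k k'. k \<in> ?KB \<and> k' \<in> ?KA}"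
      proof
        fix k assume "k \<in> ?KB"
        then have "k - w \<in> ?KB" by (rule oB(4)[OF _ that])
        moreover have "k = (k - w) + (0 + w)" by simp
        ultimately show "k \<in> {k + (k' + w) | k k'. k \<in> ?KB \<and> k' \<in> ?KA}" using oA(1) by blast
      qed
    qed
    finally show ?thesis .
  qed
  have mem: "?KA #>\<^bsub>?G\<^esub> w \<in> carrier (tensor R A F)" if "w \<in> carrier ?G" for w
    using that by (auto simp: tensor_def FactGroup_def RCOSETS_def)
  have "?KA #>\<^bsub>?G\<^esub> z = ?KA #>\<^bsub>?G\<^esub> 0"
    by (rule inj_onD[OF inj _ mem[OF z(1)] mem]) (use map[OF z(2)] map[OF oB(1)] in simp_all)
  moreover have "z \<in> ?KA #>\<^bsub>?G\<^esub> z" using oA(1) by (auto simp: r_coset_def intro!: bexI[of _ 0])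
  ultimately show ?thesis by (auto simp: r_coset_def)
qed

lemma (in cring) finsum_regular:
  "f \<in> S \<rightarrow> carrier R \<Longrightarrow> finsum (regular R) f S = finsum R f S"
proof (induct S rule: infinite_finite_induct)
  case (insert i S)
  interpret G: module R "regular R" by (rule regular_module)
  have c: "f i \<in> carrier (regular R)" "f \<in> S \<rightarrow> carrier (regular R)" using insert by (auto simp: regular_def)
  have "finsum (regular R) f (insert i S) = f i \<oplus>\<^bsub>regular R\<^esub> finsum (regular R) f S"
    by (rule G.M.finsum_insert) (use insert c in auto)
  then show ?case using insert by (simp add: Pi_def) (simp add: regular_def)
next
  case (infinite S)
  then show ?case by (simp add: finsum_def finprod_def regular_def)
next
  case empty
  interpret G: module R "regular R" by (rule regular_module)
  show ?case by (simp add: G.M.finsum_empty) (simp add: regular_def)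
qed

text \<open>The element \<open>\<Sum> X k \<otimes> x k\<close>, where \<open>X k\<close> stands for \<open>a k\<close> in the ideal \<open>I\<close> generated by these, vanishes
  in \<open>R \<otimes> F\<close>, hence in \<open>I \<otimes> F\<close>. As \<open>a\<close> vanishes from \<open>m\<close> on, all \<open>a k\<close> lie in \<open>I\<close>.\<close>

lemma flat_module_equational_zero_ext:
  assumes flat: "flat_module R F" and a: "\<And>k. a k \<in> carrier R" and x: "\<And>k. x k \<in> carrier F"
    and a0: "\<And>k. \<not> k < m \<Longrightarrow> a k = \<zero>\<^bsub>R\<^esub>"
    and rel: "lsum F m a x = \<zero>\<^bsub>F\<^esub>"
  shows "trivial_combination R F m a x"
proof -
  have F: "module R F" using flat by (simp add: flat_module_def)
  interpret F: module R F by (rule F)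
  interpret G: module R "regular R" by (rule F.R.regular_module)
  \<comment> \<open>Flatness is tested on modules of sets of lists of ring elements, so \<open>r\<close> is represented by \<open>{[r]}\<close>.\<close>
  define emb where "emb r = {[r]}" for r :: 'a
  define un where "un X = hd (the_elem X)" for X :: "'a list set"
  have ue: "un (emb r) = r" for r by (simp add: un_def emb_def)
  define B :: "('a, 'a list set) module" where "B = \<lparr>carrier = emb ` carrier R, monoid.mult = undefined, one = undefined,
    ring.zero = emb \<zero>\<^bsub>R\<^esub>, ring.add = (\<lambda>X Y. emb (un X \<oplus>\<^bsub>R\<^esub> un Y)), module.smult = (\<lambda>r X. emb (r \<otimes>\<^bsub>R\<^esub> un X))\<rparr>"
  define I where "I = {s \<in> carrier R. \<exists>r. (\<forall>k. r k \<in> carrier R) \<and> s = lsum (regular R) m r a}"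
  have aG: "a k \<in> carrier (regular R)" for k using a by (simp add: regular_def)
  have I: "submodule I R (regular R)"
  proof (rule G.submodule_smult_neg)
    show "I \<subseteq> carrier (regular R)" by (auto simp: I_def regular_def)
    show "\<zero>\<^bsub>regular R\<^esub> \<in> I"
      using G.lsum_zero[where v=a and n=m, OF aG] by (auto simp: I_def regular_def intro!: exI[of _ "\<lambda>_. \<zero>\<^bsub>R\<^esub>"])
  next
    fix s t assume "s \<in> I" "t \<in> I"
    then obtain r r' where r: "\<And>k. r k \<in> carrier R" "s = lsum (regular R) m r a"
      and r': "\<And>k. r' k \<in> carrier R" "t = lsum (regular R) m r' a" by (auto simp: I_def)
    have e: "s \<oplus>\<^bsub>regular R\<^esub> t = lsum (regular R) m (\<lambda>k. r k \<oplus>\<^bsub>R\<^esub> r' k) a"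
      unfolding r(2) r'(2) by (rule G.lsum_add_left[symmetric]) (use r r' aG in auto)
    moreover have "s \<oplus>\<^bsub>regular R\<^esub> t \<in> carrier R" using \<open>s \<in> I\<close> \<open>t \<in> I\<close> by (auto simp: I_def regular_def)
    ultimately show "s \<oplus>\<^bsub>regular R\<^esub> t \<in> I" using r r' by (auto simp: I_def intro!: exI[of _ "\<lambda>k. r k \<oplus>\<^bsub>R\<^esub> r' k"])
  next
    fix c s assume c: "c \<in> carrier R" and "s \<in> I"
    then obtain r where r: "\<And>k. r k \<in> carrier R" "s = lsum (regular R) m r a" by (auto simp: I_def)
    have e: "c \<odot>\<^bsub>regular R\<^esub> s = lsum (regular R) m (\<lambda>k. c \<otimes>\<^bsub>R\<^esub> r k) a"
      unfolding r(2) by (rule G.lsum_smult_left[symmetric]) (use r aG c in auto)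
    moreover have "c \<odot>\<^bsub>regular R\<^esub> s \<in> carrier R" using \<open>s \<in> I\<close> c by (auto simp: I_def regular_def)
    ultimately show "c \<odot>\<^bsub>regular R\<^esub> s \<in> I" using r c by (auto simp: I_def intro!: exI[of _ "\<lambda>k. c \<otimes>\<^bsub>R\<^esub> r k"])
  qed
  have IR: "I \<subseteq> carrier R" by (auto simp: I_def)
  have aI: "a k \<in> I" if "k < m" for k
    using G.lsum_unit[where v=a, OF that aG] a by (auto simp: I_def intro!: exI[of _ "\<lambda>j. if k = j then \<one>\<^bsub>R\<^esub> else \<zero>\<^bsub>R\<^esub>"])
  define A where "A = B\<lparr>carrier := emb ` I\<rparr>"
  have B: "module R B"
    by (rule module_of_surjection[OF F.R.regular_module, where p=emb]) (auto simp: B_def regular_def ue)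
  have A: "module R A"
    by (rule module_of_surjection[OF submodule.submodule_is_module[OF I F.R.regular_module], where p=emb])
      (use IR in \<open>auto simp: A_def B_def regular_def ue\<close>)
  have sub: "carrier A \<subseteq> carrier B" "ring.add A = ring.add B" "module.smult A = module.smult B"
    using IR by (auto simp: A_def B_def)
  have un: "un \<in> mod_hom R A (regular R)"
    using IR by (auto simp: mod_hom_def A_def B_def regular_def ue)
  have "\<exists>r. (\<forall>k. r k \<in> carrier R) \<and> (X \<in> carrier A \<longrightarrow> (\<Oplus>\<^bsub>R\<^esub>k\<in>{..<m}. a k \<otimes>\<^bsub>R\<^esub> r k) = un X)" for X
  proof (cases "X \<in> carrier A")
    case True
    then obtain s where s: "X = emb s" "s \<in> I" by (auto simp: A_def)
    then obtain r where r: "\<And>k. r k \<in> carrier R" "s = lsum (regular R) m r a" by (auto simp: I_def)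
    have "s = (\<Oplus>\<^bsub>R\<^esub>k\<in>{..<m}. a k \<otimes>\<^bsub>R\<^esub> r k)"
      unfolding r(2) lsum_def
      using F.R.finsum_regular[of "\<lambda>k. r k \<otimes>\<^bsub>R\<^esub> a k" "{..<m}"] a r(1)
      by (simp add: regular_def F.R.m_comm Pi_def)
    then show ?thesis using s r(1) by (auto simp: ue)
  qed (auto intro: exI[of _ "\<lambda>_. \<zero>\<^bsub>R\<^esub>"])
  from choice[OF allI[OF this]] obtain rr where rr: "\<forall>X. (\<forall>k. rr X k \<in> carrier R) \<and>
    (X \<in> carrier A \<longrightarrow> (\<Oplus>\<^bsub>R\<^esub>k\<in>{..<m}. a k \<otimes>\<^bsub>R\<^esub> rr X k) = un X)" by (rule exE)
  have aI': "a k \<in> I" for k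
    using aI[of k] a0[of k] G.submodule_closed(2)[OF I] by (cases "k < m") (auto simp: regular_def)
  define X where "X k = emb (a k)" for k
  have XA: "X k \<in> carrier A" for k using aI' by (simp add: X_def A_def)
  define e where "e = emb \<one>\<^bsub>R\<^esub>"
  have eB: "e \<in> carrier B" by (simp add: e_def B_def)
  have ae: "a k \<odot>\<^bsub>B\<^esub> e = X k" for k using a by (simp add: e_def B_def ue X_def)
  let ?z = "\<lambda>n. \<Sum>j<n. frag_of (X j, x j)"
  note ops = tensor_kernel_ops[OF B F]
  have "- frag_of (e, \<zero>\<^bsub>F\<^esub>) \<in> tensor_kernel R B F"
    using tensor_sum_in_kernel[where a=a and x=x and m=0, OF B F eB a x] by (simp add: lsum_def)
  moreover have "?z m - frag_of (e, \<zero>\<^bsub>F\<^esub>) \<in> tensor_kernel R B F"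
    using tensor_sum_in_kernel[where a=a and x=x and m=m, OF B F eB a x] by (simp add: rel ae)
  ultimately have "(?z m - frag_of (e, \<zero>\<^bsub>F\<^esub>)) - (- frag_of (e, \<zero>\<^bsub>F\<^esub>)) \<in> tensor_kernel R B F"
    using ops(4) by blast
  then have zB: "?z m \<in> tensor_kernel R B F" by simp
  have zc: "?z n \<in> carrier (free_Abelian_group (carrier A \<times> carrier F))" for n
  proof (induct n)
    case (Suc n)
    then show ?case using XA[of n] x[of n] keys_add[of "?z n" "frag_of (X n, x n)"] by auto
  qed simp
  have "(\<lambda>X. X) \<in> mod_hom R A B" using IR by (auto simp: mod_hom_def A_def B_def)
  then have inj: "inj_on (tensor_map R A B F (\<lambda>X. X)) (carrier (tensor R A F))"
    using flat A B unfolding flat_module_def by simp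
  have zA: "?z m \<in> tensor_kernel R A F"
    by (rule tensor_map_inclusion[OF sub A B F zc zB inj])
  show ?thesis
  proof (rule F.trivial_combination_of_tensor[where rr=rr and X=X, OF A a un _ _ XA _ x zA])
    show "rr Y k \<in> carrier R" for Y k using rr by blast
    show "(\<Oplus>\<^bsub>R\<^esub>k\<in>{..<m}. a k \<otimes>\<^bsub>R\<^esub> rr Y k) = un Y" if "Y \<in> carrier A" for Y using rr that by blast
    show "un (X j) = a j" for j by (simp add: X_def ue)
  qed
qed

text \<open>A relation in a flat module is a consequence of relations in the ring: the inclusion of the ideal
  generated by the coefficients stays injective after tensoring.\<close>

theorem flat_module_equational:
  assumes flat: "flat_module R F" and a: "\<And>k. a k \<in> carrier R" and x: "\<And>k. x k \<in> carrier F"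
    and rel: "lsum F m a x = \<zero>\<^bsub>F\<^esub>"
  shows "trivial_combination R F m a x"
proof -
  interpret F: module R F using flat by (simp add: flat_module_def)
  let ?a = "\<lambda>k. if k < m then a k else \<zero>\<^bsub>R\<^esub>"
  have "lsum F m ?a x = lsum F m a x" by (rule F.lsum_cong) (use a x in auto)
  then have "trivial_combination R F m ?a x"
    by (intro flat_module_equational_zero_ext[OF flat]) (use a x rel in auto)
  then obtain n b y where b: "\<forall>k l. b k l \<in> carrier R" and y: "\<forall>l. y l \<in> carrier F"
    and e: "\<forall>k<m. x k = lsum F n (b k) y" and z: "\<forall>l<n. (\<Oplus>\<^bsub>R\<^esub>k\<in>{..<m}. ?a k \<otimes>\<^bsub>R\<^esub> b k l) = \<zero>\<^bsub>R\<^esub>"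
    unfolding trivial_combination_def by blast
  have "(\<Oplus>\<^bsub>R\<^esub>k\<in>{..<m}. a k \<otimes>\<^bsub>R\<^esub> b k l) = (\<Oplus>\<^bsub>R\<^esub>k\<in>{..<m}. ?a k \<otimes>\<^bsub>R\<^esub> b k l)" for l
    using a b by (intro F.R.finsum_cong') auto
  then show ?thesis using b y e z by (intro F.trivial_combinationI) auto
qed

section \<open>Flat modules are strongly flat\<close>

lemma mod_hom_lsum:
  assumes "module R M" "module R N" "h \<in> mod_hom R M N"
    and u: "\<And>k. u k \<in> carrier R" and v: "\<And>k. v k \<in> carrier M"
  shows "h (lsum M n u v) = lsum N n u (\<lambda>k. h (v k))"
proof -
  interpret M: module R M by fact
  interpret N: module R N by fact
  have "h (lsum M n u v) = finsum N (\<lambda>k. h (u k \<odot>\<^bsub>M\<^esub> v k)) {..<n}"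
    unfolding lsum_def by (rule mod_hom_finsum[OF assms(1-3)]) (use u v in simp)
  also have "\<dots> = lsum N n u (\<lambda>k. h (v k))"
    unfolding lsum_def using mod_homD[OF assms(3)] u v by (intro N.M.finsum_cong') auto
  finally show ?thesis .
qed

text \<open>The quotient is isomorphic to \<open>F\<close>; elements that the criterion provides in \<open>F\<close> are lifted along \<open>p\<close>.\<close>

lemma flat_quotient_of_surjection:
  assumes E: "module R E" and p: "p \<in> mod_hom R E F" and surj: "\<And>y. y \<in> carrier F \<Longrightarrow> \<exists>w\<in>carrier E. p w = y"
    and flat: "flat_module R F"
  shows "flat_quotient R E {z \<in> carrier E. p z = \<zero>\<^bsub>F\<^esub>}"
  unfolding flat_quotient_def
proof (intro allI impI)
  have F: "module R F" using flat by (simp add: flat_module_def)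
  interpret E: module R E by (rule E)
  interpret F: module R F by (rule F)
  let ?N = "{z \<in> carrier E. p z = \<zero>\<^bsub>F\<^esub>}"
  fix m a x assume a': "\<forall>k. a k \<in> carrier R" and x': "\<forall>k. x k \<in> carrier E" and rel: "lsum E m a x \<in> ?N"
  then have a: "a k \<in> carrier R" and x: "x k \<in> carrier E" for k by auto
  have px: "p (x k) \<in> carrier F" for k by (rule mod_homD(1)[OF p x])
  have "lsum F m a (\<lambda>k. p (x k)) = \<zero>\<^bsub>F\<^esub>"
    using rel mod_hom_lsum[where u=a and v=x and n=m, OF E F p a x] by simp
  then have "trivial_combination R F m a (\<lambda>k. p (x k))"
    by (rule flat_module_equational[where a=a and x="\<lambda>k. p (x k)", OF flat a px])
  then obtain n b y where b: "\<forall>k l. b k l \<in> carrier R" and y: "\<forall>l. y l \<in> carrier F"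
    and e: "\<forall>k<m. p (x k) = lsum F n (b k) y" and z: "\<forall>l<n. (\<Oplus>\<^bsub>R\<^esub>k\<in>{..<m}. a k \<otimes>\<^bsub>R\<^esub> b k l) = \<zero>\<^bsub>R\<^esub>"
    unfolding trivial_combination_def by (elim exE conjE) blast
  have "\<exists>w. w \<in> carrier E \<and> p w = y l" for l using surj[of "y l"] y by blast
  from choice[OF allI[OF this]] obtain w where w: "\<forall>l. w l \<in> carrier E \<and> p (w l) = y l" by (rule exE)
  have wE: "w l \<in> carrier E" and pw: "p (w l) = y l" for l using w by auto
  have bR: "b k l \<in> carrier R" for k l using b by blast
  have "mcong E ?N (x k) (lsum E n (b k) w)" if k: "k < m" for k
  proof -
    have c: "lsum E n (b k) w \<in> carrier E" by (rule E.lsum_closed[OF bR wE])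
    have "p (lsum E n (b k) w) = p (x k)"
      using mod_hom_lsum[where u="b k" and v=w and n=n, OF E F p bR wE] e k by (simp add: pw)
    then have "p (x k \<ominus>\<^bsub>E\<^esub> lsum E n (b k) w) = \<zero>\<^bsub>F\<^esub>"
      using mod_hom_minus[OF E F p x c] px by (simp add: F.M.minus_eq F.M.r_neg)
    then show ?thesis using x c by (simp add: mcong_def)
  qed
  then show "\<exists>n b y. (\<forall>k l. b k l \<in> carrier R) \<and> (\<forall>l. y l \<in> carrier E) \<and>
      (\<forall>k<m. mcong E ?N (x k) (lsum E n (b k) y)) \<and>
      (\<forall>l<n. (\<Oplus>\<^bsub>R\<^esub>k\<in>{..<m}. a k \<otimes>\<^bsub>R\<^esub> b k l) = \<zero>\<^bsub>R\<^esub>)"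
    using b wE z by (intro exI[of _ n] exI[of _ b] exI[of _ w]) simp
qed

context
  fixes R :: "('r, 's) ring_scheme" and L :: "('r, 'l, 't) module_scheme" and C :: "('r, 'c, 'u) module_scheme"
  assumes L: "module R L" and C: "module R C"
begin

interpretation L: module R L by (rule L)
interpretation C: module R C by (rule C)
interpretation E: module R "prod_module L C" by (rule prod_module_module[OF L C])

lemma summand_submodule: "submodule ({\<zero>\<^bsub>L\<^esub>} \<times> carrier C) R (prod_module L C)"
  by (rule E.submodule_smult_neg) (auto simp: prod_module_simps)

lemma telescopes_summand:
  assumes s: "\<And>n. s n \<in> carrier R" and tel: "telescopes R C s (carrier C) {\<zero>\<^bsub>C\<^esub>}"
  shows "telescopes R (prod_module L C) s ({\<zero>\<^bsub>L\<^esub>} \<times> carrier C) {\<zero>\<^bsub>prod_module L C\<^esub>}"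
  unfolding telescopes_def
proof (intro allI impI)
  fix c :: "nat \<Rightarrow> 'l \<times> 'c" assume c: "\<forall>n. c n \<in> {\<zero>\<^bsub>L\<^esub>} \<times> carrier C"
  then have c': "c n = (\<zero>\<^bsub>L\<^esub>, snd (c n))" "snd (c n) \<in> carrier C" for n
    by (auto simp: mem_Times_iff prod_eq_iff)
  obtain y where y: "\<And>n. y n \<in> carrier C"
    and e: "\<And>n. mcong C {\<zero>\<^bsub>C\<^esub>} (y n) (snd (c n) \<oplus>\<^bsub>C\<^esub> s n \<odot>\<^bsub>C\<^esub> y (Suc n))"
    by (rule telescopesE[where c="\<lambda>n. snd (c n)", OF tel c'(2)]) blast
  have eq: "y n = snd (c n) \<oplus>\<^bsub>C\<^esub> s n \<odot>\<^bsub>C\<^esub> y (Suc n)" for n using e[of n] by (simp add: C.mcong_eq)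
  have rec: "(\<zero>\<^bsub>L\<^esub>, y n) = c n \<oplus>\<^bsub>prod_module L C\<^esub> s n \<odot>\<^bsub>prod_module L C\<^esub> (\<zero>\<^bsub>L\<^esub>, y (Suc n))" for n
    using eq[of n] s by (subst c'(1)) (simp add: prod_module_simps)
  have "mcong (prod_module L C) {\<zero>\<^bsub>prod_module L C\<^esub>} (\<zero>\<^bsub>L\<^esub>, y n)
      (c n \<oplus>\<^bsub>prod_module L C\<^esub> s n \<odot>\<^bsub>prod_module L C\<^esub> (\<zero>\<^bsub>L\<^esub>, y (Suc n)))" for n
    by (simp only: E.mcong_eq rec[symmetric]) (use y[of n] in \<open>simp add: prod_module_simps\<close>)
  then show "\<exists>y. (\<forall>n. y n \<in> {\<zero>\<^bsub>L\<^esub>} \<times> carrier C) \<and>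
      (\<forall>n. mcong (prod_module L C) {\<zero>\<^bsub>prod_module L C\<^esub>} (y n) (c n \<oplus>\<^bsub>prod_module L C\<^esub> s n \<odot>\<^bsub>prod_module L C\<^esub> y (Suc n)))"
    using y by (intro exI[of _ "\<lambda>n. (\<zero>\<^bsub>L\<^esub>, y n)"]) simp
qed

lemma neg_graph_submodule:
  assumes K: "submodule K R L" and \<phi>: "\<phi> \<in> mod_hom R (L\<lparr>carrier := K\<rparr>) C"
  shows "submodule ((\<lambda>k. (k, \<ominus>\<^bsub>C\<^esub> \<phi> k)) ` K) R (prod_module L C)"
proof (rule E.submodule_smult_neg)
  have \<phi>c: "\<phi> k \<in> carrier C" if "k \<in> K" for k using mod_homD(1)[OF \<phi>, of k] that by simp
  have \<phi>a: "\<phi> (k \<oplus>\<^bsub>L\<^esub> k') = \<phi> k \<oplus>\<^bsub>C\<^esub> \<phi> k'" if "k \<in> K" "k' \<in> K" for k k' using mod_homD(2)[OF \<phi>, of k k'] that by simp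
  have \<phi>s: "\<phi> (a \<odot>\<^bsub>L\<^esub> k) = a \<odot>\<^bsub>C\<^esub> \<phi> k" if "a \<in> carrier R" "k \<in> K" for a k using mod_homD(3)[OF \<phi>, of a k] that by simp
  note Kc = L.submodule_closed[OF K]
  let ?D = "(\<lambda>k. (k, \<ominus>\<^bsub>C\<^esub> \<phi> k)) ` K"
  show "?D \<subseteq> carrier (prod_module L C)" using Kc \<phi>c by (auto simp: prod_module_simps)
  have "\<phi> \<zero>\<^bsub>L\<^esub> = \<zero>\<^bsub>C\<^esub>"
    using mod_hom_zero[OF submodule.submodule_is_module[OF K L] C \<phi>] by simp
  then show "\<zero>\<^bsub>prod_module L C\<^esub> \<in> ?D" using Kc(2) by (auto simp: prod_module_simps intro!: image_eqI[of _ _ "\<zero>\<^bsub>L\<^esub>"])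
  show "x \<oplus>\<^bsub>prod_module L C\<^esub> y \<in> ?D" if "x \<in> ?D" "y \<in> ?D" for x y
  proof -
    from that obtain k k' where k: "k \<in> K" "k' \<in> K" "x = (k, \<ominus>\<^bsub>C\<^esub> \<phi> k)" "y = (k', \<ominus>\<^bsub>C\<^esub> \<phi> k')" by blast
    have "x \<oplus>\<^bsub>prod_module L C\<^esub> y = (k \<oplus>\<^bsub>L\<^esub> k', \<ominus>\<^bsub>C\<^esub> \<phi> (k \<oplus>\<^bsub>L\<^esub> k'))"
      using k \<phi>c by (simp add: prod_module_simps \<phi>a C.M.minus_add)
    then show ?thesis using Kc(6)[OF k(1,2)] by blast
  qed
  show "a \<odot>\<^bsub>prod_module L C\<^esub> x \<in> ?D" if a: "a \<in> carrier R" and "x \<in> ?D" for a x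
  proof -
    from that obtain k where k: "k \<in> K" "x = (k, \<ominus>\<^bsub>C\<^esub> \<phi> k)" by blast
    have "a \<odot>\<^bsub>prod_module L C\<^esub> x = (a \<odot>\<^bsub>L\<^esub> k, \<ominus>\<^bsub>C\<^esub> \<phi> (a \<odot>\<^bsub>L\<^esub> k))"
      using k \<phi>c a by (simp add: prod_module_simps \<phi>s C.smult_r_minus)
    then show ?thesis using Kc(5)[OF a k(1)] by blast
  qed
qed

text \<open>Modulo the graph of \<open>-\<phi>\<close> and \<open>C\<close>, what remains of \<open>L \<times> C\<close> is \<open>L/K\<close>.\<close>

lemma sub_sum_neg_graph:
  assumes K: "submodule K R L" and \<phi>: "\<And>k. k \<in> K \<Longrightarrow> \<phi> k \<in> carrier C"
  shows "sub_sum (prod_module L C) ({\<zero>\<^bsub>L\<^esub>} \<times> carrier C) ((\<lambda>k. (k, \<ominus>\<^bsub>C\<^esub> \<phi> k)) ` K) = K \<times> carrier C"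
proof -
  have KL: "k \<in> carrier L" if "k \<in> K" for k using L.submodule_closed(1)[OF K] that by blast
  have x0: "x \<ominus>\<^bsub>L\<^esub> \<zero>\<^bsub>L\<^esub> = x" if "x \<in> carrier L" for x using that by (simp add: L.M.minus_eq)
  show ?thesis
  proof (intro subset_antisym subsetI)
    fix z assume "z \<in> sub_sum (prod_module L C) ({\<zero>\<^bsub>L\<^esub>} \<times> carrier C) ((\<lambda>k. (k, \<ominus>\<^bsub>C\<^esub> \<phi> k)) ` K)"
    then obtain c k where c: "c \<in> carrier C" and k: "k \<in> K" and z: "z \<in> carrier (prod_module L C)"
      and e: "z \<ominus>\<^bsub>prod_module L C\<^esub> (\<zero>\<^bsub>L\<^esub>, c) = (k, \<ominus>\<^bsub>C\<^esub> \<phi> k)"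
      unfolding sub_sum_def mcong_def by blast
    obtain x d where xd: "z = (x, d)" "x \<in> carrier L" "d \<in> carrier C" using z by (auto simp: prod_module_simps)
    have "x = k" using e c xd by (simp add: prod_module_minus[OF L C] x0)
    then show "z \<in> K \<times> carrier C" using xd k by simp
  next
    fix z assume "z \<in> K \<times> carrier C"
    then obtain k d where kd: "z = (k, d)" "k \<in> K" "d \<in> carrier C" by blast
    have "d \<ominus>\<^bsub>C\<^esub> (d \<oplus>\<^bsub>C\<^esub> \<phi> k) = \<ominus>\<^bsub>C\<^esub> \<phi> k"
      using kd \<phi>[OF kd(2)] by (simp add: C.M.minus_eq C.M.minus_add C.M.r_neg2)
    then have "mcong (prod_module L C) ((\<lambda>k. (k, \<ominus>\<^bsub>C\<^esub> \<phi> k)) ` K) z (\<zero>\<^bsub>L\<^esub>, d \<oplus>\<^bsub>C\<^esub> \<phi> k)"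
      using kd \<phi>[OF kd(2)] KL[OF kd(2)] by (simp add: mcong_def prod_module_minus[OF L C] x0 prod_module_simps)
    then show "z \<in> sub_sum (prod_module L C) ({\<zero>\<^bsub>L\<^esub>} \<times> carrier C) ((\<lambda>k. (k, \<ominus>\<^bsub>C\<^esub> \<phi> k)) ` K)"
      unfolding sub_sum_def using kd \<phi>[OF kd(2)] by auto
  qed
qed

text \<open>A complement of \<open>C\<close> in \<open>L \<times> C\<close> is the graph of \<open>-g\<close> for a homomorphism \<open>g\<close>.\<close>

lemma hom_of_complement:
  assumes D: "submodule D R (prod_module L C)"
    and disj: "({\<zero>\<^bsub>L\<^esub>} \<times> carrier C) \<inter> D \<subseteq> {\<zero>\<^bsub>prod_module L C\<^esub>}"
    and sum: "sub_sum (prod_module L C) ({\<zero>\<^bsub>L\<^esub>} \<times> carrier C) D = carrier (prod_module L C)"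
  shows "\<exists>g\<in>mod_hom R L C. \<forall>x c. c \<in> carrier C \<longrightarrow> (x, \<ominus>\<^bsub>C\<^esub> c) \<in> D \<longrightarrow> g x = c"
proof -
  note Dc = E.submodule_closed[OF D]
  have DL: "x \<in> carrier L" if "(x, c) \<in> D" for x c using Dc(1)[OF that] by (auto simp: prod_module_simps)
  have "\<exists>c. x \<in> carrier L \<longrightarrow> c \<in> carrier C \<and> (x, \<ominus>\<^bsub>C\<^esub> c) \<in> D" for x
  proof (cases "x \<in> carrier L")
    case True
    then have "(x, \<zero>\<^bsub>C\<^esub>) \<in> sub_sum (prod_module L C) ({\<zero>\<^bsub>L\<^esub>} \<times> carrier C) D"
      unfolding sum by (simp add: prod_module_simps)
    then obtain c where c: "c \<in> carrier C" and "(x, \<zero>\<^bsub>C\<^esub>) \<ominus>\<^bsub>prod_module L C\<^esub> (\<zero>\<^bsub>L\<^esub>, c) \<in> D"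
      unfolding sub_sum_def mcong_def by blast
    then have "(x, \<ominus>\<^bsub>C\<^esub> c) \<in> D" using True by (simp add: prod_module_minus[OF L C] L.M.minus_eq C.M.minus_eq)
    then show ?thesis using c by blast
  qed simp
  from choice[OF allI[OF this]] obtain g where g: "\<forall>x. x \<in> carrier L \<longrightarrow> g x \<in> carrier C \<and> (x, \<ominus>\<^bsub>C\<^esub> g x) \<in> D" by (rule exE)
  have gC: "g x \<in> carrier C" and gD: "(x, \<ominus>\<^bsub>C\<^esub> g x) \<in> D" if "x \<in> carrier L" for x using g that by auto
  have uniq: "g x = c" if c: "c \<in> carrier C" and xc: "(x, \<ominus>\<^bsub>C\<^esub> c) \<in> D" for x c
  proof -
    have x: "x \<in> carrier L" by (rule DL[OF xc])
    have "(x, \<ominus>\<^bsub>C\<^esub> c) \<ominus>\<^bsub>prod_module L C\<^esub> (x, \<ominus>\<^bsub>C\<^esub> g x) \<in> D" by (rule Dc(3)[OF xc gD[OF x]])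
    then have "(\<zero>\<^bsub>L\<^esub>, \<ominus>\<^bsub>C\<^esub> c \<oplus>\<^bsub>C\<^esub> g x) \<in> D"
      using x c gC[OF x] by (simp add: prod_module_minus[OF L C] L.M.minus_eq C.M.minus_eq L.M.r_neg)
    moreover have "\<ominus>\<^bsub>C\<^esub> c \<oplus>\<^bsub>C\<^esub> g x \<in> carrier C" using c gC[OF x] by simp
    ultimately have "\<ominus>\<^bsub>C\<^esub> c \<oplus>\<^bsub>C\<^esub> g x = \<zero>\<^bsub>C\<^esub>" using disj by (auto simp: prod_module_simps)
    then have "g x = \<ominus>\<^bsub>C\<^esub> (\<ominus>\<^bsub>C\<^esub> c)" using c gC[OF x] C.M.minus_equality[of "g x" "\<ominus>\<^bsub>C\<^esub> c"] by (simp add: C.M.a_comm)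
    then show ?thesis using c by simp
  qed
  have "g \<in> mod_hom R L C"
    unfolding mod_hom_def
  proof (intro CollectI conjI ballI Pi_I)
    fix x y assume x: "x \<in> carrier L" and y: "y \<in> carrier L"
    have "(x, \<ominus>\<^bsub>C\<^esub> g x) \<oplus>\<^bsub>prod_module L C\<^esub> (y, \<ominus>\<^bsub>C\<^esub> g y) \<in> D" by (rule Dc(6)[OF gD[OF x] gD[OF y]])
    then show "g (x \<oplus>\<^bsub>L\<^esub> y) = g x \<oplus>\<^bsub>C\<^esub> g y"
      using gC[OF x] gC[OF y] by (intro uniq) (simp_all add: prod_module_simps C.M.minus_add)
  next
    fix a x assume a: "a \<in> carrier R" and x: "x \<in> carrier L"
    have "a \<odot>\<^bsub>prod_module L C\<^esub> (x, \<ominus>\<^bsub>C\<^esub> g x) \<in> D" by (rule Dc(5)[OF a gD[OF x]])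
    then show "g (a \<odot>\<^bsub>L\<^esub> x) = a \<odot>\<^bsub>C\<^esub> g x"
      using gC[OF x] a by (intro uniq) (simp_all add: prod_module_simps C.smult_r_minus)
  qed (rule gC)
  then show ?thesis using uniq by blast
qed

end

text \<open>Inside the product of \<open>res0 R F\<close> and \<open>C\<close>, extending \<open>\<phi>\<close> means to enlarge the graph of \<open>-\<phi>\<close> to a
  complement of \<open>C\<close>. The quotient by \<open>C\<close> and this graph is the flat module \<open>F\<close>, so \<open>complement_of_flat\<close>
  applies; the systems that it needs are solvable by \<open>solvable_noetherian\<close>.\<close>

theorem trivial_Ext1_of_flat:
  fixes R :: "('r, 's) ring_scheme" and F :: "('r, 'f) module" and C :: "('r, 'c) module"
  assumes noeth: "noetherian_ring R" and dom: "domain R" and count: "countable (carrier R)"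
    and \<T>: "\<And>T. T \<in> \<T> \<Longrightarrow> submonoid T R" "\<And>T. T \<in> \<T> \<Longrightarrow> \<zero>\<^bsub>R\<^esub> \<notin> T"
    and primes: "\<And>J. primeideal J R \<Longrightarrow> \<exists>T\<in>\<T>. field_after_inverting R T J"
    and flat: "flat_module R F" and C: "module R C"
    and Ext: "\<And>T. T \<in> \<T> \<Longrightarrow> trivial_group (Ext1 R (localization R T) C)"
  shows "trivial_group (Ext1 R F C)"
proof -
  have F: "module R F" using flat by (simp add: flat_module_def)
  interpret F: module R F by (rule F)
  let ?L = "res0 R F"
  have L: "module R ?L" by (rule F.res0_module)
  let ?E = "prod_module ?L C" and ?C = "{\<zero>\<^bsub>res0 R F\<^esub>} \<times> carrier C"
  have E: "module R ?E" by (rule prod_module_module[OF L C])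
  interpret L: module R ?L by (rule L)
  interpret C: module R C by (rule C)
  interpret E: module R ?E by (rule E)
  let ?K = "{c \<in> carrier ?L. lin_comb R F c = \<zero>\<^bsub>F\<^esub>}"
  have K: "submodule ?K R ?L" using F.syz_submodule by (simp add: F.syz_def)
  have Tc: "countable T" if "T \<in> \<T>" for T
    using submonoid.subset[OF \<T>(1)[OF that]] count by (rule countable_subset)
  have tel: "telescopes R ?E (den_seq R T) ?C {\<zero>\<^bsub>?E\<^esub>}" if T: "T \<in> \<T>" for T
  proof (rule telescopes_summand[OF L C])
    show "den_seq R T n \<in> carrier R" for n
      using den_seq_mem[OF \<T>(1)[OF T]] submonoid.subset[OF \<T>(1)[OF T]] by blast
    show "telescopes R C (den_seq R T) (carrier C) {\<zero>\<^bsub>C\<^esub>}"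
      by (rule domain.telescopes_of_trivial_Ext1[OF dom \<T>[OF T] Tc[OF T] C Ext[OF T]])
  qed
  have solv: "solvable R ?E (tower_rows R n A) ?C {\<zero>\<^bsub>?E\<^esub>}" if A: "\<And>i k l. A i k l \<in> carrier R" for n A
  proof (rule E.solvable_noetherian[where \<T>=\<T>, OF noeth])
    show "submonoid T R \<and> countable T" if "T \<in> \<T>" for T using \<T>(1) Tc that by blast
    show "tower_rows R n A p \<in> fsupp R" for p by (rule E.tower_rows_fsupp[OF A])
    show "indep_mod R J (tower_rows R n A)" if "primeideal J R" for J
      by (rule E.tower_rows_indep[OF A primeideal.axioms(1)[OF that]])
    show "{\<zero>\<^bsub>?E\<^esub>} \<subseteq> ?C" by (simp add: prod_module_simps)
  qed (fact primes, fact summand_submodule[OF L C], fact E.submodule_zero_set, fact tel)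
  show ?thesis
  proof (rule trivial_Ext1_of_extension[OF F C])
    fix \<phi> assume \<phi>: "\<phi> \<in> mod_hom R (?L\<lparr>carrier := ?K\<rparr>) C"
    let ?D0 = "(\<lambda>k. (k, \<ominus>\<^bsub>C\<^esub> \<phi> k)) ` ?K"
    have \<phi>c: "\<phi> k \<in> carrier C" if "k \<in> ?K" for k using mod_homD(1)[OF \<phi>, of k] that by simp
    have \<phi>0: "\<phi> \<zero>\<^bsub>?L\<^esub> = \<zero>\<^bsub>C\<^esub>"
      using mod_hom_zero[OF submodule.submodule_is_module[OF K L] C \<phi>] by simp
    have p: "(\<lambda>z. lin_comb R F (fst z)) \<in> mod_hom R ?E F"
      using mod_homD[OF F.eps_hom] by (auto simp: mod_hom_def prod_module_simps)
    have "flat_quotient R ?E {z \<in> carrier ?E. lin_comb R F (fst z) = \<zero>\<^bsub>F\<^esub>}"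
    proof (rule flat_quotient_of_surjection[OF E p _ flat])
      fix y assume y: "y \<in> carrier F"
      then have "(unitv R y, \<zero>\<^bsub>C\<^esub>) \<in> carrier ?E"
        using F.R.unitv_free[OF y] by (simp add: prod_module_simps res0_def)
      then show "\<exists>w\<in>carrier ?E. lin_comb R F (fst w) = y" using F.lin_comb_unitv[OF y] by force
    qed
    moreover have "{z \<in> carrier ?E. lin_comb R F (fst z) = \<zero>\<^bsub>F\<^esub>} = sub_sum ?E ?C ?D0"
      using sub_sum_neg_graph[where \<phi>=\<phi>, OF L C K \<phi>c] by (auto simp: prod_module_simps)
    ultimately have fl: "flat_quotient R ?E (sub_sum ?E ?C ?D0)" by simp
    have disj: "?C \<inter> ?D0 \<subseteq> {\<zero>\<^bsub>?E\<^esub>}" using \<phi>0 by (auto simp: prod_module_simps)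
    obtain D where D: "submodule D R ?E \<and> ?D0 \<subseteq> D \<and> ?C \<inter> D \<subseteq> {\<zero>\<^bsub>?E\<^esub>} \<and> sub_sum ?E ?C D = carrier ?E"
      using E.complement_of_flat[OF summand_submodule[OF L C] neg_graph_submodule[OF L C K \<phi>] disj fl count solv] by (rule exE)
    obtain g where g: "g \<in> mod_hom R ?L C" and gD: "\<forall>x c. c \<in> carrier C \<longrightarrow> (x, \<ominus>\<^bsub>C\<^esub> c) \<in> D \<longrightarrow> g x = c"
      using hom_of_complement[OF L C, of D] D by blast
    have "g c = \<phi> c" if "c \<in> ?K" for c using gD \<phi>c[OF that] D that by blast
    then show "\<exists>g\<in>mod_hom R ?L C. \<forall>c\<in>carrier ?L. lin_comb R F c = \<zero>\<^bsub>F\<^esub> \<longrightarrow> g c = \<phi> c"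
      using g by blast
  qed
qed

theorem theorem1p14:
  fixes P :: "('p, 'q) ring_scheme"
    and F :: "(nat \<Rightarrow> 'p, 'f) module"
  assumes "principal_domain P"
    and "countable (carrier P)"
    and "flat_module (UP P) F"
  shows "strongly_flat TYPE('c) (UP P)
           (mult_cross (UP P) (nonzero_constants P) (content_one_polys P)) F"
proof -
  interpret principal_domain P by fact
  interpret UP: UP_principal P "UP P" by unfold_locales (rule reflexive)
  have "trivial_group (Ext1 (UP P) F C)" if C: "weakly_cotorsion (UP P) UP.mult_sets C"
    for C :: "(nat \<Rightarrow> 'p, 'c) module"
  proof (rule trivial_Ext1_of_flat[OF UP.UP_noetherian UP.UP_domain UP.countable_UP[OF assms(2)]
        UP.mult_sets_submonoid UP.prime_field_after_inverting assms(3)])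
    show "module (UP P) C" using C by (simp add: weakly_cotorsion_def)
    show "trivial_group (Ext1 (UP P) (localization (UP P) T) C)" if "T \<in> UP.mult_sets" for T
      using C that by (simp add: weakly_cotorsion_def)
  qed
  moreover have "module (UP P) F" using assms(3) by (simp add: flat_module_def)
  ultimately show ?thesis unfolding strongly_flat_def UP.mult_sets_def[symmetric] by blast
qed

end
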